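(* Let $\{\zeta_t,t\in\mathbb Z\}$ be i.i.d. with $E\zeta_0=0$ and $E\zeta_0^2=1$. Let $a\in\mathbb R$ and real $b_j$, $j\ge1$, satisfy $b_j\sim\beta j^{d-1}$ as $j\to\infty$ for some $0<d<1/2$, $\beta>0$. Let $Q:\mathbb R\to\mathbb R$ satisfy $|Q(x)-Q(y)|\le\mathrm{Lip}_Q|x-y|$ for all $x,y$, with $\mathrm{Lip}_Q^2B^2<1$, where $B^2:=\sum_{j\ge1}b_j^2$. Let $\{X_t\}$ be a stationary $L^2$-solution of $$X_t=\sum_{s<t}b_{t-s}\zeta_sQ(a+X_s),\quad t\in\mathbb Z.$$ Then $$\mathrm{Cov}(X_0,X_t)\sim\lambda_1^2t^{2d-1},\quad t\to\infty,$$ and $$n^{-d-1/2}\sum_{t=1}^{\lfloor n\tau\rfloor}X_t\to\lambda_2B_{d+1/2}(\tau)$$ weakly in the Skorohod space $D[0,1]$, where $B_{d+1/2}$ is a fractional Brownian motion with $\mathrm{Var}(B_{d+1/2}(\tau))=\tau^{2d+1}$, $\lambda_1^2:=\beta^2\mathrm{B}(d,1-2d)\,EQ^2(a+X_0)$ and $\lambda_2^2:=\lambda_1^2/(d(1+2d))$.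
   Context: $\mathcal F_t:=\sigma(\zeta_s,s\le t)$; a process is predictable if $X_t$ is $\mathcal F_{t-1}$-measurable for each $t$. An $L^2$-solution of the displayed equation is a predictable process $\{X_t\}$ with $EX_t^2<\infty$ such that for every $t$ the series $\sum_{s<t}b_{t-s}\zeta_sQ(a+X_s)$ converges in $L^2$ and the equation holds. $\mathrm{B}(\cdot,\cdot)$ is the Beta function; $a_t\sim b_t$ means $a_t/b_t\to1$. *)

theory Defs
  imports "HOL-Probability.Probability" "HOL-Library.Landau_Symbols"
begin

definition nat_filtration :: "'a measure \<Rightarrow> (int \<Rightarrow> 'a \<Rightarrow> real) \<Rightarrow> int \<Rightarrow> 'a measure" where
  "nat_filtration M \<zeta> t =
     sigma (space M) {\<zeta> s -` A \<inter> space M | s A. s \<le> t \<and> A \<in> sets borel}"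

definition time_changes :: "(real \<Rightarrow> real) set" where
  "time_changes = {l. strict_mono_on {0..1} l \<and> continuous_on {0..1} l \<and> l ` {0..1} = {0..1}}"

definition skorohod_dist :: "(real \<Rightarrow> real) \<Rightarrow> (real \<Rightarrow> real) \<Rightarrow> real" where
  "skorohod_dist x y = Inf {e. e \<ge> 0 \<and> (\<exists>l\<in>time_changes. \<forall>t\<in>{0..1}.
       \<bar>l t - t\<bar> \<le> e \<and> \<bar>x t - y (l t)\<bar> \<le> e)}"

definition cadlag :: "(real \<Rightarrow> real) \<Rightarrow> bool" where
  "cadlag x \<longleftrightarrow> (\<forall>t\<in>{0..<1}. (x \<longlongrightarrow> x t) (at_right t)) \<and>
                 (\<forall>t\<in>{0<..1}. \<exists>l. (x \<longlongrightarrow> l) (at_left t))"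

definition skorohod_bcont :: "((real \<Rightarrow> real) \<Rightarrow> real) \<Rightarrow> bool" where
  "skorohod_bcont f \<longleftrightarrow> (\<exists>K. \<forall>x. cadlag x \<longrightarrow> \<bar>f x\<bar> \<le> K) \<and>
     (\<forall>x. cadlag x \<longrightarrow> (\<forall>e>0. \<exists>\<delta>>0. \<forall>y. cadlag y \<longrightarrow> skorohod_dist x y < \<delta> \<longrightarrow> \<bar>f x - f y\<bar> < e))"

definition weak_conv_D :: "'a measure \<Rightarrow> (nat \<Rightarrow> 'a \<Rightarrow> real \<Rightarrow> real) \<Rightarrow> 'b measure \<Rightarrow> ('b \<Rightarrow> real \<Rightarrow> real) \<Rightarrow> bool" where
  "weak_conv_D M S N Y \<longleftrightarrow> (\<forall>f. skorohod_bcont f \<longrightarrow>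
       (\<lambda>n. integral\<^sup>L M (\<lambda>\<omega>. f (S n \<omega>))) \<longlonglongrightarrow> integral\<^sup>L N (\<lambda>\<omega>. f (Y \<omega>)))"

text \<open>Fractional Brownian motion on [0,1] with Hurst index H, Var B(t) = t^(2H):
  a centred Gaussian process (specified via characteristic functions of all finite
  linear combinations) with the fBm covariance and continuous paths.\<close>
definition fbm_cov :: "real \<Rightarrow> real \<Rightarrow> real \<Rightarrow> real" where
  "fbm_cov H s t = (s powr (2*H) + t powr (2*H) - \<bar>t - s\<bar> powr (2*H)) / 2"

definition is_fBm :: "'b measure \<Rightarrow> real \<Rightarrow> (real \<Rightarrow> 'b \<Rightarrow> real) \<Rightarrow> bool" where
  "is_fBm N H B \<longleftrightarrow> prob_space N \<and> (\<forall>t. B t \<in> borel_measurable N) \<and>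
     (\<forall>\<omega>\<in>space N. continuous_on {0..1} (\<lambda>t. B t \<omega>)) \<and>
     (\<forall>T c. finite T \<longrightarrow> T \<subseteq> {0..1} \<longrightarrow>
        (CLINT \<omega>|N. iexp (\<Sum>t\<in>T. c t * B t \<omega>)) =
          complex_of_real (exp (- (\<Sum>s\<in>T. \<Sum>t\<in>T. c s * c t * fbm_cov H s t) / 2)))"

end

theory Submission
  imports Defs "HOL-Real_Asymp.Real_Asymp"
begin

text \<open>
  The innovations \<open>\<xi> s = \<zeta> s * Q (a + X s)\<close> are orthogonal martingale differences of constant
  variance, so \<open>X\<close> is a linear process in them: its covariance is a constant times
  \<open>\<Sum>j. b j * b (j + t)\<close>, a Riemann sum for a Beta integral, and summing it twice gives the variance of
  the partial sums.

  A linear statistic of \<open>X\<close> is a weighted sum of the \<open>\<xi> s\<close> with uniformly small weights. Since the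
  Picard map is a contraction in mean square, \<open>\<xi> s\<close> is approximated uniformly in \<open>s\<close> by
  \<open>z (\<zeta> s) * q s\<close> with \<open>z\<close>, \<open>q\<close> bounded and \<open>q s\<close> depending on finitely many past innovations only; for
  these McLeish's product \<open>\<Prod>(1 + \<i> * x s)\<close> is bounded, has mean one, and the sum of squares obeys a law of
  large numbers by finite-range dependence. This gives the finite-dimensional limits.

  As \<open>d > 0\<close>, second moments suffice for the dyadic chaining bound, so the interpolated paths stay in
  a set of paths with a common modulus of continuity, compact for pointwise convergence. Functionals
  continuous for the Skorohod distance are continuous on it, hence by Stone-Weierstrass uniformly
  approximable by trigonometric polynomials in finitely many coordinates, whose means converge by the
  finite-dimensional limits. Fractional Brownian motion is built from white noise by a Cholesky
  factorisation of its covariance on the dyadics and the same chaining bound.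
\<close>

text \<open>The variance of \<open>\<xi> s\<close> is constant, but its conditional variance
  \<open>(Q (a + X s))\<^sup>2\<close> is random, so the limit theorem for linear processes with
  independent innovations does not apply. The bounded finite-range substitutes make a law of large
  numbers for squares available although only second moments are given.

  Chaining rests on E |Y t - Y s|^2 \<le> C |t - s|^(2d+1): of the exponent, 1 pays for the 2^m
  intervals of level m, and 2d is left to sum over the levels.

  Functionals are controlled on cadlag paths only, and path space carries no sigma-algebra.
  Integrals of non-measurable functions have a default value, so measurability of
  \<open>f (S n \<omega>)\<close> and \<open>f (Z \<omega>)\<close> has to be proved; both come from
  step functions, which depend on finitely many coordinates. Partial sum paths jump and thus lie
  outside the compact set; they are compared with their interpolations by a uniform estimate that
  admits any cadlag path as second argument.\<close>

section \<open>Functionals continuous for the Skorohod distance\<close>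

text \<open>Two functions are separated at one coordinate where they differ. The instances below
  allow Stone-Weierstrass, which is stated over Hausdorff types, to be used on sets of paths with
  the topology of pointwise convergence.\<close>

lemma hausdorff_fun:
  fixes x y :: "'a \<Rightarrow> 'b::t2_space" assumes "x \<noteq> y"
  shows "\<exists>U V. open U \<and> open V \<and> x \<in> U \<and> y \<in> V \<and> U \<inter> V = {}"
proof -
  obtain i where i: "x i \<noteq> y i" using assms by auto
  obtain U V where UV: "open U" "open V" "x i \<in> U" "y i \<in> V" "U \<inter> V = {}"
    using hausdorff[OF i] by auto
  have "open {f. \<forall>j\<in>{i}. f j \<in> U}" "open {f. \<forall>j\<in>{i}. f j \<in> V}"
    using UV product_topology_basis'[of "{i}" "\<lambda>_. U" "\<lambda>i. i"] product_topology_basis'[of "{i}" "\<lambda>_. V" "\<lambda>i. i"] by auto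
  then show ?thesis
    using UV by (intro exI[of _ "{f. \<forall>j\<in>{i}. f j \<in> U}"] exI[of _ "{f. \<forall>j\<in>{i}. f j \<in> V}"]) auto
qed

instance "fun" :: (type, t2_space) t0_space
  by standard (metis hausdorff_fun IntI equals0D)
instance "fun" :: (type, t2_space) t1_space
  by standard (metis hausdorff_fun IntI equals0D)
instance "fun" :: (type, t2_space) t2_space
  by standard (rule hausdorff_fun)

text \<open>The identity is an admissible time change. This bound by the uniform distance is all
  that is used about the Skorohod distance, as the limit paths are continuous.\<close>

lemma skorohod_dist_le:
  assumes "0 \<le> e" "\<And>t. t \<in> {0..1} \<Longrightarrow> \<bar>x t - y t\<bar> \<le> e"
  shows "skorohod_dist x y \<le> e"
proof -
  have "(\<lambda>t. t) \<in> time_changes"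
    by (auto simp: time_changes_def strict_mono_on_def)
  then have "e \<in> {e. e \<ge> 0 \<and> (\<exists>l\<in>time_changes. \<forall>t\<in>{0..1}.
       \<bar>l t - t\<bar> \<le> e \<and> \<bar>x t - y (l t)\<bar> \<le> e)}"
    using assms by (auto intro!: bexI[of _ "\<lambda>t. t"])
  then show ?thesis
    unfolding skorohod_dist_def by (rule cInf_lower) (auto simp: bdd_below_def)
qed

lemma skorohod_bcontD:
  assumes "skorohod_bcont f" "cadlag x" "0 < e"
  obtains \<delta> where "0 < \<delta>" "\<And>y. cadlag y \<Longrightarrow> (\<And>t. t \<in> {0..1} \<Longrightarrow> \<bar>x t - y t\<bar> \<le> \<delta>) \<Longrightarrow> \<bar>f x - f y\<bar> < e"
proof -
  obtain \<delta> where d: "0 < \<delta>" "\<And>y. cadlag y \<Longrightarrow> skorohod_dist x y < \<delta> \<Longrightarrow> \<bar>f x - f y\<bar> < e"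
    using assms unfolding skorohod_bcont_def by metis
  \<comment> \<open>Half the radius turns the non-strict uniform bound into the strict Skorohod
    bound.\<close>
  have "\<bar>f x - f y\<bar> < e" if "cadlag y" "\<And>t. t \<in> {0..1} \<Longrightarrow> \<bar>x t - y t\<bar> \<le> \<delta>/2" for y
    using d(2)[OF that(1)] skorohod_dist_le[of "\<delta>/2" x y] that(2) d(1) by force
  then show ?thesis using d(1) by (intro that[of "\<delta>/2"]) auto
qed

lemma cadlag_continuous:
  assumes "continuous_on {0..1} x" shows "cadlag x"
proof -
  have 1: "(x \<longlongrightarrow> x t) (at t within {0..1})" if "t \<in> {0..1}" for t
    using assms that by (auto simp: continuous_on_def)
  have r: "(x \<longlongrightarrow> x t) (at_right t)" if "t \<in> {0..<1}" for t
  proof -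
    have "at t within {t..1} = at_right t" using that by (simp add: at_within_Icc_at_right)
    moreover have "(x \<longlongrightarrow> x t) (at t within {t..1})"
      using 1[of t] that by (intro tendsto_within_subset[OF 1[of t]]) auto
    ultimately show ?thesis by simp
  qed
  have l: "(x \<longlongrightarrow> x t) (at_left t)" if "t \<in> {0<..1}" for t
  proof -
    have "at t within {0..t} = at_left t" using that by (simp add: at_within_Icc_at_left)
    moreover have "(x \<longlongrightarrow> x t) (at t within {0..t})"
      using 1[of t] that by (intro tendsto_within_subset[OF 1[of t]]) auto
    ultimately show ?thesis by simp
  qed
  show ?thesis unfolding cadlag_def using r l by blast
qed

lemma cadlag_step: "cadlag (\<lambda>\<tau>. v (nat \<lfloor>real N * \<tau>\<rfloor>))"
proof (cases "N = 0")
  case True then show ?thesis by (auto simp: cadlag_def)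
next
  case False
  then have N: "real N > 0" by simp
  have r: "eventually (\<lambda>\<tau>. v (nat \<lfloor>real N * \<tau>\<rfloor>) = v (nat \<lfloor>real N * t\<rfloor>)) (at_right t)" for t
  proof -
    \<comment> \<open>The right-hand side is the next possible jump after \<open>t\<close>.\<close>
    have "t < (of_int \<lfloor>real N * t\<rfloor> + 1) / real N"
      using N by (simp add: field_simps) linarith
    then have "eventually (\<lambda>\<tau>. \<tau> \<in> {t<..<(of_int \<lfloor>real N * t\<rfloor> + 1) / real N}) (at_right t)"
      using eventually_at_right by (auto simp: eventually_at_right_field)
    then show ?thesis
    proof (rule eventually_mono)
      fix \<tau> assume \<tau>: "\<tau> \<in> {t<..<(of_int \<lfloor>real N * t\<rfloor> + 1) / real N}"
      have "real N * t \<le> real N * \<tau>" using \<tau> N by simp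
      moreover have "real N * \<tau> < of_int \<lfloor>real N * t\<rfloor> + 1" using \<tau> N by (simp add: field_simps)
      ultimately have "\<lfloor>real N * \<tau>\<rfloor> = \<lfloor>real N * t\<rfloor>" by linarith
      then show "v (nat \<lfloor>real N * \<tau>\<rfloor>) = v (nat \<lfloor>real N * t\<rfloor>)" by simp
    qed
  qed
  \<comment> \<open>Just left of \<open>t\<close> the floor equals the ceiling at \<open>t\<close>
    minus one, also when \<open>real N * t\<close> is an integer and the path may jump at
    \<open>t\<close>.\<close>
  have l: "eventually (\<lambda>\<tau>. v (nat \<lfloor>real N * \<tau>\<rfloor>) = v (nat (\<lceil>real N * t\<rceil> - 1))) (at_left t)" for t
  proof -
    have "(of_int \<lceil>real N * t\<rceil> - 1) / real N < t"
      using N by (simp add: field_simps) linarith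
    then have "eventually (\<lambda>\<tau>. \<tau> \<in> {(of_int \<lceil>real N * t\<rceil> - 1) / real N<..<t}) (at_left t)"
      by (auto simp: eventually_at_left_field)
    then show ?thesis
    proof (rule eventually_mono)
      fix \<tau> assume \<tau>: "\<tau> \<in> {(of_int \<lceil>real N * t\<rceil> - 1) / real N<..<t}"
      have "real N * \<tau> < real N * t" using \<tau> N by simp
      moreover have "real N * \<tau> > of_int \<lceil>real N * t\<rceil> - 1" using \<tau> N by (simp add: field_simps)
      ultimately have "\<lfloor>real N * \<tau>\<rfloor> = \<lceil>real N * t\<rceil> - 1" by linarith
      then show "v (nat \<lfloor>real N * \<tau>\<rfloor>) = v (nat (\<lceil>real N * t\<rceil> - 1))" by simp
    qed
  qed
  show ?thesis unfolding cadlag_def using tendsto_eventually[OF r] tendsto_eventually[OF l] by blast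
qed

text \<open>As a function of the sequence of step values, \<open>f\<close> is continuous for the
  product topology: on the unit interval the step path sees coordinates \<open>0\<close> to
  \<open>N\<close> only. A continuous function of sequences is Borel, and over a countable index set
  a sequence of random variables is Borel measurable coordinatewise.\<close>

lemma borel_measurable_step_functional:
  fixes V :: "nat \<Rightarrow> 'a \<Rightarrow> real"
  assumes f: "skorohod_bcont f" and V: "\<And>k. V k \<in> borel_measurable M"
  shows "(\<lambda>\<omega>. f (\<lambda>\<tau>. V (nat \<lfloor>real N * \<tau>\<rfloor>) \<omega>)) \<in> borel_measurable M"
proof -
  define G where "G v = f (\<lambda>\<tau>. v (nat \<lfloor>real N * \<tau>\<rfloor>))" for v :: "nat \<Rightarrow> real"
  have "continuous_on UNIV G"
    unfolding continuous_on_def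
  proof (intro ballI tendstoI)
    fix v :: "nat \<Rightarrow> real" and e :: real assume "0 < e"
    obtain \<delta> where d: "0 < \<delta>" "\<And>y. cadlag y \<Longrightarrow> (\<And>t. t \<in> {0..1} \<Longrightarrow> \<bar>v (nat \<lfloor>real N * t\<rfloor>) - y t\<bar> \<le> \<delta>) \<Longrightarrow>
        \<bar>f (\<lambda>\<tau>. v (nat \<lfloor>real N * \<tau>\<rfloor>)) - f y\<bar> < e"
      using skorohod_bcontD[OF f cadlag_step[of v N] \<open>0 < e\<close>] by metis
    define U where "U = {w. \<forall>k\<in>{0..N}. w k \<in> ball (v k) \<delta>}"
    have "open U" unfolding U_def by (rule product_topology_basis') auto
    moreover have "v \<in> U" using d by (auto simp: U_def)
    moreover have "dist (G w) (G v) < e" if "w \<in> U" for w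
    proof -
      have "\<bar>v (nat \<lfloor>real N * t\<rfloor>) - w (nat \<lfloor>real N * t\<rfloor>)\<bar> \<le> \<delta>" if "t \<in> {0..1}" for t
      proof -
        have "real N * t \<le> real N" using that by (simp add: mult_left_le)
        then have "\<lfloor>real N * t\<rfloor> \<le> int N" by linarith
        then have "nat \<lfloor>real N * t\<rfloor> \<in> {0..N}" by auto
        then show ?thesis using \<open>w \<in> U\<close> by (force simp: U_def dist_real_def)
      qed
      then have "\<bar>G v - G w\<bar> < e" unfolding G_def by (intro d(2) cadlag_step)
      then show ?thesis by (simp add: dist_real_def abs_minus_commute)
    qed
    ultimately show "eventually (\<lambda>w. dist (G w) (G v) < e) (at v)"
      unfolding eventually_at_topological by blast
  qed
  then have G: "G \<in> borel_measurable borel" by (rule borel_measurable_continuous_onI)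
  have "(\<lambda>\<omega> k. V k \<omega>) \<in> measurable M borel"
    by (rule measurable_coordinatewise_then_product) (rule V)
  from measurable_compose[OF this G] show ?thesis by (simp add: G_def)
qed

section \<open>A compact set of paths with a common modulus of continuity\<close>

text \<open>With \<open>r\<close> = 2^(-g) the last condition is Hoelder continuity of order g,
  tested at dyadic scales. The first one freezes a path outside the unit interval, so that two
  distinct members already differ at a time in \<open>{0..1}\<close>; this is what lets coordinates
  in \<open>{0..1}\<close> separate points.\<close>

definition holder_paths :: "real \<Rightarrow> real \<Rightarrow> (real \<Rightarrow> real) set" where
  "holder_paths r A = {x. (\<forall>t. x t = x (max 0 (min 1 t))) \<and> (\<forall>t. \<bar>x t\<bar> \<le> A) \<and>
     (\<forall>m::nat. \<forall>s\<in>{0..1}. \<forall>t\<in>{0..1}. \<bar>s - t\<bar> \<le> (1/2)^m \<longrightarrow> \<bar>x s - x t\<bar> \<le> A * r^m)}"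

lemma holder_pathsI:
  assumes "\<And>t. x t = x (max 0 (min 1 t))" "\<And>t. \<bar>x t\<bar> \<le> A"
    "\<And>m s t. s \<in> {0..1} \<Longrightarrow> t \<in> {0..1} \<Longrightarrow> \<bar>s - t\<bar> \<le> (1/2)^m \<Longrightarrow> \<bar>x s - x t\<bar> \<le> A * r^m"
  shows "x \<in> holder_paths r A"
  unfolding holder_paths_def mem_Collect_eq using assms by blast

lemma holder_pathsD:
  assumes "x \<in> holder_paths r A"
  shows "x t = x (max 0 (min 1 t))" "\<bar>x t\<bar> \<le> A"
    "s \<in> {0..1} \<Longrightarrow> t \<in> {0..1} \<Longrightarrow> \<bar>s - t\<bar> \<le> (1/2)^m \<Longrightarrow> \<bar>x s - x t\<bar> \<le> A * r^m"
  using assms unfolding holder_paths_def mem_Collect_eq by blast+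

lemma holder_paths_mono:
  assumes "0 \<le> r" "A \<le> B" shows "holder_paths r A \<subseteq> holder_paths r B"
proof
  fix x assume x: "x \<in> holder_paths r A"
  have r: "A * r^m \<le> B * r^m" for m using assms by (intro mult_right_mono) auto
  show "x \<in> holder_paths r B"
  proof (rule holder_pathsI)
    show "x t = x (max 0 (min 1 t))" for t by (rule holder_pathsD(1)[OF x])
    show "\<bar>x t\<bar> \<le> B" for t using holder_pathsD(2)[OF x, of t] assms by linarith
    show "\<bar>x s - x t\<bar> \<le> B * r^m" if "s \<in> {0..1}" "t \<in> {0..1}" "\<bar>s - t\<bar> \<le> (1/2)^m" for m s t
      using holder_pathsD(3)[OF x that] r[of m] by linarith
  qed
qed

text \<open>Tychonoff: the set is a closed subset of a product of intervals \<open>{-A..A}\<close>.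
  Each defining condition involves at most two coordinates, so it is closed for pointwise
  convergence.\<close>

lemma compact_holder_paths: "compact (holder_paths r A)"
proof -
  have c: "continuous_on UNIV (\<lambda>x. (x::real\<Rightarrow>real) i)" for i by simp
  have "compactin (product_topology (\<lambda>i::real. euclidean::real topology) UNIV) (PiE UNIV (\<lambda>_. {-A..A}))"
    by (subst compactin_PiE) simp
  then have 1: "compact (PiE (UNIV::real set) (\<lambda>_. {-A..A}))"
    by (simp add: euclidean_product_topology)
  define C1 where "C1 = (\<Inter>t. {x::real\<Rightarrow>real. x t = x (max 0 (min 1 t))})"
  define C2 where "C2 = (\<Inter>t. {x::real\<Rightarrow>real. \<bar>x t\<bar> \<le> A})"
  define C3 where "C3 = (\<Inter>p\<in>{(m,s,t). s \<in> {0..1} \<and> t \<in> {0..1} \<and> \<bar>s - t\<bar> \<le> (1/2)^m}. 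
     {x::real\<Rightarrow>real. \<bar>x (fst (snd p)) - x (snd (snd p))\<bar> \<le> A * r^fst p})"
  have "closed C1" unfolding C1_def by (intro closed_INT ballI closed_Collect_eq c)
  moreover have "closed C2" unfolding C2_def
    by (intro closed_INT ballI closed_Collect_le continuous_on_rabs c continuous_on_const)
  moreover have "closed C3" unfolding C3_def
    by (intro closed_INT ballI closed_Collect_le continuous_on_rabs continuous_on_diff c continuous_on_const)
  moreover have "holder_paths r A = C1 \<inter> C2 \<inter> C3"
    by (auto simp: holder_paths_def C1_def C2_def C3_def)
  ultimately have "closed (holder_paths r A)" by (simp add: closed_Int)
  moreover have "holder_paths r A \<subseteq> PiE UNIV (\<lambda>_. {-A..A})"
  proof
    fix x assume x: "x \<in> holder_paths r A"
    have "x t \<in> {-A..A}" for t using holder_pathsD(2)[OF x, of t] by (simp add: abs_le_iff)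
    then show "x \<in> PiE UNIV (\<lambda>_. {-A..A})" by (intro PiE_I) auto
  qed
  then have "holder_paths r A = PiE UNIV (\<lambda>_. {-A..A}) \<inter> holder_paths r A" by blast
  ultimately show ?thesis using compact_Int_closed[OF 1] by metis
qed

lemma holder_paths_continuous:
  assumes "0 \<le> r" "r < 1" "x \<in> holder_paths r A" shows "continuous_on {0..1} x"
  unfolding continuous_on_iff
proof (intro ballI allI impI)
  fix s e :: real assume s: "s \<in> {0..1}" and e: "0 < e"
  have "(\<lambda>m. A * r^m) \<longlonglongrightarrow> A * 0" using assms by (intro tendsto_intros LIMSEQ_realpow_zero) auto
  then have "eventually (\<lambda>m. A * r^m < e) sequentially" using e by (intro order_tendstoD) auto
  then obtain m where m: "A * r^m < e" by (auto simp: eventually_sequentially)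
  have "dist (x t) (x s) < e" if "t \<in> {0..1}" "dist t s < (1/2)^m" for t
    using holder_pathsD(3)[OF assms(3) that(1) s, of m] that(2) m unfolding dist_real_def by linarith
  then show "\<exists>d>0. \<forall>t\<in>{0..1}. dist t s < d \<longrightarrow> dist (x t) (x s) < e"
    by (intro exI[of _ "(1/2)^m"]) auto
qed

text \<open>Equicontinuity: two members that are within a third of \<open>\<delta>\<close> on a
  finite dyadic grid are uniformly close, the other two thirds being spent on moving each path to
  the grid point. Hence pointwise and uniform neighbourhoods agree on the set.\<close>

lemma holder_paths_nhd:
  assumes r: "0 \<le> r" "r < 1" and x: "x \<in> holder_paths r A" and d: "0 < \<delta>"
  shows "\<exists>U. open U \<and> x \<in> U \<and> (\<forall>y\<in>U \<inter> holder_paths r A. \<forall>t\<in>{0..1}. \<bar>x t - y t\<bar> \<le> \<delta>)"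
proof -
  have "(\<lambda>m. A * r^m) \<longlonglongrightarrow> A * 0" using assms by (intro tendsto_intros LIMSEQ_realpow_zero) auto
  then have "eventually (\<lambda>m. A * r^m < \<delta>/3) sequentially" using d by (intro order_tendstoD) auto
  then obtain m where m: "A * r^m < \<delta>/3" by (auto simp: eventually_sequentially)
  define U where "U = {w. \<forall>k\<in>{0..(2::nat)^m}. w (real k / 2^m) \<in> ball (x (real k / 2^m)) (\<delta>/3)}"
  have "open U" unfolding U_def by (rule product_topology_basis') auto
  moreover have "x \<in> U" using d by (auto simp: U_def)
  moreover have "\<bar>x t - y t\<bar> \<le> \<delta>" if "y \<in> U" "y \<in> holder_paths r A" "t \<in> {0..1}" for y t
  proof -
    define k where "k = nat \<lfloor>2^m * t\<rfloor>"
    have k: "real k = of_int \<lfloor>2^m * t\<rfloor>" using that unfolding k_def by simp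
    have "2^m * t \<le> 2^m" using that by simp
    then have "\<lfloor>2^m * t\<rfloor> \<le> 2^m" by (metis floor_mono floor_numeral_power of_int_numeral)
    then have k2: "real k \<le> 2^m" unfolding k by (metis of_int_le_iff of_int_numeral of_int_power)
    then have k3: "k \<in> {0..2^m}" by simp
    have "real k \<le> 2^m * t" "2^m * t \<le> real k + 1" unfolding k by linarith+
    then have "real k / 2^m \<le> t" "t \<le> real k / 2^m + 1 / 2^m"
      by (simp_all add: divide_le_eq add_divide_distrib[symmetric] le_divide_eq mult.commute)
    then have near: "\<bar>t - real k / 2^m\<bar> \<le> (1/2)^m" by (simp add: power_divide abs_le_iff)
    have kin: "real k / 2^m \<in> {0..1}" using k2 by simp
    have "\<bar>x t - x (real k / 2^m)\<bar> \<le> A * r^m" "\<bar>y t - y (real k / 2^m)\<bar> \<le> A * r^m"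
      using holder_pathsD(3)[OF x that(3) kin near] holder_pathsD(3)[OF that(2,3) kin near] by blast+
    moreover have "\<bar>x (real k / 2^m) - y (real k / 2^m)\<bar> < \<delta>/3"
      using that(1) k3 unfolding U_def by (auto simp: dist_real_def)
    ultimately show ?thesis using m by linarith
  qed
  ultimately show ?thesis by blast
qed

text \<open>A Lebesgue number argument: finitely many neighbourhoods of half the local radius cover
  the compact set. The second path \<open>y\<close> is merely cadlag, because it will be a partial
  sum path, which is a step function.\<close>

lemma skorohod_bcont_uniform_on_holder_paths:
  assumes r: "0 \<le> r" "r < 1" and f: "skorohod_bcont f" and e: "0 < e"
  obtains \<delta> where "0 < \<delta>" "\<And>x y. x \<in> holder_paths r A \<Longrightarrow> cadlag y \<Longrightarrow>
     (\<And>t. t \<in> {0..1} \<Longrightarrow> \<bar>x t - y t\<bar> \<le> \<delta>) \<Longrightarrow> \<bar>f x - f y\<bar> < e"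
proof -
  let ?K = "holder_paths r A"
  have cad: "cadlag x" if "x \<in> ?K" for x
    using cadlag_continuous holder_paths_continuous[OF r that] by blast
  have "\<exists>\<delta>. 0 < \<delta> \<and> (\<forall>y. cadlag y \<longrightarrow> (\<forall>t\<in>{0..1}. \<bar>x t - y t\<bar> \<le> \<delta>) \<longrightarrow> \<bar>f x - f y\<bar> < e/2)" if "x \<in> ?K" for x
    using skorohod_bcontD[OF f cad[OF that], of "e/2"] e by (metis half_gt_zero)
  then obtain D where D: "\<And>x. x \<in> ?K \<Longrightarrow> 0 < D x"
    "\<And>x y. x \<in> ?K \<Longrightarrow> cadlag y \<Longrightarrow> (\<forall>t\<in>{0..1}. \<bar>x t - y t\<bar> \<le> D x) \<Longrightarrow> \<bar>f x - f y\<bar> < e/2"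
    by metis
  have "\<exists>U. open U \<and> x \<in> U \<and> (\<forall>y\<in>U \<inter> ?K. \<forall>t\<in>{0..1}. \<bar>x t - y t\<bar> \<le> D x / 2)" if "x \<in> ?K" for x
    by (rule holder_paths_nhd[OF r that]) (use D(1)[OF that] in simp)
  then obtain U where U: "\<And>x. x \<in> ?K \<Longrightarrow> open (U x)" "\<And>x. x \<in> ?K \<Longrightarrow> x \<in> U x"
    "\<And>x y t. x \<in> ?K \<Longrightarrow> y \<in> U x \<Longrightarrow> y \<in> ?K \<Longrightarrow> t \<in> {0..1} \<Longrightarrow> \<bar>x t - y t\<bar> \<le> D x / 2"
    by (metis IntI)
  obtain C where C: "C \<subseteq> ?K" "finite C" "?K \<subseteq> (\<Union>c\<in>C. U c)"
    using compactE_image[OF compact_holder_paths, of ?K U r A] U(1,2) by blast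
  define \<delta> where "\<delta> = Min (insert 1 ((\<lambda>c. D c / 2) ` C))"
  have "0 < \<delta>" unfolding \<delta>_def using C D(1) by (subst Min_gr_iff) auto
  moreover have "\<bar>f x - f y\<bar> < e" if x: "x \<in> ?K" and y: "cadlag y" and xy: "\<And>t. t \<in> {0..1} \<Longrightarrow> \<bar>x t - y t\<bar> \<le> \<delta>" for x y
  proof -
    obtain c where c: "c \<in> C" "x \<in> U c" using C x by blast
    then have cK: "c \<in> ?K" using C by blast
    have dc: "\<delta> \<le> D c / 2" unfolding \<delta>_def using C c by (intro Min_le) auto
    have 1: "\<bar>c t - x t\<bar> \<le> D c / 2" if "t \<in> {0..1}" for t using U(3)[OF cK c(2) x that] .
    have "\<bar>f c - f x\<bar> < e/2" using D(1)[OF cK] 1 by (intro D(2)[OF cK cad[OF x]]) force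
    moreover have "\<bar>f c - f y\<bar> < e/2"
    proof (intro D(2)[OF cK y] ballI)
      fix t :: real assume "t \<in> {0..1}"
      then show "\<bar>c t - y t\<bar> \<le> D c" using 1[of t] xy[of t] dc by linarith
    qed
    ultimately show ?thesis by linarith
  qed
  ultimately show ?thesis by (rule that)
qed

lemma skorohod_bcont_continuous_on_holder_paths:
  assumes r: "0 \<le> r" "r < 1" and f: "skorohod_bcont f"
  shows "continuous_on (holder_paths r A) f"
  unfolding continuous_on_def
proof (intro ballI tendstoI)
  fix x and e :: real assume x: "x \<in> holder_paths r A" and e: "0 < e"
  obtain \<delta> where d: "0 < \<delta>" "\<And>x y. x \<in> holder_paths r A \<Longrightarrow> cadlag y \<Longrightarrow>
     (\<And>t. t \<in> {0..1} \<Longrightarrow> \<bar>x t - y t\<bar> \<le> \<delta>) \<Longrightarrow> \<bar>f x - f y\<bar> < e"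
    using skorohod_bcont_uniform_on_holder_paths[OF r f e] by metis
  obtain U where U: "open U" "x \<in> U" "\<forall>y\<in>U \<inter> holder_paths r A. \<forall>t\<in>{0..1}. \<bar>x t - y t\<bar> \<le> \<delta>"
    using holder_paths_nhd[OF r x d(1)] by blast
  have "dist (f y) (f x) < e" if "y \<in> U" "y \<in> holder_paths r A" for y
    using d(2)[OF x cadlag_continuous[OF holder_paths_continuous[OF r that(2)]]] U(3) that
    by (auto simp: dist_real_def abs_minus_commute)
  then show "eventually (\<lambda>y. dist (f y) (f x) < e) (at x within holder_paths r A)"
    unfolding eventually_at_topological using U(1,2) by blast
qed

subsection \<open>Trigonometric polynomials on path space\<close>

text \<open>Times are confined to \<open>{0..1}\<close> because finite-dimensional laws are known
  there only.\<close>

definition fin_lin :: "((real \<Rightarrow> real) \<Rightarrow> real) \<Rightarrow> bool" where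
  "fin_lin L \<longleftrightarrow> (\<exists>T c. finite T \<and> T \<subseteq> {0..1} \<and> L = (\<lambda>x. \<Sum>t\<in>T. c t * x t))"

lemma fin_lin_add:
  assumes "fin_lin L1" "fin_lin L2" shows "fin_lin (\<lambda>x. L1 x + k * L2 x)"
proof -
  obtain T1 c1 T2 c2 where 1: "finite T1" "T1 \<subseteq> {0..1}" "L1 = (\<lambda>x. \<Sum>t\<in>T1. c1 t * x t)"
    and 2: "finite T2" "T2 \<subseteq> {0..1}" "L2 = (\<lambda>x. \<Sum>t\<in>T2. c2 t * x t)"
    using assms unfolding fin_lin_def by blast
  define c where "c t = (if t \<in> T1 then c1 t else 0) + k * (if t \<in> T2 then c2 t else 0)" for t
  have "(\<lambda>x. L1 x + k * L2 x) = (\<lambda>x. \<Sum>t\<in>T1 \<union> T2. c t * x t)"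
  proof
    fix x
    have "(\<Sum>t\<in>T1 \<union> T2. c t * x t) = (\<Sum>t\<in>T1 \<union> T2. if t \<in> T1 then c1 t * x t else 0)
        + k * (\<Sum>t\<in>T1 \<union> T2. if t \<in> T2 then c2 t * x t else 0)"
      unfolding sum_distrib_left sum.distrib[symmetric] by (intro sum.cong) (auto simp: c_def algebra_simps)
    also have "(\<Sum>t\<in>T1 \<union> T2. if t \<in> T1 then c1 t * x t else 0) = L1 x"
      unfolding 1 using 1(1) 2(1) by (subst sum.inter_restrict[symmetric]) (auto intro: sum.cong)
    also have "(\<Sum>t\<in>T1 \<union> T2. if t \<in> T2 then c2 t * x t else 0) = L2 x"
      unfolding 2 using 1(1) 2(1) by (subst sum.inter_restrict[symmetric]) (auto intro: sum.cong)
    finally show "L1 x + k * L2 x = (\<Sum>t\<in>T1 \<union> T2. c t * x t)" by simp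
  qed
  then show ?thesis unfolding fin_lin_def using 1 2 by (intro exI[of _ "T1 \<union> T2"] exI[of _ c]) auto
qed

text \<open>The phase covers sines, and \<open>L = 0\<close> gives the constants. Product-to-sum
  formulas make the class an algebra although it is defined by sums alone, and means of its members
  are real parts of characteristic functions.\<close>

inductive trigpoly :: "((real \<Rightarrow> real) \<Rightarrow> real) \<Rightarrow> bool" where
  cos: "fin_lin L \<Longrightarrow> trigpoly (\<lambda>x. a * cos (L x + \<phi>))"
| add: "trigpoly g \<Longrightarrow> trigpoly h \<Longrightarrow> trigpoly (\<lambda>x. g x + h x)"

lemma trigpoly_const: "trigpoly (\<lambda>_. c)"
proof -
  have "fin_lin (\<lambda>x. 0)" unfolding fin_lin_def by (intro exI[of _ "{}"]) auto
  from trigpoly.cos[OF this, of c 0] show ?thesis by simp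
qed

lemma trigpoly_mult:
  assumes "trigpoly g" "trigpoly h" shows "trigpoly (\<lambda>x. g x * h x)"
  using assms
proof (induction arbitrary: h rule: trigpoly.induct)
  case (cos L a \<phi>)
  from cos(2) show ?case
  proof (induction rule: trigpoly.induct)
    case (cos L' a' \<phi>')
    have "trigpoly (\<lambda>x. (a * a' / 2) * cos ((L x + (-1) * L' x) + (\<phi> - \<phi>')) + (a * a' / 2) * cos ((L x + 1 * L' x) + (\<phi> + \<phi>')))"
      by (intro trigpoly.add trigpoly.cos fin_lin_add \<open>fin_lin L\<close> cos)
    moreover have "(a * a' / 2) * cos ((L x + (-1) * L' x) + (\<phi> - \<phi>')) + (a * a' / 2) * cos ((L x + 1 * L' x) + (\<phi> + \<phi>'))
       = a * cos (L x + \<phi>) * (a' * cos (L' x + \<phi>'))" for x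
    proof -
      have "cos (L x + \<phi>) * cos (L' x + \<phi>') = (cos ((L x + \<phi>) - (L' x + \<phi>')) + cos ((L x + \<phi>) + (L' x + \<phi>'))) / 2"
        by (rule cos_times_cos)
      moreover have "(L x + \<phi>) - (L' x + \<phi>') = (L x + (-1) * L' x) + (\<phi> - \<phi>')"
        "(L x + \<phi>) + (L' x + \<phi>') = (L x + 1 * L' x) + (\<phi> + \<phi>')" by simp_all
      ultimately have "2 * (cos (L x + \<phi>) * cos (L' x + \<phi>')) = cos ((L x + (-1) * L' x) + (\<phi> - \<phi>')) + cos ((L x + 1 * L' x) + (\<phi> + \<phi>'))"
        by simp
      then have "(a * a' / 2) * (cos ((L x + (-1) * L' x) + (\<phi> - \<phi>')) + cos ((L x + 1 * L' x) + (\<phi> + \<phi>')))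
         = (a * a' / 2) * (2 * (cos (L x + \<phi>) * cos (L' x + \<phi>')))" by (simp only:)
      then show ?thesis unfolding distrib_left by (simp only: mult_ac) simp
    qed
    ultimately show ?case by (simp only:)
  next
    case (add g h)
    then show ?case using trigpoly.add[of "\<lambda>x. a * cos (L x + \<phi>) * g x" "\<lambda>x. a * cos (L x + \<phi>) * h x"]
      by (simp add: distrib_left)
  qed
next
  case (add g1 g2)
  then show ?case using trigpoly.add[of "\<lambda>x. g1 x * h x" "\<lambda>x. g2 x * h x"] by (simp add: distrib_right)
qed

lemma trigpoly_power: "trigpoly g \<Longrightarrow> trigpoly (\<lambda>x. g x ^ k)"
  by (induction k) (auto intro: trigpoly_const trigpoly_mult)

lemma trigpoly_sum:
  assumes "\<And>i. i \<in> I \<Longrightarrow> trigpoly (g i)" shows "trigpoly (\<lambda>x. \<Sum>i\<in>I. g i x)"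
  using assms by (induction I rule: infinite_finite_induct) (auto intro: trigpoly_const trigpoly.add)

lemma trigpoly_bounded:
  assumes "trigpoly g" obtains P where "\<And>x. \<bar>g x\<bar> \<le> P"
proof -
  have "\<exists>P. \<forall>x. \<bar>g x\<bar> \<le> P" using assms
  proof (induction rule: trigpoly.induct)
    case (cos L a \<phi>)
    then show ?case by (intro exI[of _ "\<bar>a\<bar>"]) (auto simp: abs_mult intro: mult_left_le)
  next
    case (add g h)
    then obtain P P' where "\<And>x. \<bar>g x\<bar> \<le> P" "\<And>x. \<bar>h x\<bar> \<le> P'" by blast
    then show ?case by (intro exI[of _ "P + P'"]) (meson abs_triangle_ineq add_mono order_trans)
  qed
  then show ?thesis using that by blast
qed

lemma trigpoly_continuous: assumes "trigpoly g" shows "continuous_on S g"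
proof -
  have "continuous_on UNIV g" using assms
  proof (induction rule: trigpoly.induct)
    case (cos L a \<phi>)
    then obtain T c where L: "L = (\<lambda>x. \<Sum>t\<in>T. c t * x t)" by (auto simp: fin_lin_def)
    show ?case unfolding L by (intro continuous_intros continuous_on_product_coordinates)
  qed (intro continuous_intros)
  then show ?thesis by (rule continuous_on_subset) auto
qed

lemma trigpoly_dense_holder_paths:
  assumes r: "0 \<le> r" "r < 1" and f: "skorohod_bcont f" and e: "0 < e"
  obtains g where "trigpoly g" "\<And>x. x \<in> holder_paths r A \<Longrightarrow> \<bar>f x - g x\<bar> < e"
proof -
  have "\<exists>g. trigpoly g \<and> (\<forall>x \<in> holder_paths r A. \<bar>f x - g x\<bar> < e)"
  proof (rule Stone_Weierstrass_HOL[of "holder_paths r A" trigpoly])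
    show "compact (holder_paths r A)" by (rule compact_holder_paths)
    show "\<And>c. trigpoly (\<lambda>x. c)" by (rule trigpoly_const)
    show "\<And>f. trigpoly f \<Longrightarrow> continuous_on (holder_paths r A) f" by (rule trigpoly_continuous)
    show "\<And>f g. trigpoly f \<and> trigpoly g \<Longrightarrow> trigpoly (\<lambda>x. f x + g x)" by (auto intro: trigpoly.add)
    show "\<And>f g. trigpoly f \<and> trigpoly g \<Longrightarrow> trigpoly (\<lambda>x. f x * g x)" by (auto intro: trigpoly_mult)
    show "continuous_on (holder_paths r A) f" by (rule skorohod_bcont_continuous_on_holder_paths[OF r f])
    show "0 < e" by fact
    fix x y assume xy: "x \<in> holder_paths r A \<and> y \<in> holder_paths r A \<and> x \<noteq> y"
    then obtain t where "x t \<noteq> y t" by auto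
    then have ne: "x (max 0 (min 1 t)) \<noteq> y (max 0 (min 1 t))" using xy holder_pathsD(1)[of x r A t] holder_pathsD(1)[of y r A t] by metis
    \<comment> \<open>The separating time is clamped into the unit interval, where the members of
      the class may look.\<close>
    define u where "u = max 0 (min 1 t)"
    have u: "u \<in> {0..1}" by (auto simp: u_def)
    have b: "\<bar>x u\<bar> \<le> A" "\<bar>y u\<bar> \<le> A" using xy holder_pathsD(2) by blast+
    then have A: "0 \<le> A" by linarith
    \<comment> \<open>The scaling brings all values into [-1, 1], inside the interval [-pi/2, pi/2]
      on which the sine is injective; the phase -pi/2 below turns the cosine into that sine. The
      added 1 avoids division by zero.\<close>
    define c where "c = 1 / (A + 1)"
    have cb: "\<bar>c * z\<bar> \<le> 1" if "\<bar>z\<bar> \<le> A" for z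
      using that A unfolding c_def by (simp add: abs_mult field_simps)
    have "c * x u \<noteq> c * y u" using ne A unfolding c_def u_def[symmetric] by simp
    moreover have "\<bar>c * x u\<bar> \<le> pi/2" "\<bar>c * y u\<bar> \<le> pi/2" using cb b pi_half_gt_zero pi_ge_two by (force intro: order_trans)+
    ultimately have "sin (c * x u) \<noteq> sin (c * y u)"
      using sin_inj_pi[of "c * x u" "c * y u"] by (metis abs_le_iff minus_le_iff minus_divide_left)
    then have "cos (c * x u + (- pi/2)) \<noteq> cos (c * y u + (- pi/2))" by (simp add: cos_diff)
    moreover have "trigpoly (\<lambda>x. 1 * cos (c * x u + (- pi/2)))"
      using u by (intro trigpoly.cos) (auto simp: fin_lin_def intro!: exI[of _ "{u}"] exI[of _ "\<lambda>_. c"])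
    ultimately show "\<exists>g. trigpoly g \<and> g x \<noteq> g y"
      by (intro exI[of _ "\<lambda>x. 1 * cos (c * x u + (- pi/2))"]) simp
  qed
  then show ?thesis using that by blast
qed

section \<open>Weak convergence from finite-dimensional limits and tightness\<close>

lemma (in prob_space) expectation_diff_le:
  fixes g1 g2 :: "'a \<Rightarrow> real"
  assumes i: "integrable M g1" "integrable M g2" and E: "E \<in> sets M" "prob E \<ge> 1 - \<epsilon>"
    and a: "0 \<le> a" "\<And>\<omega>. \<omega> \<in> E \<Longrightarrow> \<bar>g1 \<omega> - g2 \<omega>\<bar> \<le> a"
    and b: "0 \<le> b" "\<And>\<omega>. \<omega> \<in> space M \<Longrightarrow> \<bar>g1 \<omega> - g2 \<omega>\<bar> \<le> b"
  shows "\<bar>expectation g1 - expectation g2\<bar> \<le> a + b * \<epsilon>"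
proof -
  have iI: "integrable M (\<lambda>\<omega>. b * indicator (space M - E) \<omega> :: real)"
    using E by (intro integrable_mult_right integrable_real_indicator) (auto simp: emeasure_eq_measure)
  have "\<bar>expectation g1 - expectation g2\<bar> = \<bar>expectation (\<lambda>\<omega>. g1 \<omega> - g2 \<omega>)\<bar>"
    using i by simp
  also have "\<dots> \<le> expectation (\<lambda>\<omega>. \<bar>g1 \<omega> - g2 \<omega>\<bar>)" by (rule integral_abs_bound)
  also have "\<dots> \<le> expectation (\<lambda>\<omega>. a + b * indicator (space M - E) \<omega>)"
  proof (rule integral_mono)
    show "integrable M (\<lambda>\<omega>. \<bar>g1 \<omega> - g2 \<omega>\<bar>)" using i by auto
    show "integrable M (\<lambda>\<omega>. a + b * indicator (space M - E) \<omega>)" using iI by simp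
    fix \<omega> assume "\<omega> \<in> space M"
    then show "\<bar>g1 \<omega> - g2 \<omega>\<bar> \<le> a + b * indicator (space M - E) \<omega>"
      using a b by (cases "\<omega> \<in> E") (auto intro: add_increasing)
  qed
  also have "\<dots> = a + b * prob (space M - E)" using iI by (simp add: prob_space Int_absorb2)
  also have "prob (space M - E) = 1 - prob E" using E by (simp add: prob_compl)
  also have "a + b * (1 - prob E) \<le> a + b * \<epsilon>" using E b by (intro add_left_mono mult_left_mono) auto
  finally show ?thesis .
qed

lemma fin_lin_measurable:
  assumes "fin_lin L" "\<And>t. t \<in> {0..1} \<Longrightarrow> (\<lambda>\<omega>. Y \<omega> t) \<in> borel_measurable M"
  shows "(\<lambda>\<omega>. L (Y \<omega>)) \<in> borel_measurable M"
proof -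
  obtain T c where L: "finite T" "T \<subseteq> {0..1}" "L = (\<lambda>x. \<Sum>t\<in>T. c t * x t)" using assms(1) by (auto simp: fin_lin_def)
  show ?thesis unfolding L(3) using L(2) assms(2) by (intro borel_measurable_sum borel_measurable_times borel_measurable_const) auto
qed

lemma trigpoly_measurable:
  assumes "trigpoly g" "\<And>t. t \<in> {0..1} \<Longrightarrow> (\<lambda>\<omega>. Y \<omega> t) \<in> borel_measurable M"
  shows "(\<lambda>\<omega>. g (Y \<omega>)) \<in> borel_measurable M"
  using assms(1)
proof (induction rule: trigpoly.induct)
  case (cos L a \<phi>)
  note [measurable] = fin_lin_measurable[OF cos assms(2)]
  show ?case by measurable
qed (rule borel_measurable_add)

lemma (in prob_space) trigpoly_integrable:
  assumes "trigpoly g" "\<And>t. t \<in> {0..1} \<Longrightarrow> (\<lambda>\<omega>. Y \<omega> t) \<in> borel_measurable M"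
  shows "integrable M (\<lambda>\<omega>. g (Y \<omega>))"
proof -
  obtain P where "\<And>x. \<bar>g x\<bar> \<le> P" using trigpoly_bounded[OF assms(1)] by blast
  then show ?thesis by (intro integrable_const_bound[of _ P] AE_I2 trigpoly_measurable[OF assms]) auto
qed

text \<open>Through this identity, convergence of characteristic functions gives convergence of the
  means of all trigonometric polynomials.\<close>

lemma (in prob_space) expectation_cos_eq:
  assumes [measurable]: "L \<in> borel_measurable M"
  shows "expectation (\<lambda>\<omega>. a * cos (L \<omega> + \<phi>)) = a * Re (cis \<phi> * (CLINT \<omega>|M. iexp (L \<omega>)))"
proof -
  have "integrable M (\<lambda>\<omega>. cis \<phi> * iexp (L \<omega>))"
    by (rule integrable_const_bound[of _ 1]) (auto simp: norm_mult)
  then have "Re (CLINT \<omega>|M. cis \<phi> * iexp (L \<omega>)) = expectation (\<lambda>\<omega>. Re (cis \<phi> * iexp (L \<omega>)))"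
    by (rule integral_Re[symmetric])
  also have "(\<lambda>\<omega>. Re (cis \<phi> * iexp (L \<omega>))) = (\<lambda>\<omega>. cos (L \<omega> + \<phi>))"
    by (auto simp: cis_conv_exp[symmetric] cis_mult add.commute fun_eq_iff)
  finally have "expectation (\<lambda>\<omega>. cos (L \<omega> + \<phi>)) = Re (cis \<phi> * (CLINT \<omega>|M. iexp (L \<omega>)))"
    by (simp only: integral_mult_right_zero)
  then show ?thesis by simp
qed

text \<open>Cramer-Wold form of finite-dimensional convergence. \<open>Y\<close> will be the
  interpolated partial sums and \<open>Z\<close> the scaled fractional Brownian motion, on unrelated
  probability spaces.\<close>

locale fdd_convergence = M: prob_space M + N: prob_space N for M :: "'a measure" and N :: "'b measure" +
  fixes Y :: "nat \<Rightarrow> 'a \<Rightarrow> real \<Rightarrow> real" and Z :: "'b \<Rightarrow> real \<Rightarrow> real"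
  assumes Ymeas: "\<And>n t. t \<in> {0..1} \<Longrightarrow> (\<lambda>\<omega>. Y n \<omega> t) \<in> borel_measurable M"
    and Zmeas: "\<And>t. t \<in> {0..1} \<Longrightarrow> (\<lambda>\<omega>. Z \<omega> t) \<in> borel_measurable N"
    and cf: "\<And>T c. finite T \<Longrightarrow> T \<subseteq> {0..1} \<Longrightarrow>
      (\<lambda>n. CLINT \<omega>|M. iexp (\<Sum>t\<in>T. c t * Y n \<omega> t)) \<longlonglongrightarrow> (CLINT \<omega>|N. iexp (\<Sum>t\<in>T. c t * Z \<omega> t))"
begin

lemma trigpoly_convergence:
  assumes "trigpoly g"
  shows "(\<lambda>n. integral\<^sup>L M (\<lambda>\<omega>. g (Y n \<omega>))) \<longlonglongrightarrow> integral\<^sup>L N (\<lambda>\<omega>. g (Z \<omega>))"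
  using assms
proof (induction rule: trigpoly.induct)
  case (cos L a \<phi>)
  then obtain T c where L: "finite T" "T \<subseteq> {0..1}" "L = (\<lambda>x. \<Sum>t\<in>T. c t * x t)" by (auto simp: fin_lin_def)
  have m: "(\<lambda>\<omega>. L (Y n \<omega>)) \<in> borel_measurable M" "(\<lambda>\<omega>. L (Z \<omega>)) \<in> borel_measurable N" for n
    using fin_lin_measurable[OF cos] Ymeas Zmeas by blast+
  have "(\<lambda>n. CLINT \<omega>|M. iexp (L (Y n \<omega>))) \<longlonglongrightarrow> (CLINT \<omega>|N. iexp (L (Z \<omega>)))"
    unfolding L(3) by (rule cf) (use L in auto)
  then show ?case
    unfolding M.expectation_cos_eq[OF m(1)] N.expectation_cos_eq[OF m(2)] by (intro tendsto_intros)
next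
  case (add g h)
  have "integrable M (\<lambda>\<omega>. g (Y n \<omega>))" "integrable M (\<lambda>\<omega>. h (Y n \<omega>))"
    "integrable N (\<lambda>\<omega>. g (Z \<omega>))" "integrable N (\<lambda>\<omega>. h (Z \<omega>))" for n
    using M.trigpoly_integrable N.trigpoly_integrable add Ymeas Zmeas by blast+
  then show ?case using tendsto_add[OF add.IH] by simp
qed

text \<open>On the bounded range of \<open>g\<close> the function \<open>\<phi>\<close> is uniformly
  close to a polynomial, and a polynomial in a trigonometric polynomial is again one. It is needed
  for the clipping function applied below.\<close>

lemma continuous_trigpoly_convergence:
  fixes \<phi> :: "real \<Rightarrow> real"
  assumes g: "trigpoly g" and \<phi>: "continuous_on UNIV \<phi>"
  shows "(\<lambda>n. integral\<^sup>L M (\<lambda>\<omega>. \<phi> (g (Y n \<omega>)))) \<longlonglongrightarrow> integral\<^sup>L N (\<lambda>\<omega>. \<phi> (g (Z \<omega>)))"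
proof (rule LIMSEQ_I)
  fix e :: real assume e: "0 < e"
  obtain P where P: "\<And>x. \<bar>g x\<bar> \<le> P" using trigpoly_bounded[OF g] by blast
  obtain q where q: "real_polynomial_function q" "\<And>x. x \<in> {-P..P} \<Longrightarrow> \<bar>\<phi> x - q x\<bar> < e/4"
    using Stone_Weierstrass_real_polynomial_function[of "{-P..P}" \<phi> "e/4"] continuous_on_subset[OF \<phi>] e
    by (metis compact_Icc subset_UNIV zero_less_divide_iff zero_less_numeral)
  then obtain a n where an: "q = (\<lambda>x. \<Sum>i\<le>n. a i * x ^ i)"
    using real_polynomial_function_iff_sum by blast
  have tq: "trigpoly (\<lambda>x. q (g x))" unfolding an
    by (intro trigpoly_sum trigpoly_mult trigpoly_const trigpoly_power g)
  have \<phi>m[measurable]: "\<phi> \<in> borel_measurable borel" using \<phi> by (rule borel_measurable_continuous_onI)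
  have cl: "\<bar>\<phi> (g x) - q (g x)\<bar> \<le> e/4" for x using q(2)[of "g x"] P[of x] by (simp add: abs_le_iff)
  have qb: "\<exists>B. \<forall>x. \<bar>\<phi> (g x)\<bar> \<le> B"
  proof -
    obtain B where B: "\<And>x. \<bar>q (g x)\<bar> \<le> B" using trigpoly_bounded[OF tq] by blast
    have "\<bar>\<phi> (g x)\<bar> \<le> B + e/4" for x using cl[of x] B[of x] by linarith
    then show ?thesis by blast
  qed
  then obtain B where B: "\<And>x. \<bar>\<phi> (g x)\<bar> \<le> B" by blast
  have iM: "integrable M (\<lambda>\<omega>. \<phi> (g (Y n \<omega>)))" for n
    using B measurable_compose[OF trigpoly_measurable[OF g Ymeas] \<phi>m] by (intro M.integrable_const_bound[of _ B]) auto
  have iN: "integrable N (\<lambda>\<omega>. \<phi> (g (Z \<omega>)))"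
    using B measurable_compose[OF trigpoly_measurable[OF g Zmeas] \<phi>m] by (intro N.integrable_const_bound[of _ B]) auto
  have jM: "integrable M (\<lambda>\<omega>. q (g (Y n \<omega>)))" for n using M.trigpoly_integrable[OF tq Ymeas] .
  have jN: "integrable N (\<lambda>\<omega>. q (g (Z \<omega>)))" using N.trigpoly_integrable[OF tq Zmeas] .
  obtain n0 where n0: "\<And>n. n \<ge> n0 \<Longrightarrow> \<bar>integral\<^sup>L M (\<lambda>\<omega>. q (g (Y n \<omega>))) - integral\<^sup>L N (\<lambda>\<omega>. q (g (Z \<omega>)))\<bar> < e/4"
    using LIMSEQ_D[OF trigpoly_convergence[OF tq], of "e/4"] e by auto
  have "norm (integral\<^sup>L M (\<lambda>\<omega>. \<phi> (g (Y n \<omega>))) - integral\<^sup>L N (\<lambda>\<omega>. \<phi> (g (Z \<omega>)))) < e" if "n \<ge> n0" for n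
  proof -
    have "\<bar>integral\<^sup>L M (\<lambda>\<omega>. \<phi> (g (Y n \<omega>))) - integral\<^sup>L M (\<lambda>\<omega>. q (g (Y n \<omega>)))\<bar> \<le> e/4 + (e/4) * 0"
      using cl e by (intro M.expectation_diff_le[OF iM jM, of "space M"]) (auto simp: M.prob_space)
    moreover have "\<bar>integral\<^sup>L N (\<lambda>\<omega>. \<phi> (g (Z \<omega>))) - integral\<^sup>L N (\<lambda>\<omega>. q (g (Z \<omega>)))\<bar> \<le> e/4 + (e/4) * 0"
      using cl e by (intro N.expectation_diff_le[OF iN jN, of "space N"]) (auto simp: N.prob_space)
    ultimately show ?thesis using n0[OF that] e unfolding real_norm_def by linarith
  qed
  then show "\<exists>n0. \<forall>n\<ge>n0. norm (integral\<^sup>L M (\<lambda>\<omega>. \<phi> (g (Y n \<omega>))) - integral\<^sup>L N (\<lambda>\<omega>. \<phi> (g (Z \<omega>)))) < e" by blast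
qed

text \<open>On a compact set that carries almost all mass, \<open>f\<close> is replaced by a
  trigonometric polynomial \<open>g\<close>, whose mean converges. Off that set only boundedness is
  available, and the step paths \<open>S\<close> enter only through their uniform closeness to
  \<open>Y\<close>.\<close>

lemma weak_conv_D_if_tight:
  fixes r :: real and S :: "nat \<Rightarrow> 'a \<Rightarrow> real \<Rightarrow> real"
  assumes r: "0 \<le> r" "r < 1"
    and tightY: "\<And>e. 0 < e \<Longrightarrow> \<exists>A. \<forall>\<^sub>F n in sequentially. \<exists>E\<in>sets M. measure M E \<ge> 1 - e \<and> (\<forall>\<omega>\<in>E. Y n \<omega> \<in> holder_paths r A)"
    and tightZ: "\<And>e. 0 < e \<Longrightarrow> \<exists>A. \<exists>E\<in>sets N. measure N E \<ge> 1 - e \<and> (\<forall>\<omega>\<in>E. Z \<omega> \<in> holder_paths r A)"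
    and near: "\<And>e \<delta>. 0 < e \<Longrightarrow> 0 < \<delta> \<Longrightarrow> \<forall>\<^sub>F n in sequentially. \<exists>E\<in>sets M. measure M E \<ge> 1 - e \<and>
        (\<forall>\<omega>\<in>E. \<forall>t\<in>{0..1}. \<bar>Y n \<omega> t - S n \<omega> t\<bar> \<le> \<delta>)"
    and S: "\<And>n \<omega>. cadlag (S n \<omega>)" and Z: "\<And>\<omega>. \<omega> \<in> space N \<Longrightarrow> continuous_on {0..1} (Z \<omega>)"
    and fS: "\<And>f n. skorohod_bcont f \<Longrightarrow> (\<lambda>\<omega>. f (S n \<omega>)) \<in> borel_measurable M"
    and fZ: "\<And>f. skorohod_bcont f \<Longrightarrow> (\<lambda>\<omega>. f (Z \<omega>)) \<in> borel_measurable N"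
  shows "weak_conv_D M S N Z"
  unfolding weak_conv_D_def
proof (intro allI impI LIMSEQ_I)
  fix f :: "(real \<Rightarrow> real) \<Rightarrow> real" and e :: real
  assume f: "skorohod_bcont f" and e: "0 < e"
  obtain K0 where K0: "\<And>x. cadlag x \<Longrightarrow> \<bar>f x\<bar> \<le> K0" using f unfolding skorohod_bcont_def by blast
  define K where "K = max K0 1"
  have K: "1 \<le> K" "\<And>x. cadlag x \<Longrightarrow> \<bar>f x\<bar> \<le> K" using K0 by (auto simp: K_def le_max_iff_disj)
  \<comment> \<open>Error budget: 3e/10 for passing from \<open>S\<close> to \<open>Y\<close> and
    then to \<open>g\<close> (exceptional mass \<open>2 * \<eta>\<close>, oscillation
    \<open>2 * K\<close>), e/10 for the convergence of means, 3e/20 for returning to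
    \<open>f\<close> under the limit law.\<close>
  define \<eta> where "\<eta> = e / (40 * K)"
  have \<eta>: "0 < \<eta>" using e K by (simp add: \<eta>_def)
  obtain A1 where A1: "\<forall>\<^sub>F n in sequentially. \<exists>E\<in>sets M. measure M E \<ge> 1 - \<eta> \<and> (\<forall>\<omega>\<in>E. Y n \<omega> \<in> holder_paths r A1)"
    using tightY[OF \<eta>] by blast
  obtain A2 E2 where E2: "E2 \<in> sets N" "measure N E2 \<ge> 1 - \<eta>" "\<forall>\<omega>\<in>E2. Z \<omega> \<in> holder_paths r A2"
    using tightZ[OF \<eta>] by blast
  define A where "A = max A1 A2"
  have sub: "holder_paths r A1 \<subseteq> holder_paths r A" "holder_paths r A2 \<subseteq> holder_paths r A"
    using holder_paths_mono[OF r(1)] by (auto simp: A_def)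
  obtain g where g: "trigpoly g" "\<And>x. x \<in> holder_paths r A \<Longrightarrow> \<bar>f x - g x\<bar> < e/10"
    using trigpoly_dense_holder_paths[OF r f, of "e/10" A] e by auto
  obtain \<delta> where d: "0 < \<delta>" "\<And>x y. x \<in> holder_paths r A \<Longrightarrow> cadlag y \<Longrightarrow>
     (\<And>t. t \<in> {0..1} \<Longrightarrow> \<bar>x t - y t\<bar> \<le> \<delta>) \<Longrightarrow> \<bar>f x - f y\<bar> < e/10"
    using skorohod_bcont_uniform_on_holder_paths[OF r f, of "e/10" A] e by auto
  \<comment> \<open>Off the compact set \<open>g\<close> may be far larger than \<open>K\<close>,
    whatever \<open>A\<close> is. Clipping restores the bound \<open>K\<close> and does not increase
    the distance to \<open>f\<close>, which has its values in [-K, K].\<close>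
  define \<phi> where "\<phi> y = max (-K) (min K y)" for y :: real
  have \<phi>c: "continuous_on UNIV \<phi>" unfolding \<phi>_def by (intro continuous_intros)
  then have \<phi>m[measurable]: "\<phi> \<in> borel_measurable borel" by (rule borel_measurable_continuous_onI)
  have \<phi>b: "\<bar>\<phi> y\<bar> \<le> K" for y using K by (auto simp: \<phi>_def)
  have cad: "cadlag x" if "x \<in> holder_paths r A" for x
    using cadlag_continuous holder_paths_continuous[OF r that] by blast
  have app: "\<bar>f x - \<phi> (g x)\<bar> \<le> e/10" if "x \<in> holder_paths r A" for x
    using g(2)[OF that] K(2)[OF cad[OF that]] unfolding \<phi>_def by (auto simp: max_def min_def)
  have iY: "integrable M (\<lambda>\<omega>. \<phi> (g (Y n \<omega>)))" for n
    using \<phi>b measurable_compose[OF trigpoly_measurable[OF g(1) Ymeas] \<phi>m] by (intro M.integrable_const_bound[of _ K]) auto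
  have iZ: "integrable N (\<lambda>\<omega>. \<phi> (g (Z \<omega>)))"
    using \<phi>b measurable_compose[OF trigpoly_measurable[OF g(1) Zmeas] \<phi>m] by (intro N.integrable_const_bound[of _ K]) auto
  have jS: "integrable M (\<lambda>\<omega>. f (S n \<omega>))" for n
    using K(2)[OF S] fS[OF f] by (intro M.integrable_const_bound[of _ K]) auto
  have jZ: "integrable N (\<lambda>\<omega>. f (Z \<omega>))"
    using K(2)[OF cadlag_continuous[OF Z]] fZ[OF f] by (intro N.integrable_const_bound[of _ K]) auto
  have dZ: "\<bar>integral\<^sup>L N (\<lambda>\<omega>. f (Z \<omega>)) - integral\<^sup>L N (\<lambda>\<omega>. \<phi> (g (Z \<omega>)))\<bar> \<le> e/10 + 2 * K * \<eta>"
  proof (rule N.expectation_diff_le[OF jZ iZ E2(1,2)])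
    show "\<bar>f (Z \<omega>) - \<phi> (g (Z \<omega>))\<bar> \<le> 2 * K" if "\<omega> \<in> space N" for \<omega>
      using K(2)[OF cadlag_continuous[OF Z[OF that]]] \<phi>b[of "g (Z \<omega>)"] by linarith
    show "\<bar>f (Z \<omega>) - \<phi> (g (Z \<omega>))\<bar> \<le> e/10" if "\<omega> \<in> E2" for \<omega>
      using app E2(3) sub that by blast
  qed (use e K in auto)
  have "\<forall>\<^sub>F n in sequentially. \<bar>integral\<^sup>L M (\<lambda>\<omega>. \<phi> (g (Y n \<omega>))) - integral\<^sup>L N (\<lambda>\<omega>. \<phi> (g (Z \<omega>)))\<bar> < e/10"
    using tendstoD[OF continuous_trigpoly_convergence[OF g(1) \<phi>c], of "e/10"] e by (simp add: dist_real_def)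
  with A1 near[OF \<eta> d(1)]
  have "\<forall>\<^sub>F n in sequentially. norm (integral\<^sup>L M (\<lambda>\<omega>. f (S n \<omega>)) - integral\<^sup>L N (\<lambda>\<omega>. f (Z \<omega>))) < e"
  proof eventually_elim
    case (elim n)
    obtain E1 where E1: "E1 \<in> sets M" "measure M E1 \<ge> 1 - \<eta>" "\<forall>\<omega>\<in>E1. Y n \<omega> \<in> holder_paths r A1"
      using elim(1) by blast
    obtain E3 where E3: "E3 \<in> sets M" "measure M E3 \<ge> 1 - \<eta>" "\<forall>\<omega>\<in>E3. \<forall>t\<in>{0..1}. \<bar>Y n \<omega> t - S n \<omega> t\<bar> \<le> \<delta>"
      using elim(2) by blast
    have "measure M (E1 \<union> E3) = measure M E1 + measure M E3 - measure M (E1 \<inter> E3)"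
      using E1 E3 by (simp add: M.finite_measure_Union' M.finite_measure_Diff' Int_commute)
    then have pr: "measure M (E1 \<inter> E3) \<ge> 1 - 2 * \<eta>" using M.prob_le_1[of "E1 \<union> E3"] E1 E3 by linarith
    have "\<bar>integral\<^sup>L M (\<lambda>\<omega>. f (S n \<omega>)) - integral\<^sup>L M (\<lambda>\<omega>. \<phi> (g (Y n \<omega>)))\<bar> \<le> 2*e/10 + 2 * K * (2 * \<eta>)"
    proof (rule M.expectation_diff_le[OF jS iY _ pr])
      show "\<bar>f (S n \<omega>) - \<phi> (g (Y n \<omega>))\<bar> \<le> 2 * K" if "\<omega> \<in> space M" for \<omega>
        using K(2)[OF S] \<phi>b[of "g (Y n \<omega>)"] by (smt (verit))
      show "\<bar>f (S n \<omega>) - \<phi> (g (Y n \<omega>))\<bar> \<le> 2*e/10" if "\<omega> \<in> E1 \<inter> E3" for \<omega>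
      proof -
        have yk: "Y n \<omega> \<in> holder_paths r A" using E1(3) sub that by blast
        have "\<bar>f (Y n \<omega>) - f (S n \<omega>)\<bar> < e/10" using E3(3) that by (intro d(2)[OF yk S]) auto
        with app[OF yk] show ?thesis by linarith
      qed
    qed (use e K E1 E3 in auto)
    moreover have "K * \<eta> = e / 40" using K by (simp add: \<eta>_def)
    ultimately show ?case using dZ elim(3) e unfolding real_norm_def mult.assoc by linarith
  qed
  then show "\<exists>n0. \<forall>n\<ge>n0. norm (integral\<^sup>L M (\<lambda>\<omega>. f (S n \<omega>)) - integral\<^sup>L N (\<lambda>\<omega>. f (Z \<omega>))) < e"
    by (simp add: eventually_sequentially)
qed

end

section \<open>Dyadic chaining\<close>

definition dyadic_floor :: "nat \<Rightarrow> real \<Rightarrow> real" where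
  "dyadic_floor m s = of_int \<lfloor>2^m * s\<rfloor> / 2^m"

lemma dyadic_floor_nat:
  assumes "s \<in> {0..1}"
  obtains k where "k \<le> 2^m" "dyadic_floor m s = real k / 2^m" "\<lfloor>2^m * s\<rfloor> = int k"
proof -
  have "2^m * s \<le> 2^m" using assms by simp
  then have "\<lfloor>2^m * s\<rfloor> \<le> 2^m" by (metis floor_mono floor_numeral_power of_int_numeral)
  moreover have "0 \<le> \<lfloor>2^m * s\<rfloor>" using assms by simp
  ultimately show ?thesis
    by (intro that[of "nat \<lfloor>2^m * s\<rfloor>"]) (auto simp: dyadic_floor_def nat_le_iff)
qed

lemma dyadic_floor_in: "s \<in> {0..1} \<Longrightarrow> dyadic_floor m s \<in> {0..1}"
proof -
  assume "s \<in> {0..1}"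
  then obtain k where "k \<le> 2^m" "dyadic_floor m s = real k / 2^m" by (rule dyadic_floor_nat)
  moreover from this have "real k \<le> 2^m" by (metis of_nat_le_iff of_nat_numeral of_nat_power)
  ultimately show ?thesis by simp
qed

lemma dyadic_floor_near: "\<bar>s - dyadic_floor m s\<bar> \<le> (1/2)^m"
proof -
  have "dyadic_floor m s \<le> s" "s \<le> dyadic_floor m s + 1/2^m"
    unfolding dyadic_floor_def by (simp_all add: divide_le_eq add_divide_distrib[symmetric] le_divide_eq mult.commute)
  then show ?thesis by (simp add: power_divide abs_le_iff)
qed

lemma dyadic_floor_tendsto: "(\<lambda>m. dyadic_floor m s) \<longlonglongrightarrow> s"
proof (rule Lim_transform2[OF tendsto_const])
  have "(\<lambda>m. (1/2)^m :: real) \<longlonglongrightarrow> 0" by (rule LIMSEQ_realpow_zero) auto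
  then show "(\<lambda>m. s - dyadic_floor m s) \<longlonglongrightarrow> 0"
    by (rule Lim_null_comparison[rotated]) (simp add: dyadic_floor_near)
qed

text \<open>Refining the grid doubles the index of the floor or doubles it and adds one, so the
  floor either stays or moves by one step of the finer grid.\<close>

lemma dyadic_increment:
  fixes x :: "real \<Rightarrow> real"
  assumes x: "\<And>m k. k < 2^m \<Longrightarrow> \<bar>x (real (Suc k) / 2^m) - x (real k / 2^m)\<bar> \<le> A * r^m"
    and A: "0 \<le> A" "0 \<le> r" and s: "s \<in> {0..1}"
  shows "\<bar>x (dyadic_floor (Suc m) s) - x (dyadic_floor m s)\<bar> \<le> A * r^Suc m"
proof -
  obtain k where k: "k \<le> 2^m" "dyadic_floor m s = real k / 2^m" "\<lfloor>2^m * s\<rfloor> = int k" using dyadic_floor_nat[OF s] by metis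
  obtain l where l: "l \<le> 2^Suc m" "dyadic_floor (Suc m) s = real l / 2^Suc m" "\<lfloor>2^Suc m * s\<rfloor> = int l" using dyadic_floor_nat[OF s] by metis
  have "l = 2 * k \<or> l = Suc (2 * k)"
  proof -
    have "real k \<le> 2^m * s" "2^m * s < real k + 1" using k(3) by linarith+
    then have "real (2*k) \<le> 2^Suc m * s" "2^Suc m * s < real (2 * k) + 2" by simp_all
    then have "int (2*k) \<le> int l" "int l < int (2*k) + 2" using l(3) by linarith+
    then show ?thesis by auto
  qed
  moreover have "real (2 * k) / 2^Suc m = real k / 2^m" by simp
  ultimately show ?thesis
    using x[of "2*k" "Suc m"] l k(2) A by (auto simp del: power_Suc)
qed

text \<open>Telescoping over the levels gives a geometric series; the bound is free of
  \<open>n\<close> and survives the limit.\<close>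

lemma dyadic_floor_chain:
  fixes x :: "real \<Rightarrow> real"
  assumes x: "\<And>m k. k < 2^m \<Longrightarrow> \<bar>x (real (Suc k) / 2^m) - x (real k / 2^m)\<bar> \<le> A * r^m"
    and A: "0 \<le> A" "0 \<le> r" "r < 1" and s: "s \<in> {0..1}"
  shows "\<bar>x (dyadic_floor (m + n) s) - x (dyadic_floor m s)\<bar> \<le> A * r^m / (1 - r)"
proof -
  have "\<bar>x (dyadic_floor (m + n) s) - x (dyadic_floor m s)\<bar> \<le> (\<Sum>i<n. A * r^Suc (m + i))"
  proof (induction n)
    case (Suc n)
    then show ?case using dyadic_increment[OF x A(1,2) s, of "m + n"] by simp
  qed simp
  also have "\<dots> = A * r^Suc m * (\<Sum>i<n. r^i)" by (simp add: sum_distrib_left power_add mult_ac)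
  also have "(\<Sum>i<n. r^i) = (1 - r^n) / (1 - r)" using A by (subst sum_gp_strict) auto
  also have "A * r^Suc m * ((1 - r^n) / (1 - r)) \<le> A * r^m * (1 / (1 - r))"
    using A by (intro mult_mono divide_right_mono mult_left_mono) (auto simp: mult_left_le_one_le power_le_one)
  finally show ?thesis by simp
qed

text \<open>The factor 3: one move between equal or neighbouring grid points of level
  \<open>m\<close>, and one chain up to level \<open>m + n\<close> at each end. It is stated at
  dyadic floors and not at \<open>s\<close> and \<open>t\<close>, because the Gaussian process is
  first known at dyadic times only.\<close>

lemma dyadic_modulus:
  fixes x :: "real \<Rightarrow> real"
  assumes x: "\<And>m k. k < 2^m \<Longrightarrow> \<bar>x (real (Suc k) / 2^m) - x (real k / 2^m)\<bar> \<le> A * r^m"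
    and A: "0 \<le> A" "0 \<le> r" "r < 1" and s: "s \<in> {0..1}" "t \<in> {0..1}" and st: "\<bar>s - t\<bar> \<le> (1/2)^m"
  shows "\<bar>x (dyadic_floor (m + n) s) - x (dyadic_floor (m + n) t)\<bar> \<le> 3 * A / (1 - r) * r^m"
proof -
  have main: "\<bar>x (dyadic_floor m s) - x (dyadic_floor m t)\<bar> \<le> A * r^m" if s: "s \<in> {0..1}" "t \<in> {0..1}" and st: "\<bar>s - t\<bar> \<le> (1/2)^m" "s \<le> t" for s t
  proof -
    obtain k where k: "k \<le> 2^m" "dyadic_floor m s = real k / 2^m" "\<lfloor>2^m * s\<rfloor> = int k" using dyadic_floor_nat[OF s(1)] by metis
    obtain l where l: "l \<le> 2^m" "dyadic_floor m t = real l / 2^m" "\<lfloor>2^m * t\<rfloor> = int l" using dyadic_floor_nat[OF s(2)] by metis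
    have "2^m * s \<le> 2^m * t" using st by simp
    then have "int k \<le> int l" using k(3) l(3) floor_mono by metis
    moreover have "2^m * t \<le> 2^m * s + 1"
    proof -
      have "2^m * (t - s) \<le> 2^m * (1/2)^m" using st by (intro mult_left_mono) auto
      also have "2^m * (1/2::real)^m = 1" by (simp add: power_divide)
      finally show ?thesis by (simp add: algebra_simps)
    qed
    then have "int l \<le> int k + 1" using k(3) l(3) floor_mono[of "2^m * t" "2^m * s + 1"] by simp
    ultimately have "l = k \<or> l = Suc k" by auto
    then show ?thesis using x[of k m] k l A by (auto simp: abs_minus_commute)
  qed
  have 1: "\<bar>x (dyadic_floor m s) - x (dyadic_floor m t)\<bar> \<le> A * r^m"
    using main[OF s st] main[OF s(2,1)] st by (cases "s \<le> t") (auto simp: abs_minus_commute)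
  \<comment> \<open>Makes the move on level \<open>m\<close> no larger than the bound for a chain,
    so that three equal terms add up.\<close>
  have "A * r^m * 1 \<le> A * r^m * (1 / (1 - r))" using A by (intro mult_left_mono) auto
  then have "\<bar>x (dyadic_floor (m + n) s) - x (dyadic_floor (m + n) t)\<bar> \<le> 3 * (A * r^m / (1 - r))"
    using 1 dyadic_floor_chain[OF x A s(1), of m n] dyadic_floor_chain[OF x A s(2), of m n] by simp
  then show ?thesis by simp
qed

lemma dyadic_modulus_continuous:
  fixes x :: "real \<Rightarrow> real"
  assumes x: "\<And>m k. k < 2^m \<Longrightarrow> \<bar>x (real (Suc k) / 2^m) - x (real k / 2^m)\<bar> \<le> A * r^m"
    and A: "0 \<le> A" "0 \<le> r" "r < 1" and s: "s \<in> {0..1}" "t \<in> {0..1}" and st: "\<bar>s - t\<bar> \<le> (1/2)^m"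
    and c: "continuous_on {0..1} x"
  shows "\<bar>x s - x t\<bar> \<le> 3 * A / (1 - r) * r^m"
proof -
  have l: "(\<lambda>n. x (dyadic_floor (m + n) u)) \<longlonglongrightarrow> x u" if "u \<in> {0..1}" for u
  proof -
    have "(\<lambda>n. dyadic_floor (n + m) u) \<longlonglongrightarrow> u" by (rule LIMSEQ_ignore_initial_segment[OF dyadic_floor_tendsto])
    then show ?thesis
      using c that dyadic_floor_in[OF that] by (intro continuous_on_tendsto_compose[OF c]) (auto simp: add.commute)
  qed
  have "(\<lambda>n. \<bar>x (dyadic_floor (m + n) s) - x (dyadic_floor (m + n) t)\<bar>) \<longlonglongrightarrow> \<bar>x s - x t\<bar>"
    by (intro tendsto_intros l s)
  then show ?thesis by (rule LIMSEQ_le_const2) (use dyadic_modulus[OF x A s st] in auto)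
qed

text \<open>Markov's inequality for squares and a union bound. The factor \<open>(1/2)^m\<close> in
  the hypothesis cancels the number \<open>2^m\<close> of intervals of level \<open>m\<close>; what
  is left is a geometric series of ratio \<open>\<rho> / r\<^sup>2\<close>.\<close>

lemma (in prob_space) dyadic_increments_event:
  fixes Y :: "real \<Rightarrow> 'a \<Rightarrow> real"
  assumes Y: "\<And>t. t \<in> {0..1} \<Longrightarrow> Y t \<in> borel_measurable M"
    and i: "\<And>m k. k < 2^m \<Longrightarrow> integrable M (\<lambda>\<omega>. (Y (real (Suc k) / 2^m) \<omega> - Y (real k / 2^m) \<omega>)\<^sup>2)"
    and C: "\<And>m k. k < 2^m \<Longrightarrow> expectation (\<lambda>\<omega>. (Y (real (Suc k) / 2^m) \<omega> - Y (real k / 2^m) \<omega>)\<^sup>2) \<le> C * (1/2)^m * \<rho>^m"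
    and \<rho>: "0 \<le> \<rho>" "\<rho> < r\<^sup>2" and r: "0 < r" and A: "0 < A"
  shows "\<exists>E\<in>sets M. prob E \<ge> 1 - C / (A\<^sup>2 * (1 - \<rho> / r\<^sup>2)) \<and>
     (\<forall>\<omega>\<in>E. \<forall>m. \<forall>k<2^m. \<bar>Y (real (Suc k) / 2^m) \<omega> - Y (real k / 2^m) \<omega>\<bar> \<le> A * r^m)"
proof -
  let ?D = "\<lambda>m k \<omega>. Y (real (Suc k) / 2^m) \<omega> - Y (real k / 2^m) \<omega>"
  have Dm: "?D m k \<in> borel_measurable M" if "k < 2^m" for m k
  proof -
    have "real (Suc k) \<le> 2^m" using that by (metis Suc_leI of_nat_le_iff of_nat_numeral of_nat_power)
    then show ?thesis by (intro borel_measurable_diff Y) (use that in \<open>auto simp: field_simps\<close>)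
  qed
  define F where "F m k = {\<omega> \<in> space M. (A * r^m)\<^sup>2 \<le> (?D m k \<omega>)\<^sup>2}" for m k
  have Fs: "F m k \<in> sets M" if "k < 2^m" for m k unfolding F_def using Dm[OF that] by measurable
  have Fp: "prob (F m k) \<le> C * (1/2)^m * \<rho>^m / (A * r^m)\<^sup>2" if "k < 2^m" for m k
  proof -
    have "prob (F m k) \<le> expectation (\<lambda>\<omega>. (?D m k \<omega>)\<^sup>2) / (A * r^m)\<^sup>2"
      unfolding F_def using A r by (intro integral_Markov_inequality_measure[where A="{}"] i[OF that]) auto
    also have "\<dots> \<le> C * (1/2)^m * \<rho>^m / (A * r^m)\<^sup>2" by (intro divide_right_mono C[OF that]) auto
    finally show ?thesis .
  qed
  define G where "G m = (\<Union>k<2^m. F m k)" for m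
  have Gs: "G m \<in> sets M" for m unfolding G_def using Fs by auto
  have Gp: "prob (G m) \<le> C / A\<^sup>2 * (\<rho> / r\<^sup>2)^m" for m
  proof -
    have "prob (G m) \<le> (\<Sum>k<2^m. prob (F m k))" unfolding G_def
      by (rule finite_measure_subadditive_finite) (use Fs in auto)
    also have "\<dots> \<le> (\<Sum>k<(2::nat)^m. C * (1/2)^m * \<rho>^m / (A * r^m)\<^sup>2)" by (intro sum_mono Fp) auto
    also have "\<dots> = C / A\<^sup>2 * (\<rho> / r\<^sup>2)^m"
      by (simp add: power_divide power_mult_distrib power_mult[symmetric] mult.commute)
    finally show ?thesis .
  qed
  have q: "\<rho> / r\<^sup>2 < 1" "0 \<le> \<rho> / r\<^sup>2" using \<rho> r by (auto simp: field_simps)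
  have sG: "summable (\<lambda>m. C / A\<^sup>2 * (\<rho> / r\<^sup>2)^m)" using q by (intro summable_mult summable_geometric) auto
  have sP: "summable (\<lambda>m. prob (G m))" using Gp by (intro summable_comparison_test'[OF sG, of 0]) auto
  have "prob (\<Union>m. G m) \<le> (\<Sum>m. prob (G m))"
    by (rule finite_measure_subadditive_countably) (use Gs sP in auto)
  also have "\<dots> \<le> (\<Sum>m. C / A\<^sup>2 * (\<rho> / r\<^sup>2)^m)" by (rule suminf_le[OF Gp sP sG])
  also have "\<dots> = C / A\<^sup>2 * (1 / (1 - \<rho> / r\<^sup>2))" using q
    by (subst suminf_mult) (auto intro!: summable_geometric simp: suminf_geometric)
  finally have U: "prob (\<Union>m. G m) \<le> C / (A\<^sup>2 * (1 - \<rho> / r\<^sup>2))" by simp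
  have "prob (space M - (\<Union>m. G m)) = 1 - prob (\<Union>m. G m)" using Gs by (intro prob_compl) auto
  then have "prob (space M - (\<Union>m. G m)) \<ge> 1 - C / (A\<^sup>2 * (1 - \<rho> / r\<^sup>2))" using U by linarith
  moreover have "\<bar>?D m k \<omega>\<bar> \<le> A * r^m" if "\<omega> \<in> space M - (\<Union>m. G m)" "k < 2^m" for \<omega> m k
  proof -
    have "\<not> (A * r^m)\<^sup>2 \<le> (?D m k \<omega>)\<^sup>2" using that by (auto simp: G_def F_def)
    then have "\<bar>?D m k \<omega>\<bar>\<^sup>2 \<le> (A * r^m)\<^sup>2" by simp
    then show ?thesis using A r by (intro power2_le_imp_le[of "\<bar>?D m k \<omega>\<bar>"]) auto
  qed
  ultimately show ?thesis using Gs by (intro bexI[of _ "space M - (\<Union>m. G m)"]) auto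
qed

subsection \<open>Gaussian processes with a given covariance\<close>

definition psd_kernel :: "('i \<Rightarrow> 'i \<Rightarrow> real) \<Rightarrow> bool" where
  "psd_kernel K \<longleftrightarrow> (\<forall>i j. K i j = K j i) \<and> (\<forall>T c. finite T \<longrightarrow> 0 \<le> (\<Sum>i\<in>T. \<Sum>j\<in>T. c i * c j * K i j))"

text \<open>The Schur complement of the pivot \<open>p\<close>; if \<open>K p p = 0\<close> the division by zero
  makes this \<open>K\<close> itself, which is right because then the whole row \<open>p\<close> vanishes.\<close>

definition schur :: "('i \<Rightarrow> 'i \<Rightarrow> real) \<Rightarrow> 'i \<Rightarrow> 'i \<Rightarrow> 'i \<Rightarrow> real" where
  "schur K p i j = K i j - K i p * K j p / K p p"

lemma psd_kernel_diag_nonneg: assumes "psd_kernel K" shows "0 \<le> K i i"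
proof -
  have "0 \<le> (\<Sum>k\<in>{i}. \<Sum>j\<in>{i}. 1 * 1 * K k j)"
    using assms[unfolded psd_kernel_def, THEN conjunct2, rule_format, of "{i}" "\<lambda>_. 1"] by simp
  then show ?thesis by simp
qed

text \<open>With a zero diagonal entry the quadratic form at e_i + t e_p is affine in t, and an
  affine function that stays nonnegative has slope zero.\<close>

lemma psd_kernel_zero_row: assumes "psd_kernel K" "K p p = 0" shows "K i p = 0"
proof (cases "i = p")
  case False
  have sym: "K p i = K i p" using assms(1) unfolding psd_kernel_def by metis
  \<comment> \<open>Chosen to give the form the value -1 when \<open>K i p\<close> is not
    zero.\<close>
  define t where "t = - (K i i + 1) / (2 * K i p)"
  have "0 \<le> (\<Sum>k\<in>{i,p}. \<Sum>j\<in>{i,p}. (if k = i then 1 else t) * (if j = i then 1 else t) * K k j)"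
    using assms(1)[unfolded psd_kernel_def, THEN conjunct2, rule_format, of "{i,p}" "\<lambda>k. if k = i then 1 else t"] by simp
  also have "\<dots> = K i i + 2 * t * K i p" using False assms(2) sym by simp
  finally have "0 \<le> K i i + 2 * t * K i p" .
  moreover have "2 * t * K i p = - (K i i + 1)" if "K i p \<noteq> 0" using that by (simp add: t_def)
  ultimately show ?thesis by linarith
qed (use assms in auto)

text \<open>The form of the Schur complement is the form of \<open>K\<close> minimised over the
  coefficient at the pivot, hence still nonnegative.\<close>

lemma psd_kernel_schur: assumes K: "psd_kernel K" shows "psd_kernel (schur K p)"
proof (cases "K p p = 0")
  case True
  then have "schur K p = K" by (intro ext) (simp add: schur_def)
  then show ?thesis using K by simp
next
  case False
  have sym: "K i j = K j i" for i j using K unfolding psd_kernel_def by metis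
  have "0 \<le> (\<Sum>i\<in>T. \<Sum>j\<in>T. c i * c j * schur K p i j)" if T: "finite T" for T c
  proof -
    define T' where "T' = insert p T"
    define s where "s = (\<Sum>i\<in>T. c i * K i p)"
    \<comment> \<open>The minimising correction of the coefficient at \<open>p\<close>. It is
      subtracted from whatever \<open>c\<close> prescribes there, since \<open>p\<close> may already
      belong to \<open>T\<close>.\<close>
    define a where "a = s / K p p"
    define c' where "c' i = (if i \<in> T then c i else 0) - (if i = p then a else 0)" for i
    have fT': "finite T'" using T by (simp add: T'_def)
    have sum': "(\<Sum>i\<in>T'. c' i * g i) = (\<Sum>i\<in>T. c i * g i) - a * g p" for g
    proof -
      have "(\<Sum>i\<in>T'. c' i * g i) = (\<Sum>i\<in>T'. if i \<in> T then c i * g i else 0) - (\<Sum>i\<in>T'. if i = p then a * g i else 0)"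
        unfolding sum_subtractf[symmetric] by (intro sum.cong) (auto simp: c'_def algebra_simps)
      also have "(\<Sum>i\<in>T'. if i \<in> T then c i * g i else 0) = (\<Sum>i\<in>T. c i * g i)"
        using fT' by (subst sum.inter_restrict[symmetric]) (auto simp: T'_def intro!: sum.cong)
      also have "(\<Sum>i\<in>T'. if i = p then a * g i else 0) = a * g p"
        using fT' by (simp add: sum.delta T'_def)
      finally show ?thesis .
    qed
    have "0 \<le> (\<Sum>i\<in>T'. \<Sum>j\<in>T'. c' i * c' j * K i j)"
      using K fT' unfolding psd_kernel_def by blast
    also have "\<dots> = (\<Sum>i\<in>T'. c' i * (\<Sum>j\<in>T'. c' j * K i j))" by (simp add: sum_distrib_left mult.assoc)
    also have "\<dots> = (\<Sum>i\<in>T. c i * (\<Sum>j\<in>T'. c' j * K i j)) - a * (\<Sum>j\<in>T'. c' j * K p j)" by (rule sum')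
    also have "\<dots> = (\<Sum>i\<in>T. c i * ((\<Sum>j\<in>T. c j * K i j) - a * K i p)) - a * ((\<Sum>j\<in>T. c j * K p j) - a * K p p)"
      unfolding sum' ..
    also have "(\<Sum>j\<in>T. c j * K p j) = s" unfolding s_def by (simp add: sym[of p])
    also have "s - a * K p p = 0" using False by (simp add: a_def)
    also have "(\<Sum>i\<in>T. c i * ((\<Sum>j\<in>T. c j * K i j) - a * K i p)) - a * 0 = (\<Sum>i\<in>T. \<Sum>j\<in>T. c i * c j * schur K p i j)"
    proof -
      have "(\<Sum>j\<in>T. c j * K i j) - a * K i p = (\<Sum>j\<in>T. c j * schur K p i j)" for i
      proof -
        have "a * K i p = (\<Sum>j\<in>T. c j * (K i p * K j p / K p p))"
          unfolding a_def s_def sum_distrib_right sum_divide_distrib by (intro sum.cong) (simp_all add: mult_ac)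
        then show ?thesis by (simp add: schur_def right_diff_distrib sum_subtractf)
      qed
      then have "(\<Sum>i\<in>T. c i * ((\<Sum>j\<in>T. c j * K i j) - a * K i p)) = (\<Sum>i\<in>T. c i * (\<Sum>j\<in>T. c j * schur K p i j))"
        by (simp only:)
      also have "\<dots> = (\<Sum>i\<in>T. \<Sum>j\<in>T. c i * c j * schur K p i j)"
        by (simp only: sum_distrib_left mult.assoc)
      finally show ?thesis by simp
    qed
    finally show ?thesis .
  qed
  moreover have "schur K p i j = schur K p j i" for i j by (simp add: schur_def sym[of i j] mult.commute)
  ultimately show ?thesis unfolding psd_kernel_def by blast
qed

fun schur_iter :: "(nat \<Rightarrow> nat \<Rightarrow> real) \<Rightarrow> nat \<Rightarrow> nat \<Rightarrow> nat \<Rightarrow> real" where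
  "schur_iter K 0 = K"
| "schur_iter K (Suc n) = schur (schur_iter K n) n"

lemma psd_schur_iter: "psd_kernel K \<Longrightarrow> psd_kernel (schur_iter K n)"
  by (induction n) (auto intro: psd_kernel_schur)

lemma schur_pivot_zero: assumes "psd_kernel K" shows "schur K p i p = 0"
  using psd_kernel_zero_row[OF assms, of p i] by (cases "K p p = 0") (auto simp: schur_def)

text \<open>A cleared column stays cleared: by symmetry the correction in column \<open>j\<close>
  contains the entry of row \<open>n\<close> and column \<open>j\<close>, which already
  vanishes.\<close>

lemma schur_iter_zero:
  assumes K: "psd_kernel K" shows "j < n \<Longrightarrow> schur_iter K n i j = 0"
proof (induction n arbitrary: i j)
  case (Suc n)
  show ?case
  proof (cases "j = n")
    case True
    then show ?thesis using schur_pivot_zero[OF psd_schur_iter[OF K]] by simp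
  next
    case False
    moreover have "schur_iter K n j n = schur_iter K n n j"
      using psd_schur_iter[OF K] unfolding psd_kernel_def by metis
    ultimately show ?thesis using Suc by (simp add: schur_def)
  qed
qed simp

text \<open>The lower triangular factor read off from Gaussian elimination. A zero pivot yields a
  zero column by division by zero, in agreement with the vanishing of the corresponding row.\<close>

definition cholesky :: "(nat \<Rightarrow> nat \<Rightarrow> real) \<Rightarrow> nat \<Rightarrow> nat \<Rightarrow> real" where
  "cholesky K i k = schur_iter K k i k / sqrt (schur_iter K k k k)"

text \<open>Each elimination step subtracts one product of factor entries; after \<open>n\<close>
  steps nothing remains at a column below \<open>n\<close>.\<close>

lemma cholesky_eq:
  assumes K: "psd_kernel K" and n: "i < n" "j < n"
  shows "K i j = (\<Sum>k<n. cholesky K i k * cholesky K j k)"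
proof -
  have "schur_iter K n i j = K i j - (\<Sum>k<n. cholesky K i k * cholesky K j k)" for n i j
  proof (induction n)
    case (Suc n)
    have "cholesky K i n * cholesky K j n = schur_iter K n i n * schur_iter K n j n / schur_iter K n n n"
      using psd_kernel_diag_nonneg[OF psd_schur_iter[OF K], of n n] by (simp add: cholesky_def)
    then show ?case using Suc by (simp add: schur_def)
  qed simp
  from this[of n i j] schur_iter_zero[OF K n(2), of i] show ?thesis by simp
qed

lemma cholesky_zero: "psd_kernel K \<Longrightarrow> i < k \<Longrightarrow> cholesky K i k = 0"
proof -
  assume K: "psd_kernel K" "i < k"
  have "schur_iter K k i k = schur_iter K k k i" using psd_schur_iter[OF K(1)] unfolding psd_kernel_def by metis
  then show ?thesis using schur_iter_zero[OF K] by (simp add: cholesky_def)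
qed

definition gauss_space :: "(real \<Rightarrow> real) measure" where
  "gauss_space = PiM UNIV (\<lambda>_. std_normal_distribution)"

text \<open>The white noise is indexed by the reals only because the sample space has to be a space
  of functions on the reals; the coordinates at the naturals are the ones used.\<close>

lemma prob_space_std_normal: "prob_space std_normal_distribution"
  using real_dist_normal_dist by (simp add: real_distribution_def)

lemma prob_space_gauss: "prob_space gauss_space"
  unfolding gauss_space_def by (rule prob_space_PiM) (rule prob_space_std_normal)

lemma gauss_coord_measurable: "(\<lambda>\<omega>. \<omega> k) \<in> borel_measurable gauss_space"
proof -
  have "(\<lambda>\<omega>. \<omega> k) \<in> measurable gauss_space std_normal_distribution"
    unfolding gauss_space_def by (rule measurable_component_singleton) simp
  also have "measurable gauss_space std_normal_distribution = borel_measurable gauss_space"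
    by (rule measurable_cong_sets) simp_all
  finally show ?thesis .
qed

lemma gauss_coord_distr: "distr gauss_space borel (\<lambda>\<omega>. \<omega> k) = std_normal_distribution"
proof -
  have "distr gauss_space std_normal_distribution (\<lambda>\<omega>. \<omega> k) = std_normal_distribution"
    unfolding gauss_space_def by (rule distr_PiM_component[where I = UNIV and M = "\<lambda>_. std_normal_distribution"]) (auto intro: prob_space_std_normal)
  moreover have "distr gauss_space std_normal_distribution (\<lambda>\<omega>. \<omega> k) = distr gauss_space borel (\<lambda>\<omega>. \<omega> k)"
    by (rule distr_cong) simp_all
  ultimately show ?thesis by simp
qed

lemma gauss_indep: "prob_space.indep_vars gauss_space (\<lambda>_. borel) (\<lambda>k \<omega>. \<omega> k) UNIV"
proof -
  have "sets gauss_space = sets (PiM UNIV (\<lambda>_::real. borel :: real measure))"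
    unfolding gauss_space_def by (rule sets_PiM_cong) simp_all
  then have "distr gauss_space (PiM UNIV (\<lambda>_. borel)) (\<lambda>\<omega>. \<omega>) = gauss_space"
    by (intro distr_id2) simp
  then show ?thesis
    by (subst prob_space.indep_vars_iff_distr_eq_PiM[OF prob_space_gauss])
       (auto simp: gauss_coord_distr gauss_space_def[symmetric] restrict_UNIV gauss_coord_measurable)
qed

lemma gauss_coord_moments:
  shows "integrable gauss_space (\<lambda>\<omega>. \<omega> k)" "integral\<^sup>L gauss_space (\<lambda>\<omega>. \<omega> k) = 0"
    "integrable gauss_space (\<lambda>\<omega>. (\<omega> k)\<^sup>2)" "integral\<^sup>L gauss_space (\<lambda>\<omega>. (\<omega> k)\<^sup>2) = 1"
proof -
  note [measurable] = gauss_coord_measurable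
  have 1: "integrable gauss_space (\<lambda>\<omega>. (\<omega> k)^j) = integrable std_normal_distribution (\<lambda>x. x^j)" for j
    unfolding gauss_coord_distr[of k, symmetric] by (subst integrable_distr_eq) auto
  have 2: "integral\<^sup>L gauss_space (\<lambda>\<omega>. (\<omega> k)^j) = integral\<^sup>L std_normal_distribution (\<lambda>x. x^j)" for j
    unfolding gauss_coord_distr[of k, symmetric] by (subst integral_distr) auto
  show "integrable gauss_space (\<lambda>\<omega>. \<omega> k)" using 1[of 1] integrable_std_normal_distribution_moment[of 1] by simp
  show "integrable gauss_space (\<lambda>\<omega>. (\<omega> k)\<^sup>2)" using 1[of 2] integrable_std_normal_distribution_moment[of 2] by simp
  show "integral\<^sup>L gauss_space (\<lambda>\<omega>. \<omega> k) = 0" using 2[of 1] integral_std_normal_distribution_moment_odd[of 1] by simp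
  show "integral\<^sup>L gauss_space (\<lambda>\<omega>. (\<omega> k)\<^sup>2) = 1" using 2[of 2] std_normal_distribution_even_moments(1)[of 1] by simp
qed

lemma gauss_linear_second_moment:
  fixes a :: "nat \<Rightarrow> real"
  shows "integrable gauss_space (\<lambda>\<omega>. (\<Sum>k<n. a k * \<omega> (real k))\<^sup>2)" (is ?I)
    "integral\<^sup>L gauss_space (\<lambda>\<omega>. (\<Sum>k<n. a k * \<omega> (real k))\<^sup>2) = (\<Sum>k<n. (a k)\<^sup>2)" (is ?E)
proof -
  interpret prob_space gauss_space by (rule prob_space_gauss)
  have p: "integrable gauss_space (\<lambda>\<omega>. \<omega> x * \<omega> y) \<and> integral\<^sup>L gauss_space (\<lambda>\<omega>. \<omega> x * \<omega> y) = (if x = y then 1 else 0)" for x y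
  proof (cases "x = y")
    case True
    then show ?thesis using gauss_coord_moments[of y] by (simp add: power2_eq_square)
  next
    case False
    have iv: "indep_vars (\<lambda>_. borel) (\<lambda>k \<omega>. \<omega> k) {x,y}" by (rule indep_vars_subset[OF gauss_indep]) simp
    have "integrable gauss_space (\<lambda>\<omega>. \<Prod>k\<in>{x,y}. \<omega> k)"
      by (rule indep_vars_integrable[OF _ iv]) (auto intro: gauss_coord_moments)
    moreover have "integral\<^sup>L gauss_space (\<lambda>\<omega>. \<Prod>k\<in>{x,y}. \<omega> k) = (\<Prod>k\<in>{x,y}. integral\<^sup>L gauss_space (\<lambda>\<omega>. \<omega> k))"
      by (rule indep_vars_lebesgue_integral[OF _ iv]) (auto intro: gauss_coord_moments)
    ultimately show ?thesis using False by (simp add: gauss_coord_moments)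
  qed
  have e: "(\<lambda>\<omega>. (\<Sum>k<n. a k * \<omega> (real k))\<^sup>2) = (\<lambda>\<omega>. \<Sum>k<n. \<Sum>l<n. a k * a l * (\<omega> (real k) * \<omega> (real l)))"
    by (simp add: power2_eq_square sum_product mult_ac)
  show ?I unfolding e using p by (intro Bochner_Integration.integrable_sum integrable_mult_right) auto
  have "integral\<^sup>L gauss_space (\<lambda>\<omega>. (\<Sum>k<n. a k * \<omega> (real k))\<^sup>2) = (\<Sum>k<n. \<Sum>l<n. a k * a l * (if k = l then 1 else 0))"
    unfolding e using p by (subst Bochner_Integration.integral_sum; (intro Bochner_Integration.integrable_sum integrable_mult_right)?) (auto simp: Bochner_Integration.integral_sum intro!: sum.cong)
  also have "\<dots> = (\<Sum>k<n. (a k)\<^sup>2)"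
    by (intro sum.cong) (auto simp: power2_eq_square if_distrib[of "\<lambda>x. _ * x"] sum.delta cong: if_cong)
  finally show ?E .
qed

lemma gauss_cf:
  fixes a :: "nat \<Rightarrow> real"
  shows "(CLINT \<omega>|gauss_space. iexp (\<Sum>k<n. a k * \<omega> (real k))) = complex_of_real (exp (- (\<Sum>k<n. (a k)\<^sup>2) / 2))"
proof -
  interpret prob_space gauss_space by (rule prob_space_gauss)
  note [measurable] = gauss_coord_measurable
  \<comment> \<open>The coordinates carry real indices, so the floor recovers the natural number
    that selects the coefficient.\<close>
  define f where "f x y = iexp (a (nat \<lfloor>x\<rfloor>) * y)" for x y :: real
  have inj: "inj_on real {..<n}" by (simp add: inj_on_def)
  have ind: "indep_vars (\<lambda>_. borel) (\<lambda>x \<omega>. f x (\<omega> x)) (real ` {..<n})"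
    unfolding f_def by (rule indep_vars_compose2[OF indep_vars_subset[OF gauss_indep]]) auto
  have fi: "integrable gauss_space (\<lambda>\<omega>. f x (\<omega> x))" for x
    unfolding f_def by (intro integrable_const_bound[of _ 1] AE_I2) auto
  have "iexp (\<Sum>k<n. a k * \<omega> (real k)) = (\<Prod>x\<in>real ` {..<n}. f x (\<omega> x))" for \<omega>
    by (simp add: prod.reindex[OF inj] f_def exp_sum[symmetric] sum_distrib_left)
  then have "(CLINT \<omega>|gauss_space. iexp (\<Sum>k<n. a k * \<omega> (real k))) = (CLINT \<omega>|gauss_space. (\<Prod>x\<in>real ` {..<n}. f x (\<omega> x)))"
    by simp
  also have "\<dots> = (\<Prod>x\<in>real ` {..<n}. CLINT \<omega>|gauss_space. f x (\<omega> x))"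
    by (rule indep_vars_lebesgue_integral[OF _ ind fi]) auto
  also have "\<dots> = (\<Prod>k<n. CLINT \<omega>|gauss_space. iexp (a k * \<omega> (real k)))"
    by (simp add: prod.reindex[OF inj] f_def)
  also have "\<dots> = (\<Prod>k<n. complex_of_real (exp (- (a k)\<^sup>2 / 2)))"
  proof (rule prod.cong)
    fix k
    have "(CLINT \<omega>|gauss_space. iexp (a k * \<omega> (real k))) = char (distr gauss_space borel (\<lambda>\<omega>. \<omega> (real k))) (a k)"
      unfolding char_def by (subst integral_distr) auto
    also have "\<dots> = complex_of_real (exp (- (a k)\<^sup>2 / 2))"
      unfolding gauss_coord_distr by (simp add: char_std_normal_distribution)
    finally show "(CLINT \<omega>|gauss_space. iexp (a k * \<omega> (real k))) = complex_of_real (exp (- (a k)\<^sup>2 / 2))" .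
  qed simp
  also have "\<dots> = complex_of_real (exp (- (\<Sum>k<n. (a k)\<^sup>2) / 2))"
    by (simp add: exp_sum[symmetric] sum_negf sum_divide_distrib flip: of_real_prod)
  finally show ?thesis .
qed

subsection \<open>Fractional Brownian motion\<close>

lemma set_integrable_powr_0_1:
  assumes "-1 < a" shows "set_integrable lborel {0<..1} (\<lambda>x::real. x powr a)"
proof -
  have "(\<lambda>x::real. x powr a) integrable_on {0<..1}" using assms by (intro integrable_on_powr_from_0') auto
  then have "(\<lambda>x::real. x powr a) absolutely_integrable_on {0<..1}"
    by (subst absolutely_integrable_on_iff_nonneg) auto
  then show ?thesis unfolding set_integrable_def by (subst (asm) integrable_completion) auto
qed

lemma set_integrable_powr_to_inf:
  assumes "a < -1" shows "set_integrable lborel {1..} (\<lambda>x::real. x powr a)"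
proof -
  have "(\<lambda>x::real. x powr a) integrable_on {1..}" using has_integral_powr_to_inf[OF assms, of 1] by (auto simp: integrable_on_def)
  then have "(\<lambda>x::real. x powr a) absolutely_integrable_on {1..}"
    by (subst absolutely_integrable_on_iff_nonneg) auto
  then show ?thesis unfolding set_integrable_def by (subst (asm) integrable_completion) auto
qed

lemma one_minus_cos_le: "1 - cos x \<le> (x::real)\<^sup>2"
proof -
  have "1 - cos x = 2 * (sin (x/2))\<^sup>2" using cos_double_sin[of "x/2"] by simp
  also have "\<dots> \<le> 2 * (x/2)\<^sup>2" using abs_sin_x_le_abs_x[of "x/2"] by (intro mult_left_mono) (auto simp: abs_le_square_iff[symmetric])
  also have "\<dots> \<le> x\<^sup>2" by (simp add: power2_eq_square)
  finally show ?thesis .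
qed

context
  fixes H :: real assumes H: "0 < H" "H < 1"
begin

text \<open>Up to a constant, the spectral density of fractional Brownian motion, restricted to the
  positive half-line. It serves to show that the covariance is positive semidefinite.\<close>

definition frac_wt :: "real \<Rightarrow> real" where "frac_wt x = indicator {0<..} x * x powr (-1 - 2*H)"

lemma frac_wt_nonneg: "0 \<le> frac_wt x" by (simp add: frac_wt_def)

lemma frac_wt_measurable[measurable]: "frac_wt \<in> borel_measurable borel"
  unfolding frac_wt_def[abs_def] by measurable

text \<open>Near zero the quadratic bound leaves the exponent 1 - 2H > -1, as H < 1; at infinity
  boundedness leaves -1 - 2H < -1, as H > 0.\<close>

lemma frac_wt_integrable:
  assumes [measurable]: "g \<in> borel_measurable borel" and g: "\<And>x. \<bar>g x\<bar> \<le> C * x\<^sup>2" "\<And>x. \<bar>g x\<bar> \<le> C"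
  shows "integrable lborel (\<lambda>x. g x * frac_wt x)"
proof -
  have 1: "integrable lborel (\<lambda>x. C * (indicator {0<..1} x * x powr (1 - 2*H)))"
    using set_integrable_powr_0_1[of "1-2*H"] H by (simp add: set_integrable_def)
  have 2: "integrable lborel (\<lambda>x. C * (indicator {1..} x * x powr (-1 - 2*H)))"
    using set_integrable_powr_to_inf[of "-1-2*H"] H by (simp add: set_integrable_def)
  have C: "0 \<le> C" using g(2)[of 0] by linarith
  show ?thesis
  proof (rule Bochner_Integration.integrable_bound[OF Bochner_Integration.integrable_add[OF 1 2]])
    show "AE x in lborel. norm (g x * frac_wt x) \<le> norm (C * (indicator {0<..1} x * x powr (1 - 2*H)) + C * (indicator {1..} x * x powr (-1 - 2*H)))"
    proof (rule AE_I2)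
      fix x :: real
      consider "x \<le> 0" | "0 < x" "x \<le> 1" | "1 < x" by linarith
      then show "norm (g x * frac_wt x) \<le> norm (C * (indicator {0<..1} x * x powr (1 - 2*H)) + C * (indicator {1..} x * x powr (-1 - 2*H)))"
      proof cases
        case 2
        have "x\<^sup>2 * x powr (-1 - 2*H) = x powr (1 - 2*H)"
          using 2 by (simp add: powr_add[symmetric] flip: powr_numeral)
        then have "\<bar>g x\<bar> * x powr (-1 - 2*H) \<le> C * x powr (1 - 2*H)"
          using mult_right_mono[OF g(1)[of x], of "x powr (-1 - 2*H)"] by (simp add: mult.assoc)
        moreover have "0 \<le> C * (indicator {1..} x * x powr (-1 - 2*H))" using C by simp
        ultimately show ?thesis using 2 C by (auto simp: frac_wt_def abs_mult intro: add_increasing2)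
      next
        case 3
        then show ?thesis using C mult_right_mono[OF g(2)[of x], of "x powr (-1 - 2*H)"] by (simp add: frac_wt_def abs_mult)
      qed (simp add: frac_wt_def)
    qed
  qed measurable
qed

definition frac_const :: real where "frac_const = (LINT x|lborel. (1 - cos x) * frac_wt x)"

lemma frac_integrable: "integrable lborel (\<lambda>x. (1 - cos (t * x)) * frac_wt x)"
proof (rule frac_wt_integrable[where C = "max 2 (t\<^sup>2)"])
  fix x :: real
  have "\<bar>1 - cos (t * x)\<bar> \<le> (t * x)\<^sup>2" using one_minus_cos_le[of "t*x"] cos_le_one[of "t*x"] by linarith
  also have "\<dots> \<le> max 2 (t\<^sup>2) * x\<^sup>2" by (auto simp: power_mult_distrib intro!: mult_right_mono)
  finally show "\<bar>1 - cos (t * x)\<bar> \<le> max 2 (t\<^sup>2) * x\<^sup>2" .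
  show "\<bar>1 - cos (t * x)\<bar> \<le> max 2 (t\<^sup>2)" using cos_le_one[of "t*x"] cos_ge_minus_one[of "t*x"] by (auto simp: le_max_iff_disj)
qed measurable

lemma frac_const_pos: "0 < frac_const"
proof -
  \<comment> \<open>A lower bound for the integrand on [1, 2], where the first factor is smallest at
    1 and the weight is smallest at 2.\<close>
  define c where "c = (1 - cos 1) * 2 powr (-1 - 2*H)"
  have "cos (1::real) < cos 0" by (rule cos_monotone_0_pi) (use pi_gt3 in auto)
  then have c: "0 < c" by (simp add: c_def)
  have "(LINT x|lborel. c * indicator {1..2::real} x) \<le> frac_const"
    unfolding frac_const_def
  proof (rule integral_mono)
    show "integrable lborel (\<lambda>x::real. (1 - cos x) * frac_wt x)" using frac_integrable[of 1] by simp
    fix x :: real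
    show "c * indicator {1..2} x \<le> (1 - cos x) * frac_wt x"
    proof (cases "x \<in> {1..2}")
      case True
      have "cos x \<le> cos 1" using True pi_gt3 by (intro cos_monotone_0_pi_le) auto
      moreover have "2 powr (-1 - 2*H) \<le> x powr (-1 - 2*H)" using True H by (intro powr_mono2') auto
      ultimately have "c \<le> (1 - cos x) * x powr (-1 - 2*H)" unfolding c_def by (intro mult_mono) auto
      then show ?thesis using True by (simp add: frac_wt_def)
    qed (use frac_wt_nonneg in auto)
  qed auto
  moreover have "(LINT x|lborel. c * indicator {1..2::real} x) = c" by simp
  ultimately show ?thesis using c by linarith
qed

text \<open>Substituting |t| x for x, homogeneity of the weight produces the power of |t|; this is
  self-similarity in integral form.\<close>

lemma frac_integral: "(LINT x|lborel. (1 - cos (t * x)) * frac_wt x) = frac_const * \<bar>t\<bar> powr (2*H)"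
proof (cases "t = 0")
  case False
  let ?s = "\<bar>t\<bar>"
  have s: "?s > 0" using False by simp
  have "frac_const = ?s * (LINT x|lborel. (1 - cos (?s * x)) * frac_wt (?s * x))"
    unfolding frac_const_def using lborel_integral_real_affine[of ?s "\<lambda>x. (1 - cos x) * frac_wt x" 0] False by simp
  also have "(\<lambda>x. (1 - cos (?s * x)) * frac_wt (?s * x)) = (\<lambda>x. ?s powr (-1 - 2*H) * ((1 - cos (t * x)) * frac_wt x))"
  proof
    fix x
    have "cos (?s * x) = cos (t * x)" by (cases "t \<ge> 0") auto
    moreover have "frac_wt (?s * x) = ?s powr (-1 - 2*H) * frac_wt x"
      using s by (cases "0 < x") (auto simp: frac_wt_def powr_mult zero_less_mult_iff)
    ultimately show "(1 - cos (?s * x)) * frac_wt (?s * x) = ?s powr (-1 - 2*H) * ((1 - cos (t * x)) * frac_wt x)" by simp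
  qed
  also have "?s * (LINT x|lborel. ?s powr (-1 - 2*H) * ((1 - cos (t * x)) * frac_wt x)) =
     ?s powr 1 * ?s powr (-1 - 2*H) * (LINT x|lborel. (1 - cos (t * x)) * frac_wt x)" using s by simp
  also have "?s powr 1 * ?s powr (-1 - 2*H) = ?s powr (1 + (-1 - 2*H))" by (rule powr_add[symmetric])
  also have "1 + (-1 - 2*H) = - (2*H)" by simp
  finally have "frac_const * ?s powr (2*H) = ?s powr (2*H) * ?s powr (- (2*H)) * (LINT x|lborel. (1 - cos (t * x)) * frac_wt x)" by simp
  also have "?s powr (2*H) * ?s powr (- (2*H)) = 1" using False by (simp add: powr_add[symmetric])
  finally show ?thesis by simp
qed simp

text \<open>The bracket is the real part of e^(isx) - 1 times the conjugate of e^(itx) - 1, so the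
  covariance is an integral of Gram kernels.\<close>

lemma fbm_cov_integral:
  assumes "0 \<le> s" "0 \<le> t"
  shows "2 * frac_const * fbm_cov H s t =
    (LINT x|lborel. ((1 - cos (s * x)) * (1 - cos (t * x)) + sin (s * x) * sin (t * x)) * frac_wt x)"
proof -
  have "2 * frac_const * fbm_cov H s t = frac_const * \<bar>s\<bar> powr (2*H) + frac_const * \<bar>t\<bar> powr (2*H) - frac_const * \<bar>t - s\<bar> powr (2*H)"
    using assms by (simp add: fbm_cov_def field_simps)
  also have "\<dots> = (LINT x|lborel. (1 - cos (s * x)) * frac_wt x + (1 - cos (t * x)) * frac_wt x - (1 - cos ((t - s) * x)) * frac_wt x)"
    unfolding frac_integral[symmetric] by (simp only: Bochner_Integration.integral_add Bochner_Integration.integral_diff frac_integrable Bochner_Integration.integrable_add)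
  also have "(\<lambda>x. (1 - cos (s * x)) * frac_wt x + (1 - cos (t * x)) * frac_wt x - (1 - cos ((t - s) * x)) * frac_wt x) =
    (\<lambda>x. ((1 - cos (s * x)) * (1 - cos (t * x)) + sin (s * x) * sin (t * x)) * frac_wt x)"
    by (simp add: fun_eq_iff left_diff_distrib cos_diff algebra_simps)
  finally show ?thesis .
qed

text \<open>Under the integral the quadratic form is a sum of two squares times a nonnegative
  weight. Points are given as a family, so repetitions are allowed.\<close>

lemma fbm_cov_psd:
  fixes u :: "'i \<Rightarrow> real"
  assumes T: "finite T" and u: "\<And>i. i \<in> T \<Longrightarrow> 0 \<le> u i"
  shows "0 \<le> (\<Sum>i\<in>T. \<Sum>j\<in>T. c i * c j * fbm_cov H (u i) (u j))"
proof -
  define k where "k i j x = ((1 - cos (u i * x)) * (1 - cos (u j * x)) + sin (u i * x) * sin (u j * x)) * frac_wt x" for i j x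
  have k: "k i j = (\<lambda>x. (1 - cos (u i * x)) * frac_wt x + (1 - cos (u j * x)) * frac_wt x - (1 - cos ((u j - u i) * x)) * frac_wt x)" for i j
    by (simp add: k_def fun_eq_iff left_diff_distrib cos_diff algebra_simps)
  have ki: "integrable lborel (k i j)" for i j
    unfolding k by (intro Bochner_Integration.integrable_add Bochner_Integration.integrable_diff frac_integrable)
  have "2 * frac_const * (\<Sum>i\<in>T. \<Sum>j\<in>T. c i * c j * fbm_cov H (u i) (u j)) =
      (\<Sum>i\<in>T. \<Sum>j\<in>T. c i * c j * (2 * frac_const * fbm_cov H (u i) (u j)))"
    by (simp add: sum_distrib_left mult_ac)
  also have "\<dots> = (\<Sum>i\<in>T. \<Sum>j\<in>T. c i * c j * (LINT x|lborel. k i j x))"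
    unfolding k_def by (intro sum.cong refl) (simp add: fbm_cov_integral u)
  also have "\<dots> = (LINT x|lborel. (\<Sum>i\<in>T. \<Sum>j\<in>T. c i * c j * k i j x))"
    by (simp add: ki)
  also have "\<dots> \<ge> 0"
  proof (rule integral_nonneg_AE, rule AE_I2)
    fix x
    have sq: "(\<Sum>i\<in>T. p i)\<^sup>2 + (\<Sum>i\<in>T. q i)\<^sup>2 = (\<Sum>i\<in>T. \<Sum>j\<in>T. p i * p j + q i * q j)" for p q :: "'i \<Rightarrow> real"
      by (simp add: power2_eq_square sum_product sum.distrib)
    have "(\<Sum>i\<in>T. \<Sum>j\<in>T. c i * c j * k i j x) = ((\<Sum>i\<in>T. c i * (1 - cos (u i * x)))\<^sup>2 + (\<Sum>i\<in>T. c i * sin (u i * x))\<^sup>2) * frac_wt x"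
      unfolding sq sum_distrib_right k_def by (intro sum.cong refl) (simp add: algebra_simps)
    then show "0 \<le> (\<Sum>i\<in>T. \<Sum>j\<in>T. c i * c j * k i j x)" using frac_wt_nonneg by simp
  qed
  finally show ?thesis using frac_const_pos by (simp add: zero_le_mult_iff)
qed

end

lemma fbm_cov_diag: "0 \<le> s \<Longrightarrow> 0 \<le> t \<Longrightarrow> fbm_cov H t t - 2 * fbm_cov H t s + fbm_cov H s s = \<bar>t - s\<bar> powr (2*H)"
  by (simp add: fbm_cov_def field_simps abs_minus_commute)

lemma fbm_cov_sym: "fbm_cov H s t = fbm_cov H t s"
  by (simp add: fbm_cov_def abs_minus_commute)

section \<open>The Gaussian process at dyadic times\<close>

definition dyadics :: "real set" where "dyadics = {real k / 2^m | k m. k \<le> (2::nat)^m}"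

lemma countable_dyadics: "countable dyadics"
proof -
  have "dyadics \<subseteq> range (\<lambda>(k::nat, m::nat). real k / 2^m)" by (auto simp: dyadics_def)
  then show ?thesis by (rule countable_subset) simp
qed

lemma dyadics_unit: "t \<in> dyadics \<Longrightarrow> t \<in> {0..1}"
proof -
  assume "t \<in> dyadics"
  then obtain k m where "t = real k / 2^m" "k \<le> (2::nat)^m" by (auto simp: dyadics_def)
  moreover from this have "real k \<le> 2^m" by (metis of_nat_le_iff of_nat_numeral of_nat_power)
  ultimately show ?thesis by simp
qed

lemma dyadic_floor_dyadics: "s \<in> {0..1} \<Longrightarrow> dyadic_floor m s \<in> dyadics"
  by (metis (mono_tags, lifting) dyadic_floor_nat dyadics_def mem_Collect_eq)

definition dyadic_kernel :: "real \<Rightarrow> nat \<Rightarrow> nat \<Rightarrow> real" where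
  "dyadic_kernel H i j = fbm_cov H (from_nat_into dyadics i) (from_nat_into dyadics j)"

text \<open>A row of the triangular factor applied to white noise, in the enumeration order of the
  dyadics. Zero at other times is a mere default.\<close>

definition dyadic_fbm :: "real \<Rightarrow> real \<Rightarrow> (real \<Rightarrow> real) \<Rightarrow> real" where
  "dyadic_fbm H t \<omega> = (if t \<in> dyadics then
     (\<Sum>k\<le>to_nat_on dyadics t. cholesky (dyadic_kernel H) (to_nat_on dyadics t) k * \<omega> (real k)) else 0)"

context
  fixes H :: real assumes H: "0 < H" "H < 1"
begin

lemma dyadics_ne: "dyadics \<noteq> {}"
proof -
  have "(0::real) \<in> dyadics" unfolding dyadics_def by (auto intro!: exI[of _ "0::nat"])
  then show ?thesis by auto
qed

lemma psd_dyadic_kernel: "psd_kernel (dyadic_kernel H)"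
proof -
  have "0 \<le> from_nat_into dyadics i" for i
    using dyadics_unit[OF from_nat_into[OF dyadics_ne, of i]] by simp
  then show ?thesis
    unfolding psd_kernel_def dyadic_kernel_def by (intro conjI allI impI fbm_cov_psd[OF H] fbm_cov_sym)
qed

lemma dyadic_fbm_measurable[measurable]: "dyadic_fbm H t \<in> borel_measurable gauss_space"
proof -
  note [measurable] = gauss_coord_measurable
  show ?thesis unfolding dyadic_fbm_def[abs_def] by measurable
qed

text \<open>Triangularity allows all rows to be summed up to a common length \<open>n\<close>.
  Characteristic functions and second moments of increments are both read off from this form. The
  family \<open>u\<close> need not be injective: distinct times can share a dyadic floor.\<close>

lemma dyadic_fbm_lin:
  fixes u :: "'i \<Rightarrow> real"
  assumes T: "finite T" and u: "\<And>i. i \<in> T \<Longrightarrow> u i \<in> dyadics"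
  shows "\<exists>n a. (\<forall>\<omega>. (\<Sum>i\<in>T. c i * dyadic_fbm H (u i) \<omega>) = (\<Sum>k<n. a k * \<omega> (real k))) \<and>
    (\<Sum>k<n. (a k)\<^sup>2) = (\<Sum>i\<in>T. \<Sum>j\<in>T. c i * c j * fbm_cov H (u i) (u j))"
proof -
  define N where "N i = to_nat_on dyadics (u i)" for i
  define n where "n = Suc (Max (insert 0 (N ` T)))"
  have Nn: "N i < n" if "i \<in> T" for i
    unfolding n_def using T that by (auto simp: less_Suc_eq_le intro!: Max_ge)
  let ?L = "cholesky (dyadic_kernel H)"
  define a where "a k = (\<Sum>i\<in>T. c i * ?L (N i) k)" for k
  have 1: "dyadic_fbm H (u i) \<omega> = (\<Sum>k<n. ?L (N i) k * \<omega> (real k))" if "i \<in> T" for i \<omega>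
  proof -
    have "(\<Sum>k\<le>N i. ?L (N i) k * \<omega> (real k)) = (\<Sum>k<n. ?L (N i) k * \<omega> (real k))"
      using Nn[OF that] by (intro sum.mono_neutral_left) (auto simp: cholesky_zero[OF psd_dyadic_kernel])
    then show ?thesis using u[OF that] by (simp add: dyadic_fbm_def N_def)
  qed
  have "(\<Sum>i\<in>T. c i * dyadic_fbm H (u i) \<omega>) = (\<Sum>k<n. a k * \<omega> (real k))" for \<omega>
  proof -
    have "(\<Sum>i\<in>T. c i * dyadic_fbm H (u i) \<omega>) = (\<Sum>i\<in>T. \<Sum>k<n. c i * ?L (N i) k * \<omega> (real k))"
      by (intro sum.cong refl) (simp add: 1 sum_distrib_left mult.assoc)
    then show ?thesis unfolding a_def by (subst (asm) sum.swap) (simp add: sum_distrib_right)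
  qed
  moreover have "(\<Sum>k<n. (a k)\<^sup>2) = (\<Sum>i\<in>T. \<Sum>j\<in>T. c i * c j * fbm_cov H (u i) (u j))"
  proof -
    have "(\<Sum>k<n. (a k)\<^sup>2) = (\<Sum>k<n. \<Sum>i\<in>T. \<Sum>j\<in>T. c i * c j * (?L (N i) k * ?L (N j) k))"
      unfolding a_def power2_eq_square sum_product by (intro sum.cong refl) (simp add: mult_ac)
    also have "\<dots> = (\<Sum>i\<in>T. \<Sum>k<n. \<Sum>j\<in>T. c i * c j * (?L (N i) k * ?L (N j) k))" by (rule sum.swap)
    also have "\<dots> = (\<Sum>i\<in>T. \<Sum>j\<in>T. \<Sum>k<n. c i * c j * (?L (N i) k * ?L (N j) k))" by (intro sum.cong refl) (rule sum.swap)
    also have "\<dots> = (\<Sum>i\<in>T. \<Sum>j\<in>T. c i * c j * fbm_cov H (u i) (u j))"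
    proof (intro sum.cong refl)
      fix i j assume ij: "i \<in> T" "j \<in> T"
      have "(\<Sum>k<n. ?L (N i) k * ?L (N j) k) = dyadic_kernel H (N i) (N j)"
        using cholesky_eq[OF psd_dyadic_kernel Nn[OF ij(1)] Nn[OF ij(2)]] by simp
      also have "\<dots> = fbm_cov H (u i) (u j)"
        using u[OF ij(1)] u[OF ij(2)] countable_dyadics by (simp add: dyadic_kernel_def N_def)
      finally show "(\<Sum>k<n. c i * c j * (?L (N i) k * ?L (N j) k)) = c i * c j * fbm_cov H (u i) (u j)"
        by (simp add: sum_distrib_left[symmetric])
    qed
    finally show ?thesis .
  qed
  ultimately show ?thesis by blast
qed

lemma dyadic_fbm_cf:
  fixes u :: "'i \<Rightarrow> real"
  assumes T: "finite T" and u: "\<And>i. i \<in> T \<Longrightarrow> u i \<in> dyadics"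
  shows "(CLINT \<omega>|gauss_space. iexp (\<Sum>i\<in>T. c i * dyadic_fbm H (u i) \<omega>)) =
     complex_of_real (exp (- (\<Sum>i\<in>T. \<Sum>j\<in>T. c i * c j * fbm_cov H (u i) (u j)) / 2))"
proof -
  obtain n a where "\<And>\<omega>. (\<Sum>i\<in>T. c i * dyadic_fbm H (u i) \<omega>) = (\<Sum>k<n. a k * \<omega> (real k))"
    "(\<Sum>k<n. (a k)\<^sup>2) = (\<Sum>i\<in>T. \<Sum>j\<in>T. c i * c j * fbm_cov H (u i) (u j))"
    using dyadic_fbm_lin[where T=T and u=u and c=c, OF T u] by blast
  then show ?thesis by (simp only: gauss_cf)
qed

lemma dyadic_fbm_increment:
  assumes st: "s \<in> dyadics" "t \<in> dyadics"
  shows "integrable gauss_space (\<lambda>\<omega>. (dyadic_fbm H t \<omega> - dyadic_fbm H s \<omega>)\<^sup>2)"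
    "integral\<^sup>L gauss_space (\<lambda>\<omega>. (dyadic_fbm H t \<omega> - dyadic_fbm H s \<omega>)\<^sup>2) = \<bar>t - s\<bar> powr (2*H)"
proof -
  \<comment> \<open>The increment is a two-point family with coefficients 1 and -1; indexing by
    \<open>bool\<close> makes the case \<open>s = t\<close> no exception.\<close>
  define u where "u b = (if b then t else s)" for b
  define c where "c b = (if b then 1 else - 1::real)" for b
  have ud: "finite (UNIV :: bool set)" "\<And>i. i \<in> UNIV \<Longrightarrow> u i \<in> dyadics" using st by (auto simp: u_def)
  obtain n a where na: "\<And>\<omega>. (\<Sum>i\<in>UNIV. c i * dyadic_fbm H (u i) \<omega>) = (\<Sum>k<n. a k * \<omega> (real k))"
    "(\<Sum>k<n. (a k)\<^sup>2) = (\<Sum>i\<in>UNIV. \<Sum>j\<in>UNIV. c i * c j * fbm_cov H (u i) (u j))"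
    using dyadic_fbm_lin[where T=UNIV and u=u and c=c] ud by blast
  have 1: "dyadic_fbm H t \<omega> - dyadic_fbm H s \<omega> = (\<Sum>k<n. a k * \<omega> (real k))" for \<omega>
    using na(1)[of \<omega>] by (simp add: UNIV_bool u_def c_def)
  have 2: "(\<Sum>k<n. (a k)\<^sup>2) = \<bar>t - s\<bar> powr (2*H)"
    using na(2) fbm_cov_diag[of s t H] dyadics_unit[OF st(1)] dyadics_unit[OF st(2)] fbm_cov_sym[of H s t] by (simp add: UNIV_bool u_def c_def)
  show "integrable gauss_space (\<lambda>\<omega>. (dyadic_fbm H t \<omega> - dyadic_fbm H s \<omega>)\<^sup>2)"
    unfolding 1 by (rule gauss_linear_second_moment)
  show "integral\<^sup>L gauss_space (\<lambda>\<omega>. (dyadic_fbm H t \<omega> - dyadic_fbm H s \<omega>)\<^sup>2) = \<bar>t - s\<bar> powr (2*H)"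
    unfolding 1 gauss_linear_second_moment(2) 2 ..
qed

lemma dyadic_fbm_0: "AE \<omega> in gauss_space. dyadic_fbm H 0 \<omega> = 0"
proof -
  have 0: "(0::real) \<in> dyadics" unfolding dyadics_def by (auto intro!: exI[of _ "0::nat"])
  obtain n a where na: "\<And>\<omega>. (\<Sum>i\<in>{0::nat}. 1 * dyadic_fbm H 0 \<omega>) = (\<Sum>k<n. a k * \<omega> (real k))"
    "(\<Sum>k<n. (a k)\<^sup>2) = (\<Sum>i\<in>{0::nat}. \<Sum>j\<in>{0::nat}. 1 * 1 * fbm_cov H 0 0)"
    using dyadic_fbm_lin[where T="{0::nat}" and u="\<lambda>_. 0" and c="\<lambda>_. 1"] 0 by blast
  then have "(\<Sum>k<n. (a k)\<^sup>2) = 0" by (simp add: fbm_cov_def)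
  then have "a k = 0" if "k < n" for k using that by (subst (asm) sum_nonneg_eq_0_iff) auto
  then show ?thesis using na(1) by simp
qed

end

lemma fbm_cov_tendsto:
  assumes H: "0 < H" and u: "u \<longlonglongrightarrow> s" "v \<longlonglongrightarrow> t" "\<And>n. 0 \<le> u n" "\<And>n. 0 \<le> v n"
  shows "(\<lambda>n. fbm_cov H (u n) (v n)) \<longlonglongrightarrow> fbm_cov H s t"
  unfolding fbm_cov_def using assms by (intro tendsto_intros tendsto_powr2) (auto intro!: tendsto_intros)

text \<open>An increment over a dyadic interval of level m has variance 2^(-2Hm) = 2^(-m)
  2^(-(2H-1)m). For H > 1/2 the second factor decays, so second moments suffice for chaining with
  any \<open>r\<close> satisfying the last hypothesis. All paths, not almost all, are required to
  lie in some \<open>holder_paths r A\<close>.\<close>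

theorem fBm_exists:
  assumes H: "1/2 < H" "H < 1" and r: "0 < r" "r < 1" "(1/2) powr (2*H - 1) < r\<^sup>2"
  obtains B where "is_fBm gauss_space H B"
    "\<And>\<omega>. \<exists>A. (\<lambda>t. B t \<omega>) \<in> holder_paths r A"
    "\<And>e. 0 < e \<Longrightarrow> \<exists>A. \<exists>E\<in>sets gauss_space. measure gauss_space E \<ge> 1 - e \<and> (\<forall>\<omega>\<in>E. (\<lambda>t. B t \<omega>) \<in> holder_paths r A)"
proof -
  interpret prob_space gauss_space by (rule prob_space_gauss)
  have H': "0 < H" "H < 1" using H by auto
  let ?G = "dyadic_fbm H"
  let ?D = "\<lambda>m k \<omega>. ?G (real (Suc k) / 2^m) \<omega> - ?G (real k / 2^m) \<omega>"
  note [measurable] = dyadic_fbm_measurable[OF H']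
  define \<rho> where "\<rho> = (1/2::real) powr (2*H - 1)"
  define C where "C = 1 / (1 - \<rho> / r\<^sup>2)"
  have \<rho>: "0 \<le> \<rho>" "\<rho> < r\<^sup>2" using r by (auto simp: \<rho>_def)
  have C: "0 < C" using \<rho> r by (simp add: C_def)
  have ev: "\<exists>E\<in>sets gauss_space. prob E \<ge> 1 - 1 / (A\<^sup>2 * (1 - \<rho> / r\<^sup>2)) \<and> (\<forall>\<omega>\<in>E. \<forall>m. \<forall>k<2^m. \<bar>?D m k \<omega>\<bar> \<le> A * r^m)" if "0 < A" for A
  proof (rule dyadic_increments_event[where C = 1, OF _ _ _ \<rho> r(1) that])
    fix m k :: nat assume k: "k < 2^m"
    have d: "real (Suc k) / 2^m \<in> dyadics" "real k / 2^m \<in> dyadics"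
      unfolding dyadics_def using k Suc_leI[OF k] less_imp_le[OF k] by blast+
    show "integrable gauss_space (\<lambda>\<omega>. (?D m k \<omega>)\<^sup>2)" by (rule dyadic_fbm_increment[OF H' d(2,1)])
    have "expectation (\<lambda>\<omega>. (?D m k \<omega>)\<^sup>2) = \<bar>real (Suc k) / 2^m - real k / 2^m\<bar> powr (2*H)"
      by (rule dyadic_fbm_increment[OF H' d(2,1)])
    also have "real (Suc k) / 2^m - real k / 2^m = (1/2)^m" by (simp add: diff_divide_distrib[symmetric] power_divide)
    also have "\<bar>(1/2)^m\<bar> powr (2*H) = ((1/2::real) powr real m) powr (2*H)" by (simp add: powr_realpow)
    also have "\<dots> = (1/2) powr real m * ((1/2) powr (2*H - 1)) powr real m"
      by (simp add: powr_powr powr_add[symmetric] algebra_simps)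
    also have "\<dots> = 1 * (1/2)^m * \<rho>^m" by (simp add: powr_realpow \<rho>_def)
    finally show "expectation (\<lambda>\<omega>. (?D m k \<omega>)\<^sup>2) \<le> 1 * (1/2)^m * \<rho>^m" by simp
  qed auto
  \<comment> \<open>The event on which the chaining bounds hold with constant \<open>A\<close>; the
    value at time 0 is fixed in order to bound the path itself.\<close>
  define good where "good A = {\<omega> \<in> space gauss_space. (\<forall>m. \<forall>k<2^m. \<bar>?D m k \<omega>\<bar> \<le> A * r^m) \<and> ?G 0 \<omega> = 0}" for A
  have good_sets[measurable]: "good A \<in> sets gauss_space" for A
    unfolding good_def by measurable
  have good_prob: "prob (good A) \<ge> 1 - C / A\<^sup>2" if "0 < A" for A
  proof -
    obtain E where E: "E \<in> sets gauss_space" "prob E \<ge> 1 - 1 / (A\<^sup>2 * (1 - \<rho> / r\<^sup>2))" "\<forall>\<omega>\<in>E. \<forall>m. \<forall>k<2^m. \<bar>?D m k \<omega>\<bar> \<le> A * r^m"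
      using ev[OF \<open>0 < A\<close>] by blast
    have "prob E \<le> prob (good A)"
    proof (rule finite_measure_mono_AE)
      show "AE \<omega> in gauss_space. \<omega> \<in> E \<longrightarrow> \<omega> \<in> good A"
        using dyadic_fbm_0[OF H'] AE_space by eventually_elim (use E(3) in \<open>auto simp: good_def\<close>)
    qed simp
    moreover have "1 / (A\<^sup>2 * (1 - \<rho> / r\<^sup>2)) = C / A\<^sup>2" by (simp add: C_def)
    ultimately show ?thesis using E(2) by simp
  qed
  define Gd where "Gd = (\<Union>A::nat. good (real A))"
  have Gd_sets[measurable]: "Gd \<in> sets gauss_space" unfolding Gd_def by measurable
  have Gd1: "AE \<omega> in gauss_space. \<omega> \<in> Gd"
  proof -
    have "prob Gd \<ge> 1 - C / (real (Suc n))\<^sup>2" for n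
    proof -
      have "prob (good (real (Suc n))) \<le> prob Gd" by (intro finite_measure_mono Gd_sets) (unfold Gd_def, blast)
      then show ?thesis using good_prob[of "real (Suc n)"] by simp
    qed
    moreover have "(\<lambda>n. 1 - C / (real (Suc n))\<^sup>2) \<longlonglongrightarrow> 1 - 0"
    proof (intro tendsto_intros)
      have "(\<lambda>n. C * (inverse (real (Suc n)) * inverse (real (Suc n)))) \<longlonglongrightarrow> C * (0 * 0)"
        by (intro tendsto_intros LIMSEQ_inverse_real_of_nat)
      then show "(\<lambda>n. C / (real (Suc n))\<^sup>2) \<longlonglongrightarrow> 0" by (simp add: divide_inverse power2_eq_square)
    qed
    ultimately have "1 - 0 \<le> prob Gd" by (intro LIMSEQ_le_const2) auto
    then have "prob Gd = 1" using prob_le_1[of Gd] by simp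
    then show ?thesis by (simp add: prob_eq_1)
  qed
  \<comment> \<open>On the null set outside \<open>Gd\<close> the path is set to zero, so continuity
    holds at every sample point; the clamping of \<open>t\<close> freezes the path outside the unit
    interval.\<close>
  define B where "B t \<omega> = (if \<omega> \<in> Gd then lim (\<lambda>m. ?G (dyadic_floor m (max 0 (min 1 t))) \<omega>) else 0)" for t \<omega>
  have Bmeas: "B t \<in> borel_measurable gauss_space" for t
    unfolding B_def[abs_def] by (intro measurable_If_set borel_measurable_lim_metric) measurable
  have Blim: "(\<lambda>m. ?G (dyadic_floor m t) \<omega>) \<longlonglongrightarrow> B t \<omega>" if gd: "\<omega> \<in> Gd" and t: "t \<in> {0..1}" for t \<omega>
  proof -
    obtain A :: nat where A: "\<omega> \<in> good (real A)" using gd unfolding Gd_def by blast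
    have ch: "\<bar>?G (dyadic_floor (m + n) t) \<omega> - ?G (dyadic_floor m t) \<omega>\<bar> \<le> real A * r^m / (1 - r)" for m n
      using A r t by (intro dyadic_floor_chain[where x = "\<lambda>t. ?G t \<omega>"]) (auto simp: good_def)
    have "Cauchy (\<lambda>m. ?G (dyadic_floor m t) \<omega>)"
    proof (rule CauchyI')
      fix e :: real assume e: "0 < e"
      have "(\<lambda>m. real A * r^m / (1 - r)) \<longlonglongrightarrow> real A * 0 / (1 - r)" using r by (intro tendsto_intros LIMSEQ_realpow_zero) auto
      then have "\<forall>\<^sub>F m in sequentially. real A * r^m / (1 - r) < e" using e by (intro order_tendstoD) auto
      then obtain m0 where m0: "\<And>m. m \<ge> m0 \<Longrightarrow> real A * r^m / (1 - r) < e" by (auto simp: eventually_sequentially)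
      have "dist (?G (dyadic_floor m t) \<omega>) (?G (dyadic_floor n t) \<omega>) < e" if "m \<ge> m0" "n > m" for m n
        using ch[of m "n - m"] m0[OF that(1)] that(2) by (simp add: dist_real_def abs_minus_commute)
      then show "\<exists>m0. \<forall>m\<ge>m0. \<forall>n>m. dist (?G (dyadic_floor m t) \<omega>) (?G (dyadic_floor n t) \<omega>) < e" by blast
    qed
    then have "convergent (\<lambda>m. ?G (dyadic_floor m t) \<omega>)" by (rule Cauchy_convergent)
    then show ?thesis using gd t by (simp add: B_def convergent_LIMSEQ_iff)
  qed
  \<comment> \<open>The implication in the hypothesis also covers sample points outside
    \<open>Gd\<close>, where the path is zero and any \<open>A\<close> \<ge> 0 will do.\<close>
  have Bh: "(\<lambda>t. B t \<omega>) \<in> holder_paths r (3 * A / (1 - r))" if "\<omega> \<in> Gd \<longrightarrow> \<omega> \<in> good A" "0 \<le> A" for \<omega> A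
  proof (cases "\<omega> \<in> Gd")
    case False
    then show ?thesis using that r by (intro holder_pathsI) (auto simp: B_def)
  next
    case True
    then have g: "\<omega> \<in> good A" using that by blast
    have md: "\<bar>B s \<omega> - B t \<omega>\<bar> \<le> 3 * A / (1 - r) * r^m" if st: "s \<in> {0..1}" "t \<in> {0..1}" "\<bar>s - t\<bar> \<le> (1/2)^m" for s t m
    proof -
      have "(\<lambda>n. \<bar>?G (dyadic_floor (m + n) s) \<omega> - ?G (dyadic_floor (m + n) t) \<omega>\<bar>) \<longlonglongrightarrow> \<bar>B s \<omega> - B t \<omega>\<bar>"
        using LIMSEQ_ignore_initial_segment[OF Blim[OF True st(1)], of m] LIMSEQ_ignore_initial_segment[OF Blim[OF True st(2)], of m]
        by (intro tendsto_intros) (simp_all add: add.commute)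
      moreover have "\<bar>?G (dyadic_floor (m + n) s) \<omega> - ?G (dyadic_floor (m + n) t) \<omega>\<bar> \<le> 3 * A / (1 - r) * r^m" for n
        using g r st \<open>0 \<le> A\<close> by (intro dyadic_modulus[where x = "\<lambda>t. ?G t \<omega>"]) (auto simp: good_def)
      ultimately show ?thesis by (intro LIMSEQ_le_const2) auto
    qed
    have B0: "B 0 \<omega> = 0"
    proof -
      have "dyadic_floor m 0 = 0" for m by (simp add: dyadic_floor_def)
      then have "(\<lambda>m. 0) \<longlonglongrightarrow> B 0 \<omega>" using Blim[OF True, of 0] g by (simp add: good_def)
      then show ?thesis by (simp add: LIMSEQ_const_iff)
    qed
    have Bc: "B t \<omega> = B (max 0 (min 1 t)) \<omega>" for t by (simp add: B_def)
    show ?thesis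
    proof (rule holder_pathsI)
      show "B t \<omega> = B (max 0 (min 1 t)) \<omega>" for t by (rule Bc)
      show "\<bar>B t \<omega>\<bar> \<le> 3 * A / (1 - r)" for t
        using md[of "max 0 (min 1 t)" 0 0] B0 by (subst Bc) simp
    qed (use md in auto)
  qed
  have "is_fBm gauss_space H B"
    unfolding is_fBm_def
  proof (intro conjI allI ballI impI)
    show "prob_space gauss_space" by (rule prob_space_gauss)
    show "B t \<in> borel_measurable gauss_space" for t by (rule Bmeas)
    fix \<omega> :: "real \<Rightarrow> real"
    have "\<exists>A\<ge>0. \<omega> \<in> Gd \<longrightarrow> \<omega> \<in> good A"
      unfolding Gd_def using of_nat_0_le_iff by blast
    then obtain A where "\<omega> \<in> Gd \<longrightarrow> \<omega> \<in> good A" "0 \<le> A" by blast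
    from holder_paths_continuous[OF _ r(2) Bh[OF this]] r(1)
    show "continuous_on {0..1} (\<lambda>t. B t \<omega>)" by simp
  next
    fix T :: "real set" and c :: "real \<Rightarrow> real" assume T: "finite T" "T \<subseteq> {0..1}"
    \<comment> \<open>The Gaussian formula holds at the dyadic floors; dominated convergence on the
      left and continuity of the covariance on the right carry it to arbitrary times.\<close>
    have "(\<lambda>m. CLINT \<omega>|gauss_space. iexp (\<Sum>t\<in>T. c t * ?G (dyadic_floor m t) \<omega>)) \<longlonglongrightarrow> (CLINT \<omega>|gauss_space. iexp (\<Sum>t\<in>T. c t * B t \<omega>))"
    proof (rule integral_dominated_convergence[where w = "\<lambda>_. 1"])
      show "AE \<omega> in gauss_space. (\<lambda>m. iexp (\<Sum>t\<in>T. c t * ?G (dyadic_floor m t) \<omega>)) \<longlonglongrightarrow> iexp (\<Sum>t\<in>T. c t * B t \<omega>)"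
        using Gd1
      proof eventually_elim
        case (elim \<omega>)
        then show ?case using Blim[OF elim] T by (intro tendsto_intros) auto
      qed
      show "(\<lambda>\<omega>. iexp (\<Sum>t\<in>T. c t * B t \<omega>)) \<in> borel_measurable gauss_space" using Bmeas by measurable
    qed auto
    moreover have "(\<lambda>m. CLINT \<omega>|gauss_space. iexp (\<Sum>t\<in>T. c t * ?G (dyadic_floor m t) \<omega>)) =
      (\<lambda>m. complex_of_real (exp (- (\<Sum>s\<in>T. \<Sum>t\<in>T. c s * c t * fbm_cov H (dyadic_floor m s) (dyadic_floor m t)) / 2)))"
      using T by (intro ext dyadic_fbm_cf[OF H']) (auto intro: dyadic_floor_dyadics)
    moreover have "(\<lambda>m. complex_of_real (exp (- (\<Sum>s\<in>T. \<Sum>t\<in>T. c s * c t * fbm_cov H (dyadic_floor m s) (dyadic_floor m t)) / 2)))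
       \<longlonglongrightarrow> complex_of_real (exp (- (\<Sum>s\<in>T. \<Sum>t\<in>T. c s * c t * fbm_cov H s t) / 2))"
    proof -
      have "0 \<le> dyadic_floor m s" if "s \<in> T" for m s using dyadic_floor_in[of s m] that T by auto
      then have "(\<lambda>m. fbm_cov H (dyadic_floor m s) (dyadic_floor m t)) \<longlonglongrightarrow> fbm_cov H s t" if "s \<in> T" "t \<in> T" for s t
        using that by (intro fbm_cov_tendsto dyadic_floor_tendsto H') auto
      then show ?thesis by (intro tendsto_intros) auto
    qed
    ultimately show "(CLINT \<omega>|gauss_space. iexp (\<Sum>t\<in>T. c t * B t \<omega>)) =
       complex_of_real (exp (- (\<Sum>s\<in>T. \<Sum>t\<in>T. c s * c t * fbm_cov H s t) / 2))"
      by (simp only: LIMSEQ_unique)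
  qed
  moreover have "\<exists>A. (\<lambda>t. B t \<omega>) \<in> holder_paths r A" for \<omega>
  proof -
    have "\<exists>A\<ge>0. \<omega> \<in> Gd \<longrightarrow> \<omega> \<in> good A"
      unfolding Gd_def using of_nat_0_le_iff by blast
    then show ?thesis using Bh by blast
  qed
  moreover have "\<exists>A. \<exists>E\<in>sets gauss_space. prob E \<ge> 1 - e \<and> (\<forall>\<omega>\<in>E. (\<lambda>t. B t \<omega>) \<in> holder_paths r A)" if e: "0 < e" for e
  proof -
    define A where "A = sqrt (C / e)"
    have A: "0 < A" "C / A\<^sup>2 = e" using C e by (auto simp: A_def)
    have "prob (good A) \<ge> 1 - e" using good_prob[OF A(1)] A(2) by simp
    then show ?thesis using Bh[of _ A] A by (intro exI[of _ "3 * A / (1 - r)"] bexI[of _ "good A"]) auto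
  qed
  ultimately show ?thesis by (rule that)
qed

subsection \<open>Regularly varying sums\<close>

lemma stolz_cesaro:
  fixes a c :: "nat \<Rightarrow> real"
  assumes inc: "\<And>n. c n < c (Suc n)" and lim: "filterlim c at_top sequentially"
    and L: "(\<lambda>n. (a (Suc n) - a n) / (c (Suc n) - c n)) \<longlonglongrightarrow> L"
  shows "(\<lambda>n. a n / c n) \<longlonglongrightarrow> L"
proof (rule LIMSEQ_I)
  fix e :: real assume e: "0 < e"
  obtain N where N: "\<And>n. n \<ge> N \<Longrightarrow> \<bar>(a (Suc n) - a n) / (c (Suc n) - c n) - L\<bar> < e/2"
    using LIMSEQ_D[OF L, of "e/2"] e by auto
  have step: "\<bar>a (Suc n) - a n - L * (c (Suc n) - c n)\<bar> \<le> e/2 * (c (Suc n) - c n)" if "n \<ge> N" for n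
  proof -
    have p: "0 < c (Suc n) - c n" using inc[of n] by simp
    have "a (Suc n) - a n - L * (c (Suc n) - c n) = ((a (Suc n) - a n) / (c (Suc n) - c n) - L) * (c (Suc n) - c n)"
      using p by (simp add: field_simps)
    then have "\<bar>a (Suc n) - a n - L * (c (Suc n) - c n)\<bar> = \<bar>(a (Suc n) - a n) / (c (Suc n) - c n) - L\<bar> * (c (Suc n) - c n)"
      using p by (simp add: abs_mult)
    then show ?thesis using N[OF that] p by (simp add: mult_right_mono)
  qed
  have tot: "\<bar>a n - a N - L * (c n - c N)\<bar> \<le> e/2 * (c n - c N)" if "n \<ge> N" for n
    using that
  proof (induction n rule: dec_induct)
    case (step n)
    have "\<bar>a (Suc n) - a N - L * (c (Suc n) - c N)\<bar> \<le> \<bar>a n - a N - L * (c n - c N)\<bar> + \<bar>a (Suc n) - a n - L * (c (Suc n) - c n)\<bar>"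
      by (simp add: algebra_simps)
    also have "\<dots> \<le> e/2 * (c n - c N) + e/2 * (c (Suc n) - c n)"
      using step.IH \<open>\<And>n. n \<ge> N \<Longrightarrow> \<bar>a (Suc n) - a n - L * (c (Suc n) - c n)\<bar> \<le> e/2 * (c (Suc n) - c n)\<close>[OF step.hyps(1)] by linarith
    also have "\<dots> = e/2 * (c (Suc n) - c N)" unfolding distrib_left[symmetric] by simp
    finally show ?case .
  qed simp
  \<comment> \<open>Collects everything fixed at the starting index; once \<open>c n\<close> exceeds
    \<open>2 * K / e\<close> it costs no more than the other half of the error.\<close>
  define K where "K = \<bar>a N - L * c N\<bar> + e/2 * \<bar>c N\<bar>"
  have "\<forall>\<^sub>F n in sequentially. c n > max 1 (2 * K / e)" using lim unfolding filterlim_at_top_dense by blast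
  moreover have "\<forall>\<^sub>F n in sequentially. n \<ge> N" by (rule eventually_ge_at_top)
  ultimately have "\<forall>\<^sub>F n in sequentially. norm (a n / c n - L) < e"
  proof eventually_elim
    case (elim n)
    then have cp: "0 < c n" by simp
    have "\<bar>a n - L * c n\<bar> \<le> e/2 * (c n - c N) + \<bar>a N - L * c N\<bar>"
      using tot[OF elim(2)] unfolding right_diff_distrib by linarith
    also have "\<dots> \<le> e/2 * c n + K" unfolding K_def using e by (simp add: algebra_simps abs_if)
    also have "\<dots> < e/2 * c n + e/2 * c n" using elim(1) e by (simp add: field_simps)
    finally have "\<bar>a n - L * c n\<bar> < e * c n" by simp
    moreover have "a n / c n - L = (a n - L * c n) / c n" using cp by (simp add: field_simps)
    ultimately show ?case using cp by (simp add: field_simps)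
  qed
  then show "\<exists>N. \<forall>n\<ge>N. norm (a n / c n - L) < e" by (simp add: eventually_sequentially)
qed

text \<open>Stolz-Cesaro twice: the sum of r grows like L n^(2d) / (2d), and summing twice that
  gives 2 L n^(2d+1) / (2d (2d+1)). This is the origin of the factor relating the two limit
  constants.\<close>

lemma double_sum_asymp:
  fixes r :: "nat \<Rightarrow> real" and V :: "nat \<Rightarrow> real"
  assumes d: "0 < d" and r: "(\<lambda>n. r n * real n powr (1 - 2*d)) \<longlonglongrightarrow> L"
    and V: "\<And>n. V (Suc n) - V n = r 0 + 2 * (\<Sum>k<n. r (Suc k))"
  shows "(\<lambda>n. V n / real n powr (2*d+1)) \<longlonglongrightarrow> L / (d * (1 + 2*d))"
proof -
  define a where "a n = (\<Sum>k<n. r (Suc k))" for n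
  have rS: "(\<lambda>n. r (Suc n) * real (Suc n) powr (1 - 2*d)) \<longlonglongrightarrow> L" by (rule LIMSEQ_Suc[OF r])
  have l1: "(\<lambda>n. (real (Suc n) powr (2*d) - real n powr (2*d)) * real (Suc n) powr (1 - 2*d)) \<longlonglongrightarrow> 2*d"
    using d by real_asymp
  have a: "(\<lambda>n. a n / real n powr (2*d)) \<longlonglongrightarrow> L / (2*d)"
  proof (rule stolz_cesaro)
    show "real n powr (2*d) < real (Suc n) powr (2*d)" for n using d by (intro powr_less_mono2) auto
    show "filterlim (\<lambda>n. real n powr (2*d)) at_top sequentially" using d by real_asymp
    have "(\<lambda>n. (r (Suc n) * real (Suc n) powr (1 - 2*d)) / ((real (Suc n) powr (2*d) - real n powr (2*d)) * real (Suc n) powr (1 - 2*d))) \<longlonglongrightarrow> L / (2*d)"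
      using d by (intro tendsto_divide rS l1) auto
    then show "(\<lambda>n. (a (Suc n) - a n) / (real (Suc n) powr (2*d) - real n powr (2*d))) \<longlonglongrightarrow> L / (2*d)"
      by (simp add: a_def del: of_nat_Suc)
  qed
  have l2: "(\<lambda>n. (real (Suc n) powr (2*d+1) - real n powr (2*d+1)) / real n powr (2*d)) \<longlonglongrightarrow> 2*d+1"
    using d by real_asymp
  have l3: "(\<lambda>n. r 0 / real n powr (2*d)) \<longlonglongrightarrow> 0" using d by real_asymp
  have l4: "(\<lambda>n. (r 0 / real n powr (2*d) + 2 * (a n / real n powr (2*d))) / ((real (Suc n) powr (2*d+1) - real n powr (2*d+1)) / real n powr (2*d)))
     \<longlonglongrightarrow> (0 + 2 * (L / (2*d))) / (2*d+1)"
    using d by (intro tendsto_intros l2 l3 a) auto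
  show ?thesis
  proof (rule stolz_cesaro)
    show "real n powr (2*d+1) < real (Suc n) powr (2*d+1)" for n using d by (intro powr_less_mono2) auto
    show "filterlim (\<lambda>n. real n powr (2*d+1)) at_top sequentially" using d by real_asymp
    have "\<forall>\<^sub>F n in sequentially. (r 0 / real n powr (2*d) + 2 * (a n / real n powr (2*d))) / ((real (Suc n) powr (2*d+1) - real n powr (2*d+1)) / real n powr (2*d))
      = (V (Suc n) - V n) / (real (Suc n) powr (2*d+1) - real n powr (2*d+1))"
      using eventually_gt_at_top[of 0]
    proof eventually_elim
      case (elim n)
      then have p: "real n powr (2*d) > 0" by simp
      have q: "(x / p + 2 * (y / p)) / (z / p) = (x + 2 * y) / z" if "p > 0" for x y z p :: real
        using that by (cases "z = 0") (auto simp: field_simps)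
      show ?case unfolding V a_def[symmetric] by (rule q[OF p])
    qed
    from Lim_transform_eventually[OF l4 this]
    show "(\<lambda>n. (V (Suc n) - V n) / (real (Suc n) powr (2*d+1) - real n powr (2*d+1))) \<longlonglongrightarrow> L / (d * (1 + 2*d))"
      by (simp add: add.commute)
  qed
qed

text \<open>The substitution x = u / (1 - u) carries the unit interval to the half-line and the
  kernel to the Beta integrand with exponents d - 1 and -2d.\<close>

lemma beta_kernel_integral:
  assumes d: "0 < d" "d < 1/2"
  shows "integrable lborel (\<lambda>x. indicator {0<..} x * (x powr (d - 1) * (1 + x) powr (d - 1)))"
    "(LINT x|lborel. indicator {0<..} x * (x powr (d - 1) * (1 + x) powr (d - 1))) = (Beta d (1 - 2*d) :: real)"
proof -
  let ?f = "\<lambda>x::real. x powr (d - 1) * (1 + x) powr (d - 1)"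
  let ?g = "\<lambda>u::real. u / (1 - u)"
  let ?g' = "\<lambda>u::real. 1 / (1 - u)\<^sup>2"
  let ?S = "{0<..<1::real}"
  have eq: "\<bar>?g' u\<bar> * ?f (?g u) = u powr (d - 1) * (1 - u) powr ((1 - 2*d) - 1)" if "u \<in> ?S" for u
  proof -
    have p: "0 < u" "0 < 1 - u" using that by auto
    have "1 + ?g u = 1 / (1 - u)" using p by (simp add: field_simps)
    then have "?f (?g u) = u powr (d - 1) * (1 - u) powr (1 - d) * (1 - u) powr (1 - d)"
      using p by (simp add: powr_divide powr_diff)
    moreover have "?g' u = (1 - u) powr (-2)" using p by (simp add: powr_minus powr_numeral divide_inverse)
    ultimately have "\<bar>?g' u\<bar> * ?f (?g u) = u powr (d - 1) * ((1 - u) powr (-2) * (1 - u) powr (1 - d) * (1 - u) powr (1 - d))"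
      by (simp add: mult_ac)
    also have "(1 - u) powr (-2) * (1 - u) powr (1 - d) * (1 - u) powr (1 - d) = (1 - u) powr ((1 - 2*d) - 1)"
      unfolding powr_add[symmetric] by (simp add: algebra_simps)
    finally show ?thesis .
  qed
  have hi: "((\<lambda>u. \<bar>?g' u\<bar> * ?f (?g u)) has_integral Beta d (1 - 2*d)) ?S"
    using has_integral_Beta_real[of d "1 - 2*d"] d
    by (subst has_integral_cong[OF eq]) (simp_all add: has_integral_Icc_iff_Ioo)
  have "(\<lambda>u. \<bar>?g' u\<bar> * ?f (?g u)) absolutely_integrable_on ?S"
    using hi by (intro nonnegative_absolutely_integrable_1) (auto simp: integrable_on_def)
  moreover have "integral ?S (\<lambda>u. \<bar>?g' u\<bar> * ?f (?g u)) = Beta d (1 - 2*d)" using hi by (rule integral_unique)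
  moreover have "(\<lambda>u. \<bar>?g' u\<bar> * ?f (?g u)) absolutely_integrable_on ?S \<and> integral ?S (\<lambda>u. \<bar>?g' u\<bar> * ?f (?g u)) = Beta d (1 - 2*d)
    \<longleftrightarrow> ?f absolutely_integrable_on (?g ` ?S) \<and> integral (?g ` ?S) ?f = Beta d (1 - 2*d)"
  proof (rule has_absolute_integral_change_of_variables_1')
    show "?S \<in> sets lebesgue" by simp
    show "(?g has_field_derivative ?g' u) (at u within ?S)" if "u \<in> ?S" for u
      using that by (auto intro!: derivative_eq_intros simp: power2_eq_square)
    show "inj_on ?g ?S" by (auto simp: inj_on_def field_simps)
  qed
  moreover have "?g ` ?S = {0<..}"
  proof (intro set_eqI iffI)
    fix x :: real assume "x \<in> {0<..}"
    then have "x / (1 + x) \<in> ?S" "?g (x / (1 + x)) = x" by (auto simp: field_simps)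
    then show "x \<in> ?g ` ?S" by (metis imageI)
  qed auto
  ultimately have f: "?f absolutely_integrable_on {0<..}" "integral {0<..} ?f = Beta d (1 - 2*d)" by auto
  have si: "set_integrable lborel {0<..} ?f"
    using f(1) unfolding set_integrable_def by (subst (asm) integrable_completion) auto
  then show "integrable lborel (\<lambda>x. indicator {0<..} x * ?f x)" by (simp add: set_integrable_def)
  show "(LINT x|lborel. indicator {0<..} x * ?f x) = Beta d (1 - 2*d)"
    using set_borel_integral_eq_integral(2)[OF si] f(2) by (simp add: set_lebesgue_integral_def)
qed

text \<open>Turns a series into an integral, so that dominated convergence treats the Riemann sums.
  The ceiling makes the index at least \<open>y\<close>; as the coefficients are compared with a
  decreasing power, this puts the limit kernel itself, up to a constant, above all rescaled step
  functions.\<close>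

lemma integral_step_ceiling:
  fixes v :: "nat \<Rightarrow> real"
  assumes v: "summable (\<lambda>j. \<bar>v (Suc j)\<bar>)"
  shows "(LINT y|lborel. indicator {0<..} (y::real) * v (nat \<lceil>y\<rceil>)) = (\<Sum>j. v (Suc j))"
proof -
  let ?f = "\<lambda>j y. indicator {real j<..real (Suc j)} y * v (Suc j)"
  have one: "?f j y = (if 0 < y \<and> j = nat \<lceil>y\<rceil> - 1 then v (nat \<lceil>y\<rceil>) else 0)" for j y
  proof -
    have "y \<in> {real j<..real (Suc j)} \<longleftrightarrow> 0 < y \<and> nat \<lceil>y\<rceil> = Suc j" by (auto simp: nat_eq_iff ceiling_eq_iff)
    then show ?thesis by (auto simp: indicator_def)
  qed
  have s: "(\<lambda>j. ?f j y) sums (indicator {0<..} y * v (nat \<lceil>y\<rceil>))" for y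
  proof -
    have "(\<lambda>j. if j = nat \<lceil>y\<rceil> - 1 then (if 0 < y then v (nat \<lceil>y\<rceil>) else 0) else 0) sums (if 0 < y then v (nat \<lceil>y\<rceil>) else 0)"
      using sums_single[of "nat \<lceil>y\<rceil> - 1" "\<lambda>_. if 0 < y then v (nat \<lceil>y\<rceil>) else 0"] by (simp add: eq_commute)
    moreover have "(\<lambda>j. ?f j y) = (\<lambda>j. if j = nat \<lceil>y\<rceil> - 1 then (if 0 < y then v (nat \<lceil>y\<rceil>) else 0) else 0)"
      unfolding one by auto
    moreover have "indicator {0<..} y * v (nat \<lceil>y\<rceil>) = (if 0 < y then v (nat \<lceil>y\<rceil>) else 0)" by simp
    ultimately show ?thesis by (simp only:)
  qed
  have i: "integrable lborel (?f j)" for j by (intro integrable_mult_left integrable_real_indicator) auto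
  have int: "(LINT y|lborel. ?f j y) = v (Suc j)" for j by simp
  have intn: "(LINT y|lborel. norm (?f j y)) = \<bar>v (Suc j)\<bar>" for j by (simp add: abs_mult)
  have "(LINT y|lborel. (\<Sum>j. ?f j y)) = (\<Sum>j. LINT y|lborel. ?f j y)"
  proof (rule integral_suminf[OF i])
    show "AE y in lborel. summable (\<lambda>j. norm (?f j y))"
    proof (rule AE_I2)
      fix y :: real
      have "norm (?f j y) = 0" if "j \<notin> {nat \<lceil>y\<rceil> - 1}" for j using that unfolding one by auto
      then show "summable (\<lambda>j. norm (?f j y))" by (rule summable_finite[OF finite.insertI[OF finite.emptyI]])
    qed
    show "summable (\<lambda>j. LINT y|lborel. norm (?f j y))" unfolding intn by (rule v)
  qed
  then show ?thesis unfolding int sums_unique[OF s, symmetric] .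
qed

context
  fixes b :: "nat \<Rightarrow> real" and \<beta> d :: real
  assumes d: "0 < d" "d < 1/2" and \<beta>: "0 < \<beta>"
    and b: "(\<lambda>j. b j) \<sim>[at_top] (\<lambda>j. \<beta> * real j powr (d - 1))"
begin

lemma coeff_ratio: "(\<lambda>j. b j / real j powr (d - 1)) \<longlonglongrightarrow> \<beta>"
proof -
  have "\<forall>\<^sub>F j in at_top. b j \<noteq> 0 \<or> \<beta> * real j powr (d - 1) \<noteq> 0"
    using eventually_gt_at_top[of 0] by eventually_elim (use \<beta> in auto)
  from asymp_equivD_strong[OF b this]
  have "(\<lambda>j. b j / (\<beta> * real j powr (d - 1)) * \<beta>) \<longlonglongrightarrow> 1 * \<beta>" by (intro tendsto_intros)
  then show ?thesis using \<beta> by simp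
qed

lemma coeff_bound: obtains C where "0 < C" "\<And>j. 0 < j \<Longrightarrow> \<bar>b j\<bar> \<le> C * real j powr (d - 1)"
proof -
  obtain C where C: "0 < C" "\<And>j. norm (b j / real j powr (d - 1)) \<le> C"
    using convergent_imp_Bseq[OF convergentI[OF coeff_ratio]] unfolding Bseq_def by blast
  have "\<bar>b j\<bar> \<le> C * real j powr (d - 1)" if "0 < j" for j
    using C(2)[of j] that by (simp add: abs_divide divide_le_eq)
  then show ?thesis using C(1) that by blast
qed

lemma coeff_l2: "summable (\<lambda>j. (b (Suc j))\<^sup>2)"
proof -
  obtain C where C: "0 < C" "\<And>j. 0 < j \<Longrightarrow> \<bar>b j\<bar> \<le> C * real j powr (d - 1)" by (rule coeff_bound) blast
  have "summable (\<lambda>j. C\<^sup>2 * real (Suc j) powr (2*d - 2))"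
    using d by (intro summable_mult) (subst summable_Suc_iff, simp add: summable_real_powr_iff)
  then show ?thesis
  proof (rule summable_comparison_test'[where N = 0])
    fix j :: nat
    have "\<bar>b (Suc j)\<bar>\<^sup>2 \<le> (C * real (Suc j) powr (d - 1))\<^sup>2" using C(2)[of "Suc j"] by (intro power_mono) auto
    also have "\<dots> = C\<^sup>2 * real (Suc j) powr (2*d - 2)" by (simp add: power_mult_distrib power2_eq_square powr_add[symmetric] algebra_simps)
    finally show "norm ((b (Suc j))\<^sup>2) \<le> C\<^sup>2 * real (Suc j) powr (2*d - 2)" by simp
  qed
qed

lemma coeff_product_summable: "summable (\<lambda>j. \<bar>b (Suc j) * b (Suc j + t)\<bar>)"
proof (rule summable_comparison_test'[where N = 0])
  show "summable (\<lambda>j. (b (Suc j))\<^sup>2 + (b (Suc (j + t)))\<^sup>2)"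
    using summable_ignore_initial_segment[OF coeff_l2, of t] by (intro summable_add coeff_l2)
  fix j :: nat
  show "norm \<bar>b (Suc j) * b (Suc j + t)\<bar> \<le> (b (Suc j))\<^sup>2 + (b (Suc (j + t)))\<^sup>2"
    using sum_squares_bound[of "\<bar>b (Suc j)\<bar>" "\<bar>b (Suc j + t)\<bar>"] zero_le_power2[of "b (Suc j)"] zero_le_power2[of "b (Suc j + t)"]
      mult_nonneg_nonneg[OF abs_ge_zero[of "b (Suc j)"] abs_ge_zero[of "b (Suc j + t)"]]
    unfolding real_norm_def abs_abs abs_mult add_Suc power2_abs by linarith
qed

text \<open>With j of size t x, each coefficient is \<beta> times a power d - 1, and the rescaled
  summand tends to \<beta>^2 x^(d-1) (1+x)^(d-1). The same kernel dominates, so the sum behaves like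
  the Beta integral.\<close>

lemma coeff_autocorrelation_asymp:
  "(\<lambda>t. (\<Sum>j. b (Suc j) * b (Suc j + t)) * real t powr (1 - 2*d)) \<longlonglongrightarrow> \<beta>\<^sup>2 * Beta d (1 - 2*d)"
proof -
  obtain C where C: "0 < C" "\<And>j. 0 < j \<Longrightarrow> \<bar>b j\<bar> \<le> C * real j powr (d - 1)" by (rule coeff_bound) blast
  define f where "f t y = indicator {0<..} y * (b (nat \<lceil>y\<rceil>) * b (nat \<lceil>y\<rceil> + t))" for t and y :: real
  \<comment> \<open>Of the exponent 2 - 2d, one unit is the Jacobian of y = t x and the rest is the
    normalisation in the claim.\<close>
  define F where "F t x = real t powr (2 - 2*d) * f t (real t * x)" for t and x :: real
  define w where "w x = indicator {0<..} x * (x powr (d - 1) * (1 + x) powr (d - 1))" for x :: real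
  have w: "integrable lborel w" "integral\<^sup>L lborel w = Beta d (1 - 2*d)"
    unfolding w_def using beta_kernel_integral[OF d] by auto
  have intF: "integral\<^sup>L lborel (F t) = (\<Sum>j. b (Suc j) * b (Suc j + t)) * real t powr (1 - 2*d)" if "0 < t" for t
  proof -
    have "(\<Sum>j. b (Suc j) * b (Suc j + t)) = integral\<^sup>L lborel (f t)"
      unfolding f_def[abs_def] using integral_step_ceiling[of "\<lambda>j. b j * b (j + t)"] coeff_product_summable by simp
    also have "\<dots> = real t * (LINT x|lborel. f t (real t * x))"
      using lborel_integral_real_affine[of "real t" "f t" 0] that by simp
    finally have 1: "(\<Sum>j. b (Suc j) * b (Suc j + t)) = real t * (LINT x|lborel. f t (real t * x))" .
    have "integral\<^sup>L lborel (F t) = real t powr (2 - 2*d) * (LINT x|lborel. f t (real t * x))"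
      unfolding F_def by simp
    also have "real t powr (2 - 2*d) = real t powr (1 + (1 - 2*d))" by (simp add: algebra_simps)
    also have "\<dots> = real t * real t powr (1 - 2*d)" using that by (simp only: powr_add) simp
    finally show ?thesis using 1 by (simp add: mult_ac)
  qed
  have split: "F t x = (b n / real n powr (d - 1)) * (b (n + t) / real (n + t) powr (d - 1)) * ((real n / real t) powr (d - 1) * (real (n + t) / real t) powr (d - 1))"
    if "0 < t" "0 < x" "n = nat \<lceil>real t * x\<rceil>" for t x n
  proof -
    have "0 < n" using that by simp
    have tp: "real t powr (2 - 2*d) = 1 / (real t powr (d - 1) * real t powr (d - 1))"
      by (simp add: powr_add[symmetric] powr_minus[symmetric] divide_inverse algebra_simps)
    have "F t x = real t powr (2 - 2*d) * (b n * b (n + t))" using that by (simp add: F_def f_def)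
    then show ?thesis unfolding tp using \<open>0 < n\<close> \<open>0 < t\<close> by (simp add: powr_divide field_simps)
  qed
  have ptw: "(\<lambda>t. F t x) \<longlonglongrightarrow> \<beta>\<^sup>2 * w x" for x
  proof (cases "0 < x")
    case False
    then have "F t x = 0" for t by (cases t) (auto simp: F_def f_def mult_le_0_iff indicator_def zero_less_mult_iff)
    then show ?thesis using False by (simp add: w_def)
  next
    case True
    define n where "n t = nat \<lceil>real t * x\<rceil>" for t
    have rn: "real (n t) = of_int \<lceil>real t * x\<rceil>" for t using True by (simp add: n_def)
    have ninf: "filterlim n at_top sequentially"
    proof -
      have "filterlim (\<lambda>t. real (n t)) at_top sequentially" unfolding rn
        by (rule filterlim_at_top_mono[of "\<lambda>t. real t * x"]) (use True in \<open>real_asymp, auto\<close>)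
      then show ?thesis by (simp add: filterlim_sequentially_iff_filterlim_real)
    qed
    have ninf2: "filterlim (\<lambda>t. n t + t) at_top sequentially"
      by (rule filterlim_at_top_mono[OF ninf]) auto
    have q: "(\<lambda>t. real (n t) / real t) \<longlonglongrightarrow> x"
    proof (rule real_tendsto_sandwich)
      show "\<forall>\<^sub>F t in sequentially. x \<le> real (n t) / real t"
        using eventually_gt_at_top[of 0] by eventually_elim (simp add: rn le_divide_eq mult.commute)
      show "\<forall>\<^sub>F t in sequentially. real (n t) / real t \<le> (real t * x + 1) / real t"
        by (intro always_eventually allI divide_right_mono) (auto simp: rn)
      show "(\<lambda>t. (real t * x + 1) / real t) \<longlonglongrightarrow> x" by real_asymp
    qed simp
    have q2: "(\<lambda>t. real (n t + t) / real t) \<longlonglongrightarrow> x + 1"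
    proof (rule Lim_transform_eventually)
      show "(\<lambda>t. real (n t) / real t + 1) \<longlonglongrightarrow> x + 1" by (intro tendsto_intros q)
      show "\<forall>\<^sub>F t in sequentially. real (n t) / real t + 1 = real (n t + t) / real t"
        using eventually_gt_at_top[of 0] by eventually_elim (simp add: field_simps)
    qed
    have lim: "(\<lambda>t. (b (n t) / real (n t) powr (d - 1)) * (b (n t + t) / real (n t + t) powr (d - 1)) * ((real (n t) / real t) powr (d - 1) * (real (n t + t) / real t) powr (d - 1)))
      \<longlonglongrightarrow> \<beta> * \<beta> * (x powr (d - 1) * (x + 1) powr (d - 1))"
      using True by (intro tendsto_intros q q2 filterlim_compose[OF coeff_ratio ninf] filterlim_compose[OF coeff_ratio ninf2]) auto
    have lw: "\<beta> * \<beta> * (x powr (d - 1) * (x + 1) powr (d - 1)) = \<beta>\<^sup>2 * w x" using True by (simp add: w_def power2_eq_square add.commute)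
    have ev: "\<forall>\<^sub>F t in sequentially. (b (n t) / real (n t) powr (d - 1)) * (b (n t + t) / real (n t + t) powr (d - 1)) * ((real (n t) / real t) powr (d - 1) * (real (n t + t) / real t) powr (d - 1)) = F t x"
      using eventually_gt_at_top[of 0] by eventually_elim (simp add: split[OF _ True] n_def)
    show ?thesis using Lim_transform_eventually[OF lim ev] unfolding lw .
  qed
  have bd: "norm (F t x) \<le> C\<^sup>2 * w x" if "0 < t" for t x
  proof (cases "0 < x")
    case False
    then have "F t x = 0" using that by (auto simp: F_def f_def zero_less_mult_iff)
    then show ?thesis using False by (simp add: w_def)
  next
    case True
    define n where "n = nat \<lceil>real t * x\<rceil>"
    have n0: "0 < n" using True that by (simp add: n_def)
    have rn: "real t * x \<le> real n" using True by (simp add: n_def)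
    have "\<bar>b n / real n powr (d - 1)\<bar> \<le> C" "\<bar>b (n + t) / real (n + t) powr (d - 1)\<bar> \<le> C"
      using C(2)[of n] C(2)[of "n + t"] n0 by (simp_all add: abs_divide divide_le_eq)
    moreover have "(real n / real t) powr (d - 1) \<le> x powr (d - 1)" "(real (n + t) / real t) powr (d - 1) \<le> (1 + x) powr (d - 1)"
      using d True that rn by (auto intro!: powr_mono2' simp: field_simps)
    ultimately have "norm (F t x) \<le> C * C * (x powr (d - 1) * (1 + x) powr (d - 1))"
      unfolding split[OF that True n_def] real_norm_def abs_mult using C(1) by (intro mult_mono) auto
    then show ?thesis using True by (simp add: w_def power2_eq_square)
  qed
  have meas: "F t \<in> borel_measurable lborel" for t
    unfolding F_def f_def by measurable
  \<comment> \<open>The index is shifted because the domination is established for positive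
    \<open>t\<close> only.\<close>
  have "(\<lambda>t. integral\<^sup>L lborel (F (Suc t))) \<longlonglongrightarrow> (LINT x|lborel. \<beta>\<^sup>2 * w x)"
  proof (rule integral_dominated_convergence[where w = "\<lambda>x. C\<^sup>2 * w x"])
    show "(\<lambda>x. \<beta>\<^sup>2 * w x) \<in> borel_measurable lborel" using w(1) by auto
    show "integrable lborel (\<lambda>x. C\<^sup>2 * w x)" using w(1) by simp
    show "AE x in lborel. (\<lambda>t. F (Suc t) x) \<longlonglongrightarrow> \<beta>\<^sup>2 * w x" using LIMSEQ_Suc[OF ptw] by simp
    show "AE x in lborel. norm (F (Suc t) x) \<le> C\<^sup>2 * w x" for t using bd by simp
  qed (rule meas)
  then have "(\<lambda>t. (\<Sum>j. b (Suc j) * b (Suc j + Suc t)) * real (Suc t) powr (1 - 2*d)) \<longlonglongrightarrow> \<beta>\<^sup>2 * Beta d (1 - 2*d)"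
    using w(2) by (simp add: intF del: of_nat_Suc)
  then show ?thesis by (rule LIMSEQ_imp_Suc)
qed

end

subsection \<open>Independence and the central limit theorem\<close>

text \<open>McLeish's factorisation: e^(ix) and (1 + ix) e^(-x^2/2) agree up to third order. In a
  product over many terms the first factor has mean one and the second sees only the sum of
  squares.\<close>

lemma iexp_mcleish:
  fixes x :: real assumes "\<bar>x\<bar> \<le> 1"
  shows "cmod (iexp x - (1 + \<i> * x) * exp (- (x\<^sup>2) / 2)) \<le> 2 * \<bar>x\<bar>^3"
proof -
  define y where "y = x\<^sup>2 / 2"
  have y: "0 \<le> y" by (simp add: y_def)
  have l: "1 - y \<le> exp (- y)" using exp_ge_add_one_self[of "-y"] by simp
  have u: "exp (- y) \<le> 1 - y + y\<^sup>2"
  proof -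
    have "exp (- y) = 1 / exp y" by (simp add: exp_minus divide_inverse)
    also have "\<dots> \<le> 1 / (1 + y)" using y exp_ge_add_one_self[of y] by (intro divide_left_mono) auto
    also have "\<dots> \<le> 1 - y + y\<^sup>2"
    proof -
      have "1 \<le> (1 - y + y\<^sup>2) * (1 + y)" using y by (simp add: algebra_simps power2_eq_square)
      then show ?thesis using y by (simp add: divide_le_eq)
    qed
    finally show ?thesis .
  qed
  have ey: "\<bar>exp (-y) - (1 - y)\<bar> \<le> y\<^sup>2" using l u by linarith
  have a3: "\<bar>x\<bar>^4 \<le> \<bar>x\<bar>^3" using assms power_decreasing[of 3 4 "\<bar>x\<bar>"] by simp
  have 1: "cmod (iexp x - (1 + \<i> * x - y)) \<le> \<bar>x\<bar>^3 / 6"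
  proof -
    have "(\<i> * complex_of_real x) * (\<i> * complex_of_real x) = (\<i> * \<i>) * (complex_of_real x * complex_of_real x)"
      by (simp only: mult_ac)
    then have "(\<Sum>k\<le>2. (\<i> * x)^k / fact k) = 1 + \<i> * x - y"
      by (simp add: numeral_2_eq_2 y_def power2_eq_square)
    then show ?thesis using iexp_approx1[of x 2] by (simp add: fact_numeral eval_nat_numeral)
  qed
  have n1: "cmod (1 + \<i> * x) \<le> 2"
    using norm_triangle_ineq[of 1 "\<i> * x"] assms by (simp add: norm_mult)
  have 2: "cmod ((1 + \<i> * x) * (exp (-y) - (1 - y))) \<le> \<bar>x\<bar>^3 / 2"
  proof -
    have "cmod ((1 + \<i> * x) * (exp (-y) - (1 - y))) = cmod (1 + \<i> * x) * \<bar>exp (-y) - (1 - y)\<bar>"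
      by (simp only: norm_mult norm_of_real)
    also have "\<dots> \<le> 2 * y\<^sup>2" by (intro mult_mono n1 ey) auto
    also have "\<dots> = \<bar>x\<bar>^4 / 2" by (simp add: y_def power_divide)
    finally show ?thesis using a3 by simp
  qed
  have 3: "cmod (\<i> * x * y) = \<bar>x\<bar>^3 / 2" by (simp add: norm_mult y_def power3_eq_cube power2_eq_square)
  \<comment> \<open>Both sides are compared with 1 + ix - y; the last term is what (1 + ix)(1 - y)
    has in excess. The three errors are 1/6, 1/2 and 1/2 of |x|^3.\<close>
  have "iexp x - (1 + \<i> * x) * exp (-y) = (iexp x - (1 + \<i> * x - y)) - (1 + \<i> * x) * (exp (-y) - (1 - y)) + \<i> * x * y"
    by (simp add: algebra_simps)
  moreover have "norm (A - B + D) \<le> norm A + norm B + norm D" for A B D :: complex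
    using norm_triangle_ineq[of "A - B" D] norm_triangle_ineq4[of A B] by linarith
  ultimately have "cmod (iexp x - (1 + \<i> * x) * exp (-y)) \<le> cmod (iexp x - (1 + \<i> * x - y)) + cmod ((1 + \<i> * x) * (exp (-y) - (1 - y))) + cmod (\<i> * x * y)"
    by (simp only:)
  also have "\<dots> \<le> 2 * \<bar>x\<bar>^3" using 1 2 3 zero_le_power[OF abs_ge_zero, of x 3] by linarith
  finally show ?thesis by (simp add: y_def)
qed

lemma norm_one_plus_ix: "cmod (1 + \<i> * complex_of_real x) \<le> exp (x\<^sup>2 / 2)"
proof -
  have "cmod (1 + \<i> * complex_of_real x) = sqrt (1 + x\<^sup>2)" by (simp add: cmod_def)
  also have "\<dots> \<le> sqrt (exp (x\<^sup>2))" using exp_ge_add_one_self[of "x\<^sup>2"] by (intro real_sqrt_le_mono) simp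
  also have "\<dots> = exp (x\<^sup>2 / 2)"
    by (rule real_sqrt_unique) (simp_all add: power2_eq_square exp_add[symmetric])
  finally show ?thesis .
qed

lemma iexp_prod_mcleish:
  fixes x :: "'i \<Rightarrow> real"
  assumes S: "finite S" and x: "\<And>s. s \<in> S \<Longrightarrow> \<bar>x s\<bar> \<le> 1"
  shows "cmod (iexp (\<Sum>s\<in>S. x s) - (\<Prod>s\<in>S. 1 + \<i> * x s) * exp (- (\<Sum>s\<in>S. (x s)\<^sup>2) / 2)) \<le> 2 * (\<Sum>s\<in>S. \<bar>x s\<bar>^3)"
proof -
  have "iexp (\<Sum>s\<in>S. x s) = (\<Prod>s\<in>S. iexp (x s))" using S by (simp add: exp_sum sum_distrib_left)
  moreover have "(\<Prod>s\<in>S. 1 + \<i> * x s) * exp (- (\<Sum>s\<in>S. (x s)\<^sup>2) / 2) = (\<Prod>s\<in>S. (1 + \<i> * x s) * exp (- ((x s)\<^sup>2) / 2))"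
    using S by (simp add: prod.distrib exp_sum[symmetric] sum_negf sum_divide_distrib flip: of_real_prod)
  moreover have "cmod ((\<Prod>s\<in>S. iexp (x s)) - (\<Prod>s\<in>S. (1 + \<i> * x s) * exp (- ((x s)\<^sup>2) / 2))) \<le>
     (\<Sum>s\<in>S. cmod (iexp (x s) - (1 + \<i> * x s) * exp (- ((x s)\<^sup>2) / 2)))"
  proof (rule norm_prod_diff)
    fix s
    have "cmod ((1 + \<i> * x s) * exp (- ((x s)\<^sup>2) / 2)) \<le> exp ((x s)\<^sup>2 / 2) * exp (- ((x s)\<^sup>2) / 2)"
      unfolding norm_mult by (intro mult_mono norm_one_plus_ix) auto
    also have "\<dots> = 1" by (simp add: exp_add[symmetric])
    finally show "cmod ((1 + \<i> * x s) * exp (- ((x s)\<^sup>2) / 2)) \<le> 1" .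
  qed simp
  moreover have "(\<Sum>s\<in>S. cmod (iexp (x s) - (1 + \<i> * x s) * exp (- ((x s)\<^sup>2) / 2))) \<le> (\<Sum>s\<in>S. 2 * \<bar>x s\<bar>^3)"
    by (intro sum_mono iexp_mcleish x)
  ultimately show ?thesis by (simp add: sum_distrib_left)
qed

lemma exp_minus_diff_le: assumes "0 \<le> a" "0 \<le> b" shows "\<bar>exp (- a / 2) - exp (- b / 2)\<bar> \<le> \<bar>a - b\<bar> / (2::real)"
proof -
  have *: "exp (- b / 2) - exp (- a / 2) \<le> (a - b) / 2" if "0 \<le> a" "0 \<le> b" "b \<le> a" for a b :: real
  proof -
    have "exp (- b / 2) - exp (- a / 2) = exp (- b / 2) * (1 - exp (- (a - b) / 2))"
      by (simp add: right_diff_distrib exp_add[symmetric] field_simps)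
    also have "\<dots> \<le> 1 * ((a - b) / 2)"
    proof (rule mult_mono)
      show "1 - exp (- (a - b) / 2) \<le> (a - b) / 2" using exp_ge_add_one_self[of "- (a - b) / 2"] by linarith
    qed (use that in auto)
    finally show ?thesis by simp
  qed
  show ?thesis using *[of a b] *[of b a] assms by (cases "b \<le> a") (auto simp: abs_if)
qed

section \<open>Sigma-algebras generated by sets of innovations\<close>

text \<open>An arbitrary index set covers the past, a single innovation and a finite window alike;
  independence then is disjointness of index sets.\<close>

definition noise_sigma :: "'a measure \<Rightarrow> (int \<Rightarrow> 'a \<Rightarrow> real) \<Rightarrow> int set \<Rightarrow> 'a measure" where
  "noise_sigma M \<zeta> J = sigma (space M) {\<zeta> s -` A \<inter> space M | s A. s \<in> J \<and> A \<in> sets borel}"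

lemma nat_filtration_eq: "nat_filtration M \<zeta> t = noise_sigma M \<zeta> {..t}"
  by (simp add: nat_filtration_def noise_sigma_def)

locale noise = prob_space M for M :: "'a measure" +
  fixes \<zeta> :: "int \<Rightarrow> 'a \<Rightarrow> real"
  assumes zeta_rv: "\<And>t. \<zeta> t \<in> borel_measurable M"
    and zeta_indep: "indep_vars (\<lambda>_. borel) \<zeta> UNIV"
begin

abbreviation \<F> :: "int set \<Rightarrow> 'a measure" where "\<F> \<equiv> noise_sigma M \<zeta>"

lemma space_F[simp]: "space (\<F> J) = space M"
  by (simp add: noise_sigma_def space_measure_of_conv)

lemma sets_F: "sets (\<F> J) = sigma_sets (space M) (\<Union>s\<in>J. {\<zeta> s -` A \<inter> space M | A. A \<in> sets borel})"
  unfolding noise_sigma_def by (subst sets_measure_of) (auto intro!: arg_cong2[where f = sigma_sets])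

lemma sets_F_subset: "sets (\<F> J) \<subseteq> sets M"
  unfolding sets_F by (rule sets.sigma_sets_subset) (auto intro: measurable_sets[OF zeta_rv])

lemma sets_F_mono: "J \<subseteq> J' \<Longrightarrow> sets (\<F> J) \<subseteq> sets (\<F> J')"
  unfolding sets_F by (rule sigma_sets_mono') auto

lemma measurable_F_M: "f \<in> measurable (\<F> J) N \<Longrightarrow> f \<in> measurable M N"
  using sets_F_subset[of J] by (auto simp: measurable_def)

lemma measurable_F_mono: "J \<subseteq> J' \<Longrightarrow> f \<in> measurable (\<F> J) N \<Longrightarrow> f \<in> measurable (\<F> J') N"
  using sets_F_mono[of J J'] by (auto simp: measurable_def)

lemma zeta_F: "s \<in> J \<Longrightarrow> \<zeta> s \<in> borel_measurable (\<F> J)"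
  by (rule measurableI) (auto simp: sets_F intro!: sigma_sets.Basic)

text \<open>The preimages under one innovation form an intersection-stable class, so independence
  passes to the sigma-algebras generated by disjoint groups of innovations.\<close>

lemma indep_F:
  assumes J: "J \<inter> J' = {}" and f: "f \<in> measurable (\<F> J) N" and g: "g \<in> measurable (\<F> J') N'"
  shows "indep_var N f N' g"
proof -
  let ?E = "\<lambda>i. {\<zeta> i -` A \<inter> space M | A. A \<in> sets borel}"
  have E: "indep_sets ?E UNIV" using zeta_indep unfolding indep_vars_def2 by auto
  have "indep_sets (\<lambda>j. sigma_sets (space M) (\<Union>i\<in>case_bool J J' j. ?E i)) UNIV"
  proof (rule indep_sets_collect_sigma)
    show "indep_sets ?E (\<Union>j\<in>UNIV. case_bool J J' j)" by (rule indep_sets_mono_index[OF _ E]) simp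
    show "Int_stable (?E i)" for i
    proof (rule Int_stableI)
      fix A B assume "A \<in> ?E i" "B \<in> ?E i"
      then obtain A' B' where "A = \<zeta> i -` A' \<inter> space M" "B = \<zeta> i -` B' \<inter> space M" "A' \<in> sets borel" "B' \<in> sets borel" by blast
      then show "A \<inter> B \<in> ?E i" by (intro CollectI exI[of _ "A' \<inter> B'"]) auto
    qed
    show "disjoint_family_on (case_bool J J') UNIV" using J by (auto simp: disjoint_family_on_def split: bool.splits)
  qed
  moreover have "(\<lambda>j. sigma_sets (space M) (\<Union>i\<in>case_bool J J' j. ?E i)) = case_bool (sets (\<F> J)) (sets (\<F> J'))"
    by (auto simp: fun_eq_iff sets_F split: bool.split)
  ultimately have ind: "indep_set (sets (\<F> J)) (sets (\<F> J'))" unfolding indep_set_def by simp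
  have "indep_set (sigma_sets (space M) {f -` A \<inter> space M | A. A \<in> sets N}) (sigma_sets (space M) {g -` A \<inter> space M | A. A \<in> sets N'})"
    unfolding indep_set_def
  proof (rule indep_sets_mono_sets[OF ind[unfolded indep_set_def]])
    fix i :: bool
    have "sigma_sets (space M) {f -` A \<inter> space M | A. A \<in> sets N} \<subseteq> sets (\<F> J)"
      using sets.sigma_sets_subset[of "{f -` A \<inter> space M | A. A \<in> sets N}" "\<F> J"] measurable_sets[OF f] by auto
    moreover have "sigma_sets (space M) {g -` A \<inter> space M | A. A \<in> sets N'} \<subseteq> sets (\<F> J')"
      using sets.sigma_sets_subset[of "{g -` A \<inter> space M | A. A \<in> sets N'}" "\<F> J'"] measurable_sets[OF g] by auto
    ultimately show "case_bool (sigma_sets (space M) {f -` A \<inter> space M | A. A \<in> sets N}) (sigma_sets (space M) {g -` A \<inter> space M | A. A \<in> sets N'}) i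
        \<subseteq> case_bool (sets (\<F> J)) (sets (\<F> J')) i" by (cases i) auto
  qed
  then show ?thesis unfolding indep_var_eq using measurable_F_M[OF f] measurable_F_M[OF g] by simp
qed

text \<open>The value type is left general because the factors in McLeish's product are
  complex.\<close>

lemma expectation_mult_F:
  fixes f g :: "'a \<Rightarrow> 'b::{real_normed_field, banach, second_countable_topology}"
  assumes "J \<inter> J' = {}" "f \<in> borel_measurable (\<F> J)" "g \<in> borel_measurable (\<F> J')" "integrable M f" "integrable M g"
  shows "integrable M (\<lambda>\<omega>. f \<omega> * g \<omega>)" "expectation (\<lambda>\<omega>. f \<omega> * g \<omega>) = expectation f * expectation g"
  using indep_var_integrable[OF indep_F[OF assms(1-3)] assms(4,5)] indep_var_lebesgue_integral[OF indep_F[OF assms(1-3)] assms(4,5)]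
  by auto

end

section \<open>McLeish's theorem for bounded differences of finite range\<close>

text \<open>The window of \<open>q s\<close> ends before \<open>s\<close>, which makes
  \<open>z (\<zeta> s) * q s\<close> a martingale difference, and it reaches back \<open>m\<close>
  steps, which makes such products independent at distance greater than \<open>m\<close>.\<close>

locale bounded_mds = noise +
  fixes z :: "real \<Rightarrow> real" and q :: "int \<Rightarrow> 'a \<Rightarrow> real" and m :: nat and K :: real
  assumes z_meas: "z \<in> borel_measurable borel" and z_bound: "\<And>x. \<bar>z x\<bar> \<le> K"
    and z_mean: "\<And>s. expectation (\<lambda>\<omega>. z (\<zeta> s \<omega>)) = 0"
    and q_meas: "\<And>s. q s \<in> borel_measurable (\<F> {s - int m..<s})" and q_bound: "\<And>s \<omega>. \<bar>q s \<omega>\<bar> \<le> K"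
begin

definition \<eta> :: "int \<Rightarrow> 'a \<Rightarrow> real" where "\<eta> s \<omega> = z (\<zeta> s \<omega>) * q s \<omega>"

lemma K_nonneg: "0 \<le> K" using z_bound[of 0] by linarith

lemma z_zeta_F: "(\<lambda>\<omega>. z (\<zeta> s \<omega>)) \<in> borel_measurable (\<F> {s})"
  by (rule measurable_compose[OF zeta_F z_meas]) simp

lemma eta_F: "{s - int m..s} \<subseteq> J \<Longrightarrow> \<eta> s \<in> borel_measurable (\<F> J)"
proof -
  assume J: "{s - int m..s} \<subseteq> J"
  have "(\<lambda>\<omega>. z (\<zeta> s \<omega>)) \<in> borel_measurable (\<F> J)" using J by (intro measurable_F_mono[OF _ z_zeta_F]) auto
  moreover have "q s \<in> borel_measurable (\<F> J)" using J by (intro measurable_F_mono[OF _ q_meas]) auto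
  ultimately show ?thesis unfolding \<eta>_def[abs_def] by (rule borel_measurable_times)
qed

lemma eta_M[measurable]: "\<eta> s \<in> borel_measurable M"
  using measurable_F_M[OF eta_F[of s "{s - int m..s}"]] by simp

lemma q_M[measurable]: "q s \<in> borel_measurable M" by (rule measurable_F_M[OF q_meas])

lemma z_M[measurable]: "(\<lambda>\<omega>. z (\<zeta> s \<omega>)) \<in> borel_measurable M" by (rule measurable_F_M[OF z_zeta_F])

lemma eta_bound: "\<bar>\<eta> s \<omega>\<bar> \<le> K\<^sup>2"
  unfolding \<eta>_def abs_mult power2_eq_square by (intro mult_mono z_bound q_bound K_nonneg) auto

lemma eta_sq_integrable: "integrable M (\<lambda>\<omega>. (\<eta> s \<omega>)\<^sup>2)"
proof (rule integrable_const_bound[of _ "(K\<^sup>2)\<^sup>2"])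
  have "\<bar>\<eta> s \<omega>\<bar>\<^sup>2 \<le> (K\<^sup>2)\<^sup>2" for \<omega> by (intro power_mono eta_bound) simp
  then show "AE \<omega> in M. norm ((\<eta> s \<omega>)\<^sup>2) \<le> (K\<^sup>2)\<^sup>2" by simp
qed measurable

text \<open>Induction on the largest index \<open>t\<close>: all earlier factors and
  \<open>q t\<close> depend on innovations before \<open>t\<close>, while
  \<open>z (\<zeta> t)\<close> is independent of them and centred, so the last factor contributes
  its constant 1 only.\<close>

lemma mcleish_product:
  assumes "finite S"
  shows "expectation (\<lambda>\<omega>. \<Prod>s\<in>S. 1 + \<i> * complex_of_real (c s * \<eta> s \<omega>)) = 1"
proof -
  let ?p = "\<lambda>s \<omega>. 1 + \<i> * complex_of_real (c s * \<eta> s \<omega>)"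
  have pb: "cmod (?p s \<omega>) \<le> 1 + \<bar>c s\<bar> * K\<^sup>2" for s \<omega>
  proof -
    have "cmod (?p s \<omega>) \<le> 1 + cmod (\<i> * complex_of_real (c s * \<eta> s \<omega>))" by (metis norm_triangle_ineq norm_one)
    also have "\<dots> \<le> 1 + \<bar>c s\<bar> * K\<^sup>2" by (auto simp: norm_mult abs_mult intro!: mult_left_mono eta_bound)
    finally show ?thesis .
  qed
  have pi: "integrable M (\<lambda>\<omega>. \<Prod>s\<in>A. ?p s \<omega>)" for A
  proof (rule integrable_const_bound[of _ "\<Prod>s\<in>A. 1 + \<bar>c s\<bar> * K\<^sup>2"])
    show "AE \<omega> in M. norm (\<Prod>s\<in>A. ?p s \<omega>) \<le> (\<Prod>s\<in>A. 1 + \<bar>c s\<bar> * K\<^sup>2)"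
      unfolding prod_norm[symmetric] by (intro AE_I2 prod_mono conjI norm_ge_zero pb)
  qed measurable
  show ?thesis using assms
  proof (induction S rule: finite_linorder_max_induct)
    case empty
    then show ?case by (simp add: prob_space)
  next
    case (insert t A)
    let ?P = "\<lambda>\<omega>. \<Prod>s\<in>A. ?p s \<omega>"
    have PF: "?P \<in> borel_measurable (\<F> {..<t})"
    proof (rule borel_measurable_prod)
      fix s assume "s \<in> A"
      then have [measurable]: "\<eta> s \<in> borel_measurable (\<F> {..<t})" using insert.hyps(2) by (intro eta_F) force
      show "?p s \<in> borel_measurable (\<F> {..<t})" by measurable
    qed
    have [measurable]: "q t \<in> borel_measurable (\<F> {..<t})" by (rule measurable_F_mono[OF _ q_meas]) auto
    have PqF: "(\<lambda>\<omega>. ?P \<omega> * complex_of_real (q t \<omega>)) \<in> borel_measurable (\<F> {..<t})"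
      using PF by measurable
    have Pqi: "integrable M (\<lambda>\<omega>. ?P \<omega> * complex_of_real (q t \<omega>))"
    proof (rule Bochner_Integration.integrable_bound[OF integrable_mult_right[OF pi, of K A]])
      show "AE \<omega> in M. norm (?P \<omega> * complex_of_real (q t \<omega>)) \<le> norm (complex_of_real K * ?P \<omega>)"
        using q_bound[of t] K_nonneg by (intro AE_I2) (auto simp: norm_mult mult.commute intro!: mult_right_mono)
    qed (use measurable_F_M[OF PqF] in simp)
    have zi: "integrable M (\<lambda>\<omega>. z (\<zeta> t \<omega>))" using z_bound by (intro integrable_const_bound[of _ K]) auto
    have zF: "(\<lambda>\<omega>. complex_of_real (z (\<zeta> t \<omega>))) \<in> borel_measurable (\<F> {t})" using z_zeta_F by measurable
    have "expectation (\<lambda>\<omega>. (?P \<omega> * complex_of_real (q t \<omega>)) * complex_of_real (z (\<zeta> t \<omega>))) =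
       expectation (\<lambda>\<omega>. ?P \<omega> * complex_of_real (q t \<omega>)) * expectation (\<lambda>\<omega>. complex_of_real (z (\<zeta> t \<omega>)))"
      by (rule expectation_mult_F[OF _ PqF zF Pqi]) (use zi in auto)
    also have "expectation (\<lambda>\<omega>. complex_of_real (z (\<zeta> t \<omega>))) = 0" using z_mean by simp
    finally have zero: "expectation (\<lambda>\<omega>. (?P \<omega> * complex_of_real (q t \<omega>)) * complex_of_real (z (\<zeta> t \<omega>))) = 0" by simp
    have zero_i: "integrable M (\<lambda>\<omega>. (?P \<omega> * complex_of_real (q t \<omega>)) * complex_of_real (z (\<zeta> t \<omega>)))"
      by (rule expectation_mult_F[OF _ PqF zF Pqi]) (use zi in auto)
    have "(\<lambda>\<omega>. \<Prod>s\<in>insert t A. ?p s \<omega>) = (\<lambda>\<omega>. ?P \<omega> + (\<i> * c t) * ((?P \<omega> * complex_of_real (q t \<omega>)) * complex_of_real (z (\<zeta> t \<omega>))))"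
    proof
      fix \<omega>
      have "t \<notin> A" using insert.hyps(2) by blast
      then show "(\<Prod>s\<in>insert t A. ?p s \<omega>) = ?P \<omega> + (\<i> * c t) * ((?P \<omega> * complex_of_real (q t \<omega>)) * complex_of_real (z (\<zeta> t \<omega>)))"
        using insert.hyps(1) by (simp add: \<eta>_def algebra_simps)
    qed
    then have "expectation (\<lambda>\<omega>. \<Prod>s\<in>insert t A. ?p s \<omega>) = expectation ?P + (\<i> * c t) * expectation (\<lambda>\<omega>. (?P \<omega> * complex_of_real (q t \<omega>)) * complex_of_real (z (\<zeta> t \<omega>)))"
      using pi[of A] zero_i by (simp only: Bochner_Integration.integral_add integrable_mult_right integral_mult_right_zero)
    then show ?case using insert.IH zero by simp
  qed
qed

text \<open>The centred squares are uncorrelated at distance beyond \<open>m\<close> and bounded by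
  K^4. So each index meets at most 2m + 1 others, and one of the two squared weights is at most
  \<delta>^2: the variance vanishes with the largest weight.\<close>

lemma eta_sq_variance:
  assumes S: "finite S" and c: "\<And>s. s \<in> S \<Longrightarrow> \<bar>c s\<bar> \<le> \<delta>" and C: "(\<Sum>s\<in>S. (c s)\<^sup>2) \<le> C"
  shows "expectation (\<lambda>\<omega>. ((\<Sum>s\<in>S. (c s)\<^sup>2 * (\<eta> s \<omega>)\<^sup>2) - (\<Sum>s\<in>S. (c s)\<^sup>2 * expectation (\<lambda>\<omega>. (\<eta> s \<omega>)\<^sup>2)))\<^sup>2)
     \<le> (2 * real m + 1) * \<delta>\<^sup>2 * K^8 * C"
proof -
  define y where "y s \<omega> = (\<eta> s \<omega>)\<^sup>2 - expectation (\<lambda>\<omega>. (\<eta> s \<omega>)\<^sup>2)" for s \<omega>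
  have sq: "0 \<le> (\<eta> s \<omega>)\<^sup>2" "(\<eta> s \<omega>)\<^sup>2 \<le> K^4" for s \<omega>
  proof -
    have "\<bar>\<eta> s \<omega>\<bar>\<^sup>2 \<le> (K\<^sup>2)\<^sup>2" by (intro power_mono eta_bound) simp
    then show "(\<eta> s \<omega>)\<^sup>2 \<le> K^4" by simp
  qed simp
  have Ev: "0 \<le> expectation (\<lambda>\<omega>. (\<eta> s \<omega>)\<^sup>2)" "expectation (\<lambda>\<omega>. (\<eta> s \<omega>)\<^sup>2) \<le> K^4" for s
  proof -
    show "0 \<le> expectation (\<lambda>\<omega>. (\<eta> s \<omega>)\<^sup>2)" by simp
    have "expectation (\<lambda>\<omega>. (\<eta> s \<omega>)\<^sup>2) \<le> expectation (\<lambda>\<omega>. K^4)" by (intro integral_mono eta_sq_integrable sq) auto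
    then show "expectation (\<lambda>\<omega>. (\<eta> s \<omega>)\<^sup>2) \<le> K^4" by (simp add: prob_space)
  qed
  have yb: "\<bar>y s \<omega>\<bar> \<le> K^4" for s \<omega> using sq[of s \<omega>] Ev[of s] unfolding y_def by linarith
  have yF: "y s \<in> borel_measurable (\<F> {s - int m..s})" for s
    unfolding y_def[abs_def] using eta_F[of s "{s - int m..s}"] by measurable
  have yM[measurable]: "y s \<in> borel_measurable M" for s by (rule measurable_F_M[OF yF])
  have yi: "integrable M (y s)" for s using yb by (intro integrable_const_bound[of _ "K^4"]) auto
  have y0: "expectation (y s) = 0" for s unfolding y_def using eta_sq_integrable by (simp add: prob_space)
  have yyb: "\<bar>y s \<omega> * y t \<omega>\<bar> \<le> K^8" for s t \<omega>
  proof -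
    have "\<bar>y s \<omega> * y t \<omega>\<bar> \<le> K^4 * K^4" unfolding abs_mult by (intro mult_mono yb) auto
    then show ?thesis by (simp add: power_add[symmetric])
  qed
  have yyi: "integrable M (\<lambda>\<omega>. y s \<omega> * y t \<omega>)" for s t using yyb by (intro integrable_const_bound[of _ "K^8"]) auto
  have far: "expectation (\<lambda>\<omega>. y s \<omega> * y t \<omega>) = 0" if "int m < \<bar>s - t\<bar>" for s t
    using expectation_mult_F(2)[OF _ yF[of s] yF[of t] yi yi] that y0 by auto
  have near: "expectation (\<lambda>\<omega>. y s \<omega> * y t \<omega>) \<le> K^8" for s t
  proof -
    have "expectation (\<lambda>\<omega>. y s \<omega> * y t \<omega>) \<le> expectation (\<lambda>\<omega>. K^8)"
      using yyb[of s _ t] by (intro integral_mono yyi) (auto simp: abs_le_iff)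
    then show ?thesis by (simp add: prob_space)
  qed
  have "expectation (\<lambda>\<omega>. ((\<Sum>s\<in>S. (c s)\<^sup>2 * (\<eta> s \<omega>)\<^sup>2) - (\<Sum>s\<in>S. (c s)\<^sup>2 * expectation (\<lambda>\<omega>. (\<eta> s \<omega>)\<^sup>2)))\<^sup>2)
     = expectation (\<lambda>\<omega>. \<Sum>s\<in>S. \<Sum>t\<in>S. (c s)\<^sup>2 * (c t)\<^sup>2 * (y s \<omega> * y t \<omega>))"
  proof -
    have "(\<Sum>s\<in>S. (c s)\<^sup>2 * (\<eta> s \<omega>)\<^sup>2) - (\<Sum>s\<in>S. (c s)\<^sup>2 * expectation (\<lambda>\<omega>. (\<eta> s \<omega>)\<^sup>2)) = (\<Sum>s\<in>S. (c s)\<^sup>2 * y s \<omega>)" for \<omega>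
      unfolding y_def right_diff_distrib sum_subtractf ..
    moreover have "(\<Sum>s\<in>S. (c s)\<^sup>2 * y s \<omega>)\<^sup>2 = (\<Sum>s\<in>S. \<Sum>t\<in>S. (c s)\<^sup>2 * (c t)\<^sup>2 * (y s \<omega> * y t \<omega>))" for \<omega>
      unfolding power2_eq_square[of "sum _ _"] sum_product by (simp only: mult_ac)
    ultimately show ?thesis by (simp only:)
  qed
  also have "\<dots> = (\<Sum>s\<in>S. \<Sum>t\<in>S. (c s)\<^sup>2 * (c t)\<^sup>2 * expectation (\<lambda>\<omega>. y s \<omega> * y t \<omega>))"
    by (simp add: yyi)
  also have "\<dots> \<le> (\<Sum>s\<in>S. \<Sum>t\<in>S. (c s)\<^sup>2 * (if \<bar>s - t\<bar> \<le> int m then \<delta>\<^sup>2 * K^8 else 0))"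
  proof (intro sum_mono)
    fix s t assume st: "s \<in> S" "t \<in> S"
    show "(c s)\<^sup>2 * (c t)\<^sup>2 * expectation (\<lambda>\<omega>. y s \<omega> * y t \<omega>) \<le> (c s)\<^sup>2 * (if \<bar>s - t\<bar> \<le> int m then \<delta>\<^sup>2 * K^8 else 0)"
    proof (cases "\<bar>s - t\<bar> \<le> int m")
      case True
      have "\<bar>c t\<bar>\<^sup>2 \<le> \<delta>\<^sup>2" using c[OF st(2)] by (intro power_mono) auto
      then have "(c t)\<^sup>2 * expectation (\<lambda>\<omega>. y s \<omega> * y t \<omega>) \<le> \<delta>\<^sup>2 * K^8"
        using near[of s t] by (intro order_trans[OF mult_left_mono[OF near] mult_right_mono]) auto
      then show ?thesis using True by (simp add: mult.assoc mult_left_mono)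
    qed (simp add: far)
  qed
  also have "\<dots> = (\<Sum>s\<in>S. (c s)\<^sup>2 * (\<delta>\<^sup>2 * K^8 * real (card {t\<in>S. \<bar>s - t\<bar> \<le> int m})))"
  proof (rule sum.cong[OF refl])
    fix s
    have "(\<Sum>t\<in>S. if \<bar>s - t\<bar> \<le> int m then \<delta>\<^sup>2 * K^8 else 0) = (\<Sum>t\<in>{t\<in>S. \<bar>s - t\<bar> \<le> int m}. \<delta>\<^sup>2 * K^8)"
      using S by (rule sum.inter_filter[symmetric])
    then show "(\<Sum>t\<in>S. (c s)\<^sup>2 * (if \<bar>s - t\<bar> \<le> int m then \<delta>\<^sup>2 * K^8 else 0)) = (c s)\<^sup>2 * (\<delta>\<^sup>2 * K^8 * real (card {t\<in>S. \<bar>s - t\<bar> \<le> int m}))"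
      by (simp add: sum_distrib_left[symmetric])
  qed
  also have "\<dots> \<le> (\<Sum>s\<in>S. (c s)\<^sup>2 * (\<delta>\<^sup>2 * K^8 * (2 * real m + 1)))"
  proof (intro sum_mono mult_left_mono)
    fix s
    have "card {t\<in>S. \<bar>s - t\<bar> \<le> int m} \<le> card {s - int m..s + int m}" by (intro card_mono) auto
    also have "\<dots> = 2 * m + 1" by simp
    finally have "real (card {t\<in>S. \<bar>s - t\<bar> \<le> int m}) \<le> real (2 * m + 1)" by (rule of_nat_mono)
    then show "real (card {t\<in>S. \<bar>s - t\<bar> \<le> int m}) \<le> 2 * real m + 1" by simp
  qed auto
  also have "\<dots> = (2 * real m + 1) * \<delta>\<^sup>2 * K^8 * (\<Sum>s\<in>S. (c s)\<^sup>2)"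
    by (simp add: sum_distrib_left mult_ac)
  also have "\<dots> \<le> (2 * real m + 1) * \<delta>\<^sup>2 * K^8 * C" by (intro mult_left_mono C) auto
  finally show ?thesis .
qed

text \<open>\<open>P\<close> has mean one, so \<open>P * exp (- V / 2)\<close> has the Gaussian
  value as its mean, and it is close to the exponential as soon as \<open>W\<close> is close to
  \<open>V\<close>. The threshold \<open>\<delta>\<close> depends on \<open>e\<close> and
  \<open>C\<close> but not on the weights, which allows an array of weights later.\<close>

theorem mcleish_clt:
  assumes e: "0 < e"
  shows "\<exists>\<delta>>0. \<forall>S c. finite S \<longrightarrow> (\<forall>s\<in>S. \<bar>c s\<bar> \<le> \<delta>) \<longrightarrow> (\<Sum>s\<in>S. (c s)\<^sup>2) \<le> C \<longrightarrow>
    cmod ((CLINT \<omega>|M. iexp (\<Sum>s\<in>S. c s * \<eta> s \<omega>)) - exp (- (\<Sum>s\<in>S. (c s)\<^sup>2 * expectation (\<lambda>\<omega>. (\<eta> s \<omega>)\<^sup>2)) / 2)) \<le> e"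
proof -
  \<comment> \<open>A bound for the product \<open>P\<close>, since its modulus is at most
    \<open>exp (W \<omega> / 2)\<close>. With the next choice the error left at
    \<open>\<delta> = 0\<close> is e/8.\<close>
  define B where "B = exp (K^4 * \<bar>C\<bar> / 2)"
  define \<epsilon> where "\<epsilon> = e / (2 * B)"
  have B: "0 < B" by (simp add: B_def)
  have \<epsilon>: "0 < \<epsilon>" using e B by (simp add: \<epsilon>_def)
  define G where "G = 2 * K^6 * \<bar>C\<bar>"
  define D where "D = (2 * real m + 1) * K^8 * \<bar>C\<bar>"
  have G: "0 \<le> G" and D: "0 \<le> D" by (auto simp: G_def D_def)
  have "(\<lambda>\<delta>. \<delta> * G + B * ((\<epsilon> + \<delta>\<^sup>2 * D / \<epsilon>) / 4)) \<midarrow>0\<rightarrow> 0 * G + B * ((\<epsilon> + 0\<^sup>2 * D / \<epsilon>) / 4)"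
    using \<epsilon> by (intro tendsto_intros) auto
  moreover have "0 * G + B * ((\<epsilon> + 0\<^sup>2 * D / \<epsilon>) / 4) < e" using B e by (simp add: \<epsilon>_def)
  ultimately have "\<forall>\<^sub>F \<delta> in at 0. \<delta> * G + B * ((\<epsilon> + \<delta>\<^sup>2 * D / \<epsilon>) / 4) < e" by (rule order_tendstoD)
  then obtain \<delta>0 where \<delta>0: "0 < \<delta>0" "\<And>\<delta>. \<delta> \<noteq> 0 \<Longrightarrow> \<bar>\<delta>\<bar> < \<delta>0 \<Longrightarrow> \<delta> * G + B * ((\<epsilon> + \<delta>\<^sup>2 * D / \<epsilon>) / 4) < e"
    by (auto simp: eventually_at dist_real_def)
  \<comment> \<open>The second bound keeps every summand in [-1, 1], as the third-order estimate
    requires.\<close>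
  define \<delta> where "\<delta> = min (\<delta>0 / 2) (1 / (K\<^sup>2 + 1))"
  have \<delta>: "0 < \<delta>" "\<bar>\<delta>\<bar> < \<delta>0" "\<delta> * K\<^sup>2 \<le> 1"
  proof -
    have "0 < K\<^sup>2 + 1" by (intro add_nonneg_pos) auto
    then show "0 < \<delta>" "\<bar>\<delta>\<bar> < \<delta>0" using \<delta>0(1) by (auto simp: \<delta>_def)
    have "\<delta> * K\<^sup>2 \<le> 1 / (K\<^sup>2 + 1) * K\<^sup>2" by (intro mult_right_mono) (auto simp: \<delta>_def)
    also have "\<dots> \<le> 1" using \<open>0 < K\<^sup>2 + 1\<close> by (simp add: field_simps)
    finally show "\<delta> * K\<^sup>2 \<le> 1" .
  qed
  have small: "\<delta> * G + B * ((\<epsilon> + \<delta>\<^sup>2 * D / \<epsilon>) / 4) \<le> e" using \<delta>0(2)[of \<delta>] \<delta> by simp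
  show ?thesis
  proof (intro exI[of _ \<delta>] conjI allI impI \<delta>(1))
    fix S :: "int set" and c :: "int \<Rightarrow> real"
    assume S: "finite S" and c: "\<forall>s\<in>S. \<bar>c s\<bar> \<le> \<delta>" and C: "(\<Sum>s\<in>S. (c s)\<^sup>2) \<le> C"
    define x where "x s \<omega> = c s * \<eta> s \<omega>" for s \<omega>
    define V where "V = (\<Sum>s\<in>S. (c s)\<^sup>2 * expectation (\<lambda>\<omega>. (\<eta> s \<omega>)\<^sup>2))"
    define W where "W \<omega> = (\<Sum>s\<in>S. (x s \<omega>)\<^sup>2)" for \<omega>
    define P where "P \<omega> = (\<Prod>s\<in>S. 1 + \<i> * complex_of_real (x s \<omega>))" for \<omega>
    have [measurable]: "x s \<in> borel_measurable M" for s unfolding x_def[abs_def] by measurable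
    have [measurable]: "W \<in> borel_measurable M" "P \<in> borel_measurable M" unfolding W_def[abs_def] P_def[abs_def] by measurable
    have Ca: "C = \<bar>C\<bar>" using C sum_nonneg[of S "\<lambda>s. (c s)\<^sup>2"] by simp
    have xb: "\<bar>x s \<omega>\<bar> \<le> \<bar>c s\<bar> * K\<^sup>2" for s \<omega>
      unfolding x_def abs_mult by (intro mult_left_mono eta_bound) auto
    have x1: "\<bar>x s \<omega>\<bar> \<le> \<delta> * K\<^sup>2" if "s \<in> S" for s \<omega>
      using xb[of s \<omega>] mult_right_mono[OF bspec[OF c that], of "K\<^sup>2"] by simp
    have x2: "(x s \<omega>)\<^sup>2 \<le> (c s)\<^sup>2 * K^4" for s \<omega>
    proof -
      have "\<bar>x s \<omega>\<bar>\<^sup>2 \<le> (\<bar>c s\<bar> * K\<^sup>2)\<^sup>2" by (intro power_mono xb) auto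
      then show ?thesis by (simp add: power_mult_distrib)
    qed
    have W: "0 \<le> W \<omega>" "W \<omega> \<le> K^4 * \<bar>C\<bar>" for \<omega>
    proof -
      show "0 \<le> W \<omega>" unfolding W_def by (intro sum_nonneg) auto
      have "W \<omega> \<le> (\<Sum>s\<in>S. (c s)\<^sup>2 * K^4)" unfolding W_def by (intro sum_mono x2)
      also have "\<dots> = K^4 * (\<Sum>s\<in>S. (c s)\<^sup>2)" by (simp add: sum_distrib_left mult.commute)
      also have "\<dots> \<le> K^4 * \<bar>C\<bar>" using C Ca by (intro mult_left_mono) auto
      finally show "W \<omega> \<le> K^4 * \<bar>C\<bar>" .
    qed
    have V0: "0 \<le> V" unfolding V_def by (intro sum_nonneg) auto
    have Pb: "cmod (P \<omega>) \<le> B" for \<omega>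
    proof -
      have "cmod (P \<omega>) = (\<Prod>s\<in>S. cmod (1 + \<i> * complex_of_real (x s \<omega>)))" by (simp add: P_def prod_norm)
      also have "\<dots> \<le> (\<Prod>s\<in>S. exp ((x s \<omega>)\<^sup>2 / 2))" by (intro prod_mono conjI norm_ge_zero norm_one_plus_ix)
      also have "\<dots> = exp (W \<omega> / 2)" using S by (simp add: exp_sum[symmetric] W_def sum_divide_distrib)
      also have "\<dots> \<le> B" using W[of \<omega>] by (simp add: B_def)
      finally show ?thesis .
    qed
    have Pi: "integrable M P" using Pb by (intro integrable_const_bound[of _ B]) auto
    have EP: "(CLINT \<omega>|M. P \<omega>) = 1" unfolding P_def x_def by (rule mcleish_product[OF S])
    have Ui: "integrable M (\<lambda>\<omega>. iexp (\<Sum>s\<in>S. x s \<omega>))" by (intro integrable_const_bound[of _ 1]) auto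
    have pw: "cmod (iexp (\<Sum>s\<in>S. x s \<omega>) - P \<omega> * exp (- V / 2)) \<le> \<delta> * G + B * (\<bar>W \<omega> - V\<bar> / 2)" for \<omega>
    proof -
      have "cmod (iexp (\<Sum>s\<in>S. x s \<omega>) - P \<omega> * exp (- W \<omega> / 2)) \<le> 2 * (\<Sum>s\<in>S. \<bar>x s \<omega>\<bar>^3)"
        unfolding P_def W_def using x1 \<delta>(3) by (intro iexp_prod_mcleish[OF S]) (meson order_trans)
      also have "(\<Sum>s\<in>S. \<bar>x s \<omega>\<bar>^3) \<le> (\<Sum>s\<in>S. (\<delta> * K\<^sup>2) * (x s \<omega>)\<^sup>2)"
      proof (intro sum_mono)
        fix s assume "s \<in> S"
        have "\<bar>x s \<omega>\<bar> * (x s \<omega>)\<^sup>2 \<le> (\<delta> * K\<^sup>2) * (x s \<omega>)\<^sup>2" by (intro mult_right_mono x1 \<open>s \<in> S\<close>) auto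
        moreover have "\<bar>x s \<omega>\<bar>^3 = \<bar>x s \<omega>\<bar> * (x s \<omega>)\<^sup>2" by (simp add: power3_eq_cube power2_eq_square)
        ultimately show "\<bar>x s \<omega>\<bar>^3 \<le> (\<delta> * K\<^sup>2) * (x s \<omega>)\<^sup>2" by simp
      qed
      also have "(\<Sum>s\<in>S. (\<delta> * K\<^sup>2) * (x s \<omega>)\<^sup>2) = (\<delta> * K\<^sup>2) * W \<omega>" by (simp add: W_def sum_distrib_left)
      also have "(\<delta> * K\<^sup>2) * W \<omega> \<le> (\<delta> * K\<^sup>2) * (K^4 * \<bar>C\<bar>)" using W[of \<omega>] \<delta>(1) by (intro mult_left_mono) auto
      also have "2 * ((\<delta> * K\<^sup>2) * (K^4 * \<bar>C\<bar>)) = \<delta> * G" by (simp add: G_def power_add[symmetric])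
      finally have 1: "cmod (iexp (\<Sum>s\<in>S. x s \<omega>) - P \<omega> * exp (- W \<omega> / 2)) \<le> \<delta> * G" by simp
      have "cmod (P \<omega> * exp (- W \<omega> / 2) - P \<omega> * exp (- V / 2)) = cmod (P \<omega>) * \<bar>exp (- W \<omega> / 2) - exp (- V / 2)\<bar>"
        by (simp only: right_diff_distrib[symmetric] norm_mult of_real_diff[symmetric] norm_of_real)
      also have "\<dots> \<le> B * (\<bar>W \<omega> - V\<bar> / 2)" using B by (intro mult_mono Pb exp_minus_diff_le W V0) auto
      finally have 2: "cmod (P \<omega> * exp (- W \<omega> / 2) - P \<omega> * exp (- V / 2)) \<le> B * (\<bar>W \<omega> - V\<bar> / 2)" .
      show ?thesis
        using norm_triangle_ineq[of "iexp (\<Sum>s\<in>S. x s \<omega>) - P \<omega> * exp (- W \<omega> / 2)" "P \<omega> * exp (- W \<omega> / 2) - P \<omega> * exp (- V / 2)"] 1 2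
        by simp
    qed
    \<comment> \<open>Young's inequality replaces the absolute deviation by its square, whose mean
      is the variance just estimated.\<close>
    have pw2: "cmod (iexp (\<Sum>s\<in>S. x s \<omega>) - P \<omega> * exp (- V / 2)) \<le> \<delta> * G + B * ((\<epsilon> + (W \<omega> - V)\<^sup>2 / \<epsilon>) / 4)" for \<omega>
    proof -
      have "2 * \<bar>W \<omega> - V\<bar> * \<epsilon> \<le> (W \<omega> - V)\<^sup>2 + \<epsilon>\<^sup>2" using sum_squares_bound[of "\<bar>W \<omega> - V\<bar>" \<epsilon>] by simp
      then have "\<bar>W \<omega> - V\<bar> / 2 \<le> (\<epsilon> + (W \<omega> - V)\<^sup>2 / \<epsilon>) / 4" using \<epsilon> by (simp add: field_simps power2_eq_square)
      then have "B * (\<bar>W \<omega> - V\<bar> / 2) \<le> B * ((\<epsilon> + (W \<omega> - V)\<^sup>2 / \<epsilon>) / 4)" using B by (intro mult_left_mono) auto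
      then show ?thesis using pw[of \<omega>] by linarith
    qed
    have W2i: "integrable M (\<lambda>\<omega>. (W \<omega> - V)\<^sup>2)"
    proof (rule integrable_const_bound[of _ "(K^4 * \<bar>C\<bar> + V)\<^sup>2"])
      have "\<bar>W \<omega> - V\<bar>\<^sup>2 \<le> (K^4 * \<bar>C\<bar> + V)\<^sup>2" for \<omega>
        using W[of \<omega>] V0 by (intro power_mono) auto
      then show "AE \<omega> in M. norm ((W \<omega> - V)\<^sup>2) \<le> (K^4 * \<bar>C\<bar> + V)\<^sup>2" by simp
    qed measurable
    have EW: "expectation (\<lambda>\<omega>. (W \<omega> - V)\<^sup>2) \<le> \<delta>\<^sup>2 * D"
    proof -
      have "expectation (\<lambda>\<omega>. (W \<omega> - V)\<^sup>2) \<le> (2 * real m + 1) * \<delta>\<^sup>2 * K^8 * C"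
        unfolding W_def V_def x_def power_mult_distrib using c C by (intro eta_sq_variance[OF S]) auto
      then show ?thesis using Ca by (simp add: D_def mult_ac)
    qed
    have "(CLINT \<omega>|M. iexp (\<Sum>s\<in>S. x s \<omega>)) - exp (- V / 2) = (CLINT \<omega>|M. iexp (\<Sum>s\<in>S. x s \<omega>) - P \<omega> * exp (- V / 2))"
      using Ui Pi by (simp add: EP)
    then have "cmod ((CLINT \<omega>|M. iexp (\<Sum>s\<in>S. x s \<omega>)) - exp (- V / 2)) \<le> expectation (\<lambda>\<omega>. cmod (iexp (\<Sum>s\<in>S. x s \<omega>) - P \<omega> * exp (- V / 2)))"
      by (simp only: integral_norm_bound)
    also have "\<dots> \<le> expectation (\<lambda>\<omega>. \<delta> * G + B * ((\<epsilon> + (W \<omega> - V)\<^sup>2 / \<epsilon>) / 4))"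
      using Ui Pi W2i by (intro integral_mono pw2 integrable_norm Bochner_Integration.integrable_diff Bochner_Integration.integrable_add
         integrable_mult_right integrable_divide integrable_mult_left) auto
    also have "\<dots> = \<delta> * G + B * ((\<epsilon> + expectation (\<lambda>\<omega>. (W \<omega> - V)\<^sup>2) / \<epsilon>) / 4)"
      using W2i by (simp add: prob_space)
    also have "\<dots> \<le> \<delta> * G + B * ((\<epsilon> + \<delta>\<^sup>2 * D / \<epsilon>) / 4)"
      using B \<epsilon> by (intro add_left_mono mult_left_mono divide_right_mono EW) auto
    also have "\<dots> \<le> e" by (rule small)
    finally show "cmod ((CLINT \<omega>|M. iexp (\<Sum>s\<in>S. c s * \<eta> s \<omega>)) - exp (- (\<Sum>s\<in>S. (c s)\<^sup>2 * expectation (\<lambda>\<omega>. (\<eta> s \<omega>)\<^sup>2)) / 2)) \<le> e"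
      unfolding x_def V_def .
  qed
qed

end

subsection \<open>Square integrable random variables\<close>

context prob_space
begin

definition L2 :: "('a \<Rightarrow> real) \<Rightarrow> bool" where
  "L2 f \<longleftrightarrow> f \<in> borel_measurable M \<and> integrable M (\<lambda>\<omega>. (f \<omega>)\<^sup>2)"

lemma L2_meas: "L2 f \<Longrightarrow> f \<in> borel_measurable M" by (simp add: L2_def)

lemma L2_sq: "L2 f \<Longrightarrow> integrable M (\<lambda>\<omega>. (f \<omega>)\<^sup>2)" by (simp add: L2_def)

lemma L2_mult: assumes "L2 f" "L2 g" shows "integrable M (\<lambda>\<omega>. f \<omega> * g \<omega>)"
proof (rule Bochner_Integration.integrable_bound[OF Bochner_Integration.integrable_add[OF L2_sq[OF assms(1)] L2_sq[OF assms(2)]]])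
  show "(\<lambda>\<omega>. f \<omega> * g \<omega>) \<in> borel_measurable M" using assms by (auto simp: L2_def)
  show "AE \<omega> in M. norm (f \<omega> * g \<omega>) \<le> norm ((f \<omega>)\<^sup>2 + (g \<omega>)\<^sup>2)"
  proof (rule AE_I2)
    fix \<omega>
    have "2 * \<bar>f \<omega>\<bar> * \<bar>g \<omega>\<bar> \<le> \<bar>f \<omega>\<bar>\<^sup>2 + \<bar>g \<omega>\<bar>\<^sup>2" by (rule sum_squares_bound)
    moreover have "0 \<le> \<bar>f \<omega>\<bar> * \<bar>g \<omega>\<bar>" by simp
    ultimately have "\<bar>f \<omega>\<bar> * \<bar>g \<omega>\<bar> \<le> \<bar>f \<omega>\<bar>\<^sup>2 + \<bar>g \<omega>\<bar>\<^sup>2" by linarith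
    then show "norm (f \<omega> * g \<omega>) \<le> norm ((f \<omega>)\<^sup>2 + (g \<omega>)\<^sup>2)" by (simp add: abs_mult)
  qed
qed

lemma L2_const: "L2 (\<lambda>_. c)" by (simp add: L2_def)

lemma L2_integrable: "L2 f \<Longrightarrow> integrable M f"
  using L2_mult[OF _ L2_const[of 1]] by simp

lemma L2_cmult: "L2 f \<Longrightarrow> L2 (\<lambda>\<omega>. c * f \<omega>)"
  by (auto simp: L2_def power_mult_distrib)

lemma L2_add: assumes "L2 f" "L2 g" shows "L2 (\<lambda>\<omega>. f \<omega> + g \<omega>)"
proof -
  have "integrable M (\<lambda>\<omega>. (f \<omega>)\<^sup>2 + (g \<omega>)\<^sup>2 + 2 * (f \<omega> * g \<omega>))"
    using L2_sq[OF assms(1)] L2_sq[OF assms(2)] L2_mult[OF assms] by simp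
  then show ?thesis using assms by (auto simp: L2_def power2_sum mult.assoc)
qed

lemma L2_diff: "L2 f \<Longrightarrow> L2 g \<Longrightarrow> L2 (\<lambda>\<omega>. f \<omega> - g \<omega>)"
  using L2_add[of f "\<lambda>\<omega>. (-1) * g \<omega>"] L2_cmult[of g "-1"] by simp

lemma L2_sum: "(\<And>i. i \<in> I \<Longrightarrow> L2 (f i)) \<Longrightarrow> L2 (\<lambda>\<omega>. \<Sum>i\<in>I. f i \<omega>)"
  by (induction I rule: infinite_finite_induct) (auto intro: L2_const L2_add)

lemma L2_bound: "f \<in> borel_measurable M \<Longrightarrow> (\<And>\<omega>. \<bar>f \<omega>\<bar> \<le> \<bar>g \<omega>\<bar>) \<Longrightarrow> L2 g \<Longrightarrow> L2 f"
  unfolding L2_def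
  by (auto intro!: Bochner_Integration.integrable_bound[of M "\<lambda>\<omega>. (g \<omega>)\<^sup>2" "\<lambda>\<omega>. (f \<omega>)\<^sup>2"] simp: abs_le_square_iff)

lemma L2_cauchy_schwarz: assumes "L2 f" "L2 g"
  shows "\<bar>expectation (\<lambda>\<omega>. f \<omega> * g \<omega>)\<bar> \<le> sqrt (expectation (\<lambda>\<omega>. (f \<omega>)\<^sup>2)) * sqrt (expectation (\<lambda>\<omega>. (g \<omega>)\<^sup>2))"
proof -
  define A B C where "A = expectation (\<lambda>\<omega>. (f \<omega>)\<^sup>2)" and "B = expectation (\<lambda>\<omega>. f \<omega> * g \<omega>)" and "C = expectation (\<lambda>\<omega>. (g \<omega>)\<^sup>2)"
  note i = L2_sq[OF assms(1)] L2_sq[OF assms(2)] L2_mult[OF assms]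
  have A: "0 \<le> A" and C: "0 \<le> C" by (simp_all add: A_def C_def)
  have q: "0 \<le> A - 2 * t * B + t\<^sup>2 * C" for t
  proof -
    have "0 \<le> expectation (\<lambda>\<omega>. (f \<omega> - t * g \<omega>)\<^sup>2)" by simp
    also have "(\<lambda>\<omega>. (f \<omega> - t * g \<omega>)\<^sup>2) = (\<lambda>\<omega>. (f \<omega>)\<^sup>2 - 2 * t * (f \<omega> * g \<omega>) + t\<^sup>2 * (g \<omega>)\<^sup>2)"
      by (simp add: fun_eq_iff power2_eq_square algebra_simps)
    also have "expectation \<dots> = A - 2 * t * B + t\<^sup>2 * C" unfolding A_def B_def C_def using i by simp
    finally show ?thesis .
  qed
  have "B\<^sup>2 \<le> A * C"
  proof (cases "C = 0")
    case True
    have "B = 0"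
    proof (rule ccontr)
      assume "B \<noteq> 0"
      \<comment> \<open>At this point the affine function takes the value -1.\<close>
      with q[of "(A + 1) / (2 * B)"] True show False by simp
    qed
    then show ?thesis using True by simp
  next
    case False
    have "0 \<le> A - 2 * (B / C) * B + (B / C)\<^sup>2 * C" by (rule q)
    also have "\<dots> = A - B\<^sup>2 / C" using False by (simp add: power2_eq_square field_simps)
    finally show ?thesis using False C by (simp add: field_simps)
  qed
  then have "sqrt (B\<^sup>2) \<le> sqrt (A * C)" by (rule real_sqrt_le_mono)
  then show ?thesis by (simp add: A_def B_def C_def real_sqrt_mult)
qed

lemma L2_expectation_abs: assumes "L2 f" shows "expectation (\<lambda>\<omega>. \<bar>f \<omega>\<bar>) \<le> sqrt (expectation (\<lambda>\<omega>. (f \<omega>)\<^sup>2))"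
proof -
  have "L2 (\<lambda>\<omega>. \<bar>f \<omega>\<bar>)" using assms by (auto simp: L2_def)
  from L2_cauchy_schwarz[OF this L2_const[of 1]] show ?thesis by (simp add: prob_space)
qed

lemma L2_triangle3:
  assumes "L2 f" "L2 g" "L2 h"
  shows "expectation (\<lambda>\<omega>. (f \<omega> + g \<omega> + h \<omega>)\<^sup>2) \<le>
    3 * (expectation (\<lambda>\<omega>. (f \<omega>)\<^sup>2) + expectation (\<lambda>\<omega>. (g \<omega>)\<^sup>2) + expectation (\<lambda>\<omega>. (h \<omega>)\<^sup>2))"
proof -
  have "expectation (\<lambda>\<omega>. (f \<omega> + g \<omega> + h \<omega>)\<^sup>2) \<le> expectation (\<lambda>\<omega>. 3 * ((f \<omega>)\<^sup>2 + (g \<omega>)\<^sup>2 + (h \<omega>)\<^sup>2))"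
  proof (rule integral_mono)
    show "integrable M (\<lambda>\<omega>. (f \<omega> + g \<omega> + h \<omega>)\<^sup>2)" by (intro L2_sq L2_add assms)
    show "integrable M (\<lambda>\<omega>. 3 * ((f \<omega>)\<^sup>2 + (g \<omega>)\<^sup>2 + (h \<omega>)\<^sup>2))" using assms L2_sq by simp
    fix \<omega>
    have "3 * ((f \<omega>)\<^sup>2 + (g \<omega>)\<^sup>2 + (h \<omega>)\<^sup>2) - (f \<omega> + g \<omega> + h \<omega>)\<^sup>2 = (f \<omega> - g \<omega>)\<^sup>2 + (f \<omega> - h \<omega>)\<^sup>2 + (g \<omega> - h \<omega>)\<^sup>2"
      by (simp add: power2_eq_square algebra_simps)
    then show "(f \<omega> + g \<omega> + h \<omega>)\<^sup>2 \<le> 3 * ((f \<omega>)\<^sup>2 + (g \<omega>)\<^sup>2 + (h \<omega>)\<^sup>2)"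
      using zero_le_power2[of "f \<omega> - g \<omega>"] zero_le_power2[of "f \<omega> - h \<omega>"] zero_le_power2[of "g \<omega> - h \<omega>"] by linarith
  qed
  then show ?thesis using assms L2_sq by simp
qed

lemma L2_triangle2:
  assumes "L2 f" "L2 g"
  shows "expectation (\<lambda>\<omega>. (f \<omega> + g \<omega>)\<^sup>2) \<le> 2 * (expectation (\<lambda>\<omega>. (f \<omega>)\<^sup>2) + expectation (\<lambda>\<omega>. (g \<omega>)\<^sup>2))"
proof -
  have "expectation (\<lambda>\<omega>. (f \<omega> + g \<omega>)\<^sup>2) \<le> expectation (\<lambda>\<omega>. 2 * ((f \<omega>)\<^sup>2 + (g \<omega>)\<^sup>2))"
  proof (rule integral_mono)
    show "integrable M (\<lambda>\<omega>. (f \<omega> + g \<omega>)\<^sup>2)" by (intro L2_sq L2_add assms)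
    show "integrable M (\<lambda>\<omega>. 2 * ((f \<omega>)\<^sup>2 + (g \<omega>)\<^sup>2))" using assms L2_sq by simp
    fix \<omega>
    have "2 * ((f \<omega>)\<^sup>2 + (g \<omega>)\<^sup>2) - (f \<omega> + g \<omega>)\<^sup>2 = (f \<omega> - g \<omega>)\<^sup>2"
      by (simp add: power2_eq_square algebra_simps)
    then show "(f \<omega> + g \<omega>)\<^sup>2 \<le> 2 * ((f \<omega>)\<^sup>2 + (g \<omega>)\<^sup>2)"
      using zero_le_power2[of "f \<omega> - g \<omega>"] by linarith
  qed
  then show ?thesis using assms L2_sq by simp
qed

text \<open>Continuity of the inner product in mean square. It transports second-order identities
  from partial series to \<open>X\<close>.\<close>

lemma L2_tendsto_mult:
  assumes L: "\<And>n. L2 (f n)" "\<And>n. L2 (g n)" "L2 f'" "L2 g'"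
    and f: "(\<lambda>n. expectation (\<lambda>\<omega>. (f n \<omega> - f' \<omega>)\<^sup>2)) \<longlonglongrightarrow> 0"
    and g: "(\<lambda>n. expectation (\<lambda>\<omega>. (g n \<omega> - g' \<omega>)\<^sup>2)) \<longlonglongrightarrow> 0"
  shows "(\<lambda>n. expectation (\<lambda>\<omega>. f n \<omega> * g n \<omega>)) \<longlonglongrightarrow> expectation (\<lambda>\<omega>. f' \<omega> * g' \<omega>)"
proof -
  let ?F = "\<lambda>n. sqrt (expectation (\<lambda>\<omega>. (f n \<omega> - f' \<omega>)\<^sup>2))"
  let ?G = "\<lambda>n. sqrt (expectation (\<lambda>\<omega>. (g n \<omega> - g' \<omega>)\<^sup>2))"
  let ?f = "sqrt (expectation (\<lambda>\<omega>. (f' \<omega>)\<^sup>2))" and ?g = "sqrt (expectation (\<lambda>\<omega>. (g' \<omega>)\<^sup>2))"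
  have "(\<lambda>n. expectation (\<lambda>\<omega>. f n \<omega> * g n \<omega>) - expectation (\<lambda>\<omega>. f' \<omega> * g' \<omega>)) \<longlonglongrightarrow> 0"
  proof (rule Lim_null_comparison)
    have "norm (expectation (\<lambda>\<omega>. f n \<omega> * g n \<omega>) - expectation (\<lambda>\<omega>. f' \<omega> * g' \<omega>)) \<le> ?F n * ?G n + ?F n * ?g + ?f * ?G n" for n
    proof -
      note df = L2_diff[OF L(1)[of n] L(3)] and dg = L2_diff[OF L(2)[of n] L(4)]
      have e: "f n \<omega> * g n \<omega> - f' \<omega> * g' \<omega> = (f n \<omega> - f' \<omega>) * (g n \<omega> - g' \<omega>) + (f n \<omega> - f' \<omega>) * g' \<omega> + f' \<omega> * (g n \<omega> - g' \<omega>)" for \<omega>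
        by (simp add: algebra_simps)
      have "expectation (\<lambda>\<omega>. f n \<omega> * g n \<omega>) - expectation (\<lambda>\<omega>. f' \<omega> * g' \<omega>) = expectation (\<lambda>\<omega>. f n \<omega> * g n \<omega> - f' \<omega> * g' \<omega>)"
        by (rule Bochner_Integration.integral_diff[symmetric]) (intro L2_mult L)+
      also have "\<dots> = expectation (\<lambda>\<omega>. (f n \<omega> - f' \<omega>) * (g n \<omega> - g' \<omega>)) + expectation (\<lambda>\<omega>. (f n \<omega> - f' \<omega>) * g' \<omega>) + expectation (\<lambda>\<omega>. f' \<omega> * (g n \<omega> - g' \<omega>))"
        unfolding e using L2_mult[OF df dg] L2_mult[OF df L(4)] L2_mult[OF L(3) dg] by (simp only: Bochner_Integration.integral_add Bochner_Integration.integrable_add)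
      finally show ?thesis
        using L2_cauchy_schwarz[OF df dg] L2_cauchy_schwarz[OF df L(4)] L2_cauchy_schwarz[OF L(3) dg] by (simp only: real_norm_def)
    qed
    then show "\<forall>\<^sub>F n in sequentially. norm (expectation (\<lambda>\<omega>. f n \<omega> * g n \<omega>) - expectation (\<lambda>\<omega>. f' \<omega> * g' \<omega>)) \<le> ?F n * ?G n + ?F n * ?g + ?f * ?G n" by simp
    have "(\<lambda>n. ?F n * ?G n + ?F n * ?g + ?f * ?G n) \<longlonglongrightarrow> sqrt 0 * sqrt 0 + sqrt 0 * ?g + ?f * sqrt 0"
      by (intro tendsto_intros f g)
    then show "(\<lambda>n. ?F n * ?G n + ?F n * ?g + ?f * ?G n) \<longlonglongrightarrow> 0" by simp
  qed
  then show ?thesis by (simp add: LIM_zero_iff)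
qed

lemma L2_orthogonal_sum:
  assumes S: "finite S" and f: "\<And>s. s \<in> S \<Longrightarrow> L2 (f s)"
    and o: "\<And>s t. s \<in> S \<Longrightarrow> t \<in> S \<Longrightarrow> s \<noteq> t \<Longrightarrow> expectation (\<lambda>\<omega>. f s \<omega> * f t \<omega>) = 0"
  shows "expectation (\<lambda>\<omega>. (\<Sum>s\<in>S. c s * f s \<omega>)\<^sup>2) = (\<Sum>s\<in>S. (c s)\<^sup>2 * expectation (\<lambda>\<omega>. (f s \<omega>)\<^sup>2))"
proof -
  have "expectation (\<lambda>\<omega>. (\<Sum>s\<in>S. c s * f s \<omega>)\<^sup>2) = expectation (\<lambda>\<omega>. \<Sum>s\<in>S. \<Sum>t\<in>S. c s * c t * (f s \<omega> * f t \<omega>))"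
    unfolding power2_eq_square sum_product by (simp only: mult_ac)
  also have "\<dots> = (\<Sum>s\<in>S. \<Sum>t\<in>S. c s * c t * expectation (\<lambda>\<omega>. f s \<omega> * f t \<omega>))"
    using f L2_mult by (subst Bochner_Integration.integral_sum) (auto intro!: sum.cong Bochner_Integration.integral_sum[THEN trans])
  also have "\<dots> = (\<Sum>s\<in>S. \<Sum>t\<in>S. if t = s then (c s)\<^sup>2 * expectation (\<lambda>\<omega>. (f s \<omega>)\<^sup>2) else 0)"
    by (intro sum.cong refl) (auto simp: o power2_eq_square)
  also have "\<dots> = (\<Sum>s\<in>S. (c s)\<^sup>2 * expectation (\<lambda>\<omega>. (f s \<omega>)\<^sup>2))" using S by simp
  finally show ?thesis .
qed

lemma cf_diff_le:
  assumes "L2 f" "L2 g"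
  shows "cmod ((CLINT \<omega>|M. iexp (f \<omega>)) - (CLINT \<omega>|M. iexp (g \<omega>))) \<le> sqrt (expectation (\<lambda>\<omega>. (f \<omega> - g \<omega>)\<^sup>2))"
proof -
  note [measurable] = L2_meas[OF assms(1)] L2_meas[OF assms(2)]
  have i: "integrable M (\<lambda>\<omega>. iexp (h \<omega>))" if [measurable]: "h \<in> borel_measurable M" for h
    by (intro integrable_const_bound[of _ 1]) auto
  have ii: "integrable M (\<lambda>\<omega>. iexp (f \<omega>))" "integrable M (\<lambda>\<omega>. iexp (g \<omega>))" by (rule i, measurable)+
  have le: "cmod (iexp u - iexp v) \<le> \<bar>u - v\<bar>" for u v :: real
  proof -
    have "iexp u - iexp v = iexp v * (iexp (u - v) - 1)" by (simp add: algebra_simps exp_add[symmetric])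
    moreover have "cmod (iexp (u - v) - 1) \<le> \<bar>u - v\<bar>" using iexp_approx1[of "u - v" 0] by simp
    ultimately show ?thesis by (simp add: norm_mult)
  qed
  have "cmod ((CLINT \<omega>|M. iexp (f \<omega>)) - (CLINT \<omega>|M. iexp (g \<omega>))) = cmod (CLINT \<omega>|M. iexp (f \<omega>) - iexp (g \<omega>))"
    using ii by simp
  also have "\<dots> \<le> expectation (\<lambda>\<omega>. cmod (iexp (f \<omega>) - iexp (g \<omega>)))" by (rule integral_norm_bound)
  also have "\<dots> \<le> expectation (\<lambda>\<omega>. \<bar>f \<omega> - g \<omega>\<bar>)"
    by (intro integral_mono le integrable_norm Bochner_Integration.integrable_diff ii integrable_abs[OF L2_integrable[OF L2_diff[OF assms]]])
  also have "\<dots> \<le> sqrt (expectation (\<lambda>\<omega>. (f \<omega> - g \<omega>)\<^sup>2))" by (rule L2_expectation_abs[OF L2_diff[OF assms]])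
  finally show ?thesis .
qed

lemma L2_truncation:
  assumes f: "L2 f"
  shows "(\<lambda>K. expectation (\<lambda>\<omega>. (f \<omega> - max (- real K) (min (real K) (f \<omega>)))\<^sup>2)) \<longlonglongrightarrow> 0"
proof -
  note [measurable] = L2_meas[OF f]
  have "(\<lambda>K. expectation (\<lambda>\<omega>. (f \<omega> - max (- real K) (min (real K) (f \<omega>)))\<^sup>2)) \<longlonglongrightarrow> expectation (\<lambda>\<omega>. 0)"
  proof (rule integral_dominated_convergence[where w = "\<lambda>\<omega>. (f \<omega>)\<^sup>2"])
    show "integrable M (\<lambda>\<omega>. (f \<omega>)\<^sup>2)" by (rule L2_sq[OF f])
    show "AE \<omega> in M. (\<lambda>K. (f \<omega> - max (- real K) (min (real K) (f \<omega>)))\<^sup>2) \<longlonglongrightarrow> 0"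
    proof (rule AE_I2)
      fix \<omega>
      obtain K0 :: nat where "\<bar>f \<omega>\<bar> \<le> real K0" using real_arch_simple by blast
      then have "\<forall>\<^sub>F K in sequentially. (f \<omega> - max (- real K) (min (real K) (f \<omega>)))\<^sup>2 = 0"
        by (intro eventually_mono[OF eventually_ge_at_top[of K0]]) (auto simp: max_def min_def)
      then show "(\<lambda>K. (f \<omega> - max (- real K) (min (real K) (f \<omega>)))\<^sup>2) \<longlonglongrightarrow> 0" by (rule tendsto_eventually)
    qed
    show "AE \<omega> in M. norm ((f \<omega> - max (- real K) (min (real K) (f \<omega>)))\<^sup>2) \<le> (f \<omega>)\<^sup>2" for K
      by (intro AE_I2) (auto simp: abs_le_square_iff[symmetric] max_def min_def)
  qed measurable
  then show ?thesis by simp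
qed

end

subsection \<open>The stationary solution\<close>

text \<open>\<open>X_stat\<close> concerns the marginal laws and makes the variance of the
  innovations the same at all times; covariances at different times follow from the series.\<close>

locale larch_solution = noise M \<zeta> for M :: "'a measure" and \<zeta> :: "int \<Rightarrow> 'a \<Rightarrow> real" +
  fixes X :: "int \<Rightarrow> 'a \<Rightarrow> real" and a \<beta> d LipQ :: real and b :: "nat \<Rightarrow> real" and Q :: "real \<Rightarrow> real"
  assumes zeta_ident: "\<And>t. distr M borel (\<zeta> t) = distr M borel (\<zeta> 0)"
    and zeta_int: "integrable M (\<zeta> 0)" "integrable M (\<lambda>\<omega>. (\<zeta> 0 \<omega>)\<^sup>2)"
    and zeta_mean: "expectation (\<zeta> 0) = 0"
    and zeta_var: "expectation (\<lambda>\<omega>. (\<zeta> 0 \<omega>)\<^sup>2) = 1"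
    and d: "0 < d" "d < 1/2" and beta: "\<beta> > 0"
    and b_asymp: "(\<lambda>j. b j) \<sim>[at_top] (\<lambda>j. \<beta> * real j powr (d - 1))"
    and Q_lip: "\<And>x y. \<bar>Q x - Q y\<bar> \<le> LipQ * \<bar>x - y\<bar>"
    and contr: "LipQ\<^sup>2 * (\<Sum>j. (b (Suc j))\<^sup>2) < 1"
    and X_pred: "\<And>t. X t \<in> borel_measurable (nat_filtration M \<zeta> (t - 1))"
    and X_L2: "\<And>t. integrable M (\<lambda>\<omega>. (X t \<omega>)\<^sup>2)"
    and X_eq: "\<And>t. (\<lambda>N. expectation (\<lambda>\<omega>.
           (X t \<omega> - (\<Sum>j\<in>{1..N}. b j * \<zeta> (t - int j) \<omega> * Q (a + X (t - int j) \<omega>)))\<^sup>2)) \<longlonglongrightarrow> 0"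
    and X_stat: "\<And>t. distr M borel (X t) = distr M borel (X 0)"
begin

lemma zeta_comp:
  assumes [measurable]: "g \<in> borel_measurable borel"
  shows "integrable M (\<lambda>\<omega>. g (\<zeta> t \<omega>) :: real) = integrable M (\<lambda>\<omega>. g (\<zeta> 0 \<omega>))"
    "expectation (\<lambda>\<omega>. g (\<zeta> t \<omega>)) = expectation (\<lambda>\<omega>. g (\<zeta> 0 \<omega>))"
proof -
  note [measurable] = zeta_rv
  show "integrable M (\<lambda>\<omega>. g (\<zeta> t \<omega>)) = integrable M (\<lambda>\<omega>. g (\<zeta> 0 \<omega>))"
    using integrable_distr_eq[of "\<zeta> t" M borel g] integrable_distr_eq[of "\<zeta> 0" M borel g] zeta_ident[of t] by simp
  show "expectation (\<lambda>\<omega>. g (\<zeta> t \<omega>)) = expectation (\<lambda>\<omega>. g (\<zeta> 0 \<omega>))"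
    using integral_distr[of "\<zeta> t" M borel g] integral_distr[of "\<zeta> 0" M borel g] zeta_ident[of t] by simp
qed

lemma X_F: "X t \<in> borel_measurable (\<F> {..<t})"
proof -
  have "{..t - 1} = {..<t}" by auto
  then show ?thesis using X_pred[of t] by (simp add: nat_filtration_eq)
qed

lemma X_M: "X t \<in> borel_measurable M" by (rule measurable_F_M[OF X_F])

lemma X_comp:
  assumes [measurable]: "g \<in> borel_measurable borel"
  shows "expectation (\<lambda>\<omega>. g (X t \<omega>) :: real) = expectation (\<lambda>\<omega>. g (X 0 \<omega>))"
proof -
  note [measurable] = X_M
  show ?thesis
    using integral_distr[of "X t" M borel g] integral_distr[of "X 0" M borel g] X_stat[of t] by simp
qed

lemma L2_zeta: "L2 (\<zeta> t)"
  using zeta_comp(1)[of "\<lambda>x. x\<^sup>2" t] zeta_int zeta_rv by (simp add: L2_def)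

lemma zeta_moments: "expectation (\<zeta> t) = 0" "expectation (\<lambda>\<omega>. (\<zeta> t \<omega>)\<^sup>2) = 1"
  using zeta_comp(2)[of "\<lambda>x. x\<^sup>2" t] zeta_comp(2)[of "\<lambda>x. x" t] zeta_mean zeta_var by simp_all

lemma L2_X: "L2 (X t)" using X_M X_L2 by (simp add: L2_def)

lemma Q_measurable[measurable]: "Q \<in> borel_measurable borel"
proof (rule borel_measurable_continuous_onI)
  have "(\<bar>LipQ\<bar>)-lipschitz_on UNIV Q"
  proof (rule lipschitz_onI)
    fix x y
    have "LipQ * \<bar>x - y\<bar> \<le> \<bar>LipQ\<bar> * \<bar>x - y\<bar>" by (intro mult_right_mono) auto
    then show "dist (Q x) (Q y) \<le> \<bar>LipQ\<bar> * dist x y" using Q_lip[of x y] by (simp add: dist_real_def)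
  qed simp
  then show "continuous_on UNIV Q" by (rule lipschitz_on_continuous_on)
qed

lemma Q_sq_lip: "(Q x - Q y)\<^sup>2 \<le> LipQ\<^sup>2 * (x - y)\<^sup>2"
proof -
  have "\<bar>Q x - Q y\<bar>\<^sup>2 \<le> (LipQ * \<bar>x - y\<bar>)\<^sup>2" by (intro power_mono Q_lip) simp
  then show ?thesis by (simp add: power_mult_distrib)
qed

lemma L2_Q: assumes "L2 f" shows "L2 (\<lambda>\<omega>. Q (a + f \<omega>))"
proof -
  note [measurable] = L2_meas[OF assms]
  have "L2 (\<lambda>\<omega>. Q (a + f \<omega>) - Q a)"
  proof (rule L2_bound[OF _ _ L2_cmult[OF assms, of LipQ]])
    fix \<omega>
    show "\<bar>Q (a + f \<omega>) - Q a\<bar> \<le> \<bar>LipQ * f \<omega>\<bar>"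
      using Q_lip[of "a + f \<omega>" a] abs_ge_self[of LipQ] mult_right_mono[of LipQ "\<bar>LipQ\<bar>" "\<bar>f \<omega>\<bar>"] by (simp add: abs_mult)
  qed measurable
  from L2_add[OF this L2_const[of "Q a"]] show ?thesis by simp
qed

text \<open>The innovation is independent of its past and has second moment one, so multiplication
  by it is an isometry.\<close>

lemma L2_zeta_times:
  assumes g: "L2 g" "g \<in> borel_measurable (\<F> {..<s})"
  shows "L2 (\<lambda>\<omega>. \<zeta> s \<omega> * g \<omega>)" "expectation (\<lambda>\<omega>. (\<zeta> s \<omega> * g \<omega>)\<^sup>2) = expectation (\<lambda>\<omega>. (g \<omega>)\<^sup>2)"
proof -
  have z: "(\<lambda>\<omega>. (\<zeta> s \<omega>)\<^sup>2) \<in> borel_measurable (\<F> {s})" using zeta_F[of s "{s}"] by simp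
  have g2: "(\<lambda>\<omega>. (g \<omega>)\<^sup>2) \<in> borel_measurable (\<F> {..<s})" using g by simp
  note e = expectation_mult_F[OF _ z g2 L2_sq[OF L2_zeta] L2_sq[OF g(1)]]
  show "L2 (\<lambda>\<omega>. \<zeta> s \<omega> * g \<omega>)" unfolding L2_def using e(1) zeta_rv L2_meas[OF g(1)] by (simp add: power_mult_distrib)
  show "expectation (\<lambda>\<omega>. (\<zeta> s \<omega> * g \<omega>)\<^sup>2) = expectation (\<lambda>\<omega>. (g \<omega>)\<^sup>2)"
    using e(2) zeta_moments by (simp add: power_mult_distrib)
qed

lemma mds_orthogonal:
  assumes g: "L2 g" "g \<in> borel_measurable (\<F> {..<s})" and f: "L2 f" "f \<in> borel_measurable (\<F> {..<s})"
    and z: "L2 z" "z \<in> borel_measurable (\<F> {s})" "expectation z = 0"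
  shows "expectation (\<lambda>\<omega>. f \<omega> * (z \<omega> * g \<omega>)) = 0"
proof -
  have "expectation (\<lambda>\<omega>. (f \<omega> * g \<omega>) * z \<omega>) = expectation (\<lambda>\<omega>. f \<omega> * g \<omega>) * expectation z"
    by (rule expectation_mult_F(2)[of "{..<s}" "{s}"]) (use g f z L2_mult L2_integrable in auto)
  then show ?thesis using z by (simp add: mult_ac)
qed

definition \<xi> :: "int \<Rightarrow> 'a \<Rightarrow> real" where "\<xi> s \<omega> = \<zeta> s \<omega> * Q (a + X s \<omega>)"

definition sig2 :: real where "sig2 = expectation (\<lambda>\<omega>. (Q (a + X 0 \<omega>))\<^sup>2)"

lemma sig2_nonneg: "0 \<le> sig2" by (simp add: sig2_def)

lemma QX_F: "(\<lambda>\<omega>. Q (a + X s \<omega>)) \<in> borel_measurable (\<F> {..<s})"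
  using X_F[of s] by measurable

lemma L2_QX: "L2 (\<lambda>\<omega>. Q (a + X s \<omega>))" by (rule L2_Q[OF L2_X])

lemma QX_sq: "expectation (\<lambda>\<omega>. (Q (a + X s \<omega>))\<^sup>2) = sig2"
  unfolding sig2_def by (rule X_comp) measurable

lemma L2_xi: "L2 (\<xi> s)" and xi_sq: "expectation (\<lambda>\<omega>. (\<xi> s \<omega>)\<^sup>2) = sig2"
  unfolding \<xi>_def[abs_def] using L2_zeta_times[OF L2_QX QX_F] QX_sq by auto

lemma xi_F: "s \<in> J \<Longrightarrow> {..<s} \<subseteq> J \<Longrightarrow> \<xi> s \<in> borel_measurable (\<F> J)"
  unfolding \<xi>_def[abs_def] by (intro borel_measurable_times zeta_F measurable_F_mono[OF _ QX_F]) auto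

lemma xi_orthogonal: assumes "s \<noteq> t" shows "expectation (\<lambda>\<omega>. \<xi> s \<omega> * \<xi> t \<omega>) = 0"
proof -
  have *: "expectation (\<lambda>\<omega>. \<xi> s \<omega> * \<xi> t \<omega>) = 0" if "s < t" for s t
    unfolding \<xi>_def[of t]
    by (rule mds_orthogonal[OF L2_QX QX_F L2_xi xi_F L2_zeta zeta_F zeta_moments(1)]) (use that in auto)
  show ?thesis using *[of s t] *[of t s] assms by (cases "s < t") (auto simp: mult.commute)
qed

lemma xi_mean: "expectation (\<xi> s) = 0"
  using mds_orthogonal[OF L2_QX[of s] QX_F L2_const[of 1] _ L2_zeta[of s] zeta_F zeta_moments(1)] by (simp add: \<xi>_def[abs_def])

definition B2 :: real where "B2 = (\<Sum>j. (b (Suc j))\<^sup>2)"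

lemma b_l2: "summable (\<lambda>j. (b (Suc j))\<^sup>2)" by (rule coeff_l2[OF d beta b_asymp])

lemma b_sq_sum: "(\<Sum>j\<in>{1..N}. (b j)\<^sup>2) = (\<Sum>j<N. (b (Suc j))\<^sup>2)"
  by (rule sum.reindex_bij_witness[of _ Suc "\<lambda>j. j - 1"]) auto

lemma b_sq_le: "(\<Sum>j\<in>{1..N}. (b j)\<^sup>2) \<le> B2"
  unfolding b_sq_sum B2_def by (intro sum_le_suminf b_l2) auto

lemma b_sq_tendsto: "(\<lambda>N. \<Sum>j\<in>{1..N}. (b j)\<^sup>2) \<longlonglongrightarrow> B2"
  unfolding b_sq_sum B2_def by (rule summable_LIMSEQ[OF b_l2])

lemma B2_nonneg: "0 \<le> B2" unfolding B2_def by (intro suminf_nonneg b_l2) auto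

definition series_part :: "nat \<Rightarrow> int \<Rightarrow> 'a \<Rightarrow> real" where
  "series_part N t \<omega> = (\<Sum>j\<in>{1..N}. b j * \<xi> (t - int j) \<omega>)"

lemma L2_series_part: "L2 (series_part N t)" unfolding series_part_def[abs_def] by (intro L2_sum L2_cmult L2_xi)

lemma X_series_part: "(\<lambda>N. expectation (\<lambda>\<omega>. (X t \<omega> - series_part N t \<omega>)\<^sup>2)) \<longlonglongrightarrow> 0"
  using X_eq[of t] by (simp add: series_part_def \<xi>_def mult.assoc)

lemma series_part_X: "(\<lambda>N. expectation (\<lambda>\<omega>. (series_part N t \<omega> - X t \<omega>)\<^sup>2)) \<longlonglongrightarrow> 0"
  using X_series_part[of t] by (simp add: power2_commute)

lemma series_part_mult: "expectation (\<lambda>\<omega>. series_part N s \<omega> * series_part N' (s + int k) \<omega>) = sig2 * (\<Sum>j\<in>{1..N}. if j + k \<le> N' then b j * b (j + k) else 0)"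
proof -
  have i: "integrable M (\<lambda>\<omega>. \<xi> u \<omega> * \<xi> v \<omega>)" for u v by (rule L2_mult[OF L2_xi L2_xi])
  have "expectation (\<lambda>\<omega>. series_part N s \<omega> * series_part N' (s + int k) \<omega>) =
    expectation (\<lambda>\<omega>. \<Sum>j\<in>{1..N}. \<Sum>l\<in>{1..N'}. b j * b l * (\<xi> (s - int j) \<omega> * \<xi> (s + int k - int l) \<omega>))"
    unfolding series_part_def sum_product by (simp only: mult_ac)
  also have "\<dots> = (\<Sum>j\<in>{1..N}. \<Sum>l\<in>{1..N'}. b j * b l * expectation (\<lambda>\<omega>. \<xi> (s - int j) \<omega> * \<xi> (s + int k - int l) \<omega>))"
    by (simp add: i)
  also have "\<dots> = (\<Sum>j\<in>{1..N}. \<Sum>l\<in>{1..N'}. if l = j + k then sig2 * (b j * b (j + k)) else 0)"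
  proof (intro sum.cong refl)
    fix j l assume "l \<in> {1..N'}"
    show "b j * b l * expectation (\<lambda>\<omega>. \<xi> (s - int j) \<omega> * \<xi> (s + int k - int l) \<omega>) = (if l = j + k then sig2 * (b j * b (j + k)) else 0)"
    proof (cases "l = j + k")
      case True
      then have "s + int k - int l = s - int j" by simp
      then show ?thesis using True xi_sq[of "s - int j"] by (simp add: power2_eq_square)
    next
      case False
      then have "s - int j \<noteq> s + int k - int l" by auto
      then show ?thesis using False by (simp add: xi_orthogonal)
    qed
  qed
  also have "\<dots> = (\<Sum>j\<in>{1..N}. if j + k \<le> N' then sig2 * (b j * b (j + k)) else 0)"
    by (intro sum.cong refl) (auto simp: sum.delta)
  also have "\<dots> = sig2 * (\<Sum>j\<in>{1..N}. if j + k \<le> N' then b j * b (j + k) else 0)"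
    by (simp add: sum_distrib_left if_distrib cong: if_cong)
  finally show ?thesis .
qed

lemma X_series_part_mult: "expectation (\<lambda>\<omega>. X t \<omega> * series_part m t \<omega>) = sig2 * (\<Sum>j\<in>{1..m}. (b j)\<^sup>2)"
proof -
  have lim: "(\<lambda>N. expectation (\<lambda>\<omega>. series_part m t \<omega> * series_part N t \<omega>)) \<longlonglongrightarrow> expectation (\<lambda>\<omega>. series_part m t \<omega> * X t \<omega>)"
    by (rule L2_tendsto_mult) (auto intro: L2_series_part L2_X series_part_X)
  have ev: "\<forall>\<^sub>F N in sequentially. expectation (\<lambda>\<omega>. series_part m t \<omega> * series_part N t \<omega>) = sig2 * (\<Sum>j\<in>{1..m}. (b j)\<^sup>2)"
    using eventually_ge_at_top[of m]
  proof eventually_elim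
    case (elim N)
    have "expectation (\<lambda>\<omega>. series_part m t \<omega> * series_part N t \<omega>) = sig2 * (\<Sum>j\<in>{1..m}. if j \<le> N then b j * b j else 0)"
      using series_part_mult[of m t N 0] by (simp only: of_nat_0 add_0_right)
    also have "(\<Sum>j\<in>{1..m}. if j \<le> N then b j * b j else 0) = (\<Sum>j\<in>{1..m}. (b j)\<^sup>2)"
      using elim by (intro sum.cong) (auto simp: power2_eq_square)
    finally show ?case .
  qed
  have "expectation (\<lambda>\<omega>. series_part m t \<omega> * X t \<omega>) = sig2 * (\<Sum>j\<in>{1..m}. (b j)\<^sup>2)"
    by (rule LIMSEQ_unique[OF lim tendsto_eventually[OF ev]])
  then show ?thesis by (simp add: mult.commute)
qed

definition acov :: "nat \<Rightarrow> real" where "acov k = sig2 * (\<Sum>j. b (Suc j) * b (Suc j + k))"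

lemma X_cov: "expectation (\<lambda>\<omega>. X s \<omega> * X (s + int k) \<omega>) = acov k"
proof -
  \<comment> \<open>Cutting the later series at \<open>N + k\<close> retains a partner
    \<open>j + k\<close> for every \<open>j\<close> up to \<open>N\<close>.\<close>
  have "(\<lambda>N. expectation (\<lambda>\<omega>. series_part N s \<omega> * series_part (N + k) (s + int k) \<omega>)) \<longlonglongrightarrow> expectation (\<lambda>\<omega>. X s \<omega> * X (s + int k) \<omega>)"
    by (rule L2_tendsto_mult) (auto intro: L2_series_part L2_X series_part_X LIMSEQ_ignore_initial_segment[OF series_part_X])
  moreover have "expectation (\<lambda>\<omega>. series_part N s \<omega> * series_part (N + k) (s + int k) \<omega>) = sig2 * (\<Sum>j<N. b (Suc j) * b (Suc j + k))" for N
  proof -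
    have "(\<Sum>j\<in>{1..N}. if j + k \<le> N + k then b j * b (j + k) else 0) = (\<Sum>j<N. b (Suc j) * b (Suc j + k))"
      by (rule sum.reindex_bij_witness[of _ Suc "\<lambda>j. j - 1"]) auto
    then show ?thesis unfolding series_part_mult by simp
  qed
  moreover have "(\<lambda>N. sig2 * (\<Sum>j<N. b (Suc j) * b (Suc j + k))) \<longlonglongrightarrow> acov k"
    unfolding acov_def
    by (intro tendsto_intros summable_LIMSEQ summable_rabs_cancel[OF coeff_product_summable[OF d beta b_asymp]])
  ultimately show ?thesis using LIMSEQ_unique by simp
qed

lemma acov_0: "acov 0 = sig2 * B2" by (simp add: acov_def B2_def power2_eq_square)

lemma X_sq: "expectation (\<lambda>\<omega>. (X t \<omega>)\<^sup>2) = sig2 * B2"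
  using X_cov[of t 0] acov_0 by (simp add: power2_eq_square)

lemma X_mean: "expectation (X t) = 0"
proof -
  have "(\<lambda>N. expectation (\<lambda>\<omega>. series_part N t \<omega> * 1)) \<longlonglongrightarrow> expectation (\<lambda>\<omega>. X t \<omega> * 1)"
    by (rule L2_tendsto_mult) (auto intro: L2_series_part L2_X series_part_X L2_const)
  moreover have "expectation (series_part N t) = 0" for N
    unfolding series_part_def using xi_mean L2_integrable[OF L2_xi] by simp
  ultimately show ?thesis by (simp add: LIMSEQ_const_iff)
qed

definition tail_var :: "nat \<Rightarrow> real" where "tail_var m = sig2 * (B2 - (\<Sum>j\<in>{1..m}. (b j)\<^sup>2))"

lemma tail_var_nonneg: "0 \<le> tail_var m" unfolding tail_var_def using sig2_nonneg b_sq_le by simp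

lemma tail_var_tendsto: "tail_var \<longlonglongrightarrow> 0"
proof -
  have "(\<lambda>m. sig2 * (B2 - (\<Sum>j\<in>{1..m}. (b j)\<^sup>2))) \<longlonglongrightarrow> sig2 * (B2 - B2)"
    by (intro tendsto_intros b_sq_tendsto)
  then show ?thesis by (simp add: tail_var_def[abs_def])
qed

text \<open>Pythagoras: the error is exactly the tail of the squared coefficients, and it does not
  depend on \<open>t\<close>.\<close>

lemma X_series_part_error: "expectation (\<lambda>\<omega>. (X t \<omega> - series_part m t \<omega>)\<^sup>2) = tail_var m"
proof -
  have "(\<lambda>\<omega>. (X t \<omega> - series_part m t \<omega>)\<^sup>2) = (\<lambda>\<omega>. (X t \<omega>)\<^sup>2 - 2 * (X t \<omega> * series_part m t \<omega>) + series_part m t \<omega> * series_part m t \<omega>)"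
    by (simp add: fun_eq_iff power2_eq_square algebra_simps)
  then have "expectation (\<lambda>\<omega>. (X t \<omega> - series_part m t \<omega>)\<^sup>2) = sig2 * B2 - 2 * (sig2 * (\<Sum>j\<in>{1..m}. (b j)\<^sup>2)) + expectation (\<lambda>\<omega>. series_part m t \<omega> * series_part m t \<omega>)"
    using L2_sq[OF L2_X] L2_mult[OF L2_X L2_series_part] L2_mult[OF L2_series_part L2_series_part] by (simp add: X_sq X_series_part_mult)
  also have "expectation (\<lambda>\<omega>. series_part m t \<omega> * series_part m t \<omega>) = sig2 * (\<Sum>j\<in>{1..m}. (b j)\<^sup>2)"
  proof -
    have "(\<Sum>j\<in>{1..m}. if j \<le> m then b j * b j else 0) = (\<Sum>j\<in>{1..m}. (b j)\<^sup>2)"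
      by (intro sum.cong) (auto simp: power2_eq_square)
    then show ?thesis using series_part_mult[of m t m 0] by (simp only: of_nat_0 add_0_right)
  qed
  finally show ?thesis by (simp add: tail_var_def algebra_simps)
qed

text \<open>Picard iteration with the series cut off at lag \<open>m\<close>, so that every iterate depends on
  finitely many innovations only.\<close>

fun picard :: "nat \<Rightarrow> nat \<Rightarrow> int \<Rightarrow> 'a \<Rightarrow> real" where
  "picard m 0 t \<omega> = 0"
| "picard m (Suc k) t \<omega> = (\<Sum>j\<in>{1..m}. b j * (\<zeta> (t - int j) \<omega> * Q (a + picard m k (t - int j) \<omega>)))"

lemma picard_F: "picard m k t \<in> borel_measurable (\<F> {t - int (k * m)..<t})"
proof (induction k arbitrary: t)
  case 0
  have "picard m 0 t = (\<lambda>_. 0)" by (simp add: fun_eq_iff)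
  then show ?case by simp
next
  case (Suc k)
  have "(\<lambda>\<omega>. b j * (\<zeta> (t - int j) \<omega> * Q (a + picard m k (t - int j) \<omega>))) \<in> borel_measurable (\<F> {t - int (Suc k * m)..<t})" if "j \<in> {1..m}" for j
  proof -
    have sub: "{t - int j - int (k * m)..<t - int j} \<subseteq> {t - int (Suc k * m)..<t}" "t - int j \<in> {t - int (Suc k * m)..<t}"
    proof -
      have "int (Suc k * m) = int m + int (k * m)" "1 \<le> int j" "int j \<le> int m" "0 \<le> int (k * m)" using that by auto
      then show "{t - int j - int (k * m)..<t - int j} \<subseteq> {t - int (Suc k * m)..<t}" "t - int j \<in> {t - int (Suc k * m)..<t}"
        by (auto simp del: of_nat_mult mult_Suc)
    qed
    have [measurable]: "picard m k (t - int j) \<in> borel_measurable (\<F> {t - int (Suc k * m)..<t})"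
      by (rule measurable_F_mono[OF sub(1) Suc.IH])
    have [measurable]: "\<zeta> (t - int j) \<in> borel_measurable (\<F> {t - int (Suc k * m)..<t})"
      by (rule zeta_F[OF sub(2)])
    show ?thesis by measurable
  qed
  then have "(\<lambda>\<omega>. \<Sum>j\<in>{1..m}. b j * (\<zeta> (t - int j) \<omega> * Q (a + picard m k (t - int j) \<omega>))) \<in> borel_measurable (\<F> {t - int (Suc k * m)..<t})"
    by (rule borel_measurable_sum)
  then show ?case by simp
qed

lemma picard_F': "picard m k t \<in> borel_measurable (\<F> {..<t})"
  by (rule measurable_F_mono[OF _ picard_F]) auto

lemma L2_picard: "L2 (picard m k t)"
proof (induction k arbitrary: t)
  case 0
  then show ?case using L2_const[of 0] by (simp add: L2_def)
next
  case (Suc k)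
  have "(\<lambda>\<omega>. Q (a + picard m k (t - int j) \<omega>)) \<in> borel_measurable (\<F> {..<t - int j})" for j
    using picard_F'[of m k "t - int j"] by measurable
  then have "L2 (\<lambda>\<omega>. \<Sum>j\<in>{1..m}. b j * (\<zeta> (t - int j) \<omega> * Q (a + picard m k (t - int j) \<omega>)))"
    by (intro L2_sum L2_cmult L2_zeta_times(1) L2_Q Suc.IH)
  then show ?case by simp
qed

definition rho :: real where "rho = LipQ\<^sup>2 * B2"

lemma rho: "0 \<le> rho" "rho < 1"
  using contr B2_nonneg by (auto simp: rho_def B2_def)

text \<open>One iteration multiplies the squared error by at most \<open>rho\<close> and adds the
  cut-off error \<open>tail_var m\<close>; \<open>tail_var m / (1 - rho)\<close> is the fixed point
  of that recursion. The start is the variance of \<open>X\<close>. The bound is uniform in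
  \<open>t\<close>.\<close>

lemma picard_error: "expectation (\<lambda>\<omega>. (X t \<omega> - picard m k t \<omega>)\<^sup>2) \<le> rho^k * (sig2 * B2) + tail_var m / (1 - rho)"
proof (induction k arbitrary: t)
  case 0
  have "0 \<le> tail_var m / (1 - rho)" using tail_var_nonneg rho by simp
  then show ?case by (simp add: X_sq)
next
  case (Suc k)
  define \<Delta> where "\<Delta> = rho^k * (sig2 * B2) + tail_var m / (1 - rho)"
  \<comment> \<open>Treats both errors as one martingale sum: up to lag \<open>m\<close> the
    difference of the two values of \<open>Q\<close>, beyond it the omitted term of the
    series.\<close>
  define g where "g j s \<omega> = (if j \<le> m then Q (a + X s \<omega>) - Q (a + picard m k s \<omega>) else Q (a + X s \<omega>))" for j s \<omega>
  have gF: "g j s \<in> borel_measurable (\<F> {..<s})" for j s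
    unfolding g_def[abs_def] using X_F[of s] picard_F'[of m k s] by measurable
  have gL: "L2 (g j s)" for j s
    unfolding g_def[abs_def] using L2_diff[OF L2_QX L2_Q[OF L2_picard], of s m k s] L2_QX[of s] by (cases "j \<le> m") auto
  have gle: "expectation (\<lambda>\<omega>. (g j s \<omega>)\<^sup>2) \<le> (if j \<le> m then LipQ\<^sup>2 * \<Delta> else sig2)" for j s
  proof (cases "j \<le> m")
    case True
    have "expectation (\<lambda>\<omega>. (g j s \<omega>)\<^sup>2) \<le> expectation (\<lambda>\<omega>. LipQ\<^sup>2 * (X s \<omega> - picard m k s \<omega>)\<^sup>2)"
    proof (rule integral_mono)
      show "integrable M (\<lambda>\<omega>. LipQ\<^sup>2 * (X s \<omega> - picard m k s \<omega>)\<^sup>2)"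
        using L2_sq[OF L2_diff[OF L2_X L2_picard], of s m k s] by simp
      show "(g j s \<omega>)\<^sup>2 \<le> LipQ\<^sup>2 * (X s \<omega> - picard m k s \<omega>)\<^sup>2" for \<omega>
        using True Q_sq_lip[of "a + X s \<omega>" "a + picard m k s \<omega>"] by (simp add: g_def)
    qed (rule L2_sq[OF gL])
    also have "\<dots> = LipQ\<^sup>2 * expectation (\<lambda>\<omega>. (X s \<omega> - picard m k s \<omega>)\<^sup>2)" by simp
    also have "\<dots> \<le> LipQ\<^sup>2 * \<Delta>" unfolding \<Delta>_def by (intro mult_left_mono Suc.IH) auto
    finally show ?thesis using True by simp
  qed (simp add: g_def QX_sq)
  define e where "e N \<omega> = (\<Sum>j\<in>{1..N}. b j * (\<zeta> (t - int j) \<omega> * g j (t - int j) \<omega>))" for N \<omega>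
  have e: "e N \<omega> = series_part N t \<omega> - picard m (Suc k) t \<omega>" if "m \<le> N" for N \<omega>
  proof -
    have "picard m (Suc k) t \<omega> = (\<Sum>j\<in>{1..N}. if j \<le> m then b j * (\<zeta> (t - int j) \<omega> * Q (a + picard m k (t - int j) \<omega>)) else 0)"
    proof -
      have "{j\<in>{1..N}. j \<le> m} = {1..m}" using that by auto
      then show ?thesis by (simp add: sum.inter_filter[symmetric])
    qed
    then have "series_part N t \<omega> - picard m (Suc k) t \<omega> = (\<Sum>j\<in>{1..N}. b j * \<xi> (t - int j) \<omega> - (if j \<le> m then b j * (\<zeta> (t - int j) \<omega> * Q (a + picard m k (t - int j) \<omega>)) else 0))"
      unfolding series_part_def sum_subtractf by simp
    also have "\<dots> = e N \<omega>" unfolding e_def by (intro sum.cong) (auto simp: \<xi>_def g_def algebra_simps)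
    finally show ?thesis ..
  qed
  have ef: "expectation (\<lambda>\<omega>. (e N \<omega>)\<^sup>2) \<le> rho * \<Delta> + tail_var m" if "m \<le> N" for N
  proof -
    have hL: "L2 (\<lambda>\<omega>. \<zeta> (t - int j) \<omega> * g j (t - int j) \<omega>)" for j by (rule L2_zeta_times[OF gL gF])
    have ho: "expectation (\<lambda>\<omega>. (\<zeta> (t - int i) \<omega> * g i (t - int i) \<omega>) * (\<zeta> (t - int j) \<omega> * g j (t - int j) \<omega>)) = 0" if "i \<noteq> j" for i j
    proof -
      have *: "expectation (\<lambda>\<omega>. (\<zeta> (t - int i) \<omega> * g i (t - int i) \<omega>) * (\<zeta> (t - int j) \<omega> * g j (t - int j) \<omega>)) = 0" if "j < i" for i j
      proof (rule mds_orthogonal[OF gL gF hL _ L2_zeta zeta_F zeta_moments(1)])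
        show "(\<lambda>\<omega>. \<zeta> (t - int i) \<omega> * g i (t - int i) \<omega>) \<in> borel_measurable (\<F> {..<t - int j})"
          using that by (intro borel_measurable_times zeta_F measurable_F_mono[OF _ gF]) auto
      qed simp
      show ?thesis using *[of i j] *[of j i] that by (cases "i < j") (auto simp: mult.commute)
    qed
    have "expectation (\<lambda>\<omega>. (e N \<omega>)\<^sup>2) = (\<Sum>j\<in>{1..N}. (b j)\<^sup>2 * expectation (\<lambda>\<omega>. (\<zeta> (t - int j) \<omega> * g j (t - int j) \<omega>)\<^sup>2))"
      unfolding e_def by (rule L2_orthogonal_sum) (auto intro: hL ho)
    also have "\<dots> = (\<Sum>j\<in>{1..N}. (b j)\<^sup>2 * expectation (\<lambda>\<omega>. (g j (t - int j) \<omega>)\<^sup>2))"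
      by (simp only: L2_zeta_times(2)[OF gL gF])
    also have "\<dots> \<le> (\<Sum>j\<in>{1..N}. (b j)\<^sup>2 * (if j \<le> m then LipQ\<^sup>2 * \<Delta> else sig2))"
      by (intro sum_mono mult_left_mono gle) auto
    also have "\<dots> = (\<Sum>j\<in>{1..N}. sig2 * (b j)\<^sup>2) + (\<Sum>j\<in>{1..N}. if j \<le> m then (LipQ\<^sup>2 * \<Delta> - sig2) * (b j)\<^sup>2 else 0)"
      unfolding sum.distrib[symmetric] by (intro sum.cong) (auto simp: algebra_simps)
    also have "(\<Sum>j\<in>{1..N}. if j \<le> m then (LipQ\<^sup>2 * \<Delta> - sig2) * (b j)\<^sup>2 else 0) = (\<Sum>j\<in>{1..m}. (LipQ\<^sup>2 * \<Delta> - sig2) * (b j)\<^sup>2)"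
    proof -
      have "{j\<in>{1..N}. j \<le> m} = {1..m}" using that by auto
      then show ?thesis by (simp add: sum.inter_filter[symmetric])
    qed
    also have "(\<Sum>j\<in>{1..N}. sig2 * (b j)\<^sup>2) + (\<Sum>j\<in>{1..m}. (LipQ\<^sup>2 * \<Delta> - sig2) * (b j)\<^sup>2)
      = LipQ\<^sup>2 * \<Delta> * (\<Sum>j\<in>{1..m}. (b j)\<^sup>2) + sig2 * ((\<Sum>j\<in>{1..N}. (b j)\<^sup>2) - (\<Sum>j\<in>{1..m}. (b j)\<^sup>2))"
      by (simp add: sum_distrib_left sum_subtractf algebra_simps)
    also have "\<dots> \<le> LipQ\<^sup>2 * \<Delta> * B2 + sig2 * (B2 - (\<Sum>j\<in>{1..m}. (b j)\<^sup>2))"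
    proof (intro add_mono mult_left_mono b_sq_le diff_right_mono sig2_nonneg)
      show "0 \<le> LipQ\<^sup>2 * \<Delta>" unfolding \<Delta>_def using rho tail_var_nonneg sig2_nonneg B2_nonneg by simp
    qed
    finally show ?thesis by (simp add: rho_def tail_var_def mult_ac)
  qed
  \<comment> \<open>The shift by \<open>m\<close> ensures that the partial series reaches past the
    cut-off, where the form \<open>e\<close> of the difference is valid.\<close>
  have "(\<lambda>N. expectation (\<lambda>\<omega>. (series_part (N + m) t \<omega> - picard m (Suc k) t \<omega>) * (series_part (N + m) t \<omega> - picard m (Suc k) t \<omega>))) \<longlonglongrightarrow>
     expectation (\<lambda>\<omega>. (X t \<omega> - picard m (Suc k) t \<omega>) * (X t \<omega> - picard m (Suc k) t \<omega>))"
    by (rule L2_tendsto_mult) (use LIMSEQ_ignore_initial_segment[OF series_part_X] in \<open>auto intro: L2_diff L2_series_part L2_X L2_picard simp del: picard.simps\<close>)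
  moreover have "expectation (\<lambda>\<omega>. (series_part (N + m) t \<omega> - picard m (Suc k) t \<omega>) * (series_part (N + m) t \<omega> - picard m (Suc k) t \<omega>)) \<le> rho * \<Delta> + tail_var m" for N
    using ef[of "N + m"] by (simp add: e power2_eq_square del: picard.simps)
  ultimately have "expectation (\<lambda>\<omega>. (X t \<omega> - picard m (Suc k) t \<omega>) * (X t \<omega> - picard m (Suc k) t \<omega>)) \<le> rho * \<Delta> + tail_var m"
    by (intro LIMSEQ_le_const2) auto
  also have "rho * \<Delta> + tail_var m = rho^Suc k * (sig2 * B2) + tail_var m / (1 - rho)"
    using rho by (simp add: \<Delta>_def field_simps)
  finally show ?case by (simp add: power2_eq_square del: picard.simps)
qed

end

section \<open>Central limit theorem for weighted sums of the innovations and of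
  \<open>X\<close>\<close>

lemma (in prob_space) L2_second_moment_close:
  assumes "L2 f" "L2 g" and e: "expectation (\<lambda>\<omega>. (f \<omega> - g \<omega>)\<^sup>2) \<le> e"
  shows "\<bar>expectation (\<lambda>\<omega>. (g \<omega>)\<^sup>2) - expectation (\<lambda>\<omega>. (f \<omega>)\<^sup>2)\<bar> \<le> e + 2 * sqrt (expectation (\<lambda>\<omega>. (f \<omega>)\<^sup>2)) * sqrt e"
proof -
  note df = L2_diff[OF assms(1,2)]
  have "(\<lambda>\<omega>. (g \<omega>)\<^sup>2 - (f \<omega>)\<^sup>2) = (\<lambda>\<omega>. (f \<omega> - g \<omega>)\<^sup>2 - 2 * (f \<omega> * (f \<omega> - g \<omega>)))"
    by (simp add: fun_eq_iff power2_eq_square algebra_simps)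
  moreover have "expectation (\<lambda>\<omega>. (g \<omega>)\<^sup>2) - expectation (\<lambda>\<omega>. (f \<omega>)\<^sup>2) = expectation (\<lambda>\<omega>. (g \<omega>)\<^sup>2 - (f \<omega>)\<^sup>2)"
    using assms L2_sq by simp
  ultimately have "expectation (\<lambda>\<omega>. (g \<omega>)\<^sup>2) - expectation (\<lambda>\<omega>. (f \<omega>)\<^sup>2) = expectation (\<lambda>\<omega>. (f \<omega> - g \<omega>)\<^sup>2) - 2 * expectation (\<lambda>\<omega>. f \<omega> * (f \<omega> - g \<omega>))"
    using L2_sq[OF df] L2_mult[OF assms(1) df] by simp
  moreover have "\<bar>expectation (\<lambda>\<omega>. f \<omega> * (f \<omega> - g \<omega>))\<bar> \<le> sqrt (expectation (\<lambda>\<omega>. (f \<omega>)\<^sup>2)) * sqrt e"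
    using L2_cauchy_schwarz[OF assms(1) df] e
    by (rule order_trans[OF _ mult_left_mono[OF real_sqrt_le_mono]]) simp
  moreover have "0 \<le> expectation (\<lambda>\<omega>. (f \<omega> - g \<omega>)\<^sup>2)" by simp
  ultimately show ?thesis using e unfolding mult.assoc by linarith
qed

context larch_solution
begin

definition trunc :: "nat \<Rightarrow> real \<Rightarrow> real" where "trunc K x = max (- real K) (min (real K) x)"

lemma trunc_measurable[measurable]: "trunc K \<in> borel_measurable borel"
  unfolding trunc_def[abs_def] by measurable

lemma trunc_bound: "\<bar>trunc K x\<bar> \<le> real K" by (auto simp: trunc_def max_def min_def)

lemma trunc_lip: "\<bar>trunc K x - trunc K y\<bar> \<le> \<bar>x - y\<bar>" by (auto simp: trunc_def max_def min_def)

lemma trunc_abs: "\<bar>trunc K x\<bar> \<le> \<bar>x\<bar>" by (auto simp: trunc_def max_def min_def)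

text \<open>The error is split as (\<zeta> - z) Q + z (Q - q). In both products the factors are
  independent, so second moments multiply and no higher moments are needed. First the truncation
  level \<open>K\<close> is fixed, then \<open>m\<close>; stationarity makes the choice uniform in
  \<open>s\<close>.\<close>

lemma bounded_approximation:
  assumes e: "0 < e"
  shows "\<exists>z q m K. bounded_mds M \<zeta> z q m K \<and> (\<forall>s. expectation (\<lambda>\<omega>. (\<xi> s \<omega> - z (\<zeta> s \<omega>) * q s \<omega>)\<^sup>2) \<le> e)"
proof -
  have "(\<lambda>K. 2 * (expectation (\<lambda>\<omega>. (\<zeta> 0 \<omega> - trunc K (\<zeta> 0 \<omega>))\<^sup>2) * sig2) + 2 * (2 * expectation (\<lambda>\<omega>. (Q (a + X 0 \<omega>) - trunc K (Q (a + X 0 \<omega>)))\<^sup>2)))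
    \<longlonglongrightarrow> 2 * (0 * sig2) + 2 * (2 * 0)"
    unfolding trunc_def by (intro tendsto_intros L2_truncation L2_zeta L2_QX)
  then have "\<forall>\<^sub>F K in sequentially. 2 * (expectation (\<lambda>\<omega>. (\<zeta> 0 \<omega> - trunc K (\<zeta> 0 \<omega>))\<^sup>2) * sig2) + 2 * (2 * expectation (\<lambda>\<omega>. (Q (a + X 0 \<omega>) - trunc K (Q (a + X 0 \<omega>)))\<^sup>2)) < e/2"
    using e by (intro order_tendstoD) auto
  then obtain K where K: "2 * (expectation (\<lambda>\<omega>. (\<zeta> 0 \<omega> - trunc K (\<zeta> 0 \<omega>))\<^sup>2) * sig2) + 2 * (2 * expectation (\<lambda>\<omega>. (Q (a + X 0 \<omega>) - trunc K (Q (a + X 0 \<omega>)))\<^sup>2)) < e/2"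
    by (auto simp: eventually_sequentially)
  \<comment> \<open>The number of iterations and the cut-off lag are both \<open>m\<close>, so a
    single limit disposes of both terms. The resulting range is \<open>m * m\<close>.\<close>
  have "(\<lambda>m. 4 * LipQ\<^sup>2 * (rho^m * (sig2 * B2) + tail_var m / (1 - rho))) \<longlonglongrightarrow> 4 * LipQ\<^sup>2 * (0 * (sig2 * B2) + 0 / (1 - rho))"
    using rho by (intro tendsto_intros LIMSEQ_realpow_zero tail_var_tendsto) auto
  then have "\<forall>\<^sub>F m in sequentially. 4 * LipQ\<^sup>2 * (rho^m * (sig2 * B2) + tail_var m / (1 - rho)) < e/2"
    using e by (intro order_tendstoD) auto
  then obtain m where m: "4 * LipQ\<^sup>2 * (rho^m * (sig2 * B2) + tail_var m / (1 - rho)) < e/2"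
    by (auto simp: eventually_sequentially)
  \<comment> \<open>Truncation destroys the zero mean on which the martingale property rests;
    subtracting \<open>\<mu>\<close> restores it.\<close>
  define \<mu> where "\<mu> = expectation (\<lambda>\<omega>. trunc K (\<zeta> 0 \<omega>))"
  define z where "z x = trunc K x - \<mu>" for x
  define q where "q s \<omega> = trunc K (Q (a + picard m m s \<omega>))" for s \<omega>
  define K' where "K' = real K + \<bar>\<mu>\<bar>"
  note [measurable] = zeta_rv X_M
  have picM[measurable]: "picard m m s \<in> borel_measurable M" for s by (rule L2_meas[OF L2_picard])
  have z_meas[measurable]: "z \<in> borel_measurable borel" unfolding z_def[abs_def] by measurable
  have qF: "q s \<in> borel_measurable (\<F> {s - int (m * m)..<s})" for s
    unfolding q_def[abs_def] using picard_F[of m m s] by measurable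
  have ti: "integrable M (\<lambda>\<omega>. trunc K (\<zeta> s \<omega>))" for s
    using trunc_bound by (intro integrable_const_bound[of _ "real K"]) auto
  have tm: "expectation (\<lambda>\<omega>. trunc K (\<zeta> s \<omega>)) = \<mu>" for s
    unfolding \<mu>_def by (rule zeta_comp(2)) measurable
  have bm: "bounded_mds M \<zeta> z q (m * m) K'"
  proof (unfold_locales, goal_cases)
    case 1 show ?case by measurable
    case (2 x) show ?case using trunc_bound[of K x] unfolding z_def K'_def by linarith
    case (3 s) show ?case using ti[of s] tm[of s] by (simp add: z_def prob_space)
    case (4 s) show ?case by (rule qF)
    case (5 s \<omega>) show ?case using trunc_bound[of K "Q (a + picard m m s \<omega>)"] unfolding q_def K'_def by linarith
  qed
  have "expectation (\<lambda>\<omega>. (\<xi> s \<omega> - z (\<zeta> s \<omega>) * q s \<omega>)\<^sup>2) \<le> e" for s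
  proof -
    let ?u = "\<lambda>\<omega>. \<zeta> s \<omega> - z (\<zeta> s \<omega>)" and ?v = "\<lambda>\<omega>. Q (a + X s \<omega>) - q s \<omega>"
    have zb: "\<bar>z x\<bar> \<le> \<bar>K'\<bar>" for x using trunc_bound[of K x] unfolding z_def K'_def by linarith
    have Lz: "L2 (\<lambda>\<omega>. z (\<zeta> s \<omega>))" by (rule L2_bound[OF _ _ L2_const[of K']]) (use zb in auto)
    have Lq: "L2 (q s)" by (rule L2_bound[OF measurable_F_M[OF qF] _ L2_const[of "real K"]]) (use trunc_bound in \<open>auto simp: q_def\<close>)
    have Lu: "L2 ?u" by (rule L2_diff[OF L2_zeta Lz])
    have Lv: "L2 ?v" by (rule L2_diff[OF L2_QX Lq])
    have prod: "integrable M (\<lambda>\<omega>. (f \<omega>)\<^sup>2 * (g \<omega>)\<^sup>2)" "expectation (\<lambda>\<omega>. (f \<omega>)\<^sup>2 * (g \<omega>)\<^sup>2) = expectation (\<lambda>\<omega>. (f \<omega>)\<^sup>2) * expectation (\<lambda>\<omega>. (g \<omega>)\<^sup>2)"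
      if "L2 f" "L2 g" "f \<in> borel_measurable (\<F> {s})" "g \<in> borel_measurable (\<F> {..<s})" for f g
      using expectation_mult_F[of "{s}" "{..<s}" "\<lambda>\<omega>. (f \<omega>)\<^sup>2" "\<lambda>\<omega>. (g \<omega>)\<^sup>2"] that L2_sq by auto
    have zs[measurable]: "\<zeta> s \<in> borel_measurable (\<F> {s})" by (rule zeta_F) simp
    have uF: "?u \<in> borel_measurable (\<F> {s})" "(\<lambda>\<omega>. z (\<zeta> s \<omega>)) \<in> borel_measurable (\<F> {s})" by measurable
    have [measurable]: "q s \<in> borel_measurable (\<F> {..<s})" by (rule measurable_F_mono[OF _ qF]) auto
    have [measurable]: "(\<lambda>\<omega>. Q (a + X s \<omega>)) \<in> borel_measurable (\<F> {..<s})" by (rule QX_F)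
    have vF: "?v \<in> borel_measurable (\<F> {..<s})" by measurable
    note p1 = prod[OF Lu L2_QX uF(1) QX_F] and p2 = prod[OF Lz Lv uF(2) vF]
    \<comment> \<open>Recentring can only help: the truncation error has mean
      \<open>- \<mu>\<close>, so its second moment drops by the square of
      \<open>\<mu>\<close>.\<close>
    have Eu: "expectation (\<lambda>\<omega>. (?u \<omega>)\<^sup>2) \<le> expectation (\<lambda>\<omega>. (\<zeta> 0 \<omega> - trunc K (\<zeta> 0 \<omega>))\<^sup>2)"
    proof -
      have Lt: "L2 (\<lambda>\<omega>. \<zeta> s \<omega> - trunc K (\<zeta> s \<omega>))"
        by (intro L2_diff L2_zeta L2_bound[OF _ _ L2_const[of "real K"]]) (use trunc_bound in auto)
      have mean: "expectation (\<lambda>\<omega>. \<zeta> s \<omega> - trunc K (\<zeta> s \<omega>)) = - \<mu>"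
        using ti[of s] tm[of s] L2_integrable[OF L2_zeta] zeta_moments by simp
      have "(\<lambda>\<omega>. (?u \<omega>)\<^sup>2) = (\<lambda>\<omega>. (\<zeta> s \<omega> - trunc K (\<zeta> s \<omega>))\<^sup>2 + 2 * \<mu> * (\<zeta> s \<omega> - trunc K (\<zeta> s \<omega>)) + \<mu>\<^sup>2)"
        by (simp add: fun_eq_iff z_def power2_eq_square algebra_simps)
      then have "expectation (\<lambda>\<omega>. (?u \<omega>)\<^sup>2) = expectation (\<lambda>\<omega>. (\<zeta> s \<omega> - trunc K (\<zeta> s \<omega>))\<^sup>2 + 2 * \<mu> * (\<zeta> s \<omega> - trunc K (\<zeta> s \<omega>)) + \<mu>\<^sup>2)" by (simp only:)
      also have "\<dots> = expectation (\<lambda>\<omega>. (\<zeta> s \<omega> - trunc K (\<zeta> s \<omega>))\<^sup>2) + 2 * \<mu> * expectation (\<lambda>\<omega>. \<zeta> s \<omega> - trunc K (\<zeta> s \<omega>)) + \<mu>\<^sup>2"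
        using L2_sq[OF Lt] L2_integrable[OF Lt] by (simp only: Bochner_Integration.integral_add Bochner_Integration.integrable_add integrable_mult_right integral_mult_right_zero integrable_const)
          (simp add: prob_space)
      also have "\<dots> \<le> expectation (\<lambda>\<omega>. (\<zeta> s \<omega> - trunc K (\<zeta> s \<omega>))\<^sup>2)" unfolding mean by (simp add: power2_eq_square)
      also have "\<dots> = expectation (\<lambda>\<omega>. (\<zeta> 0 \<omega> - trunc K (\<zeta> 0 \<omega>))\<^sup>2)" by (rule zeta_comp(2)) measurable
      finally show ?thesis .
    qed
    have Ez: "expectation (\<lambda>\<omega>. (z (\<zeta> s \<omega>))\<^sup>2) \<le> 1"
    proof -
      have Lt: "L2 (\<lambda>\<omega>. trunc K (\<zeta> s \<omega>))"
        by (intro L2_bound[OF _ _ L2_const[of "real K"]]) (use trunc_bound in auto)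
      have "(\<lambda>\<omega>. (z (\<zeta> s \<omega>))\<^sup>2) = (\<lambda>\<omega>. (trunc K (\<zeta> s \<omega>))\<^sup>2 - 2 * \<mu> * trunc K (\<zeta> s \<omega>) + \<mu>\<^sup>2)"
        by (simp add: fun_eq_iff z_def power2_eq_square algebra_simps)
      then have "expectation (\<lambda>\<omega>. (z (\<zeta> s \<omega>))\<^sup>2) = expectation (\<lambda>\<omega>. (trunc K (\<zeta> s \<omega>))\<^sup>2) - 2 * \<mu> * \<mu> + \<mu>\<^sup>2"
        using L2_sq[OF Lt] ti[of s] tm[of s] by (simp add: prob_space)
      also have "\<dots> \<le> expectation (\<lambda>\<omega>. (trunc K (\<zeta> s \<omega>))\<^sup>2)" by (simp add: power2_eq_square)
      also have "\<dots> \<le> expectation (\<lambda>\<omega>. (\<zeta> s \<omega>)\<^sup>2)"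
        by (intro integral_mono L2_sq Lt L2_zeta) (use trunc_abs in \<open>simp add: abs_le_square_iff[symmetric]\<close>)
      finally show ?thesis by (simp add: zeta_moments)
    qed
    have Ev: "expectation (\<lambda>\<omega>. (?v \<omega>)\<^sup>2) \<le> 2 * (expectation (\<lambda>\<omega>. (Q (a + X 0 \<omega>) - trunc K (Q (a + X 0 \<omega>)))\<^sup>2) + LipQ\<^sup>2 * (rho^m * (sig2 * B2) + tail_var m / (1 - rho)))"
    proof -
      let ?v1 = "\<lambda>\<omega>. Q (a + X s \<omega>) - trunc K (Q (a + X s \<omega>))" and ?v2 = "\<lambda>\<omega>. trunc K (Q (a + X s \<omega>)) - q s \<omega>"
      have Lt: "L2 (\<lambda>\<omega>. trunc K (Q (a + X s \<omega>)))"
        by (intro L2_bound[OF _ _ L2_const[of "real K"]]) (use trunc_bound in auto)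
      have Lv12: "L2 ?v1" "L2 ?v2" by (intro L2_diff L2_QX Lt Lq)+
      have "expectation (\<lambda>\<omega>. (?v \<omega>)\<^sup>2) = expectation (\<lambda>\<omega>. (?v1 \<omega> + ?v2 \<omega>)\<^sup>2)" by simp
      also have "\<dots> \<le> 2 * (expectation (\<lambda>\<omega>. (?v1 \<omega>)\<^sup>2) + expectation (\<lambda>\<omega>. (?v2 \<omega>)\<^sup>2))" by (rule L2_triangle2[OF Lv12])
      also have "expectation (\<lambda>\<omega>. (?v1 \<omega>)\<^sup>2) = expectation (\<lambda>\<omega>. (Q (a + X 0 \<omega>) - trunc K (Q (a + X 0 \<omega>)))\<^sup>2)"
        by (rule X_comp) measurable
      also have "expectation (\<lambda>\<omega>. (?v2 \<omega>)\<^sup>2) \<le> expectation (\<lambda>\<omega>. LipQ\<^sup>2 * (X s \<omega> - picard m m s \<omega>)\<^sup>2)"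
      proof (rule integral_mono)
        show "integrable M (\<lambda>\<omega>. (?v2 \<omega>)\<^sup>2)" by (rule L2_sq[OF Lv12(2)])
        show "integrable M (\<lambda>\<omega>. LipQ\<^sup>2 * (X s \<omega> - picard m m s \<omega>)\<^sup>2)"
          using L2_sq[OF L2_diff[OF L2_X L2_picard]] by simp
        fix \<omega>
        have "(?v2 \<omega>)\<^sup>2 \<le> (Q (a + X s \<omega>) - Q (a + picard m m s \<omega>))\<^sup>2"
          using trunc_lip by (simp add: q_def abs_le_square_iff[symmetric])
        also have "\<dots> \<le> LipQ\<^sup>2 * (X s \<omega> - picard m m s \<omega>)\<^sup>2" using Q_sq_lip[of "a + X s \<omega>" "a + picard m m s \<omega>"] by simp
        finally show "(?v2 \<omega>)\<^sup>2 \<le> LipQ\<^sup>2 * (X s \<omega> - picard m m s \<omega>)\<^sup>2" .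
      qed
      also have "expectation (\<lambda>\<omega>. LipQ\<^sup>2 * (X s \<omega> - picard m m s \<omega>)\<^sup>2) = LipQ\<^sup>2 * expectation (\<lambda>\<omega>. (X s \<omega> - picard m m s \<omega>)\<^sup>2)" by simp
      also have "\<dots> \<le> LipQ\<^sup>2 * (rho^m * (sig2 * B2) + tail_var m / (1 - rho))" by (intro mult_left_mono picard_error) simp
      finally show ?thesis by simp
    qed
    have Lp1: "L2 (\<lambda>\<omega>. ?u \<omega> * Q (a + X s \<omega>))" unfolding L2_def using p1(1) by (auto simp: power_mult_distrib)
    have Lp2: "L2 (\<lambda>\<omega>. z (\<zeta> s \<omega>) * ?v \<omega>)" unfolding L2_def using p2(1) L2_meas[OF Lv] by (auto simp: power_mult_distrib)
    have "expectation (\<lambda>\<omega>. (\<xi> s \<omega> - z (\<zeta> s \<omega>) * q s \<omega>)\<^sup>2) = expectation (\<lambda>\<omega>. (?u \<omega> * Q (a + X s \<omega>) + z (\<zeta> s \<omega>) * ?v \<omega>)\<^sup>2)"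
      by (simp add: \<xi>_def algebra_simps)
    also have "\<dots> \<le> 2 * (expectation (\<lambda>\<omega>. (?u \<omega> * Q (a + X s \<omega>))\<^sup>2) + expectation (\<lambda>\<omega>. (z (\<zeta> s \<omega>) * ?v \<omega>)\<^sup>2))"
      by (rule L2_triangle2[OF Lp1 Lp2])
    also have "\<dots> = 2 * (expectation (\<lambda>\<omega>. (?u \<omega>)\<^sup>2) * sig2 + expectation (\<lambda>\<omega>. (z (\<zeta> s \<omega>))\<^sup>2) * expectation (\<lambda>\<omega>. (?v \<omega>)\<^sup>2))"
      unfolding power_mult_distrib p1(2) p2(2) QX_sq ..
    also have "\<dots> \<le> 2 * (expectation (\<lambda>\<omega>. (\<zeta> 0 \<omega> - trunc K (\<zeta> 0 \<omega>))\<^sup>2) * sig2 + 1 * (2 * (expectation (\<lambda>\<omega>. (Q (a + X 0 \<omega>) - trunc K (Q (a + X 0 \<omega>)))\<^sup>2) + LipQ\<^sup>2 * (rho^m * (sig2 * B2) + tail_var m / (1 - rho)))))"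
      by (intro mult_left_mono add_mono mult_right_mono mult_mono Eu Ez Ev sig2_nonneg) auto
    also have "\<dots> \<le> e" using K m by (simp add: algebra_simps)
    finally show ?thesis .
  qed
  then show ?thesis using bm by blast
qed

text \<open>Three errors: replacing \<open>\<xi>\<close> by the bounded differences, McLeish's
  theorem for these, and the change of variance. The first and third are controlled by \<epsilon>
  and \<open>C\<close> alone, so \<epsilon> is fixed before \<open>n\<close> grows.\<close>

theorem mds_clt:
  fixes S :: "nat \<Rightarrow> int set" and c :: "nat \<Rightarrow> int \<Rightarrow> real" and \<delta> :: "nat \<Rightarrow> real"
  assumes S: "\<And>n. finite (S n)" and c: "\<And>n s. s \<in> S n \<Longrightarrow> \<bar>c n s\<bar> \<le> \<delta> n" and \<delta>: "\<delta> \<longlonglongrightarrow> 0"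
    and C: "\<And>n. (\<Sum>s\<in>S n. (c n s)\<^sup>2) \<le> C"
  shows "(\<lambda>n. (CLINT \<omega>|M. iexp (\<Sum>s\<in>S n. c n s * \<xi> s \<omega>)) - exp (- (sig2 * (\<Sum>s\<in>S n. (c n s)\<^sup>2)) / 2)) \<longlonglongrightarrow> 0"
proof (rule LIMSEQ_I)
  fix e :: real assume e: "0 < e"
  have "((\<lambda>\<epsilon>. sqrt (C * \<epsilon>) + C * (\<epsilon> + 2 * sqrt sig2 * sqrt \<epsilon>) / 2) \<longlongrightarrow> sqrt (C * 0) + C * (0 + 2 * sqrt sig2 * sqrt 0) / 2) (at_right 0)"
    by (intro tendsto_intros) auto
  then have "\<forall>\<^sub>F \<epsilon> in at_right 0. sqrt (C * \<epsilon>) + C * (\<epsilon> + 2 * sqrt sig2 * sqrt \<epsilon>) / 2 < e/2"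
    using e by (intro order_tendstoD) auto
  moreover have "\<forall>\<^sub>F \<epsilon> in at_right 0. 0 < (\<epsilon>::real)" by (auto simp: eventually_at_right_less)
  ultimately have "\<forall>\<^sub>F \<epsilon> in at_right 0. 0 < \<epsilon> \<and> sqrt (C * \<epsilon>) + C * (\<epsilon> + 2 * sqrt sig2 * sqrt \<epsilon>) / 2 < e/2"
    by eventually_elim auto
  then obtain \<epsilon> where \<epsilon>: "0 < \<epsilon>" "sqrt (C * \<epsilon>) + C * (\<epsilon> + 2 * sqrt sig2 * sqrt \<epsilon>) / 2 < e/2"
    using eventually_happens[of _ "at_right (0::real)"] by auto
  obtain z q m K where bm: "bounded_mds M \<zeta> z q m K" and ap: "\<And>s. expectation (\<lambda>\<omega>. (\<xi> s \<omega> - z (\<zeta> s \<omega>) * q s \<omega>)\<^sup>2) \<le> \<epsilon>"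
    using bounded_approximation[OF \<epsilon>(1)] by blast
  interpret A: bounded_mds M \<zeta> z q m K by (rule bm)
  let ?\<eta> = A.\<eta>
  have ap': "expectation (\<lambda>\<omega>. (\<xi> s \<omega> - ?\<eta> s \<omega>)\<^sup>2) \<le> \<epsilon>" for s using ap[of s] by (simp add: A.\<eta>_def)
  have L\<eta>: "L2 (?\<eta> s)" for s using A.eta_sq_integrable A.eta_M by (simp add: L2_def)
  have LD: "L2 (\<lambda>\<omega>. \<xi> s \<omega> - ?\<eta> s \<omega>)" for s by (rule L2_diff[OF L2_xi L\<eta>])
  \<comment> \<open>The approximation errors are martingale differences again. Hence their weighted
    sum has second moment at most \<epsilon> times the sum of squared weights, however many terms
    there are.\<close>
  have orth: "expectation (\<lambda>\<omega>. (\<xi> s \<omega> - ?\<eta> s \<omega>) * (\<xi> t \<omega> - ?\<eta> t \<omega>)) = 0" if "s \<noteq> t" for s t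
  proof -
    have *: "expectation (\<lambda>\<omega>. (\<xi> s \<omega> - ?\<eta> s \<omega>) * (\<xi> t \<omega> - ?\<eta> t \<omega>)) = 0" if "s < t" for s t
    proof -
      have F: "(\<lambda>\<omega>. \<xi> s \<omega> - ?\<eta> s \<omega>) \<in> borel_measurable (\<F> {..<t})"
        using that by (intro borel_measurable_diff xi_F A.eta_F) auto
      have q: "q t \<in> borel_measurable (\<F> {..<t})" by (rule measurable_F_mono[OF _ A.q_meas]) auto
      have Lq: "L2 (q t)" by (rule L2_bound[OF A.q_M _ L2_const[of K]]) (use A.q_bound[of t] A.K_nonneg in auto)
      have Lz: "L2 (\<lambda>\<omega>. z (\<zeta> t \<omega>))" by (rule L2_bound[OF A.z_M _ L2_const[of K]]) (use A.z_bound A.K_nonneg in auto)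
      have 1: "expectation (\<lambda>\<omega>. (\<xi> s \<omega> - ?\<eta> s \<omega>) * \<xi> t \<omega>) = 0"
        unfolding \<xi>_def[of t] by (rule mds_orthogonal[OF L2_QX QX_F LD F L2_zeta zeta_F zeta_moments(1)]) simp
      have 2: "expectation (\<lambda>\<omega>. (\<xi> s \<omega> - ?\<eta> s \<omega>) * ?\<eta> t \<omega>) = 0"
        unfolding A.\<eta>_def[of t] by (rule mds_orthogonal[OF Lq q LD F Lz A.z_zeta_F A.z_mean])
      have "expectation (\<lambda>\<omega>. (\<xi> s \<omega> - ?\<eta> s \<omega>) * \<xi> t \<omega> - (\<xi> s \<omega> - ?\<eta> s \<omega>) * ?\<eta> t \<omega>) = 0"
        using 1 2 L2_mult[OF LD L2_xi] L2_mult[OF LD L\<eta>] by (subst Bochner_Integration.integral_diff) auto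
      then show ?thesis by (simp only: right_diff_distrib)
    qed
    show ?thesis using *[of s t] *[of t s] that by (cases "s < t") (auto simp: mult.commute)
  qed
  obtain \<delta>0 where \<delta>0: "0 < \<delta>0" "\<forall>S c. finite S \<longrightarrow> (\<forall>s\<in>S. \<bar>c s\<bar> \<le> \<delta>0) \<longrightarrow> (\<Sum>s\<in>S. (c s)\<^sup>2) \<le> C \<longrightarrow>
    cmod ((CLINT \<omega>|M. iexp (\<Sum>s\<in>S. c s * ?\<eta> s \<omega>)) - exp (- (\<Sum>s\<in>S. (c s)\<^sup>2 * expectation (\<lambda>\<omega>. (?\<eta> s \<omega>)\<^sup>2)) / 2)) \<le> e/2"
    using A.mcleish_clt[OF half_gt_zero[OF e], of C] by blast
  have "\<forall>\<^sub>F n in sequentially. \<delta> n < \<delta>0" using \<delta>0(1) by (intro order_tendstoD[OF \<delta>])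
  then obtain n0 where n0: "\<And>n. n \<ge> n0 \<Longrightarrow> \<delta> n < \<delta>0" by (auto simp: eventually_sequentially)
  have "norm ((CLINT \<omega>|M. iexp (\<Sum>s\<in>S n. c n s * \<xi> s \<omega>)) - exp (- (sig2 * (\<Sum>s\<in>S n. (c n s)\<^sup>2)) / 2) - 0) < e" if "n \<ge> n0" for n
  proof -
    let ?V = "\<Sum>s\<in>S n. (c n s)\<^sup>2 * expectation (\<lambda>\<omega>. (?\<eta> s \<omega>)\<^sup>2)"
    let ?U = "sig2 * (\<Sum>s\<in>S n. (c n s)\<^sup>2)"
    have 1: "cmod ((CLINT \<omega>|M. iexp (\<Sum>s\<in>S n. c n s * \<xi> s \<omega>)) - (CLINT \<omega>|M. iexp (\<Sum>s\<in>S n. c n s * ?\<eta> s \<omega>))) \<le> sqrt (C * \<epsilon>)"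
    proof -
      have "cmod ((CLINT \<omega>|M. iexp (\<Sum>s\<in>S n. c n s * \<xi> s \<omega>)) - (CLINT \<omega>|M. iexp (\<Sum>s\<in>S n. c n s * ?\<eta> s \<omega>)))
        \<le> sqrt (expectation (\<lambda>\<omega>. ((\<Sum>s\<in>S n. c n s * \<xi> s \<omega>) - (\<Sum>s\<in>S n. c n s * ?\<eta> s \<omega>))\<^sup>2))"
        by (intro cf_diff_le L2_sum L2_cmult L2_xi L\<eta>)
      also have "\<dots> = sqrt (expectation (\<lambda>\<omega>. (\<Sum>s\<in>S n. c n s * (\<xi> s \<omega> - ?\<eta> s \<omega>))\<^sup>2))"
        by (simp only: right_diff_distrib sum_subtractf)
      also have "\<dots> = sqrt (\<Sum>s\<in>S n. (c n s)\<^sup>2 * expectation (\<lambda>\<omega>. (\<xi> s \<omega> - ?\<eta> s \<omega>)\<^sup>2))"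
        by (subst L2_orthogonal_sum) (auto intro: S LD orth)
      also have "\<dots> \<le> sqrt (\<Sum>s\<in>S n. (c n s)\<^sup>2 * \<epsilon>)" by (intro real_sqrt_le_mono sum_mono mult_left_mono ap') auto
      also have "\<dots> \<le> sqrt (C * \<epsilon>)" unfolding sum_distrib_right[symmetric] using \<epsilon> by (intro real_sqrt_le_mono mult_right_mono C) auto
      finally show ?thesis .
    qed
    have 2: "cmod ((CLINT \<omega>|M. iexp (\<Sum>s\<in>S n. c n s * ?\<eta> s \<omega>)) - exp (- ?V / 2)) \<le> e/2"
      using order_trans[OF c less_imp_le[OF n0[OF that]]] by (intro \<delta>0(2)[rule_format] S C) auto
    have 3: "cmod (complex_of_real (exp (- ?V / 2)) - exp (- ?U / 2)) \<le> C * (\<epsilon> + 2 * sqrt sig2 * sqrt \<epsilon>) / 2"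
    proof -
      have "\<bar>?V - ?U\<bar> = \<bar>\<Sum>s\<in>S n. (c n s)\<^sup>2 * (expectation (\<lambda>\<omega>. (?\<eta> s \<omega>)\<^sup>2) - sig2)\<bar>"
        by (simp only: right_diff_distrib sum_subtractf sum_distrib_left mult.commute)
      also have "\<dots> \<le> (\<Sum>s\<in>S n. \<bar>(c n s)\<^sup>2 * (expectation (\<lambda>\<omega>. (?\<eta> s \<omega>)\<^sup>2) - sig2)\<bar>)" by (rule sum_abs)
      also have "\<dots> \<le> (\<Sum>s\<in>S n. (c n s)\<^sup>2 * (\<epsilon> + 2 * sqrt sig2 * sqrt \<epsilon>))"
      proof (rule sum_mono)
        fix s
        have "\<bar>expectation (\<lambda>\<omega>. (?\<eta> s \<omega>)\<^sup>2) - sig2\<bar> \<le> \<epsilon> + 2 * sqrt sig2 * sqrt \<epsilon>"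
          using L2_second_moment_close[OF L2_xi L\<eta> ap', of s] unfolding xi_sq .
        then show "\<bar>(c n s)\<^sup>2 * (expectation (\<lambda>\<omega>. (?\<eta> s \<omega>)\<^sup>2) - sig2)\<bar> \<le> (c n s)\<^sup>2 * (\<epsilon> + 2 * sqrt sig2 * sqrt \<epsilon>)"
          unfolding abs_mult abs_power2 by (intro mult_left_mono) auto
      qed
      also have "\<dots> \<le> C * (\<epsilon> + 2 * sqrt sig2 * sqrt \<epsilon>)" unfolding sum_distrib_right[symmetric]
        using \<epsilon> sig2_nonneg by (intro mult_right_mono C) auto
      finally have vu: "\<bar>?V - ?U\<bar> \<le> C * (\<epsilon> + 2 * sqrt sig2 * sqrt \<epsilon>)" .
      have nn: "0 \<le> ?V" "0 \<le> ?U" using sig2_nonneg by (auto intro!: sum_nonneg mult_nonneg_nonneg)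
      have "cmod (complex_of_real (exp (- ?V / 2)) - exp (- ?U / 2)) = \<bar>exp (- ?V / 2) - exp (- ?U / 2)\<bar>"
        by (simp only: of_real_diff[symmetric] norm_of_real)
      also have "\<dots> \<le> \<bar>?V - ?U\<bar> / 2" by (rule exp_minus_diff_le[OF nn])
      also have "\<dots> \<le> C * (\<epsilon> + 2 * sqrt sig2 * sqrt \<epsilon>) / 2" using vu by (rule divide_right_mono) simp
      finally show ?thesis .
    qed
    have tri: "cmod (x - w) \<le> cmod (x - y) + cmod (y - v) + cmod (v - w)" for x y v w :: complex
      using norm_triangle_ineq[of "x - y + (y - v)" "v - w"] norm_triangle_ineq[of "x - y" "y - v"] by simp
    show ?thesis using tri[of "CLINT \<omega>|M. iexp (\<Sum>s\<in>S n. c n s * \<xi> s \<omega>)" "exp (- ?U / 2)"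
       "CLINT \<omega>|M. iexp (\<Sum>s\<in>S n. c n s * ?\<eta> s \<omega>)" "exp (- ?V / 2)"] 1 2 3 \<epsilon>(2) unfolding diff_0_right by linarith
  qed
  then show "\<exists>n0. \<forall>n\<ge>n0. norm ((CLINT \<omega>|M. iexp (\<Sum>s\<in>S n. c n s * \<xi> s \<omega>)) - exp (- (sig2 * (\<Sum>s\<in>S n. (c n s)\<^sup>2)) / 2) - 0) < e" by blast
qed

end

lemma (in prob_space) L2_sum_second_moment_le:
  assumes f: "\<And>k. k \<in> I \<Longrightarrow> L2 (f k)"
  shows "expectation (\<lambda>\<omega>. (\<Sum>k\<in>I. w k * (f k \<omega>))\<^sup>2) \<le> real (card I) * (\<Sum>k\<in>I. (w k)\<^sup>2 * expectation (\<lambda>\<omega>. (f k \<omega>)\<^sup>2))"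
proof -
  have "expectation (\<lambda>\<omega>. (\<Sum>k\<in>I. w k * (f k \<omega>))\<^sup>2) \<le> expectation (\<lambda>\<omega>. (\<Sum>k\<in>I. (w k)\<^sup>2 * (f k \<omega>)\<^sup>2) * real (card I))"
  proof (rule integral_mono)
    show "integrable M (\<lambda>\<omega>. (\<Sum>k\<in>I. w k * f k \<omega>)\<^sup>2)" by (intro L2_sq L2_sum L2_cmult f)
    show "integrable M (\<lambda>\<omega>. (\<Sum>k\<in>I. (w k)\<^sup>2 * (f k \<omega>)\<^sup>2) * real (card I))"
      using f L2_sq by (intro integrable_mult_left Bochner_Integration.integrable_sum integrable_mult_right) auto
    show "(\<Sum>k\<in>I. w k * f k \<omega>)\<^sup>2 \<le> (\<Sum>k\<in>I. (w k)\<^sup>2 * (f k \<omega>)\<^sup>2) * real (card I)" for \<omega>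
      using sum_squared_le_sum_of_squares[of "\<lambda>k. w k * f k \<omega>" I] by (simp add: power_mult_distrib)
  qed
  also have "\<dots> = real (card I) * (\<Sum>k\<in>I. (w k)\<^sup>2 * expectation (\<lambda>\<omega>. (f k \<omega>)\<^sup>2))"
    using f L2_sq by (simp add: mult.commute)
  finally show ?thesis .
qed

context larch_solution
begin

text \<open>Rewriting the sum in the innovations gives weights \<open>c n s\<close> that are
  convolutions of \<open>w n\<close> with \<open>b\<close>. By Cauchy-Schwarz they are at most of
  order n^(-d-1/2) n^(1/2) = n^(-d), hence uniformly small because d > 0; this supplies the
  Lindeberg-type condition.\<close>

lemma linear_clt:
  fixes w :: "nat \<Rightarrow> nat \<Rightarrow> real"
  assumes w: "\<And>n k. k \<in> {1..n} \<Longrightarrow> \<bar>w n k\<bar> \<le> A * real n powr (- d - 1/2)"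
    and V: "(\<lambda>n. expectation (\<lambda>\<omega>. (\<Sum>k\<in>{1..n}. w n k * X (int k) \<omega>)\<^sup>2)) \<longlonglongrightarrow> V"
  shows "(\<lambda>n. CLINT \<omega>|M. iexp (\<Sum>k\<in>{1..n}. w n k * X (int k) \<omega>)) \<longlonglongrightarrow> exp (- V / 2)"
proof -
  define L where "L n \<omega> = (\<Sum>k\<in>{1..n}. w n k * X (int k) \<omega>)" for n \<omega>
  have LL: "L2 (L n)" for n unfolding L_def[abs_def] by (intro L2_sum L2_cmult L2_X)
  have V': "(\<lambda>n. expectation (\<lambda>\<omega>. (L n \<omega>)\<^sup>2)) \<longlonglongrightarrow> V" using V by (simp only: L_def)
  show ?thesis
  \<comment> \<open>Set apart because the bound on the squared weights is obtained by dividing the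
    variance by \<open>sig2\<close>.\<close>
  proof (cases "sig2 = 0")
    case True
    have "expectation (\<lambda>\<omega>. (L n \<omega>)\<^sup>2) = 0" for n
    proof -
      have "expectation (\<lambda>\<omega>. (L n \<omega>)\<^sup>2) \<le> 0"
        unfolding L_def by (rule order_trans[OF L2_sum_second_moment_le]) (auto intro: L2_X simp: X_sq True)
      moreover have "0 \<le> expectation (\<lambda>\<omega>. (L n \<omega>)\<^sup>2)" by simp
      ultimately show ?thesis by linarith
    qed
    note z = this
    then have "V = 0" using V' by (simp add: LIMSEQ_const_iff)
    moreover have "(CLINT \<omega>|M. iexp (L n \<omega>)) = 1" for n
      using cf_diff_le[OF LL[of n] L2_const[of 0]] z[of n] by (simp add: prob_space)
    ultimately show ?thesis by (simp add: L_def)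
  next
    case False
    then have s2: "0 < sig2" using sig2_nonneg by simp
    \<comment> \<open>The series is cut so late, depending on \<open>n\<close>, that even the crude
      Cauchy-Schwarz bound over \<open>n\<close> terms leaves a vanishing error.\<close>
    have "\<exists>N. (A * real n)\<^sup>2 * tail_var N \<le> 1 / real (Suc n)" for n
    proof -
      have "(\<lambda>N. (A * real n)\<^sup>2 * tail_var N) \<longlonglongrightarrow> (A * real n)\<^sup>2 * 0" by (intro tendsto_intros tail_var_tendsto)
      then have "\<forall>\<^sub>F N in sequentially. (A * real n)\<^sup>2 * tail_var N < 1 / real (Suc n)" by (intro order_tendstoD) auto
      then show ?thesis by (auto simp: eventually_sequentially intro: less_imp_le)
    qed
    then obtain N where N: "\<And>n. (A * real n)\<^sup>2 * tail_var (N n) \<le> 1 / real (Suc n)" by metis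
    \<comment> \<open>Contains every time k - j with k in 1..n and j in
      1..\<open>N n\<close>.\<close>
    define S where "S n = {- int (N n)..int n}" for n
    define bb where "bb n k s = (if 1 \<le> int k - s \<and> int k - s \<le> int (N n) then b (nat (int k - s)) else 0)" for n k s
    define c where "c n s = (\<Sum>k\<in>{1..n}. w n k * bb n k s)" for n s
    define LN where "LN n \<omega> = (\<Sum>k\<in>{1..n}. w n k * series_part (N n) (int k) \<omega>)" for n \<omega>
    have series_part_bb: "series_part (N n) (int k) \<omega> = (\<Sum>s\<in>S n. bb n k s * \<xi> s \<omega>)" if "k \<in> {1..n}" for n k \<omega>
    proof -
      have "(\<Sum>s\<in>S n. bb n k s * \<xi> s \<omega>) = (\<Sum>s\<in>S n. if 1 \<le> int k - s \<and> int k - s \<le> int (N n) then b (nat (int k - s)) * \<xi> s \<omega> else 0)"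
        by (intro sum.cong) (auto simp: bb_def)
      also have "\<dots> = (\<Sum>s\<in>{s\<in>S n. 1 \<le> int k - s \<and> int k - s \<le> int (N n)}. b (nat (int k - s)) * \<xi> s \<omega>)"
        by (rule sum.inter_filter[symmetric]) (simp add: S_def)
      also have "\<dots> = (\<Sum>j\<in>{1..N n}. b j * \<xi> (int k - int j) \<omega>)"
        by (rule sum.reindex_bij_witness[of _ "\<lambda>j. int k - int j" "\<lambda>s. nat (int k - s)"]) (use that in \<open>auto simp: S_def\<close>)
      finally show ?thesis by (simp add: series_part_def)
    qed
    have LN: "LN n \<omega> = (\<Sum>s\<in>S n. c n s * \<xi> s \<omega>)" for n \<omega>
    proof -
      have "LN n \<omega> = (\<Sum>k\<in>{1..n}. \<Sum>s\<in>S n. w n k * bb n k s * \<xi> s \<omega>)"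
        unfolding LN_def by (intro sum.cong refl) (simp add: series_part_bb sum_distrib_left mult.assoc)
      also have "\<dots> = (\<Sum>s\<in>S n. \<Sum>k\<in>{1..n}. w n k * bb n k s * \<xi> s \<omega>)" by (rule sum.swap)
      finally show ?thesis by (simp add: c_def sum_distrib_right)
    qed
    have bb_sq: "(\<Sum>k\<in>{1..n}. (bb n k s)\<^sup>2) \<le> B2" for n s
    proof -
      define I where "I = {k\<in>{1..n}. 1 \<le> int k - s \<and> int k - s \<le> int (N n)}"
      have "(\<Sum>k\<in>{1..n}. (bb n k s)\<^sup>2) = (\<Sum>k\<in>{1..n}. if 1 \<le> int k - s \<and> int k - s \<le> int (N n) then (b (nat (int k - s)))\<^sup>2 else 0)"
        by (intro sum.cong) (auto simp: bb_def)
      also have "\<dots> = (\<Sum>k\<in>I. (b (nat (int k - s)))\<^sup>2)" unfolding I_def by (rule sum.inter_filter[symmetric]) simp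
      also have "\<dots> = (\<Sum>j\<in>(\<lambda>k. nat (int k - s)) ` I. (b j)\<^sup>2)"
        by (subst sum.reindex) (auto simp: inj_on_def I_def)
      also have "\<dots> \<le> (\<Sum>j\<in>{1..N n}. (b j)\<^sup>2)" by (rule sum_mono2) (auto simp: I_def)
      also have "\<dots> \<le> B2" by (rule b_sq_le)
      finally show ?thesis .
    qed
    have A0: "0 \<le> A"
    proof -
      have "0 \<le> A * real 1 powr (- d - 1/2)" using w[of 1 1] by (intro order_trans[OF abs_ge_zero]) auto
      then show ?thesis by simp
    qed
    define \<delta> where "\<delta> n = A * sqrt B2 * real n powr (- d)" for n
    have c_le: "\<bar>c n s\<bar> \<le> \<delta> n" for n s
    proof (cases "n = 0")
      case True then show ?thesis by (simp add: c_def \<delta>_def)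
    next
      case False
      have "\<bar>c n s\<bar> \<le> (\<Sum>k\<in>{1..n}. \<bar>w n k\<bar> * \<bar>bb n k s\<bar>)" unfolding c_def abs_mult[symmetric] by (rule sum_abs)
      also have "\<dots> \<le> (\<Sum>k\<in>{1..n}. A * real n powr (- d - 1/2) * \<bar>bb n k s\<bar>)" by (intro sum_mono mult_right_mono w) auto
      also have "\<dots> = A * real n powr (- d - 1/2) * (\<Sum>k\<in>{1..n}. \<bar>bb n k s\<bar>)" by (simp add: sum_distrib_left)
      also have "(\<Sum>k\<in>{1..n}. \<bar>bb n k s\<bar>) \<le> sqrt (B2 * real n)"
      proof (rule real_le_rsqrt)
        have "(\<Sum>k\<in>{1..n}. \<bar>bb n k s\<bar>)\<^sup>2 \<le> (\<Sum>k\<in>{1..n}. \<bar>bb n k s\<bar>\<^sup>2) * real (card {1..n})"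
          by (rule sum_squared_le_sum_of_squares)
        also have "\<dots> \<le> B2 * real n" using bb_sq by (simp add: mult_right_mono)
        finally show "(\<Sum>k\<in>{1..n}. \<bar>bb n k s\<bar>)\<^sup>2 \<le> B2 * real n" .
      qed
      also have "A * real n powr (- d - 1/2) * sqrt (B2 * real n) = \<delta> n"
      proof -
        have "real n powr (- d - 1/2) * sqrt (real n) = real n powr (- d)"
          using False by (simp add: powr_half_sqrt[symmetric] powr_add[symmetric])
        then show ?thesis by (simp add: \<delta>_def real_sqrt_mult mult_ac)
      qed
      finally show ?thesis using A0 by (simp add: mult_left_mono)
    qed
    have \<delta>0: "\<delta> \<longlonglongrightarrow> 0"
    proof -
      have "(\<lambda>n. A * sqrt B2 * real n powr (- d)) \<longlonglongrightarrow> A * sqrt B2 * 0" using d by (intro tendsto_intros) real_asymp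
      then show ?thesis by (simp add: \<delta>_def[abs_def])
    qed
    have LLN: "L2 (LN n)" for n unfolding LN_def[abs_def] by (intro L2_sum L2_cmult L2_series_part)
    have LN_sq: "expectation (\<lambda>\<omega>. (LN n \<omega>)\<^sup>2) = sig2 * (\<Sum>s\<in>S n. (c n s)\<^sup>2)" for n
    proof -
      have "expectation (\<lambda>\<omega>. (LN n \<omega>)\<^sup>2) = (\<Sum>s\<in>S n. (c n s)\<^sup>2 * expectation (\<lambda>\<omega>. (\<xi> s \<omega>)\<^sup>2))"
        unfolding LN by (rule L2_orthogonal_sum) (auto intro: L2_xi xi_orthogonal simp: S_def)
      then show ?thesis by (simp add: xi_sq sum_distrib_left mult.commute)
    qed
    have err: "expectation (\<lambda>\<omega>. (L n \<omega> - LN n \<omega>)\<^sup>2) \<le> 1 / real (Suc n)" for n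
    proof -
      have "expectation (\<lambda>\<omega>. (L n \<omega> - LN n \<omega>)\<^sup>2) = expectation (\<lambda>\<omega>. (\<Sum>k\<in>{1..n}. w n k * (X (int k) \<omega> - series_part (N n) (int k) \<omega>))\<^sup>2)"
        by (simp only: L_def LN_def right_diff_distrib sum_subtractf)
      also have "\<dots> \<le> real (card {1..n}) * (\<Sum>k\<in>{1..n}. (w n k)\<^sup>2 * expectation (\<lambda>\<omega>. (X (int k) \<omega> - series_part (N n) (int k) \<omega>)\<^sup>2))"
        by (rule L2_sum_second_moment_le) (auto intro: L2_diff L2_X L2_series_part)
      also have "\<dots> \<le> real (card {1..n}) * (\<Sum>k\<in>{1..n}. A\<^sup>2 * tail_var (N n))"
      proof (intro mult_left_mono sum_mono)
        fix k assume k: "k \<in> {1..n}"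
        then have "real n powr (- d - 1/2) \<le> real n powr 0" using d by (intro powr_mono) auto
        then have "\<bar>w n k\<bar> \<le> A" using w[OF k] A0 k mult_left_mono[of "real n powr (- d - 1/2)" 1 A] by simp
        then have "(w n k)\<^sup>2 \<le> A\<^sup>2" using power_mono[of "\<bar>w n k\<bar>" A 2] by simp
        then show "(w n k)\<^sup>2 * expectation (\<lambda>\<omega>. (X (int k) \<omega> - series_part (N n) (int k) \<omega>)\<^sup>2) \<le> A\<^sup>2 * tail_var (N n)"
          unfolding X_series_part_error using tail_var_nonneg by (intro mult_right_mono)
      qed simp
      also have "\<dots> = (A * real n)\<^sup>2 * tail_var (N n)" by (simp add: power2_eq_square)
      also have "\<dots> \<le> 1 / real (Suc n)" by (rule N)
      finally show ?thesis .
    qed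
    have inv0: "(\<lambda>n. 1 / real (Suc n)) \<longlonglongrightarrow> 0" using LIMSEQ_inverse_real_of_nat by (simp add: inverse_eq_divide)
    have VN: "(\<lambda>n. expectation (\<lambda>\<omega>. (LN n \<omega>)\<^sup>2)) \<longlonglongrightarrow> V"
    proof (rule Lim_transform[OF V'], rule Lim_null_comparison)
      show "\<forall>\<^sub>F n in sequentially. norm (expectation (\<lambda>\<omega>. (LN n \<omega>)\<^sup>2) - expectation (\<lambda>\<omega>. (L n \<omega>)\<^sup>2))
         \<le> 1 / real (Suc n) + 2 * sqrt (expectation (\<lambda>\<omega>. (L n \<omega>)\<^sup>2)) * sqrt (1 / real (Suc n))"
        using L2_second_moment_close[OF LL LLN err] by simp
      have "(\<lambda>n. 1 / real (Suc n) + 2 * sqrt (expectation (\<lambda>\<omega>. (L n \<omega>)\<^sup>2)) * sqrt (1 / real (Suc n))) \<longlonglongrightarrow> 0 + 2 * sqrt V * sqrt 0"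
        by (intro tendsto_intros V' inv0)
      then show "(\<lambda>n. 1 / real (Suc n) + 2 * sqrt (expectation (\<lambda>\<omega>. (L n \<omega>)\<^sup>2)) * sqrt (1 / real (Suc n))) \<longlonglongrightarrow> 0" by simp
    qed
    obtain K where K: "\<And>n. norm (expectation (\<lambda>\<omega>. (LN n \<omega>)\<^sup>2)) \<le> K"
      using convergent_imp_Bseq[OF convergentI[OF VN]] unfolding Bseq_def by blast
    \<comment> \<open>The squared weights are bounded because the variances converge; no direct
      estimate of the convolution is needed.\<close>
    have C: "(\<Sum>s\<in>S n. (c n s)\<^sup>2) \<le> K / sig2" for n
      using K[of n] s2 unfolding LN_sq by (simp add: field_simps)
    have c1: "(\<lambda>n. (CLINT \<omega>|M. iexp (LN n \<omega>)) - exp (- expectation (\<lambda>\<omega>. (LN n \<omega>)\<^sup>2) / 2)) \<longlonglongrightarrow> 0"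
      unfolding LN_sq unfolding LN by (rule mds_clt[OF _ c_le \<delta>0 C]) (simp add: S_def)
    have c2: "(\<lambda>n. complex_of_real (exp (- expectation (\<lambda>\<omega>. (LN n \<omega>)\<^sup>2) / 2))) \<longlonglongrightarrow> complex_of_real (exp (- V / 2))"
      by (intro tendsto_intros VN) auto
    have c3: "(\<lambda>n. (CLINT \<omega>|M. iexp (L n \<omega>)) - (CLINT \<omega>|M. iexp (LN n \<omega>))) \<longlonglongrightarrow> 0"
    proof (rule Lim_null_comparison)
      show "\<forall>\<^sub>F n in sequentially. norm ((CLINT \<omega>|M. iexp (L n \<omega>)) - (CLINT \<omega>|M. iexp (LN n \<omega>))) \<le> sqrt (1 / real (Suc n))"
        using order_trans[OF cf_diff_le[OF LL LLN] real_sqrt_le_mono[OF err]] by simp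
      have "(\<lambda>n. sqrt (1 / real (Suc n))) \<longlonglongrightarrow> sqrt 0" by (intro tendsto_intros inv0)
      then show "(\<lambda>n. sqrt (1 / real (Suc n))) \<longlonglongrightarrow> 0" by simp
    qed
    show ?thesis using tendsto_add[OF tendsto_add[OF c3 c1] c2] by (simp add: L_def)
  qed
qed

section \<open>Variance of the partial sums\<close>

text \<open>This is the squared constant \<lambda>_1^2 of the claim, not its root.\<close>

definition lam1 :: real where "lam1 = \<beta>\<^sup>2 * Beta d (1 - 2*d) * sig2"

definition lam2sq :: real where "lam2sq = lam1 / (d * (1 + 2*d))"

lemma acov_asymp: "(\<lambda>t. acov t * real t powr (1 - 2*d)) \<longlonglongrightarrow> lam1"
proof -
  have "(\<lambda>t. sig2 * ((\<Sum>j. b (Suc j) * b (Suc j + t)) * real t powr (1 - 2*d))) \<longlonglongrightarrow> sig2 * (\<beta>\<^sup>2 * Beta d (1 - 2*d))"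
    by (intro tendsto_intros coeff_autocorrelation_asymp[OF d beta b_asymp])
  then show ?thesis by (simp add: acov_def lam1_def mult_ac)
qed

text \<open>The variance of a sum of n consecutive terms, written by its increments, the form in
  which the double summation lemma takes it.\<close>

primrec var_sum :: "nat \<Rightarrow> real" where
  "var_sum 0 = 0"
| "var_sum (Suc n) = var_sum n + acov 0 + 2 * (\<Sum>k<n. acov (Suc k))"

lemma var_sum_eq: "expectation (\<lambda>\<omega>. (\<Sum>k\<in>{1..n}. X (u + int k) \<omega>)\<^sup>2) = var_sum n"
proof (induction n)
  case (Suc n)
  let ?S = "\<lambda>\<omega>. \<Sum>k\<in>{1..n}. X (u + int k) \<omega>"
  let ?x = "X (u + int (Suc n))"
  have LS: "L2 ?S" by (intro L2_sum L2_X)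
  have "(\<lambda>\<omega>. (\<Sum>k\<in>{1..Suc n}. X (u + int k) \<omega>)\<^sup>2) = (\<lambda>\<omega>. (?S \<omega>)\<^sup>2 + 2 * (?S \<omega> * ?x \<omega>) + (?x \<omega>)\<^sup>2)"
    by (simp add: fun_eq_iff power2_eq_square algebra_simps)
  then have "expectation (\<lambda>\<omega>. (\<Sum>k\<in>{1..Suc n}. X (u + int k) \<omega>)\<^sup>2) = var_sum n + 2 * expectation (\<lambda>\<omega>. ?S \<omega> * ?x \<omega>) + acov 0"
    using L2_sq[OF LS] L2_mult[OF LS L2_X] L2_sq[OF L2_X] Suc.IH by (simp add: X_sq acov_0)
  also have "expectation (\<lambda>\<omega>. ?S \<omega> * ?x \<omega>) = (\<Sum>k\<in>{1..n}. expectation (\<lambda>\<omega>. X (u + int k) \<omega> * ?x \<omega>))"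
    unfolding sum_distrib_right by (rule Bochner_Integration.integral_sum) (intro L2_mult L2_X)
  also have "\<dots> = (\<Sum>k\<in>{1..n}. acov (Suc n - k))"
  proof (intro sum.cong refl)
    fix k assume "k \<in> {1..n}"
    then have "u + int (Suc n) = (u + int k) + int (Suc n - k)" by auto
    then show "expectation (\<lambda>\<omega>. X (u + int k) \<omega> * ?x \<omega>) = acov (Suc n - k)" by (simp only: X_cov)
  qed
  also have "\<dots> = (\<Sum>k<n. acov (Suc k))"
    by (rule sum.reindex_bij_witness[of _ "\<lambda>k. n - k" "\<lambda>k. n - k"]) (auto simp: Suc_diff_le)
  finally show ?case by simp
qed simp

lemma var_sum_asymp: "(\<lambda>n. var_sum n / real n powr (2*d+1)) \<longlonglongrightarrow> lam2sq"
  unfolding lam2sq_def by (rule double_sum_asymp[OF d(1) acov_asymp]) simp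

lemma var_sum_bound: "\<exists>C\<ge>0. \<forall>n. var_sum n \<le> C * real n powr (2*d+1)"
proof -
  obtain C where C: "0 < C" "\<And>n. norm (var_sum n / real n powr (2*d+1)) \<le> C"
    using convergent_imp_Bseq[OF convergentI[OF var_sum_asymp]] unfolding Bseq_def by blast
  have "var_sum n \<le> C * real n powr (2*d+1)" for n
    using C(2)[of n] by (cases "n = 0") (auto simp: abs_divide divide_le_eq)
  then show ?thesis using C(1) by (intro exI[of _ C]) auto
qed

lemma lam1_nonneg: "0 \<le> lam1"
proof -
  have "0 < Beta d (1 - 2*d)" using d by (simp add: Beta_def Gamma_real_pos)
  then show ?thesis unfolding lam1_def using sig2_nonneg by simp
qed

lemma lam2sq_nonneg: "0 \<le> lam2sq" unfolding lam2sq_def using lam1_nonneg d by simp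

end

subsection \<open>The interpolated partial sums\<close>

definition ramp :: "real \<Rightarrow> real" where "ramp y = max 0 (min 1 y)"

text \<open>Linear interpolation as a weighted sum over a fixed range: weight 1 up to m, the
  fractional part at m + 1, then 0. In this form an interpolated path value is a linear statistic
  with weights in [0, 1], to which the central limit theorem applies.\<close>

lemma sum_ramp:
  assumes m: "real m \<le> x" "x \<le> real m + 1" and n: "m \<le> n" "x \<le> real n"
  shows "(\<Sum>k\<in>{1..n}. ramp (x - (real k - 1)) * f k) = (\<Sum>k\<in>{1..m}. f k) + (x - real m) * (f (Suc m) :: real)"
proof -
  have "(\<Sum>k\<in>{1..n}. ramp (x - (real k - 1)) * f k) =
    (\<Sum>k\<in>{1..n}. (if k \<in> {1..m} then f k else 0) + (if k = Suc m then (x - real m) * f k else 0))"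
  proof (rule sum.cong[OF refl])
    fix k assume "k \<in> {1..n}"
    consider "k \<le> m" | "k = Suc m" | "Suc (Suc m) \<le> k" by linarith
    then show "ramp (x - (real k - 1)) * f k = (if k \<in> {1..m} then f k else 0) + (if k = Suc m then (x - real m) * f k else 0)"
    proof cases
      case 1
      then have "real k \<le> real m" by simp
      then have "1 \<le> x - (real k - 1)" using m by linarith
      then show ?thesis using 1 \<open>k \<in> {1..n}\<close> by (simp add: ramp_def)
    next
      case 2
      then show ?thesis using m by (simp add: ramp_def)
    next
      case 3
      then have "real m + 2 \<le> real k" by linarith
      then have "x - (real k - 1) \<le> 0" using m by linarith
      then show ?thesis using 3 by (simp add: ramp_def)
    qed
  qed
  also have "\<dots> = (\<Sum>k\<in>{1..n}. if k \<in> {1..m} then f k else 0) + (\<Sum>k\<in>{1..n}. if k = Suc m then (x - real m) * f k else 0)"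
    by (rule sum.distrib)
  also have "(\<Sum>k\<in>{1..n}. if k \<in> {1..m} then f k else 0) = (\<Sum>k\<in>{1..m}. f k)"
    using n by (subst sum.inter_restrict[symmetric]) (auto intro!: sum.cong)
  also have "(\<Sum>k\<in>{1..n}. if k = Suc m then (x - real m) * f k else 0) = (x - real m) * f (Suc m)"
  \<comment> \<open>If m = n, the index m + 1 is outside the range, but then x = n and its
    coefficient is zero.\<close>
  proof (cases "m < n")
    case False
    then have "x = real m" using m n by simp
    then show ?thesis by simp
  qed (simp add: sum.delta)
  finally show ?thesis .
qed

context larch_solution
begin

abbreviation "hurst \<equiv> d + 1/2"

definition psum :: "nat \<Rightarrow> 'a \<Rightarrow> real" where "psum m \<omega> = (\<Sum>k\<in>{1..m}. X (int k) \<omega>)"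

definition interp_path :: "nat \<Rightarrow> 'a \<Rightarrow> real \<Rightarrow> real" where
  "interp_path n \<omega> \<tau> = real n powr (- d - 1/2) * (\<Sum>k\<in>{1..n}. ramp (real n * max 0 (min 1 \<tau>) - (real k - 1)) * X (int k) \<omega>)"

definition interp_sum :: "real \<Rightarrow> 'a \<Rightarrow> real" where
  "interp_sum x \<omega> = psum (nat \<lfloor>x\<rfloor>) \<omega> + (x - of_int \<lfloor>x\<rfloor>) * X (int (Suc (nat \<lfloor>x\<rfloor>))) \<omega>"

lemma interp_path_interp_sum: assumes "\<tau> \<in> {0..1}" shows "interp_path n \<omega> \<tau> = real n powr (- d - 1/2) * interp_sum (real n * \<tau>) \<omega>"
proof -
  define x where "x = real n * \<tau>"
  define m where "m = nat \<lfloor>x\<rfloor>"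
  have x: "0 \<le> x" "x \<le> real n" using assms by (auto simp: x_def mult_left_le)
  then have m: "real m = of_int \<lfloor>x\<rfloor>" by (simp add: m_def)
  have 1: "real m \<le> x" "x \<le> real m + 1" unfolding m by linarith+
  then have "m \<le> n" using x(2) by (metis of_nat_le_iff order_trans)
  from sum_ramp[OF 1 this x(2), of "\<lambda>k. X (int k) \<omega>"] show ?thesis
    using assms m by (simp add: interp_path_def interp_sum_def psum_def x_def[symmetric] m_def[symmetric])
qed

lemma L2_psum: "L2 (psum m)" unfolding psum_def[abs_def] by (intro L2_sum L2_X)

lemma L2_interp_sum: "L2 (interp_sum x)" unfolding interp_sum_def[abs_def] by (intro L2_add L2_psum L2_cmult L2_X)

lemma psum_diff: assumes "p \<le> q" shows "expectation (\<lambda>\<omega>. (psum q \<omega> - psum p \<omega>)\<^sup>2) = var_sum (q - p)"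
proof -
  have "psum q \<omega> - psum p \<omega> = (\<Sum>k\<in>{1..q - p}. X (int p + int k) \<omega>)" for \<omega>
  proof -
    have "{1..q} = {1..p} \<union> {p<..q}" "{1..p} \<inter> {p<..q} = {}" using assms by auto
    then have "psum q \<omega> = psum p \<omega> + (\<Sum>k\<in>{p<..q}. X (int k) \<omega>)" unfolding psum_def by (simp add: sum.union_disjoint)
    moreover have "(\<Sum>k\<in>{p<..q}. X (int k) \<omega>) = (\<Sum>k\<in>{1..q - p}. X (int p + int k) \<omega>)"
      by (rule sum.reindex_bij_witness[of _ "\<lambda>k. p + k" "\<lambda>k. k - p"]) auto
    ultimately show ?thesis by simp
  qed
  then show ?thesis using var_sum_eq[where u = "int p" and n = "q - p"] by simp
qed

lemma cX_sq: "expectation (\<lambda>\<omega>. (c * X t \<omega>)\<^sup>2) = c\<^sup>2 * acov 0"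
  by (simp add: power_mult_distrib X_sq acov_0)

text \<open>Inside one unit interval the path is linear, and its squared increment is of order u^2.
  Since 2d + 1 \<le> 2, this is below the power that governs long increments.\<close>

lemma sq_le_powr: assumes "0 \<le> u" "u \<le> 1" "u \<le> v" shows "u\<^sup>2 \<le> v powr (2*d+1)"
proof (cases "u = 0")
  case False
  then have "u\<^sup>2 = u powr 2" using assms by (simp add: powr_numeral)
  also have "\<dots> \<le> u powr (2*d+1)" using assms d by (intro powr_mono') auto
  also have "\<dots> \<le> v powr (2*d+1)" using assms d by (intro powr_mono2) auto
  finally show ?thesis .
qed simp

lemma acov_0_nonneg: "0 \<le> acov 0" using acov_0 sig2_nonneg B2_nonneg by simp

text \<open>An increment across integers splits into two fractional end pieces and a block of whole
  terms; the latter has variance \<open>var_sum\<close>, the pieces are handled by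
  \<open>sq_le_powr\<close>.\<close>

lemma interp_sum_increment:
  "\<exists>C\<ge>0. \<forall>x y. 0 \<le> x \<longrightarrow> x \<le> y \<longrightarrow> expectation (\<lambda>\<omega>. (interp_sum y \<omega> - interp_sum x \<omega>)\<^sup>2) \<le> C * (y - x) powr (2*d+1)"
proof -
  obtain CV where CV: "0 \<le> CV" "\<And>n. var_sum n \<le> CV * real n powr (2*d+1)" using var_sum_bound by blast
  define C where "C = 3 * (2 * acov 0 + CV)"
  have r0: "0 \<le> acov 0" by (rule acov_0_nonneg)
  have "expectation (\<lambda>\<omega>. (interp_sum y \<omega> - interp_sum x \<omega>)\<^sup>2) \<le> C * (y - x) powr (2*d+1)" if xy: "0 \<le> x" "x \<le> y" for x y
  proof -
    define p where "p = nat \<lfloor>x\<rfloor>"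
    define q where "q = nat \<lfloor>y\<rfloor>"
    have fl: "of_int \<lfloor>x\<rfloor> = real p" "of_int \<lfloor>y\<rfloor> = real q" using xy by (auto simp: p_def q_def)
    have px: "real p \<le> x" "x < real p + 1" and qy: "real q \<le> y" "y < real q + 1" using fl by linarith+
    have pq: "p \<le> q" unfolding p_def q_def using xy by (intro nat_mono floor_mono)
    have Gx: "interp_sum x \<omega> = psum p \<omega> + (x - real p) * X (int (Suc p)) \<omega>" and Gy: "interp_sum y \<omega> = psum q \<omega> + (y - real q) * X (int (Suc q)) \<omega>" for \<omega>
      unfolding interp_sum_def fl p_def q_def by simp_all
    show ?thesis
    proof (cases "p = q")
      case True
      have "expectation (\<lambda>\<omega>. (interp_sum y \<omega> - interp_sum x \<omega>)\<^sup>2) = expectation (\<lambda>\<omega>. ((y - x) * X (int (Suc q)) \<omega>)\<^sup>2)"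
        unfolding Gx Gy True by (simp add: algebra_simps)
      also have "\<dots> = (y - x)\<^sup>2 * acov 0" by (rule cX_sq)
      also have "\<dots> \<le> (y - x) powr (2*d+1) * acov 0" using xy px qy True by (intro mult_right_mono sq_le_powr r0) auto
      also have "\<dots> \<le> C * (y - x) powr (2*d+1)" unfolding C_def mult.commute[of _ "acov 0"] using r0 CV by (intro mult_right_mono) auto
      finally show ?thesis .
    next
      case False
      then have pq': "Suc p \<le> q" using pq by simp
      then have rpq: "real p + 1 \<le> real q" by linarith
      have TS: "psum (Suc p) \<omega> = psum p \<omega> + X (int (Suc p)) \<omega>" for \<omega> by (simp add: psum_def)
      have e: "interp_sum y \<omega> - interp_sum x \<omega> = (y - real q) * X (int (Suc q)) \<omega> + (psum q \<omega> - psum (Suc p) \<omega>) + (real p + 1 - x) * X (int (Suc p)) \<omega>" for \<omega>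
        unfolding Gx Gy TS by (simp add: algebra_simps)
      have "expectation (\<lambda>\<omega>. (interp_sum y \<omega> - interp_sum x \<omega>)\<^sup>2) \<le> 3 * (expectation (\<lambda>\<omega>. ((y - real q) * X (int (Suc q)) \<omega>)\<^sup>2)
          + expectation (\<lambda>\<omega>. (psum q \<omega> - psum (Suc p) \<omega>)\<^sup>2) + expectation (\<lambda>\<omega>. ((real p + 1 - x) * X (int (Suc p)) \<omega>)\<^sup>2))"
        unfolding e by (intro L2_triangle3 L2_cmult L2_X L2_diff L2_psum)
      also have "\<dots> = 3 * ((y - real q)\<^sup>2 * acov 0 + var_sum (q - Suc p) + (real p + 1 - x)\<^sup>2 * acov 0)"
        unfolding cX_sq psum_diff[OF pq'] ..
      also have "\<dots> \<le> 3 * ((y - x) powr (2*d+1) * acov 0 + CV * (y - x) powr (2*d+1) + (y - x) powr (2*d+1) * acov 0)"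
      proof (intro mult_left_mono add_mono mult_right_mono sq_le_powr r0)
        have "var_sum (q - Suc p) \<le> CV * real (q - Suc p) powr (2*d+1)" by (rule CV)
        also have "\<dots> \<le> CV * (y - x) powr (2*d+1)"
          using pq' px qy d CV(1) by (intro mult_left_mono powr_mono2) (auto simp: of_nat_diff)
        finally show "var_sum (q - Suc p) \<le> CV * (y - x) powr (2*d+1)" .
      qed (use px qy rpq in auto)
      also have "\<dots> = C * (y - x) powr (2*d+1)" by (simp add: C_def algebra_simps)
      finally show ?thesis .
    qed
  qed
  moreover have "0 \<le> C" unfolding C_def using r0 CV by simp
  ultimately show ?thesis by blast
qed

lemma norm_sq: "(real n powr (- d - 1/2))\<^sup>2 = real n powr (- (2*d+1))"
  by (simp add: power2_eq_square powr_add[symmetric])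

lemma L2_interp_path: "\<tau> \<in> {0..1} \<Longrightarrow> L2 (\<lambda>\<omega>. interp_path n \<omega> \<tau>)"
  by (simp add: interp_path_interp_sum L2_cmult L2_interp_sum)

lemma interp_path_increment:
  "\<exists>C\<ge>0. \<forall>n. \<forall>s\<in>{0..1}. \<forall>t\<in>{0..1}. s \<le> t \<longrightarrow> expectation (\<lambda>\<omega>. (interp_path n \<omega> t - interp_path n \<omega> s)\<^sup>2) \<le> C * (t - s) powr (2*d+1)"
proof -
  obtain C where C: "0 \<le> C" "\<And>x y. 0 \<le> x \<Longrightarrow> x \<le> y \<Longrightarrow> expectation (\<lambda>\<omega>. (interp_sum y \<omega> - interp_sum x \<omega>)\<^sup>2) \<le> C * (y - x) powr (2*d+1)"
    using interp_sum_increment by blast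
  have "expectation (\<lambda>\<omega>. (interp_path n \<omega> t - interp_path n \<omega> s)\<^sup>2) \<le> C * (t - s) powr (2*d+1)" if "s \<in> {0..1}" "t \<in> {0..1}" "s \<le> t" for n s t
  proof (cases "n = 0")
    case True
    then show ?thesis using C by (simp add: interp_path_def)
  next
    case False
    have "expectation (\<lambda>\<omega>. (interp_path n \<omega> t - interp_path n \<omega> s)\<^sup>2) = real n powr (- (2*d+1)) * expectation (\<lambda>\<omega>. (interp_sum (real n * t) \<omega> - interp_sum (real n * s) \<omega>)\<^sup>2)"
      using that by (simp add: interp_path_interp_sum right_diff_distrib[symmetric] power_mult_distrib norm_sq)
    also have "\<dots> \<le> real n powr (- (2*d+1)) * (C * (real n * t - real n * s) powr (2*d+1))"
      using that by (intro mult_left_mono C) (auto intro: mult_left_mono)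
    also have "(real n * t - real n * s) powr (2*d+1) = real n powr (2*d+1) * (t - s) powr (2*d+1)"
      using that by (simp add: right_diff_distrib[symmetric] powr_mult)
    also have "real n powr (- (2*d+1)) * (C * (real n powr (2*d+1) * (t - s) powr (2*d+1))) =
      (real n powr (- (2*d+1)) * real n powr (2*d+1)) * (C * (t - s) powr (2*d+1))" by simp
    also have "real n powr (- (2*d+1)) * real n powr (2*d+1) = 1" using False by (simp add: powr_add[symmetric])
    finally show ?thesis by simp
  qed
  then show ?thesis using C(1) by blast
qed

lemma interp_path_continuous: "continuous_on {0..1} (interp_path n \<omega>)"
  unfolding interp_path_def[abs_def] ramp_def by (intro continuous_intros)

lemma interp_path_0: "interp_path n \<omega> 0 = 0"
  by (simp add: interp_path_def ramp_def)

text \<open>Hoelder order d/2. Second moments with exponent 2d + 1 allow every order below d; any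
  \<open>\<theta>\<close> strictly between 2^(-d) and 1 would serve.\<close>

definition \<theta> :: real where "\<theta> = (1/2) powr (d/2)"

lemma theta: "0 < \<theta>" "\<theta> < 1" "(1/2) powr (2*d) < \<theta>\<^sup>2"
proof -
  show "0 < \<theta>" by (simp add: \<theta>_def)
  have "(1/2::real) powr (d/2) < (1/2) powr 0" using d by (intro powr_less_mono') auto
  then show "\<theta> < 1" by (simp add: \<theta>_def)
  have "\<theta>\<^sup>2 = (1/2) powr d" by (simp add: \<theta>_def power2_eq_square powr_add[symmetric])
  moreover have "(1/2::real) powr (2*d) < (1/2) powr d" using d by (intro powr_less_mono') auto
  ultimately show "(1/2) powr (2*d) < \<theta>\<^sup>2" by simp
qed

text \<open>The increment bound at scale 2^(-m) is \<open>C * (1/2)^m * \<rho>^m\<close> for all n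
  at once, so the chaining event and the modulus have constants free of n.\<close>

lemma interp_path_tight:
  assumes e: "0 < e"
  shows "\<exists>A. \<forall>n. \<exists>E\<in>sets M. prob E \<ge> 1 - e \<and> (\<forall>\<omega>\<in>E. interp_path n \<omega> \<in> holder_paths \<theta> A)"
proof -
  obtain C where C: "0 \<le> C" "\<And>n s t. s \<in> {0..1} \<Longrightarrow> t \<in> {0..1} \<Longrightarrow> s \<le> t \<Longrightarrow> expectation (\<lambda>\<omega>. (interp_path n \<omega> t - interp_path n \<omega> s)\<^sup>2) \<le> C * (t - s) powr (2*d+1)"
    using interp_path_increment by blast
  define \<rho> where "\<rho> = (1/2::real) powr (2*d)"
  define D where "D = C / (1 - \<rho> / \<theta>\<^sup>2)"
  have \<rho>: "0 \<le> \<rho>" "\<rho> < \<theta>\<^sup>2" using theta by (auto simp: \<rho>_def)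
  then have D: "0 \<le> D" using C(1) theta(1) by (simp add: D_def)
  \<comment> \<open>Chosen so that the exceptional mass \<open>D / A\<^sup>2\<close> is at most
    \<open>e\<close>; the 1 keeps \<open>A\<close> positive when \<open>D = 0\<close>.\<close>
  define A where "A = sqrt ((D + 1) / e)"
  have A: "0 < A" "D / A\<^sup>2 \<le> e"
  proof -
    show "0 < A" using D e by (simp add: A_def)
    have "A\<^sup>2 = (D + 1) / e" using D e by (simp add: A_def)
    then have "D \<le> e * A\<^sup>2" using e by simp
    then show "D / A\<^sup>2 \<le> e" using \<open>0 < A\<close> by (simp add: divide_le_eq)
  qed
  have "\<exists>E\<in>sets M. prob E \<ge> 1 - e \<and> (\<forall>\<omega>\<in>E. interp_path n \<omega> \<in> holder_paths \<theta> (3 * A / (1 - \<theta>)))" for n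
  proof -
    have "\<exists>E\<in>sets M. prob E \<ge> 1 - C / (A\<^sup>2 * (1 - \<rho> / \<theta>\<^sup>2)) \<and>
      (\<forall>\<omega>\<in>E. \<forall>m. \<forall>k<2^m. \<bar>interp_path n \<omega> (real (Suc k) / 2^m) - interp_path n \<omega> (real k / 2^m)\<bar> \<le> A * \<theta>^m)"
    proof (rule dyadic_increments_event[where Y = "\<lambda>t \<omega>. interp_path n \<omega> t", OF _ _ _ \<rho> theta(1) A(1)])
      show "(\<lambda>\<omega>. interp_path n \<omega> t) \<in> borel_measurable M" if "t \<in> {0..1}" for t by (rule L2_meas[OF L2_interp_path[OF that]])
      fix m k :: nat assume k: "k < 2^m"
      have "real (Suc k) \<le> 2^m" using k by (metis Suc_leI of_nat_le_iff of_nat_numeral of_nat_power)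
      then have u: "real (Suc k) / 2^m \<in> {0..1}" "real k / 2^m \<in> {0..1}" using k by auto
      show "integrable M (\<lambda>\<omega>. (interp_path n \<omega> (real (Suc k) / 2^m) - interp_path n \<omega> (real k / 2^m))\<^sup>2)"
        by (rule L2_sq[OF L2_diff[OF L2_interp_path[OF u(1)] L2_interp_path[OF u(2)]]])
      have "expectation (\<lambda>\<omega>. (interp_path n \<omega> (real (Suc k) / 2^m) - interp_path n \<omega> (real k / 2^m))\<^sup>2) \<le> C * (real (Suc k) / 2^m - real k / 2^m) powr (2*d+1)"
        by (rule C(2)[OF u(2,1)]) (simp add: divide_right_mono)
      also have "real (Suc k) / 2^m - real k / 2^m = (1/2)^m" by (simp add: diff_divide_distrib[symmetric] power_divide)
      also have "((1/2)^m) powr (2*d+1) = ((1/2::real) powr real m) powr (2*d+1)" by (simp add: powr_realpow)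
      also have "\<dots> = (1/2) powr real m * ((1/2) powr (2*d)) powr real m"
        by (simp add: powr_powr powr_add[symmetric] algebra_simps)
      also have "\<dots> = (1/2)^m * \<rho>^m" by (simp add: powr_realpow \<rho>_def)
      finally show "expectation (\<lambda>\<omega>. (interp_path n \<omega> (real (Suc k) / 2^m) - interp_path n \<omega> (real k / 2^m))\<^sup>2) \<le> C * (1/2)^m * \<rho>^m"
        by (simp add: mult.assoc)
    qed
    then obtain E where E: "E \<in> sets M" "prob E \<ge> 1 - C / (A\<^sup>2 * (1 - \<rho> / \<theta>\<^sup>2))"
      "\<And>\<omega> m k. \<omega> \<in> E \<Longrightarrow> k < 2^m \<Longrightarrow> \<bar>interp_path n \<omega> (real (Suc k) / 2^m) - interp_path n \<omega> (real k / 2^m)\<bar> \<le> A * \<theta>^m" by blast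
    have "C / (A\<^sup>2 * (1 - \<rho> / \<theta>\<^sup>2)) = D / A\<^sup>2" by (simp add: D_def)
    then have "prob E \<ge> 1 - e" using E(2) A(2) by linarith
    moreover have "interp_path n \<omega> \<in> holder_paths \<theta> (3 * A / (1 - \<theta>))" if "\<omega> \<in> E" for \<omega>
    proof -
      have md: "\<bar>interp_path n \<omega> s - interp_path n \<omega> t\<bar> \<le> 3 * A / (1 - \<theta>) * \<theta>^m" if st: "s \<in> {0..1}" "t \<in> {0..1}" "\<bar>s - t\<bar> \<le> (1/2)^m" for s t m
        using E(3)[OF \<open>\<omega> \<in> E\<close>] theta A(1) by (intro dyadic_modulus_continuous st interp_path_continuous) auto
      have Yc: "interp_path n \<omega> t = interp_path n \<omega> (max 0 (min 1 t))" for t by (simp add: interp_path_def)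
      show ?thesis
      proof (rule holder_pathsI)
        show "interp_path n \<omega> t = interp_path n \<omega> (max 0 (min 1 t))" for t by (rule Yc)
        show "\<bar>interp_path n \<omega> t\<bar> \<le> 3 * A / (1 - \<theta>)" for t
          using md[of "max 0 (min 1 t)" 0 0] interp_path_0 by (subst Yc) simp
      qed (use md in auto)
    qed
    ultimately show ?thesis using E(1) by blast
  qed
  then show ?thesis by blast
qed

definition sum_path :: "nat \<Rightarrow> 'a \<Rightarrow> real \<Rightarrow> real" where
  "sum_path n \<omega> \<tau> = real n powr (- d - 1/2) * psum (nat \<lfloor>real n * \<tau>\<rfloor>) \<omega>"

text \<open>The two paths differ by at most one normalised term, so it is enough that no |X k| with
  k \<le> n exceeds \<delta> n^(d+1/2). A union bound over n terms leaves n * n^(-(2d+1)) =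
  n^(-2d).\<close>

lemma interp_path_near_sum_path:
  assumes e: "0 < e" and \<delta>: "0 < \<delta>"
  shows "\<forall>\<^sub>F n in sequentially. \<exists>E\<in>sets M. prob E \<ge> 1 - e \<and> (\<forall>\<omega>\<in>E. \<forall>t\<in>{0..1}. \<bar>interp_path n \<omega> t - sum_path n \<omega> t\<bar> \<le> \<delta>)"
proof -
  have "(\<lambda>n. acov 0 / \<delta>\<^sup>2 * real n powr (- (2*d))) \<longlonglongrightarrow> acov 0 / \<delta>\<^sup>2 * 0" using d by (intro tendsto_intros) real_asymp
  then have "\<forall>\<^sub>F n in sequentially. acov 0 / \<delta>\<^sup>2 * real n powr (- (2*d)) < e" using e by (intro order_tendstoD) auto
  then show ?thesis using eventually_gt_at_top[of 0]
  proof eventually_elim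
    case (elim n)
    define h where "h = real n powr (- d - 1/2)"
    have h: "0 < h" using elim by (simp add: h_def)
    define F where "F k = {\<omega> \<in> space M. (\<delta> / h)\<^sup>2 \<le> (X (int k) \<omega>)\<^sup>2}" for k
    note [measurable] = X_M
    have Fs: "F k \<in> sets M" for k unfolding F_def by measurable
    have Fp: "prob (F k) \<le> acov 0 / (\<delta> / h)\<^sup>2" for k
    proof -
      have "prob (F k) \<le> expectation (\<lambda>\<omega>. (X (int k) \<omega>)\<^sup>2) / (\<delta> / h)\<^sup>2"
        unfolding F_def using \<delta> h by (intro integral_Markov_inequality_measure[where A="{}"] X_L2) auto
      then show ?thesis by (simp add: X_sq acov_0)
    qed
    define U where "U = (\<Union>k\<in>{1..n}. F k)"
    have Us: "U \<in> sets M" unfolding U_def using Fs by auto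
    have "prob U \<le> (\<Sum>k\<in>{1..n}. prob (F k))" unfolding U_def by (rule finite_measure_subadditive_finite) (use Fs in auto)
    also have "\<dots> \<le> (\<Sum>k\<in>{1..n}. acov 0 / (\<delta> / h)\<^sup>2)" by (intro sum_mono Fp)
    also have "\<dots> = acov 0 / \<delta>\<^sup>2 * (real n * h\<^sup>2)" by (simp add: power_divide)
    also have "real n * h\<^sup>2 = real n powr (- (2*d))"
    proof -
      have "real n * h\<^sup>2 = real n powr 1 * real n powr (- (2*d+1))" unfolding h_def norm_sq using elim by simp
      also have "\<dots> = real n powr (1 + (- (2*d+1)))" by (rule powr_add[symmetric])
      finally show ?thesis by simp
    qed
    finally have "prob U \<le> e" using elim by simp
    then have "prob (space M - U) \<ge> 1 - e" using Us by (simp add: prob_compl)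
    moreover have "\<bar>interp_path n \<omega> t - sum_path n \<omega> t\<bar> \<le> \<delta>" if w: "\<omega> \<in> space M - U" and t: "t \<in> {0..1}" for \<omega> t
    proof -
      define x where "x = real n * t"
      define m where "m = nat \<lfloor>x\<rfloor>"
      have x: "0 \<le> x" "x \<le> real n" using t by (auto simp: x_def mult_left_le)
      then have m: "real m = of_int \<lfloor>x\<rfloor>" by (simp add: m_def)
      have 1: "real m \<le> x" "x < real m + 1" unfolding m by linarith+
      have "interp_path n \<omega> t - sum_path n \<omega> t = h * ((x - real m) * X (int (Suc m)) \<omega>)"
        unfolding interp_path_interp_sum[OF t] sum_path_def interp_sum_def x_def[symmetric] m[symmetric] m_def[symmetric] h_def by (simp add: algebra_simps)
      moreover have "\<bar>h * ((x - real m) * X (int (Suc m)) \<omega>)\<bar> \<le> \<delta>"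
      \<comment> \<open>Only terms up to index n are controlled; at t = 1 the next index is n + 1,
        but then the fractional part is zero.\<close>
      proof (cases "m < n")
        case True
        then have "\<omega> \<notin> F (Suc m)" using w by (auto simp: U_def)
        then have "\<not> (\<delta> / h)\<^sup>2 \<le> (X (int (Suc m)) \<omega>)\<^sup>2" using w by (auto simp: F_def)
        then have "\<bar>X (int (Suc m)) \<omega>\<bar>\<^sup>2 \<le> (\<delta> / h)\<^sup>2" by simp
        then have "\<bar>X (int (Suc m)) \<omega>\<bar> \<le> \<delta> / h" using \<delta> h by (intro power2_le_imp_le[of "\<bar>X (int (Suc m)) \<omega>\<bar>"]) auto
        then have "(x - real m) * \<bar>X (int (Suc m)) \<omega>\<bar> \<le> 1 * (\<delta> / h)" using 1 by (intro mult_mono) auto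
        then have "h * ((x - real m) * \<bar>X (int (Suc m)) \<omega>\<bar>) \<le> h * (\<delta> / h)" using h by (intro mult_left_mono) auto
        then show ?thesis using h 1 by (simp add: abs_mult)
      next
        case False
        then have "x = real m" using 1 x by linarith
        then show ?thesis using \<delta> by simp
      qed
      ultimately show ?thesis by simp
    qed
    ultimately show ?case using Us by (intro bexI[of _ "space M - U"]) auto
  qed
qed

section \<open>Finite-dimensional limits of the interpolated paths\<close>

text \<open>An increment of the step path is a sum of \<open>m n\<close> consecutive terms with
  \<open>m n\<close> / n tending to t - s, so the variance asymptotics apply; passing to the
  interpolation costs an error of order n^(-(2d+1)) in mean square.\<close>

lemma interp_path_increment_tendsto:
  assumes st: "s \<in> {0..1}" "t \<in> {0..1}" "s \<le> t"
  shows "(\<lambda>n. expectation (\<lambda>\<omega>. (interp_path n \<omega> t - interp_path n \<omega> s)\<^sup>2)) \<longlonglongrightarrow> lam2sq * (t - s) powr (2*d+1)"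
proof -
  define m where "m n = nat \<lfloor>real n * t\<rfloor> - nat \<lfloor>real n * s\<rfloor>" for n
  have le: "nat \<lfloor>real n * s\<rfloor> \<le> nat \<lfloor>real n * t\<rfloor>" for n using st by (intro nat_mono floor_mono mult_left_mono) auto
  have L2S: "L2 (\<lambda>\<omega>. sum_path n \<omega> u)" for n u unfolding sum_path_def by (intro L2_cmult L2_psum)
  have SX2: "expectation (\<lambda>\<omega>. (sum_path n \<omega> t - sum_path n \<omega> s)\<^sup>2) = real n powr (- (2*d+1)) * var_sum (m n)" for n
    unfolding sum_path_def right_diff_distrib[symmetric] power_mult_distrib norm_sq m_def using psum_diff[OF le] by simp
  have lim1: "(\<lambda>n. real n powr (- (2*d+1)) * var_sum (m n)) \<longlonglongrightarrow> lam2sq * (t - s) powr (2*d+1)"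
  proof (cases "s = t")
    case True
    then show ?thesis by (simp add: m_def)
  next
    case False
    then have u: "0 < t - s" using st by simp
    have rm: "real (m n) = of_int \<lfloor>real n * t\<rfloor> - of_int \<lfloor>real n * s\<rfloor>" for n
      using le[of n] st by (simp add: m_def of_nat_diff)
    have lo: "real n * (t - s) - 1 \<le> real (m n)" and hi: "real (m n) \<le> real n * (t - s) + 1" for n
      unfolding rm right_diff_distrib by linarith+
    have q: "(\<lambda>n. real (m n) / real n) \<longlonglongrightarrow> t - s"
    proof (rule real_tendsto_sandwich)
      show "\<forall>\<^sub>F n in sequentially. (real n * (t - s) - 1) / real n \<le> real (m n) / real n"
        using lo by (intro always_eventually allI divide_right_mono) auto
      show "\<forall>\<^sub>F n in sequentially. real (m n) / real n \<le> (real n * (t - s) + 1) / real n"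
        using hi by (intro always_eventually allI divide_right_mono) auto
      show "(\<lambda>n. (real n * (t - s) - 1) / real n) \<longlonglongrightarrow> t - s" by real_asymp
      show "(\<lambda>n. (real n * (t - s) + 1) / real n) \<longlonglongrightarrow> t - s" by real_asymp
    qed
    have "filterlim (\<lambda>n. real n * (t - s) - 1) at_top sequentially" using u by real_asymp
    then have "filterlim (\<lambda>n. real (m n)) at_top sequentially"
      by (rule filterlim_at_top_mono) (use lo in auto)
    then have minf: "filterlim m at_top sequentially" by (simp add: filterlim_sequentially_iff_filterlim_real)
    have "(\<lambda>n. var_sum (m n) / real (m n) powr (2*d+1) * (real (m n) / real n) powr (2*d+1)) \<longlonglongrightarrow> lam2sq * (t - s) powr (2*d+1)"
      using u by (intro tendsto_intros filterlim_compose[OF var_sum_asymp minf] q) auto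
    moreover have "var_sum (m n) / real (m n) powr (2*d+1) * (real (m n) / real n) powr (2*d+1) = real n powr (- (2*d+1)) * var_sum (m n)" for n
      unfolding powr_minus_divide by (cases "m n = 0") (auto simp: powr_divide)
    ultimately show ?thesis by simp
  qed
  \<comment> \<open>Two endpoints, each with one normalised term of variance at most
    \<open>acov 0\<close>, and a factor 2 for squaring a sum.\<close>
  let ?e = "\<lambda>n. 4 * (real n powr (- (2*d+1)) * acov 0)"
  have e0: "?e \<longlonglongrightarrow> 0"
  proof -
    have "?e \<longlonglongrightarrow> 4 * (0 * acov 0)" using d by (intro tendsto_intros) real_asymp
    then show ?thesis by simp
  qed
  have YS: "expectation (\<lambda>\<omega>. (interp_path n \<omega> u - sum_path n \<omega> u)\<^sup>2) \<le> real n powr (- (2*d+1)) * acov 0" if u: "u \<in> {0..1}" for n u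
  proof -
    define f where "f = real n * u - of_int \<lfloor>real n * u\<rfloor>"
    have f: "0 \<le> f" "f \<le> 1" unfolding f_def by linarith+
    have "interp_path n \<omega> u - sum_path n \<omega> u = real n powr (- d - 1/2) * (f * X (int (Suc (nat \<lfloor>real n * u\<rfloor>))) \<omega>)" for \<omega>
      unfolding interp_path_interp_sum[OF u] sum_path_def interp_sum_def f_def[symmetric] by (simp add: algebra_simps)
    then have "expectation (\<lambda>\<omega>. (interp_path n \<omega> u - sum_path n \<omega> u)\<^sup>2) = expectation (\<lambda>\<omega>. (real n powr (- d - 1/2))\<^sup>2 * (f * X (int (Suc (nat \<lfloor>real n * u\<rfloor>))) \<omega>)\<^sup>2)"
      by (simp only: power_mult_distrib[of "real n powr _"])
    also have "\<dots> = real n powr (- (2*d+1)) * (f\<^sup>2 * acov 0)"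
      by (simp only: integral_mult_right_zero cX_sq norm_sq)
    also have "f\<^sup>2 * acov 0 \<le> 1 * acov 0" using f by (intro mult_right_mono acov_0_nonneg) (simp add: power_le_one)
    finally show ?thesis by (simp add: mult_left_mono)
  qed
  have err: "expectation (\<lambda>\<omega>. ((sum_path n \<omega> t - sum_path n \<omega> s) - (interp_path n \<omega> t - interp_path n \<omega> s))\<^sup>2) \<le> ?e n" for n
  proof -
    have "expectation (\<lambda>\<omega>. ((sum_path n \<omega> t - sum_path n \<omega> s) - (interp_path n \<omega> t - interp_path n \<omega> s))\<^sup>2) =
      expectation (\<lambda>\<omega>. ((sum_path n \<omega> t - interp_path n \<omega> t) + (interp_path n \<omega> s - sum_path n \<omega> s))\<^sup>2)" by (simp add: algebra_simps)
    also have "\<dots> \<le> 2 * (expectation (\<lambda>\<omega>. (sum_path n \<omega> t - interp_path n \<omega> t)\<^sup>2) + expectation (\<lambda>\<omega>. (interp_path n \<omega> s - sum_path n \<omega> s)\<^sup>2))"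
      by (intro L2_triangle2 L2_diff L2S L2_interp_path st)
    also have "\<dots> \<le> ?e n" using YS[OF st(1), of n] YS[OF st(2), of n] by (simp add: power2_commute)
    finally show ?thesis .
  qed
  have LS: "L2 (\<lambda>\<omega>. sum_path n \<omega> t - sum_path n \<omega> s)" and LY: "L2 (\<lambda>\<omega>. interp_path n \<omega> t - interp_path n \<omega> s)" for n
    by (intro L2_diff L2S L2_interp_path st)+
  have S2: "(\<lambda>n. expectation (\<lambda>\<omega>. (sum_path n \<omega> t - sum_path n \<omega> s)\<^sup>2)) \<longlonglongrightarrow> lam2sq * (t - s) powr (2*d+1)"
    unfolding SX2 by (rule lim1)
  show ?thesis
  proof (rule Lim_transform[OF S2], rule Lim_null_comparison)
    show "\<forall>\<^sub>F n in sequentially. norm (expectation (\<lambda>\<omega>. (interp_path n \<omega> t - interp_path n \<omega> s)\<^sup>2) - expectation (\<lambda>\<omega>. (sum_path n \<omega> t - sum_path n \<omega> s)\<^sup>2))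
      \<le> ?e n + 2 * sqrt (expectation (\<lambda>\<omega>. (sum_path n \<omega> t - sum_path n \<omega> s)\<^sup>2)) * sqrt (?e n)"
      using L2_second_moment_close[OF LS LY err] by (intro always_eventually allI) (simp only: real_norm_def)
    have "(\<lambda>n. ?e n + 2 * sqrt (expectation (\<lambda>\<omega>. (sum_path n \<omega> t - sum_path n \<omega> s)\<^sup>2)) * sqrt (?e n)) \<longlonglongrightarrow> 0 + 2 * sqrt (lam2sq * (t - s) powr (2*d+1)) * sqrt 0"
      by (intro tendsto_add tendsto_mult tendsto_const tendsto_real_sqrt S2 e0)
    then show "(\<lambda>n. ?e n + 2 * sqrt (expectation (\<lambda>\<omega>. (sum_path n \<omega> t - sum_path n \<omega> s)\<^sup>2)) * sqrt (?e n)) \<longlonglongrightarrow> 0" by simp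
  qed
qed

text \<open>Polarisation: variances of increments determine the covariance, exactly as in the
  formula for \<open>fbm_cov\<close>.\<close>

lemma interp_path_cov_tendsto:
  assumes st: "s \<in> {0..1}" "t \<in> {0..1}"
  shows "(\<lambda>n. expectation (\<lambda>\<omega>. interp_path n \<omega> s * interp_path n \<omega> t)) \<longlonglongrightarrow> lam2sq * fbm_cov hurst s t"
proof -
  have 0: "(0::real) \<in> {0..1}" by simp
  have sq: "(\<lambda>n. expectation (\<lambda>\<omega>. (interp_path n \<omega> u)\<^sup>2)) \<longlonglongrightarrow> lam2sq * u powr (2*d+1)" if "u \<in> {0..1}" for u
    using interp_path_increment_tendsto[OF 0 that] that by (simp add: interp_path_0)
  have df: "(\<lambda>n. expectation (\<lambda>\<omega>. (interp_path n \<omega> t - interp_path n \<omega> s)\<^sup>2)) \<longlonglongrightarrow> lam2sq * \<bar>t - s\<bar> powr (2*d+1)"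
  proof (cases "s \<le> t")
    case True
    then show ?thesis using interp_path_increment_tendsto[OF st] by simp
  next
    case False
    then show ?thesis using interp_path_increment_tendsto[OF st(2,1)] by (simp add: power2_commute abs_minus_commute)
  qed
  have e: "expectation (\<lambda>\<omega>. interp_path n \<omega> s * interp_path n \<omega> t) = (expectation (\<lambda>\<omega>. (interp_path n \<omega> s)\<^sup>2) + expectation (\<lambda>\<omega>. (interp_path n \<omega> t)\<^sup>2) - expectation (\<lambda>\<omega>. (interp_path n \<omega> t - interp_path n \<omega> s)\<^sup>2)) / 2" for n
  proof -
    note L = L2_interp_path[OF st(1), of n] L2_interp_path[OF st(2), of n]
    have "(\<lambda>\<omega>. (interp_path n \<omega> t - interp_path n \<omega> s)\<^sup>2) = (\<lambda>\<omega>. (interp_path n \<omega> s)\<^sup>2 + (interp_path n \<omega> t)\<^sup>2 - 2 * (interp_path n \<omega> s * interp_path n \<omega> t))"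
      by (simp add: fun_eq_iff power2_eq_square algebra_simps)
    then have "expectation (\<lambda>\<omega>. (interp_path n \<omega> t - interp_path n \<omega> s)\<^sup>2) = expectation (\<lambda>\<omega>. (interp_path n \<omega> s)\<^sup>2) + expectation (\<lambda>\<omega>. (interp_path n \<omega> t)\<^sup>2) - 2 * expectation (\<lambda>\<omega>. interp_path n \<omega> s * interp_path n \<omega> t)"
      using L2_sq[OF L(1)] L2_sq[OF L(2)] L2_mult[OF L] by simp
    then show ?thesis by simp
  qed
  have "(\<lambda>n. expectation (\<lambda>\<omega>. interp_path n \<omega> s * interp_path n \<omega> t)) \<longlonglongrightarrow>
     (lam2sq * s powr (2*d+1) + lam2sq * t powr (2*d+1) - lam2sq * \<bar>t - s\<bar> powr (2*d+1)) / 2"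
    unfolding e by (intro tendsto_intros sq df st) auto
  also have "(lam2sq * s powr (2*d+1) + lam2sq * t powr (2*d+1) - lam2sq * \<bar>t - s\<bar> powr (2*d+1)) / 2 = lam2sq * fbm_cov hurst s t"
    by (simp add: fbm_cov_def algebra_simps)
  finally show ?thesis .
qed

lemma interp_path_cf:
  fixes J :: "real set" and c :: "real \<Rightarrow> real"
  assumes J: "finite J" "J \<subseteq> {0..1}"
  shows "(\<lambda>n. CLINT \<omega>|M. iexp (\<Sum>t\<in>J. c t * interp_path n \<omega> t)) \<longlonglongrightarrow> exp (- (lam2sq * (\<Sum>s\<in>J. \<Sum>t\<in>J. c s * c t * fbm_cov hurst s t)) / 2)"
proof -
  define w where "w n k = (\<Sum>t\<in>J. c t * (real n powr (- d - 1/2) * ramp (real n * max 0 (min 1 t) - (real k - 1))))" for n k :: nat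
  have w: "(\<Sum>t\<in>J. c t * interp_path n \<omega> t) = (\<Sum>k\<in>{1..n}. w n k * X (int k) \<omega>)" for n \<omega>
  proof -
    have "(\<Sum>t\<in>J. c t * interp_path n \<omega> t) = (\<Sum>t\<in>J. \<Sum>k\<in>{1..n}. c t * (real n powr (- d - 1/2) * ramp (real n * max 0 (min 1 t) - (real k - 1))) * X (int k) \<omega>)"
      by (simp add: interp_path_def sum_distrib_left mult.assoc)
    also have "\<dots> = (\<Sum>k\<in>{1..n}. \<Sum>t\<in>J. c t * (real n powr (- d - 1/2) * ramp (real n * max 0 (min 1 t) - (real k - 1))) * X (int k) \<omega>)"
      by (rule sum.swap)
    finally show ?thesis by (simp add: w_def sum_distrib_right)
  qed
  have wb: "\<bar>w n k\<bar> \<le> (\<Sum>t\<in>J. \<bar>c t\<bar>) * real n powr (- d - 1/2)" for n k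
  proof -
    have "\<bar>w n k\<bar> \<le> (\<Sum>t\<in>J. \<bar>c t * (real n powr (- d - 1/2) * ramp (real n * max 0 (min 1 t) - (real k - 1)))\<bar>)"
      unfolding w_def by (rule sum_abs)
    also have "\<dots> \<le> (\<Sum>t\<in>J. \<bar>c t\<bar> * (real n powr (- d - 1/2) * 1))"
      unfolding abs_mult by (intro sum_mono mult_left_mono mult_mono) (auto simp: ramp_def)
    finally show ?thesis by (simp add: sum_distrib_right)
  qed
  have V: "(\<lambda>n. expectation (\<lambda>\<omega>. (\<Sum>k\<in>{1..n}. w n k * X (int k) \<omega>)\<^sup>2)) \<longlonglongrightarrow> lam2sq * (\<Sum>s\<in>J. \<Sum>t\<in>J. c s * c t * fbm_cov hurst s t)"
  proof -
    have LY: "L2 (\<lambda>\<omega>. interp_path n \<omega> t)" if "t \<in> J" for t n using L2_interp_path J that by auto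
    have "expectation (\<lambda>\<omega>. (\<Sum>k\<in>{1..n}. w n k * X (int k) \<omega>)\<^sup>2) = (\<Sum>s\<in>J. \<Sum>t\<in>J. c s * c t * expectation (\<lambda>\<omega>. interp_path n \<omega> s * interp_path n \<omega> t))" for n
    proof -
      have "expectation (\<lambda>\<omega>. (\<Sum>k\<in>{1..n}. w n k * X (int k) \<omega>)\<^sup>2) = expectation (\<lambda>\<omega>. \<Sum>s\<in>J. \<Sum>t\<in>J. c s * c t * (interp_path n \<omega> s * interp_path n \<omega> t))"
        unfolding w[symmetric] power2_eq_square sum_product by (simp only: mult_ac)
      also have "\<dots> = (\<Sum>s\<in>J. expectation (\<lambda>\<omega>. \<Sum>t\<in>J. c s * c t * (interp_path n \<omega> s * interp_path n \<omega> t)))"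
        by (rule Bochner_Integration.integral_sum) (intro Bochner_Integration.integrable_sum integrable_mult_right L2_mult LY)
      also have "\<dots> = (\<Sum>s\<in>J. \<Sum>t\<in>J. c s * c t * expectation (\<lambda>\<omega>. interp_path n \<omega> s * interp_path n \<omega> t))"
        by (intro sum.cong refl, subst Bochner_Integration.integral_sum) (auto intro!: integrable_mult_right L2_mult LY)
      finally show ?thesis .
    qed
    moreover have "(\<lambda>n. \<Sum>s\<in>J. \<Sum>t\<in>J. c s * c t * expectation (\<lambda>\<omega>. interp_path n \<omega> s * interp_path n \<omega> t)) \<longlonglongrightarrow> (\<Sum>s\<in>J. \<Sum>t\<in>J. c s * c t * (lam2sq * fbm_cov hurst s t))"
      using J by (intro tendsto_sum tendsto_mult tendsto_const interp_path_cov_tendsto) auto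
    moreover have "(\<Sum>s\<in>J. \<Sum>t\<in>J. c s * c t * (lam2sq * fbm_cov hurst s t)) = lam2sq * (\<Sum>s\<in>J. \<Sum>t\<in>J. c s * c t * fbm_cov hurst s t)"
      by (simp add: sum_distrib_left mult_ac)
    ultimately show ?thesis by simp
  qed
  show ?thesis unfolding w using linear_clt[OF wb V] by simp
qed

section \<open>Covariance decay and the functional limit\<close>

lemma covariance_asymp:
  "(\<lambda>t::nat. expectation (\<lambda>\<omega>. X 0 \<omega> * X (int t) \<omega>) - expectation (X 0) * expectation (X (int t)))
     \<sim>[at_top] (\<lambda>t. lam1 * real t powr (2*d - 1))"
proof -
  have cov: "expectation (\<lambda>\<omega>. X 0 \<omega> * X (int t) \<omega>) - expectation (X 0) * expectation (X (int t)) = acov t" for t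
    using X_cov[of 0 t] by (simp add: X_mean)
  show ?thesis
  proof (cases "lam1 = 0")
    \<comment> \<open>The Beta factor and \<beta> are positive, so the innovations have variance
      zero; both sides vanish identically and are asymptotically equivalent by reflexivity.\<close>
    case True
    have "0 < Beta d (1 - 2*d)" using d by (simp add: Beta_def Gamma_real_pos)
    then have "sig2 = 0" using True beta by (auto simp: lam1_def)
    then have "acov t = 0" for t by (simp add: acov_def)
    then show ?thesis unfolding cov using True by simp
  next
    case False
    have "(\<lambda>t. acov t * real t powr (1 - 2*d) / lam1) \<longlonglongrightarrow> lam1 / lam1" using False by (intro tendsto_intros acov_asymp)
    moreover have "\<forall>\<^sub>F t in sequentially. acov t * real t powr (1 - 2*d) / lam1 = acov t / (lam1 * real t powr (2*d - 1))"
      using eventually_gt_at_top[of 0]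
    proof eventually_elim
      case (elim t)
      have "real t powr (1 - 2*d) = 1 / real t powr (2*d - 1)" using powr_minus_divide[of "real t" "2*d - 1"] by simp
      then show ?case by simp
    qed
    ultimately have "(\<lambda>t. acov t / (lam1 * real t powr (2*d - 1))) \<longlonglongrightarrow> 1"
      using Lim_transform_eventually False by fastforce
    then show ?thesis unfolding cov by (rule asymp_equivI')
  qed
qed

text \<open>Scaling by \<open>sqrt lam2sq\<close> keeps the limit paths in the compact sets with a
  scaled constant and covers the degenerate case, in which the limit is zero.\<close>

theorem functional_limit:
  "\<exists>(N :: (real \<Rightarrow> real) measure) B. is_fBm N hurst B \<and> weak_conv_D M sum_path N (\<lambda>\<omega> \<tau>. sqrt lam2sq * B \<tau> \<omega>)"
proof -
  let ?l = "sqrt lam2sq"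
  have Hr: "1/2 < hurst" "hurst < 1" "(1/2) powr (2*hurst - 1) < \<theta>\<^sup>2" using d theta(3) by auto
  obtain B where B: "is_fBm gauss_space hurst B" "\<And>\<omega>. \<exists>A. (\<lambda>t. B t \<omega>) \<in> holder_paths \<theta> A"
    "\<And>e. 0 < e \<Longrightarrow> \<exists>A. \<exists>E\<in>sets gauss_space. measure gauss_space E \<ge> 1 - e \<and> (\<forall>\<omega>\<in>E. (\<lambda>t. B t \<omega>) \<in> holder_paths \<theta> A)"
    using fBm_exists[OF Hr(1,2) theta(1,2) Hr(3)] by blast
  let ?Z = "\<lambda>\<omega> \<tau>. ?l * B \<tau> \<omega>"
  have Bm[measurable]: "B t \<in> borel_measurable gauss_space" for t using B(1) by (simp add: is_fBm_def)
  have scale: "(\<lambda>t. ?l * x t) \<in> holder_paths \<theta> (?l * A)" if x: "x \<in> holder_paths \<theta> A" for x A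
  proof (rule holder_pathsI)
    have l: "0 \<le> ?l" using lam2sq_nonneg by simp
    show "?l * x t = ?l * x (max 0 (min 1 t))" for t using holder_pathsD(1)[OF x, of t] by simp
    show "\<bar>?l * x t\<bar> \<le> ?l * A" for t unfolding abs_mult using l holder_pathsD(2)[OF x, of t] by (simp add: mult_left_mono)
    show "\<bar>?l * x s - ?l * x t\<bar> \<le> ?l * A * \<theta>^m" if "s \<in> {0..1}" "t \<in> {0..1}" "\<bar>s - t\<bar> \<le> (1/2)^m" for m s t
      using l mult_left_mono[OF holder_pathsD(3)[OF x that] l] by (simp add: right_diff_distrib[symmetric] abs_mult mult.assoc)
  qed
  have Zc: "continuous_on {0..1} (?Z \<omega>)" for \<omega>
  proof -
    obtain A where "(\<lambda>t. B t \<omega>) \<in> holder_paths \<theta> A" using B(2)[of \<omega>] by blast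
    from holder_paths_continuous[OF less_imp_le[OF theta(1)] theta(2) scale[OF this]] show ?thesis .
  qed
  have cfB: "\<forall>J c. finite J \<longrightarrow> J \<subseteq> {0..1} \<longrightarrow> (CLINT \<omega>|gauss_space. iexp (\<Sum>t\<in>J. c t * B t \<omega>)) =
      complex_of_real (exp (- (\<Sum>s\<in>J. \<Sum>t\<in>J. c s * c t * fbm_cov hurst s t) / 2))"
    using B(1) unfolding is_fBm_def by (elim conjE)
  have fdd: "fdd_convergence M gauss_space interp_path ?Z"
  proof (rule fdd_convergence.intro[OF prob_space_axioms prob_space_gauss], unfold_locales)
    show "(\<lambda>\<omega>. interp_path n \<omega> t) \<in> borel_measurable M" if "t \<in> {0..1}" for n t by (rule L2_meas[OF L2_interp_path[OF that]])
    show "(\<lambda>\<omega>. ?l * B t \<omega>) \<in> borel_measurable gauss_space" for t by measurable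
    fix S :: "real set" and c :: "real \<Rightarrow> real" assume S: "finite S" "S \<subseteq> {0..1}"
    have "(CLINT \<omega>|gauss_space. iexp (\<Sum>t\<in>S. (c t * ?l) * B t \<omega>)) = complex_of_real (exp (- (\<Sum>s\<in>S. \<Sum>t\<in>S. (c s * ?l) * (c t * ?l) * fbm_cov hurst s t) / 2))"
      by (rule cfB[rule_format, OF S])
    also have "(\<Sum>s\<in>S. \<Sum>t\<in>S. (c s * ?l) * (c t * ?l) * fbm_cov hurst s t) = lam2sq * (\<Sum>s\<in>S. \<Sum>t\<in>S. c s * c t * fbm_cov hurst s t)"
    proof -
      have "(c s * ?l) * (c t * ?l) * fbm_cov hurst s t = lam2sq * (c s * c t * fbm_cov hurst s t)" for s t
      proof -
        have "(c s * ?l) * (c t * ?l) * fbm_cov hurst s t = (?l * ?l) * (c s * c t * fbm_cov hurst s t)" by (simp only: mult_ac)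
        then show ?thesis using lam2sq_nonneg by simp
      qed
      then show ?thesis by (simp only: sum_distrib_left)
    qed
    finally show "(\<lambda>n. CLINT \<omega>|M. iexp (\<Sum>t\<in>S. c t * interp_path n \<omega> t)) \<longlonglongrightarrow> (CLINT \<omega>|gauss_space. iexp (\<Sum>t\<in>S. c t * (?l * B t \<omega>)))"
      using interp_path_cf[OF S, of c] by (simp only: mult.assoc)
  qed
  have "weak_conv_D M sum_path gauss_space ?Z"
  proof (rule fdd_convergence.weak_conv_D_if_tight[OF fdd less_imp_le[OF theta(1)] theta(2)])
    show "\<exists>A. \<forall>\<^sub>F n in sequentially. \<exists>E\<in>sets M. prob E \<ge> 1 - e \<and> (\<forall>\<omega>\<in>E. interp_path n \<omega> \<in> holder_paths \<theta> A)" if e: "0 < e" for e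
    proof -
      obtain A where "\<forall>n. \<exists>E\<in>sets M. prob E \<ge> 1 - e \<and> (\<forall>\<omega>\<in>E. interp_path n \<omega> \<in> holder_paths \<theta> A)" using interp_path_tight[OF e] by blast
      then show ?thesis by (intro exI[of _ A] always_eventually)
    qed
    show "\<exists>A. \<exists>E\<in>sets gauss_space. measure gauss_space E \<ge> 1 - e \<and> (\<forall>\<omega>\<in>E. ?Z \<omega> \<in> holder_paths \<theta> A)" if "0 < e" for e
      using B(3)[OF that] scale by meson
    show "\<forall>\<^sub>F n in sequentially. \<exists>E\<in>sets M. prob E \<ge> 1 - e \<and> (\<forall>\<omega>\<in>E. \<forall>t\<in>{0..1}. \<bar>interp_path n \<omega> t - sum_path n \<omega> t\<bar> \<le> \<delta>)"
      if "0 < e" "0 < \<delta>" for e \<delta> by (rule interp_path_near_sum_path[OF that])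
    show "cadlag (sum_path n \<omega>)" for n \<omega>
      unfolding sum_path_def[abs_def] by (rule cadlag_step[of "\<lambda>k. real n powr (- d - 1/2) * psum k \<omega>"])
    show "continuous_on {0..1} (?Z \<omega>)" for \<omega> by (rule Zc)
    fix f assume f: "skorohod_bcont f"
    show "(\<lambda>\<omega>. f (sum_path n \<omega>)) \<in> borel_measurable M" for n
      unfolding sum_path_def[abs_def]
      by (rule borel_measurable_step_functional[OF f, where V = "\<lambda>k \<omega>. real n powr (- d - 1/2) * psum k \<omega>"]) (intro L2_meas L2_cmult L2_psum)
    \<comment> \<open>Step paths through the dyadic values converge uniformly to the continuous
      path. They make \<open>f\<close> of the limit path a pointwise limit of measurable
      functions.\<close>
    define V where "V m \<omega> \<tau> = ?l * B (real (nat \<lfloor>real (2^m) * \<tau>\<rfloor>) / 2^m) \<omega>" for m :: nat and \<omega> \<tau>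
    have Vm: "(\<lambda>\<omega>. f (V m \<omega>)) \<in> borel_measurable gauss_space" for m
      unfolding V_def[abs_def]
      by (rule borel_measurable_step_functional[OF f, where V = "\<lambda>k \<omega>. ?l * B (real k / 2^m) \<omega>"]) measurable
    show "(\<lambda>\<omega>. f (?Z \<omega>)) \<in> borel_measurable gauss_space"
    proof (rule borel_measurable_LIMSEQ_real[OF _ Vm])
      fix \<omega>
      obtain A where A: "?Z \<omega> \<in> holder_paths \<theta> A" using B(2)[of \<omega>] scale by meson
      show "(\<lambda>m. f (V m \<omega>)) \<longlonglongrightarrow> f (?Z \<omega>)"
      proof (rule LIMSEQ_I)
        fix e :: real assume e: "0 < e"
        obtain \<delta> where \<delta>: "0 < \<delta>" "\<And>y. cadlag y \<Longrightarrow> (\<And>t. t \<in> {0..1} \<Longrightarrow> \<bar>?Z \<omega> t - y t\<bar> \<le> \<delta>) \<Longrightarrow> \<bar>f (?Z \<omega>) - f y\<bar> < e"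
          using skorohod_bcontD[OF f cadlag_continuous[OF Zc[of \<omega>]] e] by metis
        have "(\<lambda>m. A * \<theta>^m) \<longlonglongrightarrow> A * 0" using theta by (intro tendsto_intros LIMSEQ_realpow_zero) auto
        then have "\<forall>\<^sub>F m in sequentially. A * \<theta>^m < \<delta>" using \<delta>(1) by (intro order_tendstoD) auto
        then obtain m0 where m0: "\<And>m. m \<ge> m0 \<Longrightarrow> A * \<theta>^m < \<delta>" by (auto simp: eventually_sequentially)
        have "norm (f (V m \<omega>) - f (?Z \<omega>)) < e" if "m \<ge> m0" for m
        proof -
          have "cadlag (V m \<omega>)" unfolding V_def[abs_def] by (rule cadlag_step[of "\<lambda>k. ?l * B (real k / 2^m) \<omega>"])
          moreover have "\<bar>?Z \<omega> t - V m \<omega> t\<bar> \<le> \<delta>" if t: "t \<in> {0..1}" for t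
          proof -
            have "real (nat \<lfloor>real (2^m) * t\<rfloor>) / 2^m = dyadic_floor m t" using t by (simp add: dyadic_floor_def)
            then have "\<bar>?Z \<omega> t - V m \<omega> t\<bar> \<le> A * \<theta>^m"
              unfolding V_def using holder_pathsD(3)[OF A t dyadic_floor_in[OF t] dyadic_floor_near] by simp
            then show ?thesis using m0[OF \<open>m \<ge> m0\<close>] by linarith
          qed
          ultimately show ?thesis using \<delta>(2) by (simp add: abs_minus_commute)
        qed
        then show "\<exists>m0. \<forall>m\<ge>m0. norm (f (V m \<omega>) - f (?Z \<omega>)) < e" by blast
      qed
    qed
  qed
  then show ?thesis using B(1) by blast
qed

end

theorem theorem9:
  fixes M :: "'a measure" and \<zeta> X :: "int \<Rightarrow> 'a \<Rightarrow> real"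
    and a \<beta> d LipQ :: real and b :: "nat \<Rightarrow> real" and Q :: "real \<Rightarrow> real"
  assumes M: "prob_space M"
    and zeta_rv: "\<And>t. \<zeta> t \<in> borel_measurable M"
    and zeta_indep: "prob_space.indep_vars M (\<lambda>_. borel) \<zeta> UNIV"
    and zeta_ident: "\<And>t. distr M borel (\<zeta> t) = distr M borel (\<zeta> 0)"
    and zeta_int: "integrable M (\<zeta> 0)" "integrable M (\<lambda>\<omega>. (\<zeta> 0 \<omega>)\<^sup>2)"
    and zeta_mean: "integral\<^sup>L M (\<zeta> 0) = 0"
    and zeta_var: "integral\<^sup>L M (\<lambda>\<omega>. (\<zeta> 0 \<omega>)\<^sup>2) = 1"
    and d: "0 < d" "d < 1/2" and beta: "\<beta> > 0"
    and b_asymp: "(\<lambda>j. b j) \<sim>[at_top] (\<lambda>j. \<beta> * real j powr (d - 1))"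
    and Q_lip: "\<And>x y. \<bar>Q x - Q y\<bar> \<le> LipQ * \<bar>x - y\<bar>"
    and contr: "LipQ\<^sup>2 * (\<Sum>j. (b (Suc j))\<^sup>2) < 1"
    and X_pred: "\<And>t. X t \<in> borel_measurable (nat_filtration M \<zeta> (t - 1))"
    and X_rv: "\<And>t. X t \<in> borel_measurable M"
    and X_L2: "\<And>t. integrable M (\<lambda>\<omega>. (X t \<omega>)\<^sup>2)"
    and X_eq_int: "\<And>t N. integrable M (\<lambda>\<omega>.
           (X t \<omega> - (\<Sum>j\<in>{1..N}. b j * \<zeta> (t - int j) \<omega> * Q (a + X (t - int j) \<omega>)))\<^sup>2)"
    and X_eq: "\<And>t. (\<lambda>N. integral\<^sup>L M (\<lambda>\<omega>.
           (X t \<omega> - (\<Sum>j\<in>{1..N}. b j * \<zeta> (t - int j) \<omega> * Q (a + X (t - int j) \<omega>)))\<^sup>2))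
           \<longlonglongrightarrow> 0"
    and X_stat: "\<And>h. distr M (Pi\<^sub>M UNIV (\<lambda>_. borel)) (\<lambda>\<omega> t. X (t + h) \<omega>)
                    = distr M (Pi\<^sub>M UNIV (\<lambda>_. borel)) (\<lambda>\<omega> t. X t \<omega>)"
  shows "let lam1sq = \<beta>\<^sup>2 * (Beta d (1 - 2*d) :: real) * integral\<^sup>L M (\<lambda>\<omega>. (Q (a + X 0 \<omega>))\<^sup>2);
             lam2 = sqrt (lam1sq / (d * (1 + 2*d)))
         in (\<lambda>t::nat. integral\<^sup>L M (\<lambda>\<omega>. X 0 \<omega> * X (int t) \<omega>)
                       - integral\<^sup>L M (X 0) * integral\<^sup>L M (X (int t)))
              \<sim>[at_top] (\<lambda>t. lam1sq * real t powr (2*d - 1))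
          \<and> (\<exists>(N :: (real \<Rightarrow> real) measure) B. is_fBm N (d + 1/2) B \<and>
               weak_conv_D M
                 (\<lambda>n \<omega> \<tau>. real n powr (- d - 1/2) * (\<Sum>t\<in>{1..nat \<lfloor>real n * \<tau>\<rfloor>}. X (int t) \<omega>))
                 N (\<lambda>\<omega> \<tau>. lam2 * B \<tau> \<omega>))"
proof -
  interpret prob_space M by (rule M)
  \<comment> \<open>Projection of the laws of the shifted and the original process to coordinate
    0.\<close>
  have stat: "distr M borel (X t) = distr M borel (X 0)" for t
  proof -
    have mX: "(\<lambda>\<omega> s. X (s + h) \<omega>) \<in> measurable M (Pi\<^sub>M UNIV (\<lambda>_. borel))" for h
      by (rule measurable_PiM_single') (use X_rv in auto)
    have co: "(\<lambda>x. x 0) \<in> borel_measurable (Pi\<^sub>M UNIV (\<lambda>_::int. borel :: real measure))"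
      by (rule measurable_component_singleton) simp
    have "distr M borel (X h) = distr (distr M (Pi\<^sub>M UNIV (\<lambda>_. borel)) (\<lambda>\<omega> s. X (s + h) \<omega>)) borel (\<lambda>x. x 0)" for h
      by (subst distr_distr[OF co mX]) (simp add: o_def)
    from this[of t] this[of 0] show ?thesis using X_stat[of t] by simp
  qed
  interpret larch_solution M \<zeta> X a \<beta> d LipQ b Q
    by (unfold_locales; (fact assms stat)?)
  have l1: "lam1 = \<beta>\<^sup>2 * Beta d (1 - 2*d) * integral\<^sup>L M (\<lambda>\<omega>. (Q (a + X 0 \<omega>))\<^sup>2)"
    by (simp add: lam1_def sig2_def)
  have path: "sum_path = (\<lambda>n \<omega> \<tau>. real n powr (- d - 1/2) * (\<Sum>t\<in>{1..nat \<lfloor>real n * \<tau>\<rfloor>}. X (int t) \<omega>))"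
    by (simp add: sum_path_def psum_def fun_eq_iff)
  show ?thesis
    unfolding Let_def l1[symmetric] lam2sq_def[symmetric] path[symmetric]
    using covariance_asymp functional_limit by blast
qed

end
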